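(* Let $0\le l\le r-1$ and $0\le j\le m-2$. After shrinking $\mathcal V$, there exists a horizontal lift $$\nabla^{flat}_{\mathbb P^1\times\mathcal V[\bar h],v_{l,j}}\colon(\mathcal O^{hol}_{\mathbb P^1\times\mathcal V[\bar h]})^{\oplus r}\longrightarrow(\mathcal O^{hol}_{\mathbb P^1\times\mathcal V[\bar h]})^{\oplus r}\otimes(\iota_{\mathcal V[\bar h]})_*\Omega^1_{(\mathbb P^1\times\mathcal V\setminus\Gamma_{\mathcal V})[\bar h]/\mathcal V}(\infty\times\mathcal V[\bar h])^{hol}$$ of the relative connection $\nabla_{\mathbb P^1\times\mathcal V[\bar h],v_{l,j}}$ with connection matrix $(A_\infty(z,\epsilon)+\bar h\tilde\Xi_{l,j}(z,\epsilon))\dfrac{dz}{z^m-\epsilon^m}$.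
   Context: **Local connection.** $\Delta=\{|z|<1\}\subset\mathbb C$, $m\ge2$, $r\ge1$, $\zeta_m=\exp(2\pi\sqrt{-1}/m)$; $(z,\epsilon,w)$ are the coordinates on $\Delta\times\Delta\times\Delta^s$; $D=\{z^m-\epsilon^m=0\}$; $\Gamma_\Delta=\bigcup_{j=1}^m\{(t\zeta_m^j\epsilon,\epsilon,w)\mid0\le t\le1\}$. We regard $\Delta\times\Delta\times\Delta^s\subset\mathbb P^1\times\Delta\times\Delta^s$. $\mu_1,\dots,\mu_r\in\mathbb C$ are distinct and $\nu(T)=\sum_{l=0}^{r-1}\big(\sum_{j=0}^{m-1}c_{l,j}z^j\big)T^l$, $c_{l,j}$ holomorphic on $\Delta\times\Delta^s$, with $\nu(\mu_1)|_p,\dots,\nu(\mu_r)|_p$ distinct for all $p\in D$. $\tilde\gamma\colon[0,1]\times\Delta\times\Delta^s\to\Delta\times\Delta\times\Delta^s$ is a continuous family of loops over $\Delta\times\Delta^s$ and $W$ an open set whose fiber $W_b$ over each $b$ is a disk containing $D_b$ with boundary $\tilde\gamma([0,1]\times\{b\})$. $\nabla_\Delta$ is a relative connection on the trivial rank $r$ bundle on $\Delta\times\Delta\times\Delta^s$ over $\Delta\times\Delta^s$ with connection matrix $A(z,\epsilon,w)\frac{dz}{z^m-\epsilon^m}$, $A$ holomorphic, $A|_D=\mathrm{Diag}(\nu(\mu_k))|_D$. Assume: (i) the monodromy of $\nabla_{\Delta_b}=\nabla_\Delta|_{\Delta\times\{b\}}$ along $\tilde\gamma_b$ has a diagonal representation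 matrix of holomorphic functions over $\Delta\times\Delta^s$ with $r$ distinct eigenvalues for any $b$; (ii) $H^0(\Delta\times\{b\},\ker\nabla^\dagger_{\Delta_b})=\mathbb C$ for each $b$, where $\nabla^\dagger_{\Delta_b}(u)=\nabla_{\Delta_b}\circ u-u\circ\nabla_{\Delta_b}$ on $\mathcal End(\mathcal O^{\oplus r})$. **Extension to $\mathbb P^1$.** $\mathcal V$ is an open neighborhood of $(0,0)$ in $\Delta\times\Delta^s$ and $\nabla^{\mathbb P^1}$ a relative connection on the trivial rank $r$ bundle on $\mathbb P^1\times\mathcal V$ over $\mathcal V$, with poles along $D_{\mathcal V}\cup(\{\infty\}\times\mathcal V)$ (simple at $\infty$), whose restriction to $\Delta\times\mathcal V$ is isomorphic to $\nabla_\Delta|_{\Delta\times\mathcal V}$ (this exists for suitable $\mathcal V$). Its connection matrix is $A_\infty\frac{dz}{z^m-\epsilon^m}$ with $A_\infty=\sum_{q=0}^{m-1}A_{\infty,q}z^q$, $A_{\infty,q}$ matrices of holomorphic functions on $\mathcal V$. Subscript $\mathcal V$ means base change; $X[\bar h]=X\times\mathrm{Spec}\,\mathbb C[h]/(h^2)$. **Adjusting data.** Let $P$ be an invertible matrix of holomorphic functions near $D_{\mathcal V}$ with $\big(P^{-1}dP+P^{-1}A_\infty\frac{dz}{z^m-\epsilon^m}P\big)|_{2D_{\mathcal V}}=\mathrm{Diag}(\nu(\mu_k))\frac{dz}{z^m-\epsilon^m}|_{2D_{\mathcal V}}$. Let $\psi(T)\in\mathcal O_{\mathcal V}[z][T]$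 be of degree $<r$ in $T$ and coefficients of degree $<m$ in $z$ with $\psi(\mathrm{Diag}(\nu(\mu_k)))|_{D_{\mathcal V}}=\mathrm{Diag}(\mu_k)|_{D_{\mathcal V}}$. $\Xi_{l,j}$ is obtained from $z^j\psi(A_\infty)^l$ by substituting $\epsilon^m$ for $z^m$ (so it has degree $<m$ in $z$). On the closed subspace $\mathcal V_{\epsilon^m}=\{\epsilon^m=0\}$ put $B_{0,l,j}=P\,\mathrm{Diag}\big(\mu_k^l\frac{z^{j-m+1}}{j-m+1}\big)P^{-1}$ and $A'_{l,j}\frac{dz}{z^m}=dB_{0,l,j}+[A_\infty,B_{0,l,j}]\frac{dz}{z^m}$ ($d$ in the $z$-direction), and let $R'_{l,j}=\sum_{l'\ge0}R'^{(l)}_{0,j,l'}z^{l'}$ be a convergent power series of matrices such that $\tilde A'_{l,j}$ defined by $A'_{l,j}\frac{dz}{z^m}=dR'_{l,j}+(\tilde A'_{l,j}+[A_\infty,R'_{l,j}])\frac{dz}{z^m}$ is a polynomial in $z$ of degree $\le m-2$. Put $B'_{0,l,j}=B_{0,l,j}-R'_{l,j}$. An adjusting data is a collection of matrices $R^{(l)}_{j,l'}$ ($0\le l'\le m-1$) over $\mathcal O^{hol}_{\mathcal V}$ with $R^{(l)}_{j,l'}|_{\epsilon^m=0}=R'^{(l)}_{0,j,l'}$ such that the $z^{m-1}$-coefficient of $\Xi_{l,j}$ equals $\sum_{l'=0}^{m-1}[A_{\infty,m-l'-1},R^{(l)}_{j,l'}]$. Fix one and put $$\tilde\Xi_{l,j}=\Xi_{l,j}-\sum_{q+l'\le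 m-1}[A_{\infty,q},R^{(l)}_{j,l'}]z^{q+l'}-\sum_{q+l'\ge m}[A_{\infty,q},R^{(l)}_{j,l'}]\epsilon^mz^{q+l'-m}\quad(0\le q,l'\le m-1).$$ **Horizontal lift.** Let $\iota_{\mathcal V[\bar h]}\colon(\mathbb P^1\times\mathcal V\setminus\Gamma_{\mathcal V})[\bar h]\hookrightarrow\mathbb P^1\times\mathcal V[\bar h]$ be the inclusion. A horizontal lift of $\nabla_{\mathbb P^1\times\mathcal V[\bar h],v_{l,j}}$ is a connection as in the claim with connection matrix $\omega=(A_\infty+\bar h\tilde\Xi_{l,j})\frac{dz}{z^m-\epsilon^m}+B_{l,j}\,d\bar h$ (differentials relative to $\mathcal V$, i.e. in $dz$ and $d\bar h$) such that $B_{l,j}|_{\epsilon^m=0}=B'_{0,l,j}$ and $d\omega+\omega\wedge\omega=0$. *)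

theory Defs
  imports "HOL-Analysis.Analysis" "HOL-Computational_Algebra.Polynomial"
begin

text \<open>
  Conventions. The base \<open>\<Delta> \<times> \<Delta>\<^sup>s\<close> sits in \<open>complex ^ 'b\<close>, where \<open>'b\<close> is a finite index type with
  \<open>s + 1\<close> elements and one distinguished index \<open>e\<close>: a base point \<open>b\<close> encodes \<open>(\<epsilon>, w)\<close> with
  \<open>\<epsilon> = b $ e\<close>, the other components being \<open>w\<close>. In this way every \<open>s \<ge> 0\<close> is covered.
  The rank is \<open>r = CARD('r)\<close>. Functions on (subsets of) \<open>\<complex> \<times> base\<close> are curried, \<open>F z b\<close>; all
  differentials are relative to the base.
\<close>

type_synonym ('b, 'r) matfun = "complex \<Rightarrow> complex ^ 'b \<Rightarrow> complex ^ 'r ^ 'r"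


section \<open>Matrices\<close>

definition diag_mat :: "('r \<Rightarrow> 'a::zero) \<Rightarrow> 'a ^ 'r ^ 'r"
  where "diag_mat d = (\<chi> i k. if i = k then d i else 0)"

definition mscale :: "'a::times \<Rightarrow> 'a ^ 'r ^ 'r \<Rightarrow> 'a ^ 'r ^ 'r"
  where "mscale a M = (\<chi> i k. a * M $ i $ k)"

text \<open>The power with respect to the matrix product \<open>**\<close>.\<close>

definition mat_power :: "'a::semiring_1 ^ 'r ^ 'r \<Rightarrow> nat \<Rightarrow> 'a ^ 'r ^ 'r"
  where "mat_power M n = (((**) M) ^^ n) (mat 1)"

definition commutator :: "'a::ring_1 ^ 'r ^ 'r \<Rightarrow> 'a ^ 'r ^ 'r \<Rightarrow> 'a ^ 'r ^ 'r"
  where "commutator X Y = X ** Y - Y ** X"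

text \<open>Value at a square matrix \<open>M\<close> of size \<open>r\<close> of the polynomial \<open>\<Sum>i<r. a i * T ^ i\<close>.\<close>

definition eval_T :: "(nat \<Rightarrow> 'a::comm_ring_1) \<Rightarrow> 'a ^ 'r ^ 'r \<Rightarrow> 'a ^ 'r ^ 'r"
  where "eval_T a M = (\<Sum>i<CARD('r). mscale (a i) (mat_power M i))"


section \<open>Holomorphic functions of several variables\<close>

text \<open>
  Holomorphic means continuous and holomorphic in each variable separately. These predicates
  are only meant for open sets \<open>U\<close>.
\<close>

definition holo_base :: "(complex ^ 'b \<Rightarrow> complex) \<Rightarrow> (complex ^ 'b) set \<Rightarrow> bool"
  where "holo_base f U \<longleftrightarrow> continuous_on U f \<and>
    (\<forall>b\<in>U. \<forall>i. (\<lambda>t. f (b + axis i t)) field_differentiable at 0)"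

definition holo_total ::
    "(complex \<Rightarrow> complex ^ 'b \<Rightarrow> complex) \<Rightarrow> (complex \<times> (complex ^ 'b)) set \<Rightarrow> bool"
  where "holo_total f U \<longleftrightarrow> continuous_on U (\<lambda>(z, b). f z b) \<and>
    (\<forall>(z, b)\<in>U. (\<lambda>x. f x b) field_differentiable at z \<and>
       (\<forall>i. (\<lambda>t. f z (b + axis i t)) field_differentiable at 0))"

definition mholo_base :: "(complex ^ 'b \<Rightarrow> complex ^ 'r ^ 'r) \<Rightarrow> (complex ^ 'b) set \<Rightarrow> bool"
  where "mholo_base F U \<longleftrightarrow> (\<forall>i k. holo_base (\<lambda>b. F b $ i $ k) U)"

definition mholo_total ::
    "('b::finite, 'r::finite) matfun \<Rightarrow> (complex \<times> (complex ^ 'b)) set \<Rightarrow> bool"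
  where "mholo_total F U \<longleftrightarrow> (\<forall>i k. holo_total (\<lambda>z b. F z b $ i $ k) U)"

definition mderiv :: "('b::finite, 'r::finite) matfun \<Rightarrow> ('b::finite, 'r::finite) matfun"
  where "mderiv F z b = (\<chi> i k. deriv (\<lambda>x. F x b $ i $ k) z)"

text \<open>
  Equality of restrictions to a closed analytic subspace \<open>{h = 0}\<close> of \<open>U\<close>, which may be
  non-reduced: the difference is \<open>h\<close> times a holomorphic function.
\<close>

definition cong_total ::
    "(complex \<times> (complex ^ 'b)) set \<Rightarrow> (complex \<Rightarrow> complex ^ 'b \<Rightarrow> complex)
      \<Rightarrow> ('b::finite, 'r::finite) matfun \<Rightarrow> ('b::finite, 'r::finite) matfun \<Rightarrow> bool"
  where "cong_total U h F G \<longleftrightarrow>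
    (\<exists>H. mholo_total H U \<and> (\<forall>(z, b)\<in>U. F z b - G z b = mscale (h z b) (H z b)))"

definition cong_base ::
    "(complex ^ 'b) set \<Rightarrow> (complex ^ 'b \<Rightarrow> complex)
      \<Rightarrow> (complex ^ 'b \<Rightarrow> complex ^ 'r ^ 'r) \<Rightarrow> (complex ^ 'b \<Rightarrow> complex ^ 'r ^ 'r) \<Rightarrow> bool"
  where "cong_base U h F G \<longleftrightarrow>
    (\<exists>H. mholo_base H U \<and> (\<forall>b\<in>U. F b - G b = mscale (h b) (H b)))"


section \<open>Connections on the trivial bundle over a subset of the \<open>z\<close>-line\<close>

text \<open>The connection with matrix \<open>A dz / (z ^ m - \<epsilon> ^ m)\<close>, applied to a section \<open>f\<close>;
  this is the coefficient of \<open>dz\<close>.\<close>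

definition nabla ::
    "nat \<Rightarrow> complex \<Rightarrow> (complex \<Rightarrow> complex ^ 'r ^ 'r) \<Rightarrow> (complex \<Rightarrow> complex ^ 'r)
      \<Rightarrow> complex \<Rightarrow> complex ^ 'r"
  where "nabla m \<epsilon> A f z =
    (\<chi> i. deriv (\<lambda>x. f x $ i) z + (A z *v f z) $ i / (z ^ m - \<epsilon> ^ m))"

text \<open>
  \<open>u\<close> satisfies \<open>\<nabla>\<^sub>2 \<circ> u = u \<circ> \<nabla>\<^sub>1\<close> over \<open>S\<close>, where \<open>\<nabla>\<^sub>i\<close> has matrix
  \<open>A\<^sub>i dz / (z ^ m - \<epsilon> ^ m)\<close>. For \<open>A\<^sub>1 = A\<^sub>2\<close> these are the sections killed by
  \<open>u \<mapsto> \<nabla> \<circ> u - u \<circ> \<nabla>\<close>.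
\<close>

definition horizontal_hom ::
    "nat \<Rightarrow> complex \<Rightarrow> complex set \<Rightarrow> (complex \<Rightarrow> complex ^ 'r ^ 'r)
      \<Rightarrow> (complex \<Rightarrow> complex ^ 'r ^ 'r) \<Rightarrow> (complex \<Rightarrow> complex ^ 'r ^ 'r) \<Rightarrow> bool"
  where "horizontal_hom m \<epsilon> S A1 A2 u \<longleftrightarrow>
    (\<forall>f. (\<forall>i. (\<lambda>z. f z $ i) holomorphic_on S) \<longrightarrow>
      (\<forall>z\<in>S. z ^ m \<noteq> \<epsilon> ^ m \<longrightarrow>
        nabla m \<epsilon> A2 (\<lambda>x. u x *v f x) z = u z *v nabla m \<epsilon> A1 f z))"

text \<open>
  \<open>Y\<close> is the analytic continuation, along the (merely continuous) path \<open>g\<close>, of a matrix whose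
  columns are horizontal sections.
\<close>

definition horizontal_along ::
    "nat \<Rightarrow> complex \<Rightarrow> (complex \<Rightarrow> complex ^ 'r ^ 'r) \<Rightarrow> (real \<Rightarrow> complex)
      \<Rightarrow> (real \<Rightarrow> complex ^ 'r ^ 'r) \<Rightarrow> bool"
  where "horizontal_along m \<epsilon> A g Y \<longleftrightarrow>
    (\<forall>t\<in>{0..1}. \<exists>U \<Phi>. open U \<and> g t \<in> U \<and>
      (\<forall>i k. (\<lambda>z. \<Phi> z $ i $ k) holomorphic_on U) \<and>
      (\<forall>z\<in>U. z ^ m \<noteq> \<epsilon> ^ m \<and> (\<forall>v. nabla m \<epsilon> A (\<lambda>x. \<Phi> x *v v) z = 0)) \<and>
      (\<exists>\<delta>>0. \<forall>x\<in>{0..1}. \<bar>x - t\<bar> < \<delta> \<longrightarrow> g x \<in> U \<and> Y x = \<Phi> (g x)))"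

text \<open>\<open>M\<close> represents the monodromy along the loop \<open>g\<close> in some basis of the horizontal sections
  near \<open>g 0 = g 1\<close>.\<close>

definition monodromy_matrix ::
    "nat \<Rightarrow> complex \<Rightarrow> (complex \<Rightarrow> complex ^ 'r ^ 'r) \<Rightarrow> (real \<Rightarrow> complex)
      \<Rightarrow> complex ^ 'r ^ 'r \<Rightarrow> bool"
  where "monodromy_matrix m \<epsilon> A g M \<longleftrightarrow>
    (\<exists>Y. horizontal_along m \<epsilon> A g Y \<and> invertible (Y 0) \<and> Y 1 = Y 0 ** M)"


section \<open>The local connection\<close>

definition polydisc :: "(complex ^ 'b) set"
  where "polydisc = {b. \<forall>i. cmod (b $ i) < 1}"

definition Ddiv :: "nat \<Rightarrow> 'b \<Rightarrow> (complex ^ 'b) set \<Rightarrow> (complex \<times> (complex ^ 'b)) set"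
  where "Ddiv m e V = {(z, b). b \<in> V \<and> z ^ m - (b $ e) ^ m = 0}"

definition Gam :: "nat \<Rightarrow> 'b \<Rightarrow> (complex ^ 'b) set \<Rightarrow> (complex \<times> (complex ^ 'b)) set"
  where "Gam m e V = {(of_real t * exp (2 * of_real pi * \<i> / of_nat m) ^ j * b $ e, b) | t j b.
    0 \<le> t \<and> t \<le> 1 \<and> j \<in> {1..m} \<and> b \<in> V}"

text \<open>The locus \<open>z = 0\<close>, \<open>\<epsilon> = 0\<close>, around which the data on \<open>{\<epsilon> ^ m = 0}\<close> live.\<close>

definition central :: "'b \<Rightarrow> (complex ^ 'b) set \<Rightarrow> (complex \<times> (complex ^ 'b)) set"
  where "central e V = {(0, b) | b. b \<in> V \<and> b $ e = 0}"

definition nu ::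
    "nat \<Rightarrow> nat \<Rightarrow> (nat \<Rightarrow> nat \<Rightarrow> complex ^ 'b \<Rightarrow> complex) \<Rightarrow> complex
      \<Rightarrow> complex \<Rightarrow> complex ^ 'b \<Rightarrow> complex"
  where "nu r m c T z b = (\<Sum>l<r. (\<Sum>j<m. c l j b * z ^ j) * T ^ l)"

definition exponents ::
    "nat \<Rightarrow> 'b \<Rightarrow> ('r::finite \<Rightarrow> complex) \<Rightarrow> (nat \<Rightarrow> nat \<Rightarrow> complex ^ 'b \<Rightarrow> complex) \<Rightarrow> bool"
  where "exponents m e \<mu> c \<longleftrightarrow>
    inj \<mu> \<and>
    (\<forall>l<CARD('r). \<forall>j<m. holo_base (c l j) polydisc) \<and>
    (\<forall>(z, b)\<in>Ddiv m e polydisc. inj (\<lambda>k. nu CARD('r) m c (\<mu> k) z b))"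

text \<open>A disk is understood topologically.\<close>

definition loop_family ::
    "nat \<Rightarrow> 'b \<Rightarrow> (real \<Rightarrow> complex ^ 'b \<Rightarrow> complex) \<Rightarrow> (complex \<times> (complex ^ 'b)) set \<Rightarrow> bool"
  where "loop_family m e \<gamma> W \<longleftrightarrow>
    continuous_on ({0..1} \<times> polydisc) (\<lambda>(t, b). \<gamma> t b) \<and>
    (\<forall>b\<in>polydisc. \<gamma> 0 b = \<gamma> 1 b \<and> (\<forall>t\<in>{0..1}. \<gamma> t b \<in> ball 0 1)) \<and>
    open W \<and> W \<subseteq> ball 0 1 \<times> polydisc \<and>
    (\<forall>b\<in>polydisc.
      {z. (z, b) \<in> W} homeomorphic (ball 0 1 :: complex set) \<and>
      {z. z ^ m - (b $ e) ^ m = 0} \<subseteq> {z. (z, b) \<in> W} \<and>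
      frontier {z. (z, b) \<in> W} = (\<lambda>t. \<gamma> t b) ` {0..1})"

definition local_connection ::
    "nat \<Rightarrow> 'b \<Rightarrow> ('r::finite \<Rightarrow> complex) \<Rightarrow> (nat \<Rightarrow> nat \<Rightarrow> complex ^ 'b \<Rightarrow> complex)
      \<Rightarrow> ('b::finite, 'r::finite) matfun \<Rightarrow> bool"
  where "local_connection m e \<mu> c A \<longleftrightarrow>
    mholo_total A (ball 0 1 \<times> polydisc) \<and>
    cong_total (ball 0 1 \<times> polydisc) (\<lambda>z b. z ^ m - (b $ e) ^ m)
      A (\<lambda>z b. diag_mat (\<lambda>k. nu CARD('r) m c (\<mu> k) z b))"

definition distinct_monodromy ::
    "nat \<Rightarrow> 'b \<Rightarrow> (real \<Rightarrow> complex ^ 'b \<Rightarrow> complex) \<Rightarrow> ('b::finite, 'r::finite) matfun \<Rightarrow> bool"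
  where "distinct_monodromy m e \<gamma> A \<longleftrightarrow>
    (\<exists>d :: 'r \<Rightarrow> complex ^ 'b \<Rightarrow> complex.
      (\<forall>k. holo_base (d k) polydisc) \<and>
      (\<forall>b\<in>polydisc. inj (\<lambda>k. d k b) \<and>
        monodromy_matrix m (b $ e) (\<lambda>z. A z b) (\<lambda>t. \<gamma> t b) (diag_mat (\<lambda>k. d k b))))"

text \<open>Scalar constants are always horizontal, so only the non-trivial inclusion is stated.\<close>

definition only_scalar_endomorphisms :: "nat \<Rightarrow> 'b \<Rightarrow> ('b::finite, 'r::finite) matfun \<Rightarrow> bool"
  where "only_scalar_endomorphisms m e A \<longleftrightarrow>
    (\<forall>b\<in>polydisc. \<forall>u.
      (\<forall>i k. (\<lambda>z. u z $ i $ k) holomorphic_on ball 0 1) \<and>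
      horizontal_hom m (b $ e) (ball 0 1) (\<lambda>z. A z b) (\<lambda>z. A z b) u
      \<longrightarrow> (\<exists>a. \<forall>z\<in>ball 0 1. u z = mat a))"


section \<open>Extension to the projective line\<close>

definition Ainf_fun ::
    "nat \<Rightarrow> (nat \<Rightarrow> complex ^ 'b \<Rightarrow> complex ^ 'r ^ 'r) \<Rightarrow> ('b::finite, 'r::finite) matfun"
  where "Ainf_fun m Ai z b = (\<Sum>q<m. mscale (z ^ q) (Ai q b))"

text \<open>
  Since \<open>Ainf_fun\<close> has degree less than \<open>m\<close> in \<open>z\<close>, the pole at infinity is automatically simple.
\<close>

definition extends_to_P1 ::
    "nat \<Rightarrow> 'b \<Rightarrow> ('b::finite, 'r::finite) matfun \<Rightarrow> (complex ^ 'b) set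
      \<Rightarrow> (nat \<Rightarrow> complex ^ 'b \<Rightarrow> complex ^ 'r ^ 'r) \<Rightarrow> bool"
  where "extends_to_P1 m e A V Ai \<longleftrightarrow>
    (\<forall>q<m. mholo_base (Ai q) V) \<and>
    (\<exists>Q. mholo_total Q (ball 0 1 \<times> V) \<and>
      (\<forall>z\<in>ball 0 1. \<forall>b\<in>V. invertible (Q z b)) \<and>
      (\<forall>b\<in>V. horizontal_hom m (b $ e) (ball 0 1)
         (\<lambda>z. A z b) (\<lambda>z. Ainf_fun m Ai z b) (\<lambda>z. Q z b)))"


section \<open>Adjusting data\<close>

text \<open>Both sides are multiplied by \<open>z ^ m - \<epsilon> ^ m\<close>; \<open>dz / (z ^ m - \<epsilon> ^ m)\<close> generates the forms
  with poles along \<open>D\<close>.\<close>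

definition diagonalizer ::
    "nat \<Rightarrow> 'b \<Rightarrow> ('r::finite \<Rightarrow> complex) \<Rightarrow> (nat \<Rightarrow> nat \<Rightarrow> complex ^ 'b \<Rightarrow> complex)
      \<Rightarrow> (complex ^ 'b) set \<Rightarrow> (nat \<Rightarrow> complex ^ 'b \<Rightarrow> complex ^ 'r ^ 'r)
      \<Rightarrow> ('b::finite, 'r::finite) matfun \<Rightarrow> bool"
  where "diagonalizer m e \<mu> c V Ai P \<longleftrightarrow>
    (\<exists>N. open N \<and> Ddiv m e V \<subseteq> N \<and> N \<subseteq> ball 0 1 \<times> V \<and>
      mholo_total P N \<and> (\<forall>(z, b)\<in>N. invertible (P z b)) \<and>
      cong_total N (\<lambda>z b. (z ^ m - (b $ e) ^ m)\<^sup>2)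
        (\<lambda>z b. mscale (z ^ m - (b $ e) ^ m) (matrix_inv (P z b) ** mderiv P z b)
               + matrix_inv (P z b) ** Ainf_fun m Ai z b ** P z b)
        (\<lambda>z b. diag_mat (\<lambda>k. nu CARD('r) m c (\<mu> k) z b)))"

text \<open>\<open>\<psi> i q\<close> is the coefficient of \<open>z ^ q * T ^ i\<close>.\<close>

definition inverse_exponents ::
    "nat \<Rightarrow> 'b \<Rightarrow> ('r::finite \<Rightarrow> complex) \<Rightarrow> (nat \<Rightarrow> nat \<Rightarrow> complex ^ 'b \<Rightarrow> complex)
      \<Rightarrow> (complex ^ 'b) set \<Rightarrow> (nat \<Rightarrow> nat \<Rightarrow> complex ^ 'b \<Rightarrow> complex) \<Rightarrow> bool"
  where "inverse_exponents m e \<mu> c V \<psi> \<longleftrightarrow>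
    (\<forall>i<CARD('r). \<forall>q<m. holo_base (\<psi> i q) V) \<and>
    cong_total (ball 0 1 \<times> V) (\<lambda>z b. z ^ m - (b $ e) ^ m)
      (\<lambda>z b. eval_T (\<lambda>i. \<Sum>q<m. \<psi> i q b * z ^ q)
                (diag_mat (\<lambda>k. nu CARD('r) m c (\<mu> k) z b)))
      (\<lambda>z b. diag_mat \<mu>)"

definition subst_zm :: "nat \<Rightarrow> complex \<Rightarrow> complex poly \<Rightarrow> complex poly"
  where "subst_zm m a p = (\<Sum>n\<le>degree p. monom (coeff p n * a ^ (n div m)) (n mod m))"

text \<open>The matrix polynomial in \<open>z\<close> obtained from \<open>z ^ j * \<psi>(Ainf) ^ l\<close> on replacing \<open>z ^ m\<close> by
  \<open>\<epsilon> ^ m\<close>.\<close>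

definition Xi ::
    "nat \<Rightarrow> 'b \<Rightarrow> (nat \<Rightarrow> nat \<Rightarrow> complex ^ 'b \<Rightarrow> complex)
      \<Rightarrow> (nat \<Rightarrow> complex ^ 'b \<Rightarrow> complex ^ 'r ^ 'r) \<Rightarrow> nat \<Rightarrow> nat
      \<Rightarrow> complex ^ 'b \<Rightarrow> complex poly ^ 'r ^ 'r"
  where "Xi m e \<psi> Ai l j b =
    (let Ap = (\<chi> i k. \<Sum>q<m. monom (Ai q b $ i $ k) q);
         M = mscale (monom 1 j) (mat_power (eval_T (\<lambda>i. \<Sum>q<m. monom (\<psi> i q b) q) Ap) l)
     in \<chi> i k. subst_zm m ((b $ e) ^ m) (M $ i $ k))"

definition mcoeff :: "complex poly ^ 'r ^ 'r \<Rightarrow> nat \<Rightarrow> complex ^ 'r ^ 'r"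
  where "mcoeff M q = (\<chi> i k. coeff (M $ i $ k) q)"

definition mpoly_eval :: "complex poly ^ 'r ^ 'r \<Rightarrow> complex \<Rightarrow> complex ^ 'r ^ 'r"
  where "mpoly_eval M z = (\<chi> i k. poly (M $ i $ k) z)"

definition B0 ::
    "nat \<Rightarrow> ('r::finite \<Rightarrow> complex) \<Rightarrow> ('b::finite, 'r::finite) matfun \<Rightarrow> nat \<Rightarrow> nat \<Rightarrow> ('b::finite, 'r::finite) matfun"
  where "B0 m \<mu> P l j z b =
    P z b ** diag_mat (\<lambda>k. \<mu> k ^ l * (z powi (int j - int m + 1) / of_int (int j - int m + 1)))
      ** matrix_inv (P z b)"

definition mseries ::
    "(nat \<Rightarrow> complex ^ 'b \<Rightarrow> complex ^ 'r ^ 'r) \<Rightarrow> ('b::finite, 'r::finite) matfun"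
  where "mseries S z b = (\<chi> i k. \<Sum>n. S n b $ i $ k * z ^ n)"

text \<open>
  \<open>S n\<close> is the coefficient of \<open>z ^ n\<close> in \<open>R'\<close> for the pair \<open>(l, j)\<close>, and \<open>a q\<close>, \<open>q \<le> m - 2\<close>, are
  the coefficients of the polynomial \<open>\<tilde>A'\<close>. Functions on the non-reduced space \<open>{\<epsilon> ^ m = 0}\<close> are
  given by representatives on a neighbourhood of \<open>{\<epsilon> = 0}\<close> and compared modulo \<open>\<epsilon> ^ m\<close>. The
  equation is multiplied by \<open>z ^ m\<close>; its left-hand side is \<open>A'\<close>.
\<close>

definition normalizing_series ::
    "nat \<Rightarrow> 'b \<Rightarrow> ('r::finite \<Rightarrow> complex) \<Rightarrow> (complex ^ 'b) set
      \<Rightarrow> (nat \<Rightarrow> complex ^ 'b \<Rightarrow> complex ^ 'r ^ 'r) \<Rightarrow> ('b::finite, 'r::finite) matfun \<Rightarrow> nat \<Rightarrow> nat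
      \<Rightarrow> (nat \<Rightarrow> complex ^ 'b \<Rightarrow> complex ^ 'r ^ 'r) \<Rightarrow> bool"
  where "normalizing_series m e \<mu> V Ai P l j S \<longleftrightarrow>
    (\<exists>N V0 a. open N \<and> central e V \<subseteq> N \<and> N \<subseteq> ball 0 1 \<times> V0 \<and>
      open V0 \<and> {b \<in> V. b $ e = 0} \<subseteq> V0 \<and> V0 \<subseteq> V \<and>
      (\<forall>n. mholo_base (S n) V0) \<and>
      (\<forall>(z, b)\<in>N. \<forall>i k. summable (\<lambda>n. S n b $ i $ k * z ^ n)) \<and>
      mholo_total (mseries S) N \<and>
      (\<forall>q\<le>m - 2. mholo_base (a q) V0) \<and>
      cong_total (N - {(z, b). z = 0}) (\<lambda>z b. (b $ e) ^ m)
        (\<lambda>z b. mscale (z ^ m) (mderiv (B0 m \<mu> P l j) z b)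
               + commutator (Ainf_fun m Ai z b) (B0 m \<mu> P l j z b))
        (\<lambda>z b. mscale (z ^ m) (mderiv (mseries S) z b)
               + ((\<Sum>q\<le>m - 2. mscale (z ^ q) (a q b))
                  + commutator (Ainf_fun m Ai z b) (mseries S z b))))"

text \<open>\<open>R' l j n\<close> and \<open>R l j n\<close> are the matrices with indices \<open>(l)\<close>, \<open>j\<close> and \<open>l' = n\<close>.\<close>

definition adjusting_data ::
    "nat \<Rightarrow> 'b \<Rightarrow> (nat \<Rightarrow> nat \<Rightarrow> complex ^ 'b \<Rightarrow> complex) \<Rightarrow> (complex ^ 'b) set
      \<Rightarrow> (nat \<Rightarrow> complex ^ 'b \<Rightarrow> complex ^ 'r ^ 'r)
      \<Rightarrow> (nat \<Rightarrow> nat \<Rightarrow> nat \<Rightarrow> complex ^ 'b \<Rightarrow> complex ^ 'r ^ 'r)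
      \<Rightarrow> (nat \<Rightarrow> nat \<Rightarrow> nat \<Rightarrow> complex ^ 'b \<Rightarrow> complex ^ 'r ^ 'r) \<Rightarrow> bool"
  where "adjusting_data m e \<psi> V Ai R' R \<longleftrightarrow>
    (\<forall>l<CARD('r). \<forall>j\<le>m - 2.
      (\<forall>n<m. mholo_base (R l j n) V \<and>
        (\<exists>V0. open V0 \<and> {b \<in> V. b $ e = 0} \<subseteq> V0 \<and> V0 \<subseteq> V \<and>
          cong_base V0 (\<lambda>b. (b $ e) ^ m) (R l j n) (R' l j n))) \<and>
      (\<forall>b\<in>V. mcoeff (Xi m e \<psi> Ai l j b) (m - 1)
             = (\<Sum>n<m. commutator (Ai (m - n - 1) b) (R l j n b))))"

definition Xi_tilde ::
    "nat \<Rightarrow> 'b \<Rightarrow> (nat \<Rightarrow> nat \<Rightarrow> complex ^ 'b \<Rightarrow> complex)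
      \<Rightarrow> (nat \<Rightarrow> complex ^ 'b \<Rightarrow> complex ^ 'r ^ 'r)
      \<Rightarrow> (nat \<Rightarrow> nat \<Rightarrow> nat \<Rightarrow> complex ^ 'b \<Rightarrow> complex ^ 'r ^ 'r) \<Rightarrow> nat \<Rightarrow> nat
      \<Rightarrow> ('b::finite, 'r::finite) matfun"
  where "Xi_tilde m e \<psi> Ai R l j z b =
    mpoly_eval (Xi m e \<psi> Ai l j b) z
    - (\<Sum>q<m. \<Sum>n | n < m \<and> q + n \<le> m - 1.
         mscale (z ^ (q + n)) (commutator (Ai q b) (R l j n b)))
    - (\<Sum>q<m. \<Sum>n | n < m \<and> q + n \<ge> m.
         mscale ((b $ e) ^ m * z ^ (q + n - m)) (commutator (Ai q b) (R l j n b)))"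


section \<open>Flat connections over the dual numbers and horizontal lifts\<close>

text \<open>
  Relative matrix one-forms over \<open>X[h]\<close>, \<open>h\<^sup>2 = 0\<close>: the triple \<open>(a0, a1, g)\<close> stands for
  \<open>(a0 + h a1) dz + g dh\<close>. Since \<open>h dh = 0\<close>, the coefficient of \<open>dh\<close> only matters modulo \<open>h\<close>, and
  a two-form is \<open>k dz \<and> dh\<close> with \<open>k\<close> modulo \<open>h\<close>.
\<close>

type_synonym ('b, 'r) form1 = "('b, 'r) matfun \<times> ('b, 'r) matfun \<times> ('b, 'r) matfun"

fun ext_d :: "('b::finite, 'r::finite) form1 \<Rightarrow> ('b::finite, 'r::finite) matfun"
  where "ext_d (a0, a1, g) = (\<lambda>z b. mderiv g z b - a1 z b)"

fun wedge ::
    "('b::finite, 'r::finite) form1 \<Rightarrow> ('b::finite, 'r::finite) form1 \<Rightarrow> ('b::finite, 'r::finite) matfun"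
  where "wedge (a0, a1, g) (a0', a1', g') = (\<lambda>z b. a0 z b ** g' z b - g z b ** a0' z b)"

text \<open>With \<open>u = 1 / z\<close> one has \<open>dz = - du / u\<^sup>2\<close>.\<close>

definition simple_pole_at_inf_dz :: "(complex ^ 'b) set \<Rightarrow> ('b::finite, 'r::finite) matfun \<Rightarrow> bool"
  where "simple_pole_at_inf_dz V F \<longleftrightarrow>
    (\<exists>U G. open U \<and> {0} \<times> V \<subseteq> U \<and> mholo_total G U \<and>
      (\<forall>(u, b)\<in>U. u \<noteq> 0 \<longrightarrow> G u b = mscale (u * (- 1 / u\<^sup>2)) (F (1 / u) b)))"

definition simple_pole_at_inf_fun :: "(complex ^ 'b) set \<Rightarrow> ('b::finite, 'r::finite) matfun \<Rightarrow> bool"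
  where "simple_pole_at_inf_fun V F \<longleftrightarrow>
    (\<exists>U G. open U \<and> {0} \<times> V \<subseteq> U \<and> mholo_total G U \<and>
      (\<forall>(u, b)\<in>U. u \<noteq> 0 \<longrightarrow> G u b = mscale u (F (1 / u) b)))"

text \<open>Holomorphic outside \<open>\<Gamma>\<close>, with at most a simple pole along infinity.\<close>

fun form_section :: "nat \<Rightarrow> 'b \<Rightarrow> (complex ^ 'b) set \<Rightarrow> ('b::finite, 'r::finite) form1 \<Rightarrow> bool"
  where "form_section m e V (a0, a1, g) \<longleftrightarrow>
    mholo_total a0 (UNIV \<times> V - Gam m e V) \<and>
    mholo_total a1 (UNIV \<times> V - Gam m e V) \<and>
    mholo_total g (UNIV \<times> V - Gam m e V) \<and>
    simple_pole_at_inf_dz V a0 \<and> simple_pole_at_inf_dz V a1 \<and> simple_pole_at_inf_fun V g"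

text \<open>
  \<open>B'\<close> is only defined near \<open>z = 0\<close>, so \<open>B|\<^sub>\<epsilon>\<^sup>m\<^sub>=\<^sub>0 = B'\<close> is imposed on a punctured
  neighbourhood; note that over \<open>\<epsilon> = 0\<close> the set \<open>\<Gamma>\<close> is just \<open>z = 0\<close>.
\<close>

definition horizontal_lift ::
    "nat \<Rightarrow> 'b \<Rightarrow> ('r::finite \<Rightarrow> complex) \<Rightarrow> (nat \<Rightarrow> nat \<Rightarrow> complex ^ 'b \<Rightarrow> complex)
      \<Rightarrow> (complex ^ 'b) set \<Rightarrow> (nat \<Rightarrow> complex ^ 'b \<Rightarrow> complex ^ 'r ^ 'r)
      \<Rightarrow> ('b::finite, 'r::finite) matfun
      \<Rightarrow> (nat \<Rightarrow> nat \<Rightarrow> nat \<Rightarrow> complex ^ 'b \<Rightarrow> complex ^ 'r ^ 'r)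
      \<Rightarrow> (nat \<Rightarrow> nat \<Rightarrow> nat \<Rightarrow> complex ^ 'b \<Rightarrow> complex ^ 'r ^ 'r)
      \<Rightarrow> nat \<Rightarrow> nat \<Rightarrow> ('b::finite, 'r::finite) form1 \<Rightarrow> bool"
  where "horizontal_lift m e \<mu> \<psi> V Ai P R' R l j \<omega> \<longleftrightarrow>
    (\<exists>B. \<omega> = ((\<lambda>z b. mscale (1 / (z ^ m - (b $ e) ^ m)) (Ainf_fun m Ai z b)),
               (\<lambda>z b. mscale (1 / (z ^ m - (b $ e) ^ m)) (Xi_tilde m e \<psi> Ai R l j z b)),
               B) \<and>
      (\<exists>N. open N \<and> central e V \<subseteq> N \<and> N \<subseteq> ball 0 1 \<times> V \<and>
        cong_total (N - Gam m e V) (\<lambda>z b. (b $ e) ^ m)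
          B (\<lambda>z b. B0 m \<mu> P l j z b - mseries (R' l j) z b))) \<and>
    form_section m e V \<omega> \<and>
    (\<forall>(z, b)\<in>UNIV \<times> V - Gam m e V. ext_d \<omega> z b + wedge \<omega> \<omega> z b = 0)"

end

theory Submission
  imports Defs "HOL-Complex_Analysis.Complex_Analysis"
begin

text \<open>
  In the coordinate \<open>u = 1 / z\<close> the flatness equation \<open>(z\<^sup>m - \<epsilon>\<^sup>m) \<partial>\<^sub>z B + [A\<^sub>\<infinity>, B] = \<Xi>~\<close> for the
  \<open>dh\<close>-coefficient \<open>B\<close> is a linear system with a regular singular point at \<open>u = 0\<close>, governed by the
  adjoint action of the residue \<open>A\<^bsub>\<infinity>, m - 1\<^esub>\<close>, over a domain that is star-shaped in \<open>u\<close>.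
  Over \<open>\<epsilon> = 0\<close> the point \<open>z = 0\<close> is the only finite singularity, so the monodromy along \<open>\<gamma>\<close> is conjugate
  to a power of the one around infinity; its eigenvalues being distinct, those of the residue do not
  differ by integers, and this persists after shrinking. Hence a solution \<open>B\<close> exists
  outside \<open>\<Gamma>\<close> for every prescribed value at infinity in the commutant of the residue.

  The adjusting data make \<open>\<Xi>~\<close> and the polynomial \<open>A~'\<close> congruent modulo \<open>\<epsilon>\<^sup>m\<close> (compare the
  coefficients of \<open>z\<^sup>s\<close>, \<open>s < m\<close>, of two expressions for \<open>[A\<^sub>\<infinity>, R']\<close>), so \<open>B\<^sub>0'\<close> solves the equation
  modulo \<open>\<epsilon>\<^sup>m\<close> near the origin. If a solution \<open>B\<close> agrees with \<open>B\<^sub>0'\<close> modulo \<open>\<epsilon>\<^sup>n\<close>, \<open>n < m\<close>, then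
  \<open>(B\<^sub>0' - B) / \<epsilon>\<^sup>n\<close> is horizontal over \<open>\<epsilon> = 0\<close>, and adding to \<open>B\<close> the product of \<open>\<epsilon>\<^sup>n\<close> and a global
  horizontal section that extends it improves the congruence by one order.
\<close>

text \<open>Solutions are expanded at infinity because over \<epsilon> = 0 the poles of the form
  collide in z = 0: the pole there has order m, and formal solutions in z need not converge. At
  infinity the pole stays simple for all \<epsilon>. Increasing |z| from a point outside \<Gamma>
  never enters \<Gamma>, so integration along rays can replace power series:
  \<open>u d/du + N\<close> is inverted by an integral, a Picard series converges for large N, and
  nonresonance then lowers N one order at a time. The result lives on the whole complement of
  \<Gamma> and is holomorphic in the parameters without gluing. The value at infinity is the only
  freedom, and the matching consumes it. So elements of the commutant of the residue have to be
  extended holomorphically in the base; as the residue has simple spectrum, they are polynomials in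
  it, with coefficients read off on a cyclic vector. A horizontal section given near z = 0 over
  \<epsilon> = 0 is single-valued, hence in log z it is periodic, grows at most like a power of z,
  and has an integer leading exponent; nonresonance leaves only the exponent 0.\<close>

no_notation fps_nth (infixl "$" 75)

section \<open>Holomorphic functions of several variables\<close>

type_synonym 'b point = "complex \<times> (complex ^ 'b)"

text \<open>Coordinates are indexed by \<open>'b option\<close>, where \<open>None\<close> stands for \<open>z\<close>.\<close>

definition dir :: "'b::finite option \<Rightarrow> complex \<Rightarrow> 'b point"
  where "dir k t = (case k of None \<Rightarrow> (t, 0) | Some i \<Rightarrow> (0, axis i t))"

definition crd :: "'b::finite option \<Rightarrow> 'b point \<Rightarrow> complex"
  where "crd k p = (case k of None \<Rightarrow> fst p | Some i \<Rightarrow> snd p $ i)"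

lemma crd_simps [simp]: "crd None p = fst p" "crd (Some i) p = snd p $ i"
  by (simp_all add: crd_def)

lemma dir_simps: "dir None t = (t, 0)" "dir (Some i) t = (0, axis i t)"
  by (simp_all add: dir_def)

lemma bounded_linear_dir: "bounded_linear (dir k)"
proof (cases k)
  case None
  then show ?thesis
    by (simp add: dir_def [abs_def] bounded_linear_Pair bounded_linear_ident bounded_linear_zero)
next
  case (Some i)
  have "bounded_linear (\<lambda>t::complex. axis i t)"
    by (rule linear_conv_bounded_linear[THEN iffD1])
      (auto simp: linear_iff vec_eq_iff axis_def)
  then show ?thesis
    using Some by (simp add: dir_def [abs_def] bounded_linear_Pair bounded_linear_zero)
qed

lemma dir_0 [simp]: "dir k 0 = 0"
  using bounded_linear_dir linear_simps(3) by blast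

lemma dir_add: "dir k (s + t) = dir k s + dir k t"
  using bounded_linear_dir linear_simps(1) by blast

lemma continuous_on_dir [continuous_intros]: "continuous_on S f \<Longrightarrow> continuous_on S (\<lambda>x. dir k (f x))"
  using bounded_linear.continuous_on bounded_linear_dir by blast

lemma norm_axis: "norm (axis i t :: complex ^ 'b::finite) = cmod t"
  by (simp add: norm_eq_sqrt_inner inner_axis_axis)

lemma norm_dir [simp]: "norm (dir k t) = cmod t"
  by (cases k) (simp_all add: dir_def norm_Pair norm_axis)

lemma bounded_linear_crd: "bounded_linear (crd k)"
proof (cases k)
  case None
  then show ?thesis by (simp add: crd_def [abs_def] bounded_linear_fst)
next
  case (Some i)
  then show ?thesis
    using bounded_linear_compose[OF bounded_linear_vec_nth bounded_linear_snd]
    by (simp add: crd_def [abs_def])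
qed

lemma continuous_on_crd [continuous_intros]: "continuous_on S f \<Longrightarrow> continuous_on S (\<lambda>x. crd k (f x))"
  using bounded_linear.continuous_on bounded_linear_crd by blast

lemma crd_add: "crd k (p + q) = crd k p + crd k q"
  and crd_diff: "crd k (p - q) = crd k p - crd k q"
  by (cases k; simp add: crd_def)+

lemma crd_dir: "crd k (dir k' t) = (if k = k' then t else 0)"
  by (cases k; cases k') (auto simp: dir_def axis_def)

lemma norm_crd_le: "cmod (crd k p) \<le> norm p"
proof (cases k)
  case None
  then show ?thesis using norm_fst_le[of "fst p" "snd p"] by simp
next
  case (Some i)
  then show ?thesis
    by (cases p) (auto intro: order_trans[OF Finite_Cartesian_Product.norm_nth_le norm_snd_le])
qed

text \<open>The predicate treats z and the base coordinates alike. A derivative at \<open>0\<close>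
  along each direction suffices, since it is demanded at every point of \<open>U\<close>.\<close>

definition hol :: "(('b::finite) point \<Rightarrow> complex) \<Rightarrow> 'b point set \<Rightarrow> bool"
  where "hol f U \<longleftrightarrow> continuous_on U f \<and>
    (\<forall>p\<in>U. \<forall>k. (\<lambda>t. f (p + dir k t)) field_differentiable at 0)"

definition pd :: "'b::finite option \<Rightarrow> ('b point \<Rightarrow> complex) \<Rightarrow> 'b point \<Rightarrow> complex"
  where "pd k f p = deriv (\<lambda>t. f (p + dir k t)) 0"

lemma holI:
  assumes "continuous_on U f"
    and "\<And>p k. p \<in> U \<Longrightarrow> (\<lambda>t. f (p + dir k t)) field_differentiable at 0"
  shows "hol f U"
  using assms by (auto simp: hol_def)

lemma hol_continuous: "hol f U \<Longrightarrow> continuous_on U f"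
  by (simp add: hol_def)

lemma hol_subset: "hol f U \<Longrightarrow> V \<subseteq> U \<Longrightarrow> hol f V"
  by (auto simp: hol_def intro: continuous_on_subset)

lemma eventually_dir:
  assumes "open U" "p \<in> U"
  shows "eventually (\<lambda>t. p + dir k t \<in> U) (nhds 0)"
proof -
  have "continuous_on UNIV (\<lambda>t. p + dir k t)" by (intro continuous_intros)
  then have "open ((\<lambda>t. p + dir k t) -` U)" using assms(1) by (rule open_vimage[rotated])
  then show ?thesis
    using assms(2) by (auto simp: eventually_nhds intro!: exI[of _ "(\<lambda>t. p + dir k t) -` U"])
qed

lemma field_differentiable_cong:
  assumes "eventually (\<lambda>t. f t = g t) (nhds z)" "f field_differentiable at z"
  shows "g field_differentiable at z"
  using assms DERIV_cong_ev[OF refl assms(1) refl] unfolding field_differentiable_def by blast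

lemma hol_cong:
  assumes "open U" "hol f U" "\<And>p. p \<in> U \<Longrightarrow> f p = g p"
  shows "hol g U"
proof (rule holI)
  show "continuous_on U g"
    using assms hol_continuous by (metis continuous_on_cong)
  fix p k assume p: "p \<in> U"
  have "eventually (\<lambda>t. f (p + dir k t) = g (p + dir k t)) (nhds 0)"
    using eventually_dir[OF assms(1) p] by (rule eventually_mono) (use assms(3) in blast)
  moreover have "(\<lambda>t. f (p + dir k t)) field_differentiable at 0"
    using assms(2) p unfolding hol_def by blast
  ultimately show "(\<lambda>t. g (p + dir k t)) field_differentiable at 0"
    by (rule field_differentiable_cong)
qed

lemma hol_local:
  assumes "\<And>p. p \<in> U \<Longrightarrow> \<exists>V. open V \<and> p \<in> V \<and> hol f V"
  shows "hol f U"
proof (rule holI)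
  show "continuous_on U f"
    unfolding continuous_on_eq_continuous_within
  proof
    fix p assume "p \<in> U"
    then obtain V where "open V" "p \<in> V" "hol f V" using assms by blast
    then have "continuous (at p) f"
      using hol_continuous continuous_on_eq_continuous_at by blast
    then show "continuous (at p within U) f"
      using continuous_at_imp_continuous_at_within by blast
  qed
qed (use assms in \<open>auto simp: hol_def\<close>)

lemma hol_has_derivative:
  assumes "hol f U" "p + dir k s \<in> U"
  shows "((\<lambda>s. f (p + dir k s)) has_field_derivative pd k f (p + dir k s)) (at s)"
proof -
  have "(\<lambda>t. f ((p + dir k s) + dir k t)) field_differentiable at 0"
    using assms unfolding hol_def by blast
  then have "((\<lambda>t. f ((p + dir k s) + dir k t)) has_field_derivative pd k f (p + dir k s)) (at 0)"
    unfolding pd_def by (simp add: field_differentiable_derivI)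
  then have "((\<lambda>t. f (p + dir k (t + s))) has_field_derivative pd k f (p + dir k s)) (at 0)"
    by (simp add: dir_add algebra_simps)
  then show ?thesis
    using DERIV_shift[of "\<lambda>s. f (p + dir k s)" _ 0 s] by simp
qed

lemma hol_has_derivative_0:
  assumes "hol f U" "p \<in> U"
  shows "((\<lambda>s. f (p + dir k s)) has_field_derivative pd k f p) (at 0)"
  using hol_has_derivative[of f U p k 0] assms by simp

lemma pd_eqI: "((\<lambda>s. f (p + dir k s)) has_field_derivative D) (at 0) \<Longrightarrow> pd k f p = D"
  by (simp add: pd_def DERIV_imp_deriv)

lemma pd_cong:
  assumes "open U" "p \<in> U" "\<And>p. p \<in> U \<Longrightarrow> f p = g p"
  shows "pd k f p = pd k g p"
  unfolding pd_def
  by (rule deriv_cong_ev[OF eventually_mono[OF eventually_dir[OF assms(1,2), of k]]]) (use assms(3) in auto)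

lemma hol_const [simp]: "hol (\<lambda>p. c) U"
  by (intro holI) auto

lemma hol_crd: "hol (\<lambda>p. crd k p) U"
proof (intro holI continuous_intros)
  fix p k'
  show "(\<lambda>t. crd k (p + dir k' t)) field_differentiable at 0"
    by (cases "k = k'") (auto simp: crd_add crd_dir intro!: derivative_intros)
qed

lemma hol_fst: "hol (\<lambda>p. fst p) U"
  using hol_crd[of None] by simp

lemma hol_snd_nth: "hol (\<lambda>p. snd p $ i) U"
  using hol_crd[of "Some i"] by simp

lemma hol_add: "hol f U \<Longrightarrow> hol g U \<Longrightarrow> hol (\<lambda>p. f p + g p) U"
  and hol_diff: "hol f U \<Longrightarrow> hol g U \<Longrightarrow> hol (\<lambda>p. f p - g p) U"
  and hol_mult: "hol f U \<Longrightarrow> hol g U \<Longrightarrow> hol (\<lambda>p. f p * g p) U"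
  and hol_uminus: "hol f U \<Longrightarrow> hol (\<lambda>p. - f p) U"
  by (auto simp: hol_def intro!: continuous_intros derivative_intros)

lemma hol_sum: "(\<And>i. i \<in> I \<Longrightarrow> hol (f i) U) \<Longrightarrow> hol (\<lambda>p. \<Sum>i\<in>I. f i p) U"
  by (induction I rule: infinite_finite_induct) (auto intro: hol_add)

lemma hol_prod: "(\<And>i. i \<in> I \<Longrightarrow> hol (f i) U) \<Longrightarrow> hol (\<lambda>p. \<Prod>i\<in>I. f i p) U"
  by (induction I rule: infinite_finite_induct) (auto intro: hol_mult)

lemma hol_power: "hol f U \<Longrightarrow> hol (\<lambda>p. f p ^ n) U"
  by (induction n) (auto intro: hol_mult)

lemma hol_divide: "hol f U \<Longrightarrow> hol g U \<Longrightarrow> (\<And>p. p \<in> U \<Longrightarrow> g p \<noteq> 0) \<Longrightarrow> hol (\<lambda>p. f p / g p) U"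
  by (auto simp: hol_def intro!: continuous_intros field_differentiable_divide)

lemma hol_compose_outer:
  assumes "hol f U" "g holomorphic_on S" "open S" "\<And>p. p \<in> U \<Longrightarrow> f p \<in> S"
  shows "hol (\<lambda>p. g (f p)) U"
proof (rule holI)
  show "continuous_on U (\<lambda>p. g (f p))"
    using assms by (intro continuous_on_compose2[OF holomorphic_on_imp_continuous_on[OF assms(2)] hol_continuous[OF assms(1)]]) auto
  fix p k assume p: "p \<in> U"
  have "g field_differentiable at (f (p + dir k 0))"
    using assms(2,3,4) p holomorphic_on_imp_differentiable_at by auto
  then have "(g \<circ> (\<lambda>t. f (p + dir k t))) field_differentiable at 0"
    using assms(1) p unfolding hol_def by (intro field_differentiable_compose) auto
  then show "(\<lambda>t. g (f (p + dir k t))) field_differentiable at 0"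
    by (simp add: o_def)
qed

lemmas hol_intros = hol_const hol_crd hol_fst hol_snd_nth hol_add hol_diff hol_mult hol_uminus hol_sum
  hol_prod hol_power hol_divide

text \<open>Substitutions that preserve the families of coordinate lines avoid Hartogs-type arguments.\<close>

lemma hol_compose:
  assumes f: "hol f W" and c: "continuous_on U \<phi>" and W: "\<And>p. p \<in> U \<Longrightarrow> \<phi> p \<in> W"
    and ax: "\<And>p k. p \<in> U \<Longrightarrow> \<exists>g k'. g field_differentiable at 0 \<and> g 0 = 0 \<and>
      eventually (\<lambda>t. \<phi> (p + dir k t) = \<phi> p + dir k' (g t)) (nhds 0)"
  shows "hol (\<lambda>p. f (\<phi> p)) U"
proof (rule holI)
  show "continuous_on U (\<lambda>p. f (\<phi> p))"
    using continuous_on_compose2[OF hol_continuous[OF f] c] W by blast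
  fix p k assume p: "p \<in> U"
  obtain g k' where g: "g field_differentiable at 0" "g 0 = 0"
     "eventually (\<lambda>t. \<phi> (p + dir k t) = \<phi> p + dir k' (g t)) (nhds 0)"
    using ax[OF p] by blast
  have "(\<lambda>t. f (\<phi> p + dir k' t)) field_differentiable at (g 0)"
    using f W[OF p] g(2) unfolding hol_def by auto
  then have "((\<lambda>t. f (\<phi> p + dir k' t)) \<circ> g) field_differentiable at 0"
    using g(1) field_differentiable_compose by blast
  then show "(\<lambda>t. f (\<phi> (p + dir k t))) field_differentiable at 0"
    by (rule field_differentiable_cong[rotated])
      (use g(3) in \<open>auto simp: o_def elim: eventually_mono\<close>)
qed

lemma hol_translate:
  assumes "hol f W" "\<And>p. p \<in> U \<Longrightarrow> p + a \<in> W"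
  shows "hol (\<lambda>p. f (p + a)) U"
proof (rule hol_compose[OF assms(1)])
  fix p k
  have "(\<lambda>t. t) field_differentiable at 0 \<and> (0::complex) = 0 \<and>
      eventually (\<lambda>t. p + dir k t + a = p + a + dir k t) (nhds 0)"
    by (auto simp: algebra_simps)
  then show "\<exists>g k'. g field_differentiable at 0 \<and> g 0 = 0 \<and>
      eventually (\<lambda>t. p + dir k t + a = p + a + dir k' (g t)) (nhds 0)"
    by blast
qed (auto intro!: continuous_intros assms(2))

section \<open>Integrals with holomorphic parameters\<close>

lemma contour_integral_circlepath_0:
  "contour_integral (circlepath 0 r) f =
    integral {0..1} (\<lambda>x. f (circlepath 0 r x) * (2 * pi * \<i> * r * exp (2 * of_real pi * \<i> * x)))"
  unfolding contour_integral_integral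
proof (rule integral_cong)
  fix x :: real
  have "(circlepath 0 r has_vector_derivative 2 * pi * \<i> * r * exp (2 * of_real pi * \<i> * x)) (at x)"
    using has_vector_derivative_circlepath[of 0 r x UNIV] by simp
  then show "f (circlepath 0 r x) * vector_derivative (circlepath 0 r) (at x) =
      f (circlepath 0 r x) * (2 * pi * \<i> * r * exp (2 * of_real pi * \<i> * x))"
    by (simp add: vector_derivative_at)
qed

text \<open>Cauchy's formula on the circle of radius \<open>r\<close> turns the derivative into an
  integral whose kernel is jointly continuous in \<open>s\<close>, \<open>t\<close> and the position
  on the circle; continuity of parameter integrals does the rest. The Leibniz rule below asks for
  exactly this joint continuity.\<close>

lemma continuous_deriv_param:
  fixes q :: "real \<Rightarrow> complex \<Rightarrow> complex"
  assumes c: "continuous_on ({0..1} \<times> cball 0 r) (\<lambda>(t, s). q t s)"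
    and h: "\<And>t. t \<in> {0..1} \<Longrightarrow> q t holomorphic_on ball 0 r" and r: "r > 0"
  shows "continuous_on (ball 0 r \<times> cbox 0 1) (\<lambda>(s, t). deriv (q t) s)"
proof -
  define K where "K = (\<lambda>(s, t) x. q t (circlepath 0 r x) / (circlepath 0 r x - s)\<^sup>2 *
     (2 * pi * \<i> * r * exp (2 * of_real pi * \<i> * x)))"
  have cq: "continuous_on (cball 0 r) (q t)" if "t \<in> {0..1}" for t
    using that by (intro continuous_on_compose2[OF c, of _ "\<lambda>s. (t, s)", simplified])
      (auto intro!: continuous_intros)
  have eq: "deriv (q t) s = 1 / (2 * of_real pi * \<i>) * integral {0..1} (K (s, t))"
    if "s \<in> ball 0 r" "t \<in> {0..1}" for s t
  proof -
    have "deriv (q t) s = 1 / (2 * of_real pi * \<i>) * contour_integral (circlepath 0 r) (\<lambda>u. q t u / (u - s)\<^sup>2)"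
      using Cauchy_derivative_integral_circlepath(2)[OF cq h] that DERIV_imp_deriv by blast
    also have "contour_integral (circlepath 0 r) (\<lambda>u. q t u / (u - s)\<^sup>2) = integral {0..1} (K (s, t))"
      unfolding contour_integral_circlepath_0 K_def by simp
    finally show ?thesis .
  qed
  have circ: "circlepath 0 r x \<in> cball 0 r" "cmod (circlepath 0 r x) = r" for x
    using r by (auto simp: circlepath norm_mult)
  have "continuous_on ((ball 0 r \<times> cbox 0 1) \<times> cbox 0 1) (\<lambda>(z, x). K z x)"
  proof -
    have 1: "continuous_on ((ball 0 r \<times> cbox 0 1) \<times> cbox 0 1) (\<lambda>z. circlepath 0 r (snd z))"
      unfolding circlepath by (intro continuous_intros)
    have 2: "continuous_on ((ball 0 r \<times> cbox 0 1) \<times> cbox 0 1) (\<lambda>z. q (snd (fst z)) (circlepath 0 r (snd z)))"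
      using circ(1) continuous_on_compose2[OF c, of _ "\<lambda>z. (snd (fst z), circlepath 0 r (snd z))"]
        continuous_on_Pair[OF continuous_on_snd[OF continuous_on_fst[OF continuous_on_id]] 1]
      by force
    show ?thesis
      unfolding K_def case_prod_beta
    proof (intro continuous_intros 1 2 ballI)
      fix z :: "(complex \<times> real) \<times> real" assume "z \<in> (ball 0 r \<times> cbox 0 1) \<times> cbox 0 1"
      then have "cmod (fst (fst z)) < r" by auto
      then have "circlepath 0 r (snd z) \<noteq> fst (fst z)" using circ(2)[of "snd z"] by auto
      then show "(circlepath 0 r (snd z) - fst (fst z))\<^sup>2 \<noteq> 0" by simp
    qed
  qed
  then have "continuous_on (ball 0 r \<times> cbox 0 1) (\<lambda>z. integral (cbox 0 1) (K z))"
    by (rule integral_continuous_on_param)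
  then have "continuous_on (ball 0 r \<times> cbox 0 1) (\<lambda>z. 1 / (2 * of_real pi * \<i>) * integral (cbox 0 1) (K z))"
    by (intro continuous_intros)
  then show ?thesis
    by (rule continuous_on_eq) (auto simp: eq)
qed

text \<open>The one-variable Leibniz rule is applied on each coordinate line: the line through
  \<open>p\<close> in direction \<open>k\<close> is parametrised by a small disc, on which the
  derivative of the integrand is jointly continuous by Cauchy's formula.\<close>

lemma
  fixes h :: "real \<Rightarrow> ('b::finite) point \<Rightarrow> complex"
  assumes U: "open U" and c: "continuous_on ({0..1} \<times> U) (\<lambda>(t, p). h t p)"
    and h: "\<And>t. t \<in> {0..1} \<Longrightarrow> hol (h t) U"
  shows hol_integral: "hol (\<lambda>p. integral {0..1} (\<lambda>t. h t p)) U"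
    and pd_integral: "p \<in> U \<Longrightarrow> pd k (\<lambda>p. integral {0..1} (\<lambda>t. h t p)) p = integral {0..1} (\<lambda>t. pd k (h t) p)"
proof -
  have D: "((\<lambda>s. integral {0..1} (\<lambda>t. h t (p + dir k s))) has_field_derivative integral {0..1} (\<lambda>t. pd k (h t) p)) (at 0)"
    if p: "p \<in> U" for p k
  proof -
    obtain r where r: "r > 0" "cball p r \<subseteq> U"
      using U p open_contains_cball by blast
    define q where "q = (\<lambda>t s. h t (p + dir k s))"
    have inU: "p + dir k s \<in> U" if "s \<in> cball 0 r" for s
      using that r(2) by (auto simp: dist_norm)
    have cq: "continuous_on ({0..1} \<times> cball 0 r) (\<lambda>(t, s). q t s)"
      unfolding q_def case_prod_beta
      using inU by (intro continuous_on_compose2[OF c, of _ "\<lambda>z. (fst z, p + dir k (snd z))", simplified])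
        (auto intro!: continuous_intros)
    have der: "(q t has_field_derivative pd k (h t) (p + dir k s)) (at s)" if "s \<in> cball 0 r" "t \<in> {0..1}" for s t
      unfolding q_def using hol_has_derivative[OF h inU] that by blast
    have hq: "q t holomorphic_on ball 0 r" if "t \<in> {0..1}" for t
      unfolding holomorphic_on_open[OF open_ball] using der[OF _ that] ball_subset_cball by blast
    have int: "q t s = h t (p + dir k s)" for t s by (simp add: q_def)
    have "((\<lambda>s. integral (cbox 0 1) (\<lambda>t. q t s)) has_field_derivative integral (cbox 0 1) (\<lambda>t. deriv (q t) 0)) (at 0 within ball 0 r)"
    proof (rule leibniz_rule_field_derivative[where U = "ball 0 r" and fx = "\<lambda>s t. deriv (q t) s"])
      show "continuous_on (ball 0 r \<times> cbox 0 1) (\<lambda>(s, t). deriv (q t) s)"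
        using continuous_deriv_param[OF cq hq r(1)] .
      show "(\<lambda>t. q t s) integrable_on cbox 0 1" if "s \<in> ball 0 r" for s
        using that by (intro integrable_continuous continuous_on_compose2[OF cq, of _ "\<lambda>t. (t, s)", simplified])
          (auto intro!: continuous_intros)
      show "((\<lambda>s. q t s) has_field_derivative deriv (q t) s) (at s within ball 0 r)"
        if "s \<in> ball 0 r" "t \<in> cbox 0 1" for s t
        using der[of s t] that ball_subset_cball[of 0 r] DERIV_imp_deriv[OF der[of s t]]
        by (auto intro: has_field_derivative_at_within)
    qed (use r in auto)
    then have "((\<lambda>s. integral {0..1} (\<lambda>t. q t s)) has_field_derivative integral {0..1} (\<lambda>t. deriv (q t) 0)) (at 0)"
      using r(1) by (simp add: at_within_open[of 0 "ball 0 r"])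
    moreover have "integral {0..1} (\<lambda>t. deriv (q t) 0) = integral {0..1} (\<lambda>t. pd k (h t) p)"
      by (rule integral_cong) (simp add: q_def pd_def)
    ultimately show ?thesis by (simp add: q_def)
  qed
  show "pd k (\<lambda>p. integral {0..1} (\<lambda>t. h t p)) p = integral {0..1} (\<lambda>t. pd k (h t) p)" if "p \<in> U"
    using D[OF that] by (rule pd_eqI)
  show "hol (\<lambda>p. integral {0..1} (\<lambda>t. h t p)) U"
  proof (rule holI)
    have "continuous_on (U \<times> cbox 0 1) (\<lambda>(p, t). h t p)"
      unfolding case_prod_beta
      by (intro continuous_on_compose2[OF c, of _ "\<lambda>z. (snd z, fst z)", simplified])
        (auto intro!: continuous_intros)
    then show "continuous_on U (\<lambda>p. integral {0..1} (\<lambda>t. h t p))"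
      using integral_continuous_on_param[of U 0 1 "\<lambda>p t. h t p"] by simp
  qed (use D field_differentiable_def in blast)
qed

text \<open>Cauchy's formula on the coordinate line in direction \<open>k\<close> expresses the
  derivative as a weighted average of translates of \<open>f\<close>, and each translate is
  holomorphic in all variables at once. No power series in several variables is involved.\<close>

lemma hol_pd:
  assumes f: "hol f U" and U: "open U"
  shows "hol (pd k f) U"
proof (rule hol_local)
  fix p0 assume p0: "p0 \<in> U"
  \<comment> \<open>The factor 2 leaves room for a centre at distance \<open>r\<close> from
    \<open>p0\<close> and a circle of radius \<open>r\<close> around it.\<close>
  obtain r where r: "r > 0" "cball p0 (2 * r) \<subseteq> U"
  proof -
    obtain R where "R > 0" "cball p0 R \<subseteq> U" using U p0 open_contains_cball by blast
    then show ?thesis by (intro that[of "R / 2"]) auto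
  qed
  have inU: "p + dir k s \<in> U" if "p \<in> ball p0 r" "s \<in> cball 0 r" for p s
  proof -
    have "dist p0 (p + dir k s) \<le> dist p0 p + norm (dir k s)"
      using norm_triangle_ineq4[of "p0 - p" "dir k s"] by (simp add: dist_norm algebra_simps)
    then show ?thesis using that r(2) by (auto intro!: subsetD[OF r(2)])
  qed
  define e where "e = (\<lambda>x. r * exp (2 * of_real pi * \<i> * of_real x) :: complex)"
  have e: "cmod (e x) = r" "e x \<noteq> 0" for x
    using r(1) by (auto simp: e_def norm_mult)
  have eq: "pd k f p = integral {0..1} (\<lambda>x. f (p + dir k (e x)) / e x)" if p: "p \<in> ball p0 r" for p
  proof -
    have d: "((\<lambda>s. f (p + dir k s)) has_field_derivative pd k f (p + dir k s)) (at s)" if "s \<in> cball 0 r" for s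
      using hol_has_derivative[OF f inU[OF p that]] .
    have "(\<lambda>s. f (p + dir k s)) holomorphic_on cball 0 r"
      unfolding holomorphic_on_def field_differentiable_def
      using d has_field_derivative_at_within by blast
    then have h: "continuous_on (cball 0 r) (\<lambda>s. f (p + dir k s))" "(\<lambda>s. f (p + dir k s)) holomorphic_on ball 0 r"
      by (auto intro: holomorphic_on_imp_continuous_on elim: holomorphic_on_subset)
    have "pd k f p = 1 / (2 * of_real pi * \<i>) * contour_integral (circlepath 0 r) (\<lambda>u. f (p + dir k u) / (u - 0)\<^sup>2)"
      unfolding pd_def by (rule DERIV_imp_deriv) (rule Cauchy_derivative_integral_circlepath(2)[OF h], use r(1) in simp)
    also have "contour_integral (circlepath 0 r) (\<lambda>u. f (p + dir k u) / (u - 0)\<^sup>2) =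
      integral {0..1} (\<lambda>x. (2 * of_real pi * \<i>) * (f (p + dir k (e x)) / e x))"
      unfolding contour_integral_circlepath_0 using r(1)
      by (intro integral_cong) (simp add: circlepath e_def power2_eq_square field_simps)
    finally show ?thesis by (simp only: integral_mult_right) simp
  qed
  have "hol (\<lambda>p. integral {0..1} (\<lambda>x. f (p + dir k (e x)) / e x)) (ball p0 r)"
  proof (rule hol_integral)
    show "hol (\<lambda>p. f (p + dir k (e t)) / e t) (ball p0 r)" for t
      by (intro hol_divide hol_const hol_translate[OF f]) (use e inU in auto)
    have 1: "continuous_on S (\<lambda>z. e (fst z))" for S :: "(real \<times> 'a point) set"
      unfolding e_def by (intro continuous_intros)
    show "continuous_on ({0..1} \<times> ball p0 r) (\<lambda>(t, p). f (p + dir k (e t)) / e t)"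
      unfolding case_prod_beta
      by (intro continuous_intros 1 continuous_on_compose2[OF hol_continuous[OF f]])
        (use e inU in auto)
  qed auto
  then have "hol (pd k f) (ball p0 r)"
    by (rule hol_cong[rotated]) (use eq in auto)
  then show "\<exists>V. open V \<and> p0 \<in> V \<and> hol (pd k f) V"
    using r(1) by (intro exI[of _ "ball p0 r"]) auto
qed

text \<open>Meant for the Picard series: the one-variable theorem on uniform limits applies on each
  coordinate line, and joint continuity passes to the limit as well.\<close>

lemma hol_uniform_limit:
  assumes U: "open U" and f: "\<And>n. hol (f n) U"
    and lim: "\<And>p. p \<in> U \<Longrightarrow> \<exists>d>0. cball p d \<subseteq> U \<and> uniform_limit (cball p d) f g sequentially"
  shows "hol g U"
proof (rule hol_local)
  fix p0 assume "p0 \<in> U"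
  then obtain d where d: "d > 0" "cball p0 d \<subseteq> U" "uniform_limit (cball p0 d) f g sequentially"
    using lim by blast
  have "hol g (ball p0 d)"
  proof (rule holI)
    have "continuous_on (cball p0 d) g"
    proof (rule uniform_limit_theorem[OF _ d(3)])
      show "\<forall>\<^sub>F n in sequentially. continuous_on (cball p0 d) (f n)"
        using f d(2) by (intro always_eventually allI continuous_on_subset[OF hol_continuous]) 
    qed simp
    then show "continuous_on (ball p0 d) g" using ball_subset_cball continuous_on_subset by blast
    fix p k assume p: "p \<in> ball p0 d"
    obtain r where r: "r > 0" "cball p r \<subseteq> ball p0 d" using p open_contains_cball by (metis open_ball)
    have inU: "p + dir k s \<in> cball p0 d" if "s \<in> ball 0 r" for s
      using subsetD[OF r(2), of "p + dir k s"] that by (auto simp: dist_norm)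
    have "(\<lambda>s. g (p + dir k s)) holomorphic_on ball 0 r"
    proof (rule holomorphic_uniform_sequence[where f = "\<lambda>n s. f n (p + dir k s)"])
      show "(\<lambda>s. f n (p + dir k s)) holomorphic_on ball 0 r" for n
        unfolding holomorphic_on_open[OF open_ball]
        using hol_has_derivative[OF f] inU d(2) by blast
      fix x :: complex assume x: "x \<in> ball 0 r"
      then obtain e where e: "e > 0" "cball x e \<subseteq> ball 0 r" using open_contains_cball by (metis open_ball)
      have "uniform_limit (cball x e) (\<lambda>n s. f n (p + dir k s)) (\<lambda>s. g (p + dir k s)) sequentially"
        by (rule uniform_limit_compose'[OF d(3)]) (use e inU in auto)
      then show "\<exists>e>0. cball x e \<subseteq> ball 0 r \<and> uniform_limit (cball x e) (\<lambda>n s. f n (p + dir k s)) (\<lambda>s. g (p + dir k s)) sequentially"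
        using e by blast
    qed auto
    then show "(\<lambda>s. g (p + dir k s)) field_differentiable at 0"
      using r(1) by (intro holomorphic_on_imp_differentiable_at[of _ "ball 0 r"]) auto
  qed
  then show "\<exists>V. open V \<and> p0 \<in> V \<and> hol g V"
    using d(1) by (intro exI[of _ "ball p0 d"]) auto
qed

section \<open>Division by a coordinate, vectors and matrices\<close>

text \<open>Permits cancelling a coordinate from an identity: every point of the hyperplane
  \<open>crd k p = 0\<close> is approached along its own coordinate line by points off the
  hyperplane.\<close>

lemma coord_nonzero_dense:
  fixes f :: "'b::finite point \<Rightarrow> 'c::t2_space"
  assumes U: "open U" and f: "continuous_on U f" and g: "continuous_on U g"
    and eq: "\<And>p. p \<in> U \<Longrightarrow> crd k p \<noteq> 0 \<Longrightarrow> f p = g p" and p: "p \<in> U"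
  shows "f p = g p"
proof (cases "crd k p = 0")
  case True
  have nhd: "eventually (\<lambda>t. p + dir k t \<in> U) (at 0)"
    using eventually_dir[OF U p] eventually_nhds_conv_at by blast
  have lim: "((\<lambda>t. p + dir k t) \<longlongrightarrow> p) (at 0)"
  proof -
    have "isCont (\<lambda>t. p + dir k t) 0"
      using bounded_linear.isCont[OF bounded_linear_dir[of k] continuous_ident, of 0] by (intro isCont_add) auto
    then show ?thesis by (simp add: isCont_def)
  qed
  have c: "((\<lambda>t. h (p + dir k t)) \<longlongrightarrow> h p) (at 0)" if "continuous_on U h" for h :: "'b point \<Rightarrow> 'c"
    using that p U lim continuous_on_eq_continuous_at isCont_tendsto_compose by blast
  have "eventually (\<lambda>t. f (p + dir k t) = g (p + dir k t)) (at 0)"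
    using nhd unfolding eventually_at_filter
    by (rule eventually_mono) (auto simp: eq crd_add crd_dir True)
  then have "((\<lambda>t. g (p + dir k t)) \<longlongrightarrow> f p) (at 0)"
    using c[OF f] by (rule Lim_transform_eventually[rotated])
  then show ?thesis
    using c[OF g] by (rule tendsto_unique[OF at_neq_bot])
qed (use eq p in auto)

text \<open>Hadamard's lemma. Off the hyperplane the quotient is harmless; near it the quotient is
  the mean of \<open>pd k f\<close> over the segment from the foot point on the hyperplane to
  \<open>p\<close>, which is a holomorphic parameter integral.\<close>

lemma hol_coord_quotient:
  assumes U: "open U" and f: "hol f U" and z: "\<And>p. p \<in> U \<Longrightarrow> crd k p = 0 \<Longrightarrow> f p = 0"
  obtains g where "hol g U" "\<And>p. p \<in> U \<Longrightarrow> f p = crd k p * g p"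
proof
  define g where "g = (\<lambda>p. if crd k p = 0 then pd k f p else f p / crd k p)"
  show "f p = crd k p * g p" if "p \<in> U" for p
    using z[OF that] by (simp add: g_def)
  show "hol g U"
  proof (rule hol_local)
    fix p0 assume p0: "p0 \<in> U"
    show "\<exists>V. open V \<and> p0 \<in> V \<and> hol g V"
    proof (cases "crd k p0 = 0")
      case False
      define V where "V = U \<inter> crd k -` (- {0})"
      have "open V" unfolding V_def
        by (intro open_Int U open_vimage open_Compl continuous_intros)
      moreover have "hol (\<lambda>p. f p / crd k p) V"
        by (intro hol_divide hol_crd hol_subset[OF f]) (auto simp: V_def)
      then have "hol g V"
        by (rule hol_cong[OF \<open>open V\<close>]) (auto simp: g_def V_def)
      ultimately show ?thesis using p0 False by (auto simp: V_def intro!: exI[of _ V])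
    next
      case True
      obtain R where R: "R > 0" "cball p0 R \<subseteq> U" using U p0 open_contains_cball by blast
      \<comment> \<open>Moving \<open>p\<close> towards the hyperplane shifts it by at most
        \<open>cmod (crd k p)\<close>, and this is at most the distance from \<open>p\<close> to
        \<open>p0\<close> because \<open>p0\<close> lies on the hyperplane; hence half the radius
        suffices.\<close>
      define r where "r = R / 2"
      have r: "r > 0" using R by (simp add: r_def)
      define \<phi> where "\<phi> = (\<lambda>t p. p + dir k ((of_real t - 1) * crd k p))"
      have crd\<phi>: "crd k (\<phi> t p) = of_real t * crd k p" for t p
        by (simp add: \<phi>_def crd_add crd_dir algebra_simps)
      have \<phi>U: "\<phi> t p \<in> U" if p: "p \<in> ball p0 r" and t: "t \<in> {0..1}" for t p
      proof -
        have "cmod (crd k p) \<le> norm (p - p0)"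
          using norm_crd_le[of k "p - p0"] True by (simp add: crd_diff)
        moreover have "cmod (of_real t - 1) \<le> 1"
          using t by (metis abs_minus_commute abs_of_nonneg atLeastAtMost_iff diff_ge_0_iff_ge diff_le_eq le_add_same_cancel1 norm_of_real of_real_1 of_real_diff)
        ultimately have "norm ((of_real t - 1) * crd k p) \<le> norm (p - p0)"
          unfolding norm_mult by (meson mult_left_le_one_le norm_ge_zero order_trans)
        then have "norm (p0 - \<phi> t p) \<le> norm (p - p0) + norm (p - p0)"
          using norm_triangle_ineq4[of "p0 - p" "dir k ((of_real t - 1) * crd k p)"]
          by (simp add: \<phi>_def algebra_simps norm_minus_commute)
        then have "dist p0 (\<phi> t p) \<le> R"
          using p by (simp add: dist_norm r_def norm_minus_commute)
        then show ?thesis using R by auto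
      qed
      have \<phi>c: "continuous_on S (\<lambda>z. \<phi> (fst z) (snd z))" for S
        unfolding \<phi>_def by (intro continuous_intros)
      have \<phi>c': "continuous_on S (\<phi> t)" for S t
        unfolding \<phi>_def by (intro continuous_intros)
      \<comment> \<open>The substitution maps coordinate lines to coordinate lines, with speed
        \<open>t\<close> in direction \<open>k\<close> and speed 1 otherwise, as
        \<open>hol_compose\<close> requires.\<close>
      have ax: "\<phi> t (p + dir k' s) = \<phi> t p + dir k' (if k' = k then of_real t * s else s)" for t p k' s
      proof (cases "k' = k")
        case True
        have "(of_real t - 1) * (crd k p + s) = (of_real t - 1) * crd k p + (of_real t * s - s)"
          by (simp add: algebra_simps)
        then show ?thesis
          using True dir_add[of k s "of_real t * s - s"] by (simp add: \<phi>_def crd_add crd_dir dir_add)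
      next
        case False
        then show ?thesis by (simp add: \<phi>_def crd_add crd_dir)
      qed
      have h: "hol (\<lambda>p. pd k f (\<phi> t p)) (ball p0 r)" if t: "t \<in> {0..1}" for t
      proof (rule hol_compose[OF hol_pd[OF f U] \<phi>c'])
        fix p :: "'a point" and k'
        have "(\<lambda>s. if k' = k then of_real t * s else s) field_differentiable at 0"
          by (cases "k' = k") (auto intro!: derivative_intros)
        then show "\<exists>g k''. g field_differentiable at 0 \<and> g 0 = 0 \<and>
            (\<forall>\<^sub>F s in nhds 0. \<phi> t (p + dir k' s) = \<phi> t p + dir k'' (g s))"
          using ax by (intro exI[of _ "\<lambda>s. if k' = k then of_real t * s else s"] exI[of _ k']) auto
      qed (use \<phi>U t in auto)
      define G where "G = (\<lambda>p. integral {0..1} (\<lambda>t. pd k f (\<phi> t p)))"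
      have "hol G (ball p0 r)"
        unfolding G_def
      proof (rule hol_integral[OF open_ball _ h])
        show "continuous_on ({0..1} \<times> ball p0 r) (\<lambda>(t, p). pd k f (\<phi> t p))"
          unfolding case_prod_beta
          by (intro continuous_on_compose2[OF hol_continuous[OF hol_pd[OF f U]] \<phi>c]) (use \<phi>U in auto)
      qed
      moreover have "G p = g p" if p: "p \<in> ball p0 r" for p
      proof (cases "crd k p = 0")
        case True
        then show ?thesis by (simp add: G_def g_def \<phi>_def)
      next
        case False
        have \<phi>s: "\<phi> t p = p + dir k ((of_real t - 1) * crd k p)" for t by (simp add: \<phi>_def)
        have "((\<lambda>t. f (\<phi> t p)) has_vector_derivative crd k p * pd k f (\<phi> t p)) (at t within {0..1})"
          if t: "t \<in> {0..1}" for t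
        proof -
          have *: "((\<lambda>s. f (p + dir k s)) has_field_derivative pd k f (\<phi> t p)) (at ((of_real t - 1) * crd k p))"
            using hol_has_derivative[OF f, of p k "(of_real t - 1) * crd k p"] \<phi>U[OF p t] by (simp add: \<phi>_def)
          have "((\<lambda>t. (of_real t - 1) * crd k p) has_vector_derivative crd k p) (at t within {0..1})"
            by (auto intro!: derivative_eq_intros simp: scaleR_conv_of_real)
          then show ?thesis
            using field_vector_diff_chain_within[where f = "\<lambda>t. (of_real t - 1) * crd k p" and x = t
                and g = "\<lambda>s. f (p + dir k s)" and S = "{0..1}", OF _ has_field_derivative_at_within[OF *]]
            by (simp add: \<phi>_def o_def)
        qed
        then have "((\<lambda>t. crd k p * pd k f (\<phi> t p)) has_integral f (\<phi> 1 p) - f (\<phi> 0 p)) {0..1}"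
          by (intro fundamental_theorem_of_calculus) auto
        moreover have "f (\<phi> 0 p) = 0"
          using z[OF \<phi>U[OF p, of 0]] crd\<phi>[of 0 p] by simp
        ultimately have "((\<lambda>t. crd k p * pd k f (\<phi> t p)) has_integral f p) {0..1}"
          by (simp add: \<phi>_def)
        then have "crd k p * G p = f p"
          unfolding G_def by (metis integral_mult_right integral_unique)
        then show ?thesis using False by (simp add: g_def field_simps)
      qed
      ultimately have "hol g (ball p0 r)"
        using hol_cong[OF open_ball, of G p0 r g] by simp
      then show ?thesis using r by (intro exI[of _ "ball p0 r"]) auto
    qed
  qed
qed

section \<open>Vector- and matrix-valued holomorphic functions\<close>

definition vhol :: "('b::finite point \<Rightarrow> complex ^ 'n) \<Rightarrow> 'b point set \<Rightarrow> bool"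
  where "vhol F U \<longleftrightarrow> (\<forall>i. hol (\<lambda>p. F p $ i) U)"

definition mhol :: "('b::finite point \<Rightarrow> complex ^ 'n ^ 'm) \<Rightarrow> 'b point set \<Rightarrow> bool"
  where "mhol F U \<longleftrightarrow> (\<forall>i k. hol (\<lambda>p. F p $ i $ k) U)"

definition vpd :: "'b::finite option \<Rightarrow> ('b point \<Rightarrow> complex ^ 'n) \<Rightarrow> 'b point \<Rightarrow> complex ^ 'n"
  where "vpd k F p = (\<chi> i. pd k (\<lambda>q. F q $ i) p)"

definition mpd :: "'b::finite option \<Rightarrow> ('b point \<Rightarrow> complex ^ 'n ^ 'm) \<Rightarrow> 'b point \<Rightarrow> complex ^ 'n ^ 'm"
  where "mpd k F p = (\<chi> i j. pd k (\<lambda>q. F q $ i $ j) p)"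

lemma mhol_subset: "mhol G U \<Longrightarrow> V \<subseteq> U \<Longrightarrow> mhol G V"
  by (auto simp: mhol_def intro: hol_subset)

lemma mhol_cong: "open U \<Longrightarrow> mhol F U \<Longrightarrow> (\<And>p. p \<in> U \<Longrightarrow> F p = G p) \<Longrightarrow> mhol G U"
  unfolding mhol_def by (metis (no_types, lifting) hol_cong)

lemma vhol_continuous:
  fixes F :: "'b::finite point \<Rightarrow> complex ^ 'n"
  shows "vhol F U \<Longrightarrow> continuous_on U F"
proof -
  assume F: "vhol F U"
  have "continuous_on U (\<lambda>p. \<chi> i. F p $ i)"
    using F unfolding vhol_def by (intro continuous_on_vec_lambda hol_continuous) auto
  then show ?thesis by (simp add: vec_lambda_eta)
qed

lemma mhol_continuous:
  fixes F :: "'b::finite point \<Rightarrow> complex ^ 'n ^ 'm"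
  shows "mhol F U \<Longrightarrow> continuous_on U F"
proof -
  assume F: "mhol F U"
  have "continuous_on U (\<lambda>p. \<chi> i j. F p $ i $ j)"
    using F unfolding mhol_def by (intro continuous_on_vec_lambda hol_continuous) auto
  then show ?thesis by (simp add: vec_lambda_eta)
qed

lemma hol_nth: "vhol F U \<Longrightarrow> hol (\<lambda>p. F p $ i) U"
  and hol_nth_nth: "mhol G U \<Longrightarrow> hol (\<lambda>p. G p $ i $ k) U"
  by (simp_all add: vhol_def mhol_def)

lemma vhol_const: "vhol (\<lambda>p. c) U"
  and vhol_add: "vhol F U \<Longrightarrow> vhol G U \<Longrightarrow> vhol (\<lambda>p. F p + G p) U"
  and vhol_diff: "vhol F U \<Longrightarrow> vhol G U \<Longrightarrow> vhol (\<lambda>p. F p - G p) U"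
  and vhol_uminus: "vhol F U \<Longrightarrow> vhol (\<lambda>p. - F p) U"
  and vhol_smult: "hol f U \<Longrightarrow> vhol F U \<Longrightarrow> vhol (\<lambda>p. f p *s F p) U"
  and vhol_sum: "(\<And>i. i \<in> I \<Longrightarrow> vhol (H i) U) \<Longrightarrow> vhol (\<lambda>p. \<Sum>i\<in>I. H i p) U"
  by (auto simp: vhol_def intro!: hol_intros)

lemma mhol_const: "mhol (\<lambda>p. c) U"
  and mhol_add: "mhol F U \<Longrightarrow> mhol G U \<Longrightarrow> mhol (\<lambda>p. F p + G p) U"
  and mhol_diff: "mhol F U \<Longrightarrow> mhol G U \<Longrightarrow> mhol (\<lambda>p. F p - G p) U"
  and mhol_uminus: "mhol F U \<Longrightarrow> mhol (\<lambda>p. - F p) U"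
  and mhol_mscale: "hol f U \<Longrightarrow> mhol F U \<Longrightarrow> mhol (\<lambda>p. mscale (f p) (F p)) U"
  and mhol_sum: "(\<And>i. i \<in> I \<Longrightarrow> mhol (H i) U) \<Longrightarrow> mhol (\<lambda>p. \<Sum>i\<in>I. H i p) U"
  by (auto simp: mhol_def mscale_def intro!: hol_intros)

lemma mhol_mult: "mhol F U \<Longrightarrow> mhol G U \<Longrightarrow> mhol (\<lambda>p. F p ** G p) U"
  and vhol_matvec: "mhol F U \<Longrightarrow> vhol v U \<Longrightarrow> vhol (\<lambda>p. F p *v v p) U"
  by (auto simp: vhol_def mhol_def matrix_matrix_mult_def matrix_vector_mult_def intro!: hol_sum hol_mult)

lemma mhol_commutator: "mhol F U \<Longrightarrow> mhol G U \<Longrightarrow> mhol (\<lambda>p. commutator (F p) (G p)) U"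
  unfolding commutator_def by (intro mhol_diff mhol_mult)

lemma mhol_mat_power: "mhol F U \<Longrightarrow> mhol (\<lambda>p. mat_power (F p) n) U"
  by (induction n) (auto simp: mat_power_def intro: mhol_const mhol_mult)

lemma mhol_diag_mat: "(\<And>k. hol (f k) U) \<Longrightarrow> mhol (\<lambda>p. diag_mat (\<lambda>k. f k p)) U"
proof -
  assume f: "\<And>k. hol (f k) U"
  have "hol (\<lambda>p. if c then f k p else 0) U" for c k
    using f by (cases c) auto
  then show ?thesis by (simp add: mhol_def diag_mat_def)
qed

lemma hol_det: "mhol F U \<Longrightarrow> hol (\<lambda>p. det (F p)) U"
  unfolding det_def mhol_def by (intro hol_intros) auto

lemma matrix_inv:
  fixes A :: "complex ^ 'n ^ 'n"
  assumes "invertible A"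
  shows "A ** matrix_inv A = mat 1" "matrix_inv A ** A = mat 1"
proof -
  have "\<exists>B. A ** B = mat 1 \<and> B ** A = mat 1" using assms by (simp add: invertible_def)
  then have "A ** matrix_inv A = mat 1 \<and> matrix_inv A ** A = mat 1"
    unfolding matrix_inv_def by (rule someI_ex)
  then show "A ** matrix_inv A = mat 1" "matrix_inv A ** A = mat 1" by auto
qed

text \<open>By Cramer's rule each entry of the inverse is a quotient of determinants of matrices
  with holomorphic entries.\<close>

lemma mhol_matrix_inv:
  fixes F :: "'b::finite point \<Rightarrow> complex ^ 'n ^ 'n"
  assumes U: "open U" and F: "mhol F U" and inv: "\<And>p. p \<in> U \<Longrightarrow> invertible (F p)"
  shows "mhol (\<lambda>p. matrix_inv (F p)) U"
  unfolding mhol_def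
proof (intro allI)
  fix i k
  have "hol (\<lambda>p. det (\<chi> a c. if c = i then axis k 1 $ a else F p $ a $ c) / det (F p)) U"
  proof (intro hol_divide hol_det)
    show "mhol (\<lambda>p. \<chi> a c. if c = i then axis k 1 $ a else F p $ a $ c) U"
      unfolding mhol_def
    proof (intro allI)
      fix a c
      show "hol (\<lambda>p. (\<chi> a c. if c = i then axis k 1 $ a else F p $ a $ c) $ a $ c) U"
        using F by (cases "c = i") (auto simp: mhol_def)
    qed
  qed (use F inv invertible_det_nz in auto)
  then show "hol (\<lambda>p. matrix_inv (F p) $ i $ k) U"
  proof (rule hol_cong[OF U])
    fix p assume p: "p \<in> U"
    have "F p *v (matrix_inv (F p) *v axis k 1) = axis k 1"
      by (simp add: matrix_vector_mul_assoc matrix_inv(1)[OF inv[OF p]])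
    then have "matrix_inv (F p) *v axis k 1 =
        (\<chi> j. det (\<chi> a c. if c = j then axis k 1 $ a else F p $ a $ c) / det (F p))"
      using cramer inv[OF p] invertible_det_nz by blast
    then have "(matrix_inv (F p) *v axis k 1) $ i = det (\<chi> a c. if c = i then axis k 1 $ a else F p $ a $ c) / det (F p)"
      by simp
    moreover have "(matrix_inv (F p) *v axis k 1) $ i = matrix_inv (F p) $ i $ k"
      by (simp add: matrix_vector_mult_def axis_def if_distrib cong: if_cong)
    ultimately show "det (\<chi> a c. if c = i then axis k 1 $ a else F p $ a $ c) / det (F p) = matrix_inv (F p) $ i $ k"
      by simp
  qed
qed

lemmas mhol_intros = mhol_const mhol_add mhol_diff mhol_uminus mhol_mscale mhol_sum mhol_mult
  mhol_commutator mhol_mat_power mhol_diag_mat vhol_const vhol_add vhol_diff vhol_uminus vhol_smult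
  vhol_sum vhol_matvec

lemma vhol_vpd: "vhol F U \<Longrightarrow> open U \<Longrightarrow> vhol (vpd k F) U"
  and mhol_mpd: "mhol G U \<Longrightarrow> open U \<Longrightarrow> mhol (mpd k G) U"
  by (auto simp: vhol_def mhol_def vpd_def mpd_def intro: hol_pd[unfolded eta_contract_eq])

lemma pd_const [simp]: "pd k (\<lambda>p. c) p = 0"
  by (simp add: pd_def)

lemma pd_add: "hol f U \<Longrightarrow> hol g U \<Longrightarrow> p \<in> U \<Longrightarrow> pd k (\<lambda>p. f p + g p) p = pd k f p + pd k g p"
  and pd_diff: "hol f U \<Longrightarrow> hol g U \<Longrightarrow> p \<in> U \<Longrightarrow> pd k (\<lambda>p. f p - g p) p = pd k f p - pd k g p"
  and pd_mult: "hol f U \<Longrightarrow> hol g U \<Longrightarrow> p \<in> U \<Longrightarrow> pd k (\<lambda>p. f p * g p) p = pd k f p * g p + f p * pd k g p"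
  using hol_has_derivative_0[of f U p k] hol_has_derivative_0[of g U p k]
  by (auto intro!: pd_eqI derivative_eq_intros)

lemma pd_sum: "finite I \<Longrightarrow> (\<And>i. i \<in> I \<Longrightarrow> hol (f i) U) \<Longrightarrow> p \<in> U \<Longrightarrow> pd k (\<lambda>p. \<Sum>i\<in>I. f i p) p = (\<Sum>i\<in>I. pd k (f i) p)"
  by (auto intro!: pd_eqI DERIV_sum hol_has_derivative_0)

lemma mpd_add: "mhol F U \<Longrightarrow> mhol G U \<Longrightarrow> p \<in> U \<Longrightarrow> mpd k (\<lambda>p. F p + G p) p = mpd k F p + mpd k G p"
  and mpd_diff: "mhol F U \<Longrightarrow> mhol G U \<Longrightarrow> p \<in> U \<Longrightarrow> mpd k (\<lambda>p. F p - G p) p = mpd k F p - mpd k G p"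
  and mpd_mscale: "hol f U \<Longrightarrow> mhol F U \<Longrightarrow> p \<in> U \<Longrightarrow> 
     mpd k (\<lambda>p. mscale (f p) (F p)) p = mscale (pd k f p) (F p) + mscale (f p) (mpd k F p)"
  by (auto simp: mhol_def mpd_def vec_eq_iff mscale_def pd_add[where U=U] pd_diff[where U=U] pd_mult[where U=U])

lemma vpd_add: "vhol F U \<Longrightarrow> vhol G U \<Longrightarrow> p \<in> U \<Longrightarrow> vpd k (\<lambda>p. F p + G p) p = vpd k F p + vpd k G p"
  and vpd_smult: "hol f U \<Longrightarrow> vhol F U \<Longrightarrow> p \<in> U \<Longrightarrow> 
     vpd k (\<lambda>p. f p *s F p) p = pd k f p *s F p + f p *s vpd k F p"
  by (auto simp: vhol_def vpd_def vec_eq_iff pd_add[where U=U] pd_mult[where U=U])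

lemma mpd_mult:
  fixes F :: "'b::finite point \<Rightarrow> complex ^ 'n::finite ^ 'm" and G :: "'b point \<Rightarrow> complex ^ 'l ^ 'n"
  assumes "mhol F U" "mhol G U" "p \<in> U"
  shows "mpd k (\<lambda>p. F p ** G p) p = mpd k F p ** G p + F p ** mpd k G p"
proof -
  have "pd k (\<lambda>p. \<Sum>j\<in>UNIV. F p $ i $ j * G p $ j $ a) p =
      (\<Sum>j\<in>UNIV. pd k (\<lambda>p. F p $ i $ j) p * G p $ j $ a + F p $ i $ j * pd k (\<lambda>p. G p $ j $ a) p)" for i a
    using assms by (subst pd_sum[where U=U]) (auto simp: pd_mult[where U=U] mhol_def intro!: hol_mult)
  then show ?thesis
    by (simp add: mpd_def vec_eq_iff matrix_matrix_mult_def sum.distrib)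
qed

lemma mhol_coord_quotient:
  assumes U: "open U" and F: "mhol F U" and z: "\<And>p. p \<in> U \<Longrightarrow> crd k p = 0 \<Longrightarrow> F p = 0"
  obtains G where "mhol G U" "\<And>p. p \<in> U \<Longrightarrow> F p = mscale (crd k p) (G p)"
proof -
  have "\<exists>g. hol g U \<and> (\<forall>p\<in>U. F p $ i $ j = crd k p * g p)" for i j
    using hol_coord_quotient[OF U hol_nth_nth[OF F, of i j], of k] z by (metis zero_index)
  then obtain g where g: "\<And>i j. hol (g i j) U" "\<And>i j p. p \<in> U \<Longrightarrow> F p $ i $ j = crd k p * g i j p"
    by metis
  show ?thesis
    by (rule that[of "\<lambda>p. \<chi> i j. g i j p"]) (auto simp: mhol_def g mscale_def vec_eq_iff)
qed

lemma vhol_coord_quotient: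
  assumes U: "open U" and F: "vhol F U" and z: "\<And>p. p \<in> U \<Longrightarrow> crd k p = 0 \<Longrightarrow> F p = 0"
  obtains G where "vhol G U" "\<And>p. p \<in> U \<Longrightarrow> F p = crd k p *s G p"
proof -
  have "\<exists>g. hol g U \<and> (\<forall>p\<in>U. F p $ i = crd k p * g p)" for i
    using hol_coord_quotient[OF U hol_nth[OF F, of i], of k] z by (metis zero_index)
  then obtain g where g: "\<And>i. hol (g i) U" "\<And>i p. p \<in> U \<Longrightarrow> F p $ i = crd k p * g i p"
    by metis
  show ?thesis
    by (rule that[of "\<lambda>p. \<chi> i. g i p"]) (auto simp: vhol_def g vec_eq_iff)
qed

section \<open>The predicates of the statement in uncurried form\<close>

lemma split_option_all: "(\<forall>k. P k) \<longleftrightarrow> P None \<and> (\<forall>i. P (Some i))"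
  by (metis option.exhaust)

lemma holo_total_iff: "holo_total f U \<longleftrightarrow> hol (\<lambda>p. f (fst p) (snd p)) U"
proof -
  have *: "(\<lambda>x. f x b) field_differentiable at z \<longleftrightarrow> (\<lambda>t. f (z + t) b) field_differentiable at 0" for z b
  proof -
    have "((\<lambda>x. f x b) has_field_derivative D) (at z) \<longleftrightarrow> ((\<lambda>t. f (z + t) b) has_field_derivative D) (at 0)" for D
      using DERIV_shift[of "\<lambda>x. f x b" D 0 z] by (simp add: add.commute)
    then show ?thesis by (simp add: field_differentiable_def)
  qed
  show ?thesis
    unfolding holo_total_def hol_def by (simp add: case_prod_beta * dir_simps split_beta split_option_all)
qed

text \<open>A function on the base is viewed as a function on the total space that does not depend
  on z, so that a single calculus serves both.\<close>

lemma holo_base_iff: "holo_base f V \<longleftrightarrow> hol (\<lambda>p. f (snd p)) (UNIV \<times> V)"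
proof
  assume f: "holo_base f V"
  show "hol (\<lambda>p. f (snd p)) (UNIV \<times> V)"
  proof (rule holI)
    show "continuous_on (UNIV \<times> V) (\<lambda>p. f (snd p))"
      using f unfolding holo_base_def by (intro continuous_on_compose2[of V f _ snd]) (auto intro: continuous_intros)
    show "(\<lambda>t. f (snd (p + dir k t))) field_differentiable at 0" if "p \<in> UNIV \<times> V" for p k
      using f that unfolding holo_base_def by (cases k) (auto simp: dir_simps)
  qed
next
  assume f: "hol (\<lambda>p. f (snd p)) (UNIV \<times> V)"
  have "continuous_on V (\<lambda>b. f (snd (0::complex, b)))"
    using hol_continuous[OF f] by (intro continuous_on_compose2[of "UNIV \<times> V" "\<lambda>p. f (snd p)" _ "\<lambda>b. (0, b)"])
      (auto intro!: continuous_intros)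
  moreover have "(\<lambda>t. f (b + axis i t)) field_differentiable at 0" if "b \<in> V" for b i
    using f that unfolding hol_def by (auto simp: dir_simps dest!: bspec[of _ _ "(0, b)"] spec[of _ "Some i"])
  ultimately show "holo_base f V" by (simp add: holo_base_def)
qed

lemma mholo_total_iff: "mholo_total F U \<longleftrightarrow> mhol (\<lambda>p. F (fst p) (snd p)) U"
  by (simp add: mholo_total_def mhol_def holo_total_iff)

lemma mholo_base_iff: "mholo_base F V \<longleftrightarrow> mhol (\<lambda>p. F (snd p)) (UNIV \<times> V)"
  by (simp add: mholo_base_def mhol_def holo_base_iff)

lemma pd_None: "pd None f (z, b) = deriv (\<lambda>x. f (x, b)) z"
  by (simp add: pd_def dir_simps deriv_shift_0[of _ z] o_def)

lemma mderiv_eq: "mderiv F z b = mpd None (\<lambda>p. F (fst p) (snd p)) (z, b)"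
  by (simp add: mderiv_def mpd_def pd_None)

section \<open>Matrices as vectors, commutators as matrices\<close>

definition flatten :: "'a ^ 'r ^ 'r \<Rightarrow> 'a ^ ('r \<times> 'r)"
  where "flatten M = (\<chi> p. M $ fst p $ snd p)"

definition unflatten :: "'a ^ ('r \<times> 'r) \<Rightarrow> 'a ^ 'r ^ 'r"
  where "unflatten v = (\<chi> i k. v $ (i, k))"

lemma flatten_unflatten [simp]: "flatten (unflatten v) = v" "unflatten (flatten M) = M"
  by (simp_all add: flatten_def unflatten_def vec_eq_iff)

lemma flatten_nth [simp]: "flatten M $ (i, k) = M $ i $ k" "unflatten v $ i $ k = v $ (i, k)"
  by (simp_all add: flatten_def unflatten_def)

text \<open>The matrix of \<open>X \<mapsto> commutator A X\<close> on flattened matrices, that is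
  \<open>A \<otimes> 1 - 1 \<otimes> A^T\<close> in the basis of index pairs.\<close>

definition ad_mat :: "complex ^ 'r ^ 'r \<Rightarrow> complex ^ ('r \<times> 'r) ^ ('r \<times> 'r)"
  where "ad_mat A = (\<chi> p q. (if snd p = snd q then A $ fst p $ fst q else 0)
    - (if fst p = fst q then A $ snd q $ snd p else 0))"

lemma ad_mat_flatten: "ad_mat A *v flatten X = flatten (commutator A X)"
proof -
  have "(ad_mat A *v flatten X) $ (i, k) = flatten (commutator A X) $ (i, k)" for i k
  proof -
    have "(ad_mat A *v flatten X) $ (i, k) = (\<Sum>(a, c)\<in>UNIV \<times> UNIV.
        ((if k = c then A $ i $ a else 0) - (if i = a then A $ c $ k else 0)) * X $ a $ c)"
      by (simp add: ad_mat_def matrix_vector_mult_def flatten_def case_prod_beta cong: if_cong)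
    also have "\<dots> = (\<Sum>a\<in>UNIV. \<Sum>c\<in>UNIV. (if c = k then A $ i $ a * X $ a $ c else 0)) -
        (\<Sum>a\<in>UNIV. if a = i then \<Sum>c\<in>UNIV. A $ c $ k * X $ a $ c else 0)"
    proof -
      have "(\<Sum>c\<in>UNIV. ((if k = c then A $ i $ a else 0) - (if i = a then A $ c $ k else 0)) * X $ a $ c) =
          (\<Sum>c\<in>UNIV. (if c = k then A $ i $ a * X $ a $ c else 0)) -
          (if a = i then \<Sum>c\<in>UNIV. A $ c $ k * X $ a $ c else 0)" for a
      proof -
        have "(\<Sum>c\<in>UNIV. (if k = c then A $ i $ a else 0) * X $ a $ c) =
            (\<Sum>c\<in>UNIV. (if c = k then A $ i $ a * X $ a $ c else 0))"
          by (rule sum.cong) auto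
        then show ?thesis
          by (cases "a = i") (simp_all add: sum_subtractf left_diff_distrib)
      qed
      then show ?thesis
        by (simp only: sum.cartesian_product[symmetric] sum_subtractf[symmetric])
    qed
    also have "\<dots> = (commutator A X) $ i $ k"
      by (simp add: commutator_def matrix_matrix_mult_def mult.commute)
    finally show ?thesis by simp
  qed
  then show ?thesis by (simp add: vec_eq_iff)
qed

lemma mhol_ad_mat: "mhol F U \<Longrightarrow> mhol (\<lambda>p. ad_mat (F p)) U"
proof -
  assume F: "mhol F U"
  have "hol (\<lambda>p. if c then F p $ i $ k else 0) U" for c i k
    using F by (cases c) (auto simp: mhol_def)
  then show ?thesis by (simp add: mhol_def ad_mat_def hol_diff)
qed

lemma vhol_flatten: "mhol F U \<Longrightarrow> vhol (\<lambda>p. flatten (F p)) U"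
  by (auto simp: mhol_def vhol_def flatten_def)

lemma mhol_unflatten: "vhol F U \<Longrightarrow> mhol (\<lambda>p. unflatten (F p)) U"
  by (auto simp: mhol_def vhol_def unflatten_def)

lemma mpd_unflatten: "mpd k (\<lambda>p. unflatten (F p)) p = unflatten (vpd k F p)"
  by (simp add: vpd_def mpd_def unflatten_def vec_eq_iff)

section \<open>Linear equations with a regular singular point, with parameters\<close>

text \<open>The homotopy that contracts the fibre to its origin. In the main application the fibre
  coordinate is \<open>u = 1 / z\<close>, so the origin is the point at infinity.\<close>

definition ray :: "real \<Rightarrow> 'b point \<Rightarrow> 'b point"
  where "ray t p = (of_real t * fst p, snd p)"

definition ray_closed :: "'b point set \<Rightarrow> bool"
  where "ray_closed D \<longleftrightarrow> (\<forall>p\<in>D. \<forall>t\<in>{0..1}. ray t p \<in> D)"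

text \<open>An entrywise norm in place of the operator norm: it dominates the latter and is visibly
  continuous in the entries.\<close>

definition msum :: "complex ^ 'n ^ 'm \<Rightarrow> real"
  where "msum A = (\<Sum>i\<in>UNIV. \<Sum>j\<in>UNIV. cmod (A $ i $ j))"

lemma ray_simps [simp]: "fst (ray t p) = of_real t * fst p" "snd (ray t p) = snd p" "ray 1 p = p"
  "ray s (ray t p) = ray (s * t) p"
  by (simp_all add: ray_def)

lemma ray_0: "fst p = 0 \<Longrightarrow> ray t p = p"
  by (simp add: ray_def prod_eq_iff)

lemma rayD: "ray_closed D \<Longrightarrow> p \<in> D \<Longrightarrow> 0 \<le> t \<Longrightarrow> t \<le> 1 \<Longrightarrow> ray t p \<in> D"
  by (auto simp: ray_closed_def)

lemma continuous_on_ray [continuous_intros]: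
  "continuous_on S f \<Longrightarrow> continuous_on S g \<Longrightarrow> continuous_on S (\<lambda>x. ray (f x) (g x))"
  unfolding ray_def by (intro continuous_intros)

lemma msum_nonneg [simp]: "0 \<le> msum A"
  by (simp add: msum_def sum_nonneg)

lemma norm_matvec_le:
  fixes A :: "complex ^ 'n::finite ^ 'm::finite"
  shows "norm (A *v y) \<le> msum A * norm y"
proof -
  have "norm (A *v y) \<le> (\<Sum>i\<in>UNIV. cmod ((A *v y) $ i))"
    unfolding norm_vec_def by (rule L2_set_le_sum) simp
  also have "\<dots> \<le> (\<Sum>i\<in>UNIV. \<Sum>j\<in>UNIV. cmod (A $ i $ j) * norm y)"
  proof (rule sum_mono)
    fix i
    have "cmod ((A *v y) $ i) \<le> (\<Sum>j\<in>UNIV. cmod (A $ i $ j * y $ j))"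
      unfolding matrix_vector_mult_def by (simp add: norm_sum)
    also have "\<dots> \<le> (\<Sum>j\<in>UNIV. cmod (A $ i $ j) * norm y)"
      unfolding norm_mult by (intro sum_mono mult_left_mono Finite_Cartesian_Product.norm_nth_le) simp
    finally show "cmod ((A *v y) $ i) \<le> (\<Sum>j\<in>UNIV. cmod (A $ i $ j) * norm y)" .
  qed
  also have "\<dots> = msum A * norm y"
    by (simp add: msum_def sum_distrib_right)
  finally show ?thesis .
qed

lemma continuous_on_msum: "continuous_on S F \<Longrightarrow> continuous_on S (\<lambda>x. msum (F x))"
  unfolding msum_def by (intro continuous_intros)

lemma hol_ray:
  fixes f :: "'b::finite point \<Rightarrow> complex"
  assumes "hol f D" "ray_closed D" "t \<in> {0..1}"
  shows "hol (\<lambda>p. f (ray t p)) D"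
proof (rule hol_compose[OF assms(1)])
  show "continuous_on D (ray t)" by (intro continuous_intros)
  fix p :: "'b point" and k :: "'b option"
  have "(\<lambda>s. if k = None then of_real t * s else s) field_differentiable at 0"
    by (cases "k = None") (auto intro!: derivative_intros)
  moreover have "ray t (p + dir k s) = ray t p + dir k (if k = None then of_real t * s else s)" for s
    by (cases k) (auto simp: ray_def dir_simps algebra_simps)
  ultimately show "\<exists>g k'. g field_differentiable at 0 \<and> g 0 = 0 \<and>
     (\<forall>\<^sub>F s in nhds 0. ray t (p + dir k s) = ray t p + dir k' (g s))"
    by (intro exI[of _ "\<lambda>s. if k = None then of_real t * s else s"] exI[of _ k]) auto
qed (use assms in \<open>auto simp: ray_closed_def\<close>)

lemma vhol_ray: "vhol F D \<Longrightarrow> ray_closed D \<Longrightarrow> t \<in> {0..1} \<Longrightarrow> vhol (\<lambda>p. F (ray t p)) D"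
  and mhol_ray: "mhol G D \<Longrightarrow> ray_closed D \<Longrightarrow> t \<in> {0..1} \<Longrightarrow> mhol (\<lambda>p. G (ray t p)) D"
  by (auto simp: vhol_def mhol_def intro: hol_ray)

text \<open>On \<open>u ^ k\<close> the integral gives \<open>u ^ k / (N + k)\<close>; so it is
  regular for \<open>N \<ge> 1\<close> and small for large \<open>N\<close>, which drives the
  contraction argument.\<close>

definition euler_inv :: "nat \<Rightarrow> ('b::finite point \<Rightarrow> complex ^ 'n) \<Rightarrow> 'b point \<Rightarrow> complex ^ 'n"
  where "euler_inv N Z p = integral {0..1} (\<lambda>t. t ^ (N - 1) *\<^sub>R Z (ray t p))"

lemma continuous_along_ray:
  assumes "continuous_on D Z" "ray_closed D" "p \<in> D"
  shows "continuous_on {0..1} (\<lambda>t. Z (ray t p))"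
  by (rule continuous_on_compose2[OF assms(1)]) (use assms in \<open>auto intro!: continuous_intros rayD\<close>)

lemma euler_inv_integrable:
  fixes Z :: "'b::finite point \<Rightarrow> complex ^ 'n"
  assumes "continuous_on D Z" "ray_closed D" "p \<in> D"
  shows "(\<lambda>t. t ^ (N - 1) *\<^sub>R Z (ray t p)) integrable_on {0..1}"
  by (intro integrable_continuous_interval continuous_intros continuous_along_ray[OF assms])

lemma euler_inv_nth:
  fixes Z :: "'b::finite point \<Rightarrow> complex ^ 'n"
  assumes "continuous_on D Z" "ray_closed D" "p \<in> D"
  shows "euler_inv N Z p $ i = integral {0..1} (\<lambda>t. of_real (t ^ (N - 1)) * Z (ray t p) $ i)"
  using integral_linear[OF euler_inv_integrable[OF assms, of N] bounded_linear_vec_nth[of i]]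
  by (simp add: euler_inv_def o_def scaleR_conv_of_real[where 'a = complex])

lemma vhol_euler_inv:
  fixes Z :: "'b::finite point \<Rightarrow> complex ^ 'n"
  assumes D: "open D" "ray_closed D" and Z: "vhol Z D"
  shows "vhol (euler_inv N Z) D"
  unfolding vhol_def
proof
  fix i
  have "hol (\<lambda>p. integral {0..1} (\<lambda>t. of_real (t ^ (N - 1)) * Z (ray t p) $ i)) D"
  proof (rule hol_integral[OF D(1)])
    show "continuous_on ({0..1} \<times> D) (\<lambda>(t, p). of_real (t ^ (N - 1)) * Z (ray t p) $ i)"
      unfolding case_prod_beta
      by (intro continuous_intros continuous_on_compose2[OF vhol_continuous[OF Z]])
        (use D in \<open>auto intro: rayD\<close>)
    show "hol (\<lambda>p. of_real (t ^ (N - 1)) * Z (ray t p) $ i) D" if "t \<in> {0..1}" for t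
      using vhol_ray[OF Z D(2) that] by (intro hol_intros) (auto simp: vhol_def)
  qed
  then show "hol (\<lambda>p. euler_inv N Z p $ i) D"
    by (rule hol_cong[OF D(1)]) (simp add: euler_inv_nth[OF vhol_continuous[OF Z] D(2)])
qed

text \<open>The operator inverts \<open>u \<partial>\<^sub>u + N\<close>, by integration by parts along the ray from \<open>0\<close> to \<open>u\<close>.\<close>

lemma euler_inv_ode:
  fixes Z :: "'b::finite point \<Rightarrow> complex ^ 'n"
  assumes D: "open D" "ray_closed D" and Z: "vhol Z D" and N: "N \<ge> 1" and p: "p \<in> D"
  shows "fst p *s vpd None (euler_inv N Z) p = Z p - of_nat N *s euler_inv N Z p"
proof -
  have "fst p * vpd None (euler_inv N Z) p $ i = Z p $ i - of_nat N * euler_inv N Z p $ i" for i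
  proof -
    define z where "z = (\<lambda>p. Z p $ i)"
    have z: "hol z D" using Z by (simp add: z_def vhol_def)
    have pz: "pd None (\<lambda>p. of_real (t ^ (N - 1)) * z (ray t p)) p = of_real (t ^ N) * pd None z (ray t p)"
      if t: "t \<in> {0..1}" for t
    proof (rule pd_eqI)
      have "((\<lambda>s. z (ray t p + dir None s)) has_field_derivative pd None z (ray t p)) (at (of_real t * 0))"
        using hol_has_derivative_0[OF z rayD[OF D(2) p]] t by simp
      moreover have "((\<lambda>s::complex. of_real t * s) has_field_derivative of_real t) (at 0)"
        by (auto intro!: derivative_eq_intros)
      ultimately have "((\<lambda>s. z (ray t p + dir None (of_real t * s))) has_field_derivative pd None z (ray t p) * of_real t) (at 0)"
        by (rule DERIV_chain2[where f = "\<lambda>s. z (ray t p + dir None s)"])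
      moreover have "ray t p + dir None (of_real t * s) = ray t (p + dir None s)" for s
        by (auto simp: ray_def dir_simps algebra_simps)
      ultimately have "((\<lambda>s. of_real (t ^ (N - 1)) * z (ray t (p + dir None s))) has_field_derivative
          of_real (t ^ (N - 1)) * (pd None z (ray t p) * of_real t)) (at 0)"
        by (intro DERIV_cmult) simp
      moreover have "t ^ (N - 1) * t = t ^ N" using N by (cases N) auto
      then have "complex_of_real (t ^ (N - 1)) * (pd None z (ray t p) * of_real t) = of_real (t ^ N) * pd None z (ray t p)"
        by (metis (no_types, lifting) mult.assoc mult.commute of_real_mult)
      ultimately show "((\<lambda>s. of_real (t ^ (N - 1)) * z (ray t (p + dir None s))) has_field_derivative
          of_real (t ^ N) * pd None z (ray t p)) (at 0)" by (simp only:)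
    qed
    have E: "pd None (\<lambda>p. euler_inv N Z p $ i) p = integral {0..1} (\<lambda>t. of_real (t ^ N) * pd None z (ray t p))"
    proof -
      have "pd None (\<lambda>p. euler_inv N Z p $ i) p = pd None (\<lambda>p. integral {0..1} (\<lambda>t. of_real (t ^ (N - 1)) * z (ray t p))) p"
        by (rule pd_cong[OF D(1) p]) (simp add: euler_inv_nth[OF vhol_continuous[OF Z] D(2)] z_def)
      also have "\<dots> = integral {0..1} (\<lambda>t. pd None (\<lambda>p. of_real (t ^ (N - 1)) * z (ray t p)) p)"
      proof (rule pd_integral[OF D(1) _ _ p])
        show "continuous_on ({0..1} \<times> D) (\<lambda>(t, p). of_real (t ^ (N - 1)) * z (ray t p))"
          unfolding case_prod_beta
          by (intro continuous_intros continuous_on_compose2[OF hol_continuous[OF z]])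
            (use D in \<open>auto intro: rayD\<close>)
        show "hol (\<lambda>p. of_real (t ^ (N - 1)) * z (ray t p)) D" if "t \<in> {0..1}" for t
          using hol_ray[OF z D(2) that] by (intro hol_intros)
      qed
      also have "\<dots> = integral {0..1} (\<lambda>t. of_real (t ^ N) * pd None z (ray t p))"
        by (rule integral_cong) (rule pz)
      finally show ?thesis .
    qed
    have d: "((\<lambda>t. of_real (t ^ N) * z (ray t p)) has_vector_derivative
        of_nat N * (of_real (t ^ (N - 1)) * z (ray t p)) + fst p * (of_real (t ^ N) * pd None z (ray t p))) (at t within {0..1})"
      if t: "t \<in> {0..1}" for t
    proof -
      have "((\<lambda>s. z ((0, snd p) + dir None s)) has_field_derivative pd None z (ray t p)) (at (of_real t * fst p))"
        using hol_has_derivative[OF z, of "(0, snd p)" None "of_real t * fst p"] rayD[OF D(2) p, of t] t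
        by (simp add: dir_simps ray_def)
      moreover have "((\<lambda>t. of_real t * fst p) has_vector_derivative fst p) (at t within {0..1})"
        by (auto intro!: derivative_eq_intros simp: scaleR_conv_of_real)
      ultimately have "((\<lambda>s. z ((0, snd p) + dir None s)) \<circ> (\<lambda>t. of_real t * fst p) has_vector_derivative fst p * pd None z (ray t p)) (at t within {0..1})"
        using field_vector_diff_chain_within[where f = "\<lambda>t. of_real t * fst p" and x = t
                and g = "\<lambda>s. z ((0, snd p) + dir None s)" and S = "{0..1}"] has_field_derivative_at_within by blast
      then have 1: "((\<lambda>t. z (ray t p)) has_vector_derivative fst p * pd None z (ray t p)) (at t within {0..1})"
        by (simp add: o_def dir_simps ray_def)
      have 2: "((\<lambda>t. complex_of_real (t ^ N)) has_vector_derivative of_nat N * of_real (t ^ (N - 1))) (at t within {0..1})"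
        by (rule has_vector_derivative_of_real[THEN has_vector_derivative_eq_rhs])
          (auto intro!: derivative_eq_intros)
      show ?thesis
        using has_vector_derivative_mult[OF 2 1] by (simp add: algebra_simps)
    qed
    have i1: "(\<lambda>t. of_real (t ^ (N - 1)) * z (ray t p)) integrable_on {0..1}"
      by (intro integrable_continuous_interval continuous_intros continuous_along_ray[OF hol_continuous[OF z] D(2) p])
    have i2: "(\<lambda>t. of_real (t ^ N) * pd None z (ray t p)) integrable_on {0..1}"
      by (intro integrable_continuous_interval continuous_intros
          continuous_along_ray[OF hol_continuous[OF hol_pd[OF z D(1)]] D(2) p])
    \<comment> \<open>The boundary term of \<open>t ^ N * z (ray t p)\<close> at
      \<open>t = 0\<close> vanishes because \<open>N \<ge> 1\<close>.\<close>
    have H1: "((\<lambda>t. of_nat N * (of_real (t ^ (N - 1)) * z (ray t p)) + fst p * (of_real (t ^ N) * pd None z (ray t p)))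
        has_integral z p) {0..1}"
      using fundamental_theorem_of_calculus[OF _ d] N by (simp add: power_0_left)
    have H2: "((\<lambda>t. of_nat N * (of_real (t ^ (N - 1)) * z (ray t p)) + fst p * (of_real (t ^ N) * pd None z (ray t p)))
        has_integral (of_nat N * euler_inv N Z p $ i + fst p * vpd None (euler_inv N Z) p $ i)) {0..1}"
      using has_integral_add[OF has_integral_mult_right[OF integrable_integral[OF i1]]
          has_integral_mult_right[OF integrable_integral[OF i2]], of "of_nat N" "fst p"]
      by (simp add: euler_inv_nth[OF vhol_continuous[OF Z] D(2) p] vpd_def E z_def)
    have "of_nat N * euler_inv N Z p $ i + fst p * vpd None (euler_inv N Z) p $ i = z p"
      by (rule has_integral_unique[OF H2 H1])
    then show ?thesis by (simp add: z_def algebra_simps)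
  qed
  then show ?thesis by (simp add: vec_eq_iff)
qed

text \<open>A weighted estimate in the manner of Bielecki. The part \<open>a\<close> of the
  coefficient that is present at the origin gains only the factor \<open>1 / N\<close> from the
  integration; the part \<open>K * t\<close> that grows along the ray gains \<open>1 / L\<close>
  from integrating the exponential weight. Large \<open>N\<close> and \<open>L\<close> make the
  total factor small, whatever the size of \<open>K\<close>.\<close>

lemma euler_inv_bound:
  fixes Z :: "'b::finite point \<Rightarrow> complex ^ 'n"
  assumes D: "ray_closed D" "p \<in> D" and Z: "continuous_on D Z" and N: "N \<ge> 1" and L: "L > 0" and s: "s \<in> {0..1}"
    and C: "C \<ge> 0" "a \<ge> 0" "K \<ge> 0"
    and b: "\<And>t. t \<in> {0..1} \<Longrightarrow> norm (Z (ray t p)) \<le> (a + K * t) * (C * exp (L * t))"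
  shows "norm (euler_inv N Z (ray s p)) \<le> (a / N + K / L) * (C * exp (L * s))"
proof -
  \<comment> \<open>Majorant of the integrand: in the first summand the weight is bounded by its
    value at the endpoint; in the second \<open>t * t ^ (N - 1) \<le> 1\<close> is used and the
    weight is kept, to be integrated.\<close>
  define g where "g = (\<lambda>t. a * C * exp (L * s) * t ^ (N - 1) + C * K * s * exp (L * s * t))"
  have g: "(g has_integral (a * C * exp (L * s) / N * 1 ^ N + C * K / L * exp (L * s * 1)
      - (a * C * exp (L * s) / N * 0 ^ N + C * K / L * exp (L * s * 0)))) {0..1}"
  proof (rule fundamental_theorem_of_calculus)
    fix t :: real
    have "((\<lambda>t. a * C * exp (L * s) / N * t ^ N + C * K / L * exp (L * s * t)) has_real_derivative g t) (at t within {0..1})"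
      using N L by (auto simp: g_def intro!: derivative_eq_intros)
    then show "((\<lambda>t. a * C * exp (L * s) / N * t ^ N + C * K / L * exp (L * s * t)) has_vector_derivative g t) (at t within {0..1})"
      by (simp add: has_real_derivative_iff_has_vector_derivative)
  qed simp
  have "norm (euler_inv N Z (ray s p)) \<le> integral {0..1} g"
    unfolding euler_inv_def
  proof (rule integral_norm_bound_integral)
    show "(\<lambda>t. t ^ (N - 1) *\<^sub>R Z (ray t (ray s p))) integrable_on {0..1}"
      using s by (intro euler_inv_integrable[OF Z D(1)] rayD[OF D]) auto
    show "g integrable_on {0..1}" using g by blast
    fix t :: real assume t: "t \<in> {0..1}"
    have ts: "t * s \<in> {0..1}" using s t mult_le_one[of t s] by auto
    have "t ^ (N - 1) \<le> 1" using t by (intro power_le_one) auto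
    have e: "exp (L * (t * s)) \<le> exp (L * s)" using s t L mult_left_le_one_le[of s t] by simp
    have "norm (t ^ (N - 1) *\<^sub>R Z (ray t (ray s p))) = t ^ (N - 1) * norm (Z (ray (t * s) p))"
      using t by simp
    also have "\<dots> \<le> t ^ (N - 1) * ((a + K * (t * s)) * (C * exp (L * (t * s))))"
      using b[OF ts] t by (intro mult_left_mono) auto
    also have "\<dots> = a * C * t ^ (N - 1) * exp (L * (t * s)) + C * K * s * exp (L * (t * s)) * (t * t ^ (N - 1))"
      by (simp add: algebra_simps)
    also have "\<dots> \<le> a * C * t ^ (N - 1) * exp (L * s) + C * K * s * exp (L * (t * s)) * 1"
      using s t C e \<open>t ^ (N - 1) \<le> 1\<close> by (intro add_mono mult_left_mono mult_le_one) auto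
    also have "\<dots> = g t" by (simp add: g_def algebra_simps)
    finally show "norm (t ^ (N - 1) *\<^sub>R Z (ray t (ray s p))) \<le> g t" .
  qed
  also have "\<dots> = a * C * exp (L * s) / N + C * K / L * exp (L * s) - C * K / L"
    using integral_unique[OF g] N by (simp add: power_0_left)
  also have "\<dots> \<le> (a / N + K / L) * (C * exp (L * s))"
    using C L by (simp add: algebra_simps)
  finally show ?thesis .
qed

lemma euler_inv_add:
  fixes Z :: "'b::finite point \<Rightarrow> complex ^ 'n"
  assumes D: "ray_closed D" "p \<in> D" and Z: "continuous_on D Z" "continuous_on D Z'"
  shows "euler_inv N (\<lambda>p. Z p + Z' p) p = euler_inv N Z p + euler_inv N Z' p"
  unfolding euler_inv_def scaleR_add_right
  by (rule integral_add) (intro euler_inv_integrable[OF _ D] Z)+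

lemma vpd_cong:
  assumes "open U" "p \<in> U" "\<And>p. p \<in> U \<Longrightarrow> F p = G p"
  shows "vpd k F p = vpd k G p"
proof -
  have "pd k (\<lambda>q. F q $ i) p = pd k (\<lambda>q. G q $ i) p" for i
    by (rule pd_cong[OF assms(1,2)]) (use assms(3) in auto)
  then show ?thesis by (simp add: vpd_def)
qed

text \<open>Picard iteration for the fixed point equation \<open>Y = euler_inv N (A Y + G)\<close>.
  Only the size of \<open>A\<close> at the origin of the fibre has to be small against
  \<open>N\<close>; its growth along the rays is absorbed by the exponential weight, so the solution
  exists on all of \<open>D\<close>.\<close>

lemma euler_ode_large:
  fixes A :: "'b::finite point \<Rightarrow> complex ^ 'n ^ 'n"
  assumes D: "open D" "ray_closed D" and A: "mhol A D" and G: "vhol G D"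
    and a0: "a0 \<ge> 0" "\<And>p. p \<in> D \<Longrightarrow> msum (A (ray 0 p)) \<le> a0" and N: "real N \<ge> 4 * (a0 + 1)"
  obtains Y where "vhol Y D"
    "\<And>p. p \<in> D \<Longrightarrow> fst p *s vpd None Y p = A p *v Y p + G p - of_nat N *s Y p"
proof -
  have N1: "N \<ge> 1" using N a0(1) by (cases N) auto
  \<comment> \<open>Increments of the iteration; their partial sums \<open>S n\<close> are the
    iterates started at \<open>0\<close>.\<close>
  define d where "d = rec_nat (euler_inv N G) (\<lambda>_ Z. euler_inv N (\<lambda>p. A p *v Z p))"
  have d0: "d 0 = euler_inv N G" and dS: "d (Suc k) = euler_inv N (\<lambda>p. A p *v d k p)" for k
    by (simp_all add: d_def)
  have dh: "vhol (d k) D" for k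
    by (induction k) (auto simp: d0 dS intro!: vhol_euler_inv D G vhol_matvec A)
  define S where "S = (\<lambda>n p. \<Sum>k<n. d k p)"
  have Sh: "vhol (S n) D" for n
    unfolding S_def by (intro vhol_sum dh)
  have AS: "vhol (\<lambda>p. A p *v S n p + G p) D" for n
    by (intro vhol_add vhol_matvec A Sh G)
  have SE: "S (Suc n) p = euler_inv N (\<lambda>p. A p *v S n p + G p) p" if p: "p \<in> D" for n p
  proof (induction n)
    case 0
    then show ?case by (simp add: S_def d0)
  next
    case (Suc n)
    have "S (Suc (Suc n)) p = S (Suc n) p + d (Suc n) p" by (simp add: S_def)
    also have "\<dots> = euler_inv N (\<lambda>p. A p *v S n p + G p) p + euler_inv N (\<lambda>p. A p *v d n p) p"
      by (simp add: Suc dS)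
    also have "\<dots> = euler_inv N (\<lambda>p. (A p *v S n p + G p) + A p *v d n p) p"
      by (rule euler_inv_add[symmetric, OF D(2) p])
        (intro vhol_continuous AS vhol_matvec A dh)+
    also have "(\<lambda>p. (A p *v S n p + G p) + A p *v d n p) = (\<lambda>p. A p *v S (Suc n) p + G p)"
      by (auto simp: S_def matrix_vector_right_distrib)
    finally show ?case .
  qed
  have bnd: "\<exists>r>0. \<exists>C. cball p0 r \<subseteq> D \<and>
      (\<forall>p\<in>cball p0 r. \<forall>s\<in>{0..1}. \<forall>k. norm (d k (ray s p)) \<le> C * (1 / 2) ^ k)" if p0: "p0 \<in> D" for p0
  proof -
    obtain r where r: "r > 0" "cball p0 r \<subseteq> D" using D(1) p0 open_contains_cball by blast
    define K where "K = {0..1::real} \<times> cball p0 r"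
    have K: "compact K" unfolding K_def by (intro compact_Times) auto
    have KD: "ray (fst z) (snd z) \<in> D" if "z \<in> K" for z
      using that r(2) by (auto simp: K_def intro!: rayD[OF D(2)])
    have cA: "continuous_on K (\<lambda>z. msum (A (ray (fst z) (snd z))))"
      by (intro continuous_on_msum continuous_on_compose2[OF mhol_continuous[OF A]] continuous_intros) (use KD in auto)
    have cG: "continuous_on K (\<lambda>z. norm (G (ray (fst z) (snd z))))"
      by (intro continuous_intros continuous_on_compose2[OF vhol_continuous[OF G]]) (use KD in auto)
    obtain M where M: "\<And>z. z \<in> K \<Longrightarrow> msum (A (ray (fst z) (snd z))) \<le> M"
      using compact_imp_bounded[OF compact_continuous_image[OF cA K]] unfolding bounded_real by (auto simp: abs_le_iff)
    obtain C where C: "\<And>z. z \<in> K \<Longrightarrow> norm (G (ray (fst z) (snd z))) \<le> C"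
      using compact_imp_bounded[OF compact_continuous_image[OF cG K]] unfolding bounded_real by (auto simp: abs_le_iff)
    have z0: "(0, p0) \<in> K" using r by (auto simp: K_def)
    have M0: "M \<ge> 0" using M[OF z0] msum_nonneg order_trans by blast
    have C0: "C \<ge> 0" using C[OF z0] norm_ge_zero order_trans by blast
    obtain \<delta> where \<delta>: "\<delta> > 0" "\<And>z z'. z \<in> K \<Longrightarrow> z' \<in> K \<Longrightarrow> dist z' z < \<delta> \<Longrightarrow>
        dist (msum (A (ray (fst z') (snd z')))) (msum (A (ray (fst z) (snd z)))) < 1"
      using compact_uniformly_continuous[OF cA K] unfolding uniformly_continuous_on_def
      by (metis zero_less_one)
    define \<kappa> where "\<kappa> = M / \<delta>"
    have \<kappa>: "\<kappa> \<ge> 0" using M0 \<delta>(1) by (simp add: \<kappa>_def)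
    \<comment> \<open>For small \<open>t\<close> uniform continuity bounds the coefficient by
      \<open>a0 + 1\<close>; for \<open>t \<ge> \<delta>\<close> the global bound \<open>M\<close>
      is at most \<open>\<kappa> * t\<close>. This linear majorant has the shape that
      \<open>euler_inv_bound\<close> asks for.\<close>
    have Ab: "msum (A (ray t p)) \<le> (a0 + 1) + \<kappa> * t" if p: "p \<in> cball p0 r" and t: "t \<in> {0..1}" for t p
    proof (cases "t < \<delta>")
      case True
      have "dist (msum (A (ray t p))) (msum (A (ray 0 p))) < 1"
        using \<delta>(2)[of "(0, p)" "(t, p)"] p t True by (simp add: K_def dist_Pair_Pair)
      then have "msum (A (ray t p)) \<le> a0 + 1"
        using a0(2)[of p] p r(2) by (auto simp: dist_real_def)
      also have "\<dots> \<le> (a0 + 1) + \<kappa> * t" using \<kappa> t by simp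
      finally show ?thesis .
    next
      case False
      then have "M \<le> \<kappa> * t" using M0 \<delta>(1) by (simp add: \<kappa>_def field_simps mult_left_mono)
      then show ?thesis using M[of "(t, p)"] p t a0(1) by (auto simp: K_def)
    qed
    \<comment> \<open>Makes \<open>\<kappa> / L\<close> at most a quarter. The hypothesis on
      \<open>N\<close> gives another quarter, so in the weighted norm each increment is at most half
      the previous one.\<close>
    define L where "L = 4 * \<kappa> + 1"
    have L: "L > 0" using \<kappa> by (simp add: L_def)
    have q: "(a0 + 1) / N + \<kappa> / L \<le> 1 / 2" "1 / N \<le> (1::real)"
    proof -
      have "(a0 + 1) / N \<le> 1 / 4" using N N1 by (simp add: field_simps)
      moreover have "\<kappa> / L \<le> 1 / 4" using L by (simp add: field_simps L_def)
      ultimately show "(a0 + 1) / N + \<kappa> / L \<le> 1 / 2" by linarith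
      show "1 / N \<le> (1::real)" using N1 by simp
    qed
    have main: "norm (d k (ray s p)) \<le> C * (1 / 2) ^ k * exp (L * s)"
      if p: "p \<in> cball p0 r" and s: "s \<in> {0..1}" for k s p
      using s
    proof (induction k arbitrary: s)
      case 0
      have pD: "p \<in> D" using p r by auto
      have "norm (d 0 (ray s p)) \<le> (1 / N + 0 / L) * (C * exp (L * s))"
        unfolding d0
      proof (rule euler_inv_bound[OF D(2) pD vhol_continuous[OF G] N1 L 0 C0])
        fix t :: real assume t: "t \<in> {0..1}"
        have "norm (G (ray t p)) \<le> C" using C[of "(t, p)"] p t by (auto simp: K_def)
        also have "\<dots> \<le> C * exp (L * t)"
          using mult_left_mono[of 1 "exp (L * t)" C] C0 L t by simp
        finally show "norm (G (ray t p)) \<le> (1 + 0 * t) * (C * exp (L * t))" by simp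
      qed auto
      also have "\<dots> \<le> 1 * (C * exp (L * s))"
        using q(2) C0 by (intro mult_right_mono) auto
      finally show ?case by simp
    next
      case (Suc k)
      have pD: "p \<in> D" using p r by auto
      have "norm (d (Suc k) (ray s p)) \<le> ((a0 + 1) / N + \<kappa> / L) * (C * (1 / 2) ^ k * exp (L * s))"
        unfolding dS
      proof (rule euler_inv_bound[OF D(2) pD _ N1 L Suc.prems])
        show "continuous_on D (\<lambda>p. A p *v d k p)"
          by (intro vhol_continuous vhol_matvec A dh)
        fix t :: real assume t: "t \<in> {0..1}"
        have "norm (A (ray t p) *v d k (ray t p)) \<le> msum (A (ray t p)) * norm (d k (ray t p))"
          by (rule norm_matvec_le)
        also have "\<dots> \<le> ((a0 + 1) + \<kappa> * t) * (C * (1 / 2) ^ k * exp (L * t))"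
          using a0(1) \<kappa> t by (intro mult_mono Ab[OF p t] Suc.IH[OF t]) auto
        finally show "norm (A (ray t p) *v d k (ray t p)) \<le> ((a0 + 1) + \<kappa> * t) * (C * (1 / 2) ^ k * exp (L * t))" .
      qed (use C0 a0 \<kappa> in auto)
      also have "\<dots> \<le> (1 / 2) * (C * (1 / 2) ^ k * exp (L * s))"
        using q(1) C0 by (intro mult_right_mono) auto
      finally show ?case by simp
    qed
    have "norm (d k (ray s p)) \<le> (C * exp L) * (1 / 2) ^ k" if p: "p \<in> cball p0 r" and s: "s \<in> {0..1}" for k s p
    proof -
      have "exp (L * s) \<le> exp L" using s L by simp
      then have "C * (1 / 2) ^ k * exp (L * s) \<le> C * (1 / 2) ^ k * exp L"
        using C0 by (intro mult_left_mono) auto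
      then show ?thesis using main[OF p s, of k] by (simp add: mult.commute mult.left_commute)
    qed
    then show ?thesis using r by blast
  qed
  define Y where "Y = (\<lambda>p. \<Sum>k. d k p)"
  \<comment> \<open>Convergence is needed uniformly along whole rays and not merely near a point,
    because the limit is to be taken under the integral of \<open>euler_inv\<close>.\<close>
  have ul: "uniform_limit {ray s p |s p. s \<in> {0..1} \<and> p \<in> cball p0 r} S Y sequentially"
    if b: "\<forall>p\<in>cball p0 r. \<forall>s\<in>{0..1}. \<forall>k. norm (d k (ray s p)) \<le> C * (1 / 2) ^ k" for p0 r C
    unfolding S_def Y_def
  proof (rule Weierstrass_m_test)
    show "summable (\<lambda>k. C * (1 / 2) ^ k)" by (intro summable_mult summable_geometric) simp
  qed (use b in auto)
  have Yh: "vhol Y D"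
    unfolding vhol_def
  proof
    fix i
    show "hol (\<lambda>p. Y p $ i) D"
    proof (rule hol_uniform_limit[OF D(1)])
      show "hol (\<lambda>p. S n p $ i) D" for n using Sh by (simp add: vhol_def)
      fix p0 assume "p0 \<in> D"
      then obtain r C where r: "r > 0" "cball p0 r \<subseteq> D"
        and b: "\<forall>p\<in>cball p0 r. \<forall>s\<in>{0..1}. \<forall>k. norm (d k (ray s p)) \<le> C * (1 / 2) ^ k"
        using bnd by blast
      have "cball p0 r \<subseteq> {ray s p |s p. s \<in> {0..1} \<and> p \<in> cball p0 r}"
      proof
        fix p assume "p \<in> cball p0 r"
        then show "p \<in> {ray s p |s p. s \<in> {0..1} \<and> p \<in> cball p0 r}"
          by (intro CollectI exI[of _ 1] exI[of _ p]) simp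
      qed
      then have "uniform_limit (cball p0 r) S Y sequentially"
        using uniform_limit_on_subset[OF ul[OF b]] by blast
      then show "\<exists>d>0. cball p0 d \<subseteq> D \<and> uniform_limit (cball p0 d) (\<lambda>n p. S n p $ i) (\<lambda>p. Y p $ i) sequentially"
        using r bounded_linear.uniform_limit[OF bounded_linear_vec_nth] by blast
    qed
  qed
  have Zh: "vhol (\<lambda>p. A p *v Y p + G p) D"
    by (intro vhol_add vhol_matvec A Yh G)
  have YE: "Y p = euler_inv N (\<lambda>p. A p *v Y p + G p) p" if p: "p \<in> D" for p
  proof -
    obtain r C where r: "r > 0" "cball p r \<subseteq> D"
        and b: "\<forall>q\<in>cball p r. \<forall>s\<in>{0..1}. \<forall>k. norm (d k (ray s q)) \<le> C * (1 / 2) ^ k"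
        using bnd[OF p] by blast
    have u: "uniform_limit {ray s q |s q. s \<in> {0..1} \<and> q \<in> cball p r} S Y sequentially"
      using ul[OF b] .
    define F where "F = (\<lambda>n t. t ^ (N - 1) *\<^sub>R (A (ray t p) *v S n (ray t p) + G (ray t p)))"
    define F' where "F' = (\<lambda>t. t ^ (N - 1) *\<^sub>R (A (ray t p) *v Y (ray t p) + G (ray t p)))"
    have "continuous_on {0..1} (\<lambda>t. msum (A (ray t p)))"
      by (intro continuous_on_msum continuous_along_ray[OF mhol_continuous[OF A] D(2) p])
    then have "bounded ((\<lambda>t. msum (A (ray t p))) ` {0..1})"
      by (intro compact_imp_bounded compact_continuous_image) auto
    then obtain M where M': "\<forall>x\<in>(\<lambda>t. msum (A (ray t p))) ` {0..1}. \<bar>x\<bar> \<le> M"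
      unfolding bounded_real by blast
    have M: "msum (A (ray t p)) \<le> M" if "t \<in> {0..1}" for t
      using M' that by auto
    have M0: "M \<ge> 0" by (rule order_trans[OF msum_nonneg M[of 0]]) simp
    have uF: "uniform_limit (cbox 0 1) F F' sequentially"
    proof (rule uniform_limitI)
      fix e :: real assume e: "e > 0"
      have "\<forall>\<^sub>F n in sequentially. \<forall>x\<in>{ray s q |s q. s \<in> {0..1} \<and> q \<in> cball p r}. dist (S n x) (Y x) < e / (M + 1)"
        using u e M0 by (intro uniform_limitD) auto
      then show "\<forall>\<^sub>F n in sequentially. \<forall>t\<in>cbox 0 1. dist (F n t) (F' t) < e"
      proof (rule eventually_mono, intro ballI)
        fix n and t :: real
        assume *: "\<forall>x\<in>{ray s q |s q. s \<in> {0..1} \<and> q \<in> cball p r}. dist (S n x) (Y x) < e / (M + 1)"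
          and "t \<in> cbox 0 1"
        then have t: "t \<in> {0..1}" by simp
        have "ray t p \<in> {ray s q |s q. s \<in> {0..1} \<and> q \<in> cball p r}"
          using t r(1) by (intro CollectI exI[of _ t] exI[of _ p]) auto
        then have s: "norm (S n (ray t p) - Y (ray t p)) < e / (M + 1)"
          using bspec[OF *] unfolding dist_norm by blast
        have "F n t - F' t = t ^ (N - 1) *\<^sub>R (A (ray t p) *v (S n (ray t p) - Y (ray t p)))"
          by (simp add: F_def F'_def matrix_vector_mult_diff_distrib scaleR_diff_right[symmetric])
        then have "norm (F n t - F' t) \<le> norm (A (ray t p) *v (S n (ray t p) - Y (ray t p)))"
          using t power_le_one[of t "N - 1"] by (simp add: mult_left_le_one_le)
        also have "\<dots> \<le> msum (A (ray t p)) * norm (S n (ray t p) - Y (ray t p))"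
          by (rule norm_matvec_le)
        also have "\<dots> \<le> M * (e / (M + 1))"
          using M[OF t] s M0 by (intro mult_mono) auto
        also have "\<dots> < e" using M0 e by (simp add: field_simps)
        finally show "dist (F n t) (F' t) < e" by (simp add: dist_norm)
      qed
    qed
    have cF: "continuous_on (cbox 0 1) (F n)" for n
      unfolding F_def cbox_interval
      by (intro continuous_intros continuous_along_ray[OF vhol_continuous[OF AS] D(2) p])
    obtain I J where I: "\<And>n. (F n has_integral I n) (cbox 0 1)" "(F' has_integral J) (cbox 0 1)" "I \<longlonglongrightarrow> J"
      by (rule uniform_limit_integral_cbox[OF uF cF trivial_limit_sequentially]) blast
    have "I = (\<lambda>n. S (Suc n) p)"
    proof
      show "I n = S (Suc n) p" for n
        using integral_unique[OF I(1)[of n]] SE[OF p, of n] by (simp add: F_def euler_inv_def)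
    qed
    then have "(\<lambda>n. S (Suc n) p) \<longlonglongrightarrow> J" using I(3) by simp
    moreover have "J = euler_inv N (\<lambda>p. A p *v Y p + G p) p"
      using integral_unique[OF I(2)] by (simp add: F'_def euler_inv_def)
    moreover have "p \<in> {ray s q |s q. s \<in> {0..1} \<and> q \<in> cball p r}"
      using r(1) by (intro CollectI exI[of _ 1] exI[of _ p]) auto
    then have "(\<lambda>n. S n p) \<longlonglongrightarrow> Y p" using tendsto_uniform_limitI[OF u] by blast
    then have "(\<lambda>n. S (Suc n) p) \<longlonglongrightarrow> Y p" by (rule LIMSEQ_Suc)
    ultimately show ?thesis using LIMSEQ_unique by blast
  qed
  show ?thesis
  proof (rule that[OF Yh])
    fix p assume p: "p \<in> D"
    have "vpd None Y p = vpd None (euler_inv N (\<lambda>p. A p *v Y p + G p)) p"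
      by (rule vpd_cong[OF D(1) p YE])
    then show "fst p *s vpd None Y p = A p *v Y p + G p - of_nat N *s Y p"
      using euler_inv_ode[OF D Zh N1 p] YE[OF p] by simp
  qed
qed

section \<open>Descent to order zero\<close>

lemma invertible_iff_ker:
  fixes A :: "complex ^ 'n ^ 'n"
  shows "invertible A \<longleftrightarrow> (\<forall>x. A *v x = 0 \<longrightarrow> x = 0)"
  unfolding invertible_left_inverse matrix_left_invertible_ker by simp

lemma mat_matvec [simp]: "mat a *v x = (a :: complex) *s x"
proof -
  have "(if i = j then a else 0) * x $ j = (if j = i then a * x $ j else 0)" for i j
    by simp
  then show ?thesis
    by (simp add: vec_eq_iff matrix_vector_mult_def mat_def)
qed

lemma vpd_None_const:
  assumes "open D" "p \<in> D" "\<And>p. p \<in> D \<Longrightarrow> F p = F (ray 0 p)"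
  shows "vpd None F p = 0"
proof -
  have "vpd None F p = vpd None (\<lambda>p. F (ray 0 p)) p"
    by (rule vpd_cong[OF assms])
  also have "\<dots> = 0"
    by (simp add: vpd_def pd_def ray_def dir_simps vec_eq_iff)
  finally show ?thesis .
qed

text \<open>The equation for the cofactor of \<open>u ^ k\<close>: if \<open>Y\<close> solves it,
  then \<open>u ^ k Y\<close> solves the equation for \<open>k = 0\<close> with inhomogeneity
  \<open>u ^ k G\<close>. Large \<open>k\<close> is the easy end.\<close>

definition euler_solvable :: "('b::finite point \<Rightarrow> complex ^ 'n ^ 'n) \<Rightarrow> 'b point set \<Rightarrow> nat \<Rightarrow> bool"
  where "euler_solvable A D k \<longleftrightarrow> (\<forall>G. vhol G D \<longrightarrow>
    (\<exists>Y. vhol Y D \<and> (\<forall>p\<in>D. fst p *s vpd None Y p = A p *v Y p + G p - of_nat k *s Y p)))"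

text \<open>Substituting \<open>Y = Y\<^sub>0 + u Y'\<close> and dividing the residual by \<open>u\<close> raises \<open>k\<close> by one.\<close>

lemma euler_ode_step:
  fixes A :: "'b::finite point \<Rightarrow> complex ^ 'n ^ 'n"
  assumes D: "open D" "ray_closed D" and A: "mhol A D" and G: "vhol G D"
    and sol: "euler_solvable A D (Suc k)"
    and Y0: "vhol Y0 D" "\<And>p. p \<in> D \<Longrightarrow> Y0 (ray 0 p) = Y0 p"
      "\<And>p. p \<in> D \<Longrightarrow> A (ray 0 p) *v Y0 p + G (ray 0 p) = of_nat k *s Y0 p"
  obtains Y where "vhol Y D" "\<And>p. p \<in> D \<Longrightarrow> Y (ray 0 p) = Y0 p"
    "\<And>p. p \<in> D \<Longrightarrow> fst p *s vpd None Y p = A p *v Y p + G p - of_nat k *s Y p"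
proof -
  have E: "vhol (\<lambda>p. A p *v Y0 p + G p - of_nat k *s Y0 p) D"
    by (intro vhol_add vhol_diff vhol_smult vhol_matvec A G Y0 hol_const)
  have E0: "A p *v Y0 p + G p - of_nat k *s Y0 p = 0" if "p \<in> D" "crd None p = 0" for p
    using Y0(3)[OF that(1)] ray_0[of p 0] that(2) by simp
  have "\<exists>H. vhol H D \<and> (\<forall>p\<in>D. A p *v Y0 p + G p - of_nat k *s Y0 p = crd None p *s H p)"
    by (rule vhol_coord_quotient[OF D(1) E E0]; blast)
  then obtain H where H: "vhol H D"
    "\<And>p. p \<in> D \<Longrightarrow> A p *v Y0 p + G p - of_nat k *s Y0 p = crd None p *s H p"
    by blast
  obtain X where X: "vhol X D" "\<And>p. p \<in> D \<Longrightarrow> fst p *s vpd None X p = A p *v X p + H p - of_nat (Suc k) *s X p"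
    using sol H(1) unfolding euler_solvable_def by blast
  define Y where "Y = (\<lambda>p. Y0 p + fst p *s X p)"
  show ?thesis
  proof (rule that)
    show "vhol Y D"
      unfolding Y_def by (intro vhol_add vhol_smult hol_fst X Y0)
    fix p assume p: "p \<in> D"
    show "Y (ray 0 p) = Y0 p" using Y0(2)[OF p] by (simp add: Y_def)
    have "vpd None Y p = vpd None Y0 p + (pd None fst p *s X p + fst p *s vpd None X p)"
      unfolding Y_def using p
      by (simp add: vpd_add[where U=D] vpd_smult[where U=D] vhol_smult hol_fst X Y0)
    also have "vpd None Y0 p = 0"
      using vpd_None_const[OF D(1) p, of Y0] Y0(2) by simp
    also have "pd None fst p = 1"
      by (rule pd_eqI) (auto simp: dir_simps intro!: derivative_eq_intros)
    finally have *: "vpd None Y p = X p + fst p *s vpd None X p" by simp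
    have "(fst p *s vpd None Y p) $ i = (A p *v Y p + G p - of_nat k *s Y p) $ i" for i
    proof -
      have 1: "fst p * vpd None X p $ i = (A p *v X p) $ i + H p $ i - (1 + of_nat k) * X p $ i"
        using arg_cong[OF X(2)[OF p], of "\<lambda>v. v $ i"] by (simp add: algebra_simps)
      have 2: "(A p *v Y0 p) $ i + G p $ i - of_nat k * Y0 p $ i = fst p * H p $ i"
        using arg_cong[OF H(2)[OF p], of "\<lambda>v. v $ i"] by simp
      have 3: "(A p *v Y p) $ i = (A p *v Y0 p) $ i + fst p * (A p *v X p) $ i"
        by (simp add: Y_def matrix_vector_right_distrib vector_scalar_commute)
      have "(fst p *s vpd None Y p) $ i = fst p * X p $ i + fst p * (fst p * vpd None X p $ i)"
        by (simp add: * algebra_simps)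
      also have "\<dots> = fst p * (A p *v X p) $ i + fst p * H p $ i - fst p * of_nat k * X p $ i"
        by (simp add: 1 algebra_simps)
      also have "\<dots> = (A p *v Y p + G p - of_nat k *s Y p) $ i"
        by (simp add: 2[symmetric] 3) (simp add: Y_def algebra_simps)
      finally show ?thesis .
    qed
    then show "fst p *s vpd None Y p = A p *v Y p + G p - of_nat k *s Y p"
      by (simp add: vec_eq_iff)
  qed
qed

text \<open>Descending induction on the order \<open>k\<close>. At a large order the Picard series
  converges; from \<open>k + 1\<close> to \<open>k \<ge> 1\<close> the constant term is found by
  inverting \<open>k - A\<close> at the origin, which is nonresonance; at order \<open>0\<close>
  this matrix may be singular, and the prescribed \<open>Y0\<close> takes the place of the
  inverse.\<close>

theorem euler_ode:
  fixes A :: "'b::finite point \<Rightarrow> complex ^ 'n ^ 'n"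
  assumes D: "open D" "ray_closed D" and A: "mhol A D" and G: "vhol G D"
    and a0: "\<And>p. p \<in> D \<Longrightarrow> msum (A (ray 0 p)) \<le> a0"
    and nonres: "\<And>n p. n \<ge> 1 \<Longrightarrow> p \<in> D \<Longrightarrow> invertible (mat (of_nat n) - A (ray 0 p))"
    and Y0: "vhol Y0 D" "\<And>p. p \<in> D \<Longrightarrow> Y0 (ray 0 p) = Y0 p"
      "\<And>p. p \<in> D \<Longrightarrow> A (ray 0 p) *v Y0 p + G (ray 0 p) = 0"
  obtains Y where "vhol Y D" "\<And>p. p \<in> D \<Longrightarrow> Y (ray 0 p) = Y0 p"
    "\<And>p. p \<in> D \<Longrightarrow> fst p *s vpd None Y p = A p *v Y p + G p"
proof -
  define c where "c = max a0 0"
  obtain N0 where N0: "real N0 \<ge> 4 * (c + 1)" using real_arch_simple by blast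
  have "euler_solvable A D (Suc N0)"
    unfolding euler_solvable_def
  proof (intro allI impI)
    fix G :: "'b point \<Rightarrow> complex ^ 'n" assume G: "vhol G D"
    have c: "c \<ge> 0" "msum (A (ray 0 p)) \<le> c" if "p \<in> D" for p
      using a0[OF that] by (auto simp: c_def)
    have N: "real (Suc N0) \<ge> 4 * (c + 1)" using N0 by simp
    have "c \<ge> 0" by (simp add: c_def)
    show "\<exists>Y. vhol Y D \<and> (\<forall>p\<in>D. fst p *s vpd None Y p = A p *v Y p + G p - of_nat (Suc N0) *s Y p)"
      by (rule euler_ode_large[OF D A G \<open>c \<ge> 0\<close> c(2) N]; blast)
  qed
  then have "euler_solvable A D 1"
  proof (rule inc_induct[rotated])
    fix k assume k: "1 \<le> k" and sol: "euler_solvable A D (Suc k)"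
    show "euler_solvable A D k"
      unfolding euler_solvable_def
    proof (intro allI impI)
      fix G :: "'b point \<Rightarrow> complex ^ 'n" assume G: "vhol G D"
      define Y0 where "Y0 = (\<lambda>p. matrix_inv (mat (of_nat k) - A (ray 0 p)) *v G (ray 0 p))"
      have Y0h: "vhol Y0 D"
        unfolding Y0_def
        by (intro vhol_matvec mhol_matrix_inv D(1) nonres[OF k] mhol_diff mhol_const mhol_ray[OF A D(2)] vhol_ray[OF G D(2)]) auto
      have Y0r: "Y0 (ray 0 p) = Y0 p" for p by (simp add: Y0_def)
      have Y0e: "A (ray 0 p) *v Y0 p + G (ray 0 p) = of_nat k *s Y0 p" if p: "p \<in> D" for p
      proof -
        have "(mat (of_nat k) - A (ray 0 p)) *v Y0 p = G (ray 0 p)"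
          by (simp add: Y0_def matrix_vector_mul_assoc matrix_inv(1)[OF nonres[OF k p]])
        then show ?thesis by (simp add: matrix_vector_mult_diff_rdistrib algebra_simps)
      qed
      show "\<exists>Y. vhol Y D \<and> (\<forall>p\<in>D. fst p *s vpd None Y p = A p *v Y p + G p - of_nat k *s Y p)"
        by (rule euler_ode_step[OF D A G sol Y0h Y0r Y0e]; blast)
    qed
  qed simp
  then have sol: "euler_solvable A D (Suc 0)" by simp
  have Y0e: "A (ray 0 p) *v Y0 p + G (ray 0 p) = of_nat 0 *s Y0 p" if "p \<in> D" for p
    using Y0(3)[OF that] by simp
  show ?thesis
    by (rule euler_ode_step[OF D A G sol Y0(1,2) Y0e]) (use that in auto)
qed

text \<open>A regular point is the harmless case of a singular one: after moving \<open>x0\<close>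
  to the origin and multiplying by the variable, the residue is \<open>0\<close>, every positive
  integer is nonresonant, and the full plane is closed under rays. The extra factor is cancelled
  again by density.\<close>

theorem linear_ode_param:
  fixes a :: "'b::finite point \<Rightarrow> complex ^ 'n ^ 'n"
  assumes V: "open V" and a: "mhol a (UNIV \<times> V)" and y0: "vhol (\<lambda>p. y0 (snd p)) (UNIV \<times> V)"
  obtains Y where "vhol Y (UNIV \<times> V)" "\<And>b. b \<in> V \<Longrightarrow> Y (x0, b) = y0 b"
    "\<And>p. p \<in> UNIV \<times> V \<Longrightarrow> vpd None Y p = a p *v Y p"
proof -
  let ?D = "UNIV \<times> V :: 'b point set"
  have D: "open ?D" "ray_closed ?D" using V by (auto simp: ray_closed_def ray_def open_Times)
  have tr: "mhol (\<lambda>p. a (p + (x0, 0))) ?D"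
    using a by (auto simp: mhol_def intro!: hol_translate[where W = "?D"])
  define A where "A = (\<lambda>p. mscale (fst p) (a (p + (x0, 0))))"
  have A: "mhol A ?D" unfolding A_def by (intro mhol_mscale hol_fst tr)
  have A0: "A (ray 0 p) = 0" for p by (simp add: A_def mscale_def vec_eq_iff)
  obtain X where X: "vhol X ?D" "\<And>p. p \<in> ?D \<Longrightarrow> X (ray 0 p) = y0 (snd p)"
      "\<And>p. p \<in> ?D \<Longrightarrow> fst p *s vpd None X p = A p *v X p + 0"
  proof (rule euler_ode[OF D A vhol_const, of 0 "\<lambda>p. y0 (snd p)" 0])
    show "msum (A (ray 0 p)) \<le> 0" for p by (simp add: A0 msum_def)
    show "invertible (mat (of_nat n) - A (ray 0 p))" if "n \<ge> 1" for n p
      using that by (auto simp: invertible_iff_ker A0 vec_eq_iff)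
  qed (use y0 A0 in auto)
  have eq: "vpd None X p = a (p + (x0, 0)) *v X p" if p: "p \<in> ?D" for p
  proof (rule coord_nonzero_dense[OF D(1) _ _ _ p, of _ _ None])
    show "continuous_on ?D (vpd None X)"
      by (intro vhol_continuous vhol_vpd X D)
    show "continuous_on ?D (\<lambda>p. a (p + (x0, 0)) *v X p)"
      by (intro vhol_continuous vhol_matvec tr X)
    fix q :: "'b point" assume q: "q \<in> ?D" "crd None q \<noteq> 0"
    have "A q *v X q = fst q *s (a (q + (x0, 0)) *v X q)"
      by (simp add: A_def mscale_def vec_eq_iff matrix_vector_mult_def sum_distrib_left mult.assoc)
    with X(3)[OF q(1)] have "fst q *s vpd None X q = fst q *s (a (q + (x0, 0)) *v X q)" by simp
    then show "vpd None X q = a (q + (x0, 0)) *v X q" using q(2) by (simp add: vec_eq_iff)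
  qed
  show ?thesis
  proof (rule that[of "\<lambda>p. X (p + (- x0, 0))"])
    show "vhol (\<lambda>p. X (p + (- x0, 0))) ?D"
      using X(1) by (auto simp: vhol_def intro!: hol_translate[where W = "?D"])
    show "X ((x0, b) + (- x0, 0)) = y0 b" if "b \<in> V" for b
      using X(2)[of "(0, b)"] that by (simp add: ray_def)
    fix p :: "'b point" assume p: "p \<in> ?D"
    have "vpd None (\<lambda>p. X (p + (- x0, 0))) p = vpd None X (p + (- x0, 0))"
      by (simp add: vpd_def pd_def add.assoc add.commute[of "dir None _"])
    also have "\<dots> = a p *v X (p + (- x0, 0))"
      using eq[of "p + (- x0, 0)"] p by (cases p) auto
    finally show "vpd None (\<lambda>p. X (p + (- x0, 0))) p = a p *v X (p + (- x0, 0))" .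
  qed
qed

section \<open>Periodic solutions of linear equations\<close>

lemma msum_triangle: "msum (A + B) \<le> msum A + msum B"
  unfolding msum_def sum.distrib[symmetric] by (intro sum_mono) (simp add: norm_triangle_ineq)

lemma msum_mat_le: "cmod (A $ i $ j) \<le> msum (A :: complex ^ 'n ^ 'm::finite)"
proof -
  have "cmod (A $ i $ j) \<le> (\<Sum>j\<in>UNIV. cmod (A $ i $ j))"
    by (rule member_le_sum) auto
  also have "\<dots> \<le> msum A"
    unfolding msum_def by (rule member_le_sum[of i UNIV "\<lambda>i. \<Sum>j\<in>UNIV. cmod (A $ i $ j)"]) (auto intro: sum_nonneg)
  finally show ?thesis .
qed

text \<open>Gronwall's inequality, applied to the squared norm along the segment because the norm
  itself need not be differentiable where the solution vanishes.\<close>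

lemma linear_ode_growth:
  fixes \<phi> :: "complex \<Rightarrow> complex ^ 'n" and a :: "complex \<Rightarrow> complex ^ 'n ^ 'n"
  assumes der: "\<And>t i. t \<in> {0..1} \<Longrightarrow>
      ((\<lambda>x. \<phi> x $ i) has_field_derivative (a (x0 + of_real t * h) *v \<phi> (x0 + of_real t * h)) $ i) (at (x0 + of_real t * h))"
    and K: "\<And>t. t \<in> {0..1} \<Longrightarrow> msum (a (x0 + of_real t * h)) \<le> K"
  shows "norm (\<phi> (x0 + h)) \<le> norm (\<phi> x0) * exp (K * cmod h)"
proof -
  define f where "f = (\<lambda>t. \<phi> (x0 + of_real t * h))"
  define f' where "f' = (\<lambda>t. h *s (a (x0 + of_real t * h) *v f t))"
  have d: "((\<lambda>t. f t $ i) has_vector_derivative f' t $ i) (at t)" if "t \<in> {0..1}" for t i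
  proof -
    have "((\<lambda>t. x0 + of_real t * h) has_vector_derivative h) (at t)"
      by (auto intro!: derivative_eq_intros simp: scaleR_conv_of_real)
    from field_vector_diff_chain_at[OF this der[OF that]]
    show ?thesis by (simp add: o_def f_def f'_def)
  qed
  define S where "S = (\<lambda>t. \<Sum>i\<in>UNIV. (Re (f t $ i))\<^sup>2 + (Im (f t $ i))\<^sup>2)"
  have S: "S t = (norm (f t))\<^sup>2" for t
    unfolding S_def power2_norm_eq_inner inner_vec_def inner_complex_def by (simp add: power2_eq_square)
  have dS: "(S has_real_derivative 2 * (f t \<bullet> f' t)) (at t)" if t: "t \<in> {0..1}" for t
  proof -
    have "(S has_real_derivative (\<Sum>i\<in>UNIV. 2 * Re (f t $ i) * Re (f' t $ i) + 2 * Im (f t $ i) * Im (f' t $ i))) (at t)"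
      unfolding S_def
    proof (rule DERIV_sum)
      fix i
      show "((\<lambda>t. (Re (f t $ i))\<^sup>2 + (Im (f t $ i))\<^sup>2) has_real_derivative
          2 * Re (f t $ i) * Re (f' t $ i) + 2 * Im (f t $ i) * Im (f' t $ i)) (at t)"
      proof -
        note r = has_field_derivative_Re[OF d[OF t, of i]] and m = has_field_derivative_Im[OF d[OF t, of i]]
        show ?thesis
          unfolding power2_eq_square
          by (rule DERIV_cong[OF DERIV_add[OF DERIV_mult[OF r r] DERIV_mult[OF m m]]]) simp
      qed
    qed
    then show ?thesis
      by (simp add: inner_vec_def inner_complex_def sum_distrib_left algebra_simps)
  qed
  \<comment> \<open>The factor 2 is due to squaring the norm; it disappears again when the square
    root is taken.\<close>
  define k where "k = 2 * K * cmod h"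
  have "S 1 * exp (- (k * 1)) \<le> S 0 * exp (- (k * 0))"
  proof (rule DERIV_nonpos_imp_nonincreasing[of 0 1 "\<lambda>t. S t * exp (- (k * t))"])
    fix t :: real assume t: "0 \<le> t" "t \<le> 1"
    have "((\<lambda>t. S t * exp (- (k * t))) has_real_derivative
        (2 * (f t \<bullet> f' t)) * exp (- (k * t)) + S t * (exp (- (k * t)) * (- k))) (at t)"
      using t by (auto intro!: derivative_eq_intros dS)
    moreover have "2 * (f t \<bullet> f' t) \<le> k * S t"
    proof -
      have "norm (f' t) \<le> cmod h * (msum (a (x0 + of_real t * h)) * norm (f t))"
      proof -
        have "norm (h *s v) = cmod h * norm v" for v :: "complex ^ 'n"
          by (simp add: norm_vec_def norm_mult L2_set_right_distrib)
        then show ?thesis by (simp add: f'_def mult_left_mono norm_matvec_le)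
      qed
      also have "\<dots> \<le> cmod h * (K * norm (f t))"
        using K[of t] t by (intro mult_left_mono mult_right_mono) auto
      finally have "norm (f t) * norm (f' t) \<le> norm (f t) * (cmod h * (K * norm (f t)))"
        by (intro mult_left_mono) auto
      moreover have "f t \<bullet> f' t \<le> norm (f t) * norm (f' t)" by (rule norm_cauchy_schwarz)
      ultimately show ?thesis by (simp add: S k_def power2_eq_square algebra_simps)
    qed
    then have "(2 * (f t \<bullet> f' t) - k * S t) * exp (- (k * t)) \<le> 0"
      by (intro mult_nonpos_nonneg) auto
    ultimately show "\<exists>y. ((\<lambda>t. S t * exp (- (k * t))) has_real_derivative y) (at t) \<and> y \<le> 0"
      by (intro exI[of _ "(2 * (f t \<bullet> f' t)) * exp (- (k * t)) + S t * (exp (- (k * t)) * (- k))"])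
        (simp add: algebra_simps)
  qed simp
  then have "S 1 \<le> S 0 * exp k" by (simp add: exp_minus field_simps)
  also have "exp k = (exp (K * cmod h))\<^sup>2"
    by (simp add: k_def exp_double[symmetric] mult.assoc)
  finally have "(norm (f 1))\<^sup>2 \<le> (norm (f 0) * exp (K * cmod h))\<^sup>2"
    by (simp add: S power_mult_distrib)
  then have "norm (f 1) \<le> norm (f 0) * exp (K * cmod h)"
    by (rule power2_le_imp_le) simp
  then show ?thesis by (simp add: f_def)
qed

lemma linear_ode_unique:
  fixes \<phi> :: "complex \<Rightarrow> complex ^ 'n" and a :: "complex \<Rightarrow> complex ^ 'n ^ 'n"
  assumes S: "convex S" and a: "continuous_on S a"
    and der: "\<And>x i. x \<in> S \<Longrightarrow> ((\<lambda>x. \<phi> x $ i) has_field_derivative (a x *v \<phi> x) $ i) (at x)"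
    and x: "x0 \<in> S" "x \<in> S" and 0: "\<phi> x0 = 0"
  shows "\<phi> x = 0"
proof -
  have seg: "x0 + of_real t * (x - x0) \<in> S" if "t \<in> {0..1}" for t
    using convexD_alt[OF S x, of t] that by (auto simp: algebra_simps scaleR_conv_of_real)
  have "continuous_on {0..1} (\<lambda>t. msum (a (x0 + of_real t * (x - x0))))"
    by (intro continuous_on_msum continuous_on_compose2[OF a] continuous_intros) (use seg in auto)
  then have "bounded ((\<lambda>t. msum (a (x0 + of_real t * (x - x0)))) ` {0..1})"
    by (intro compact_imp_bounded compact_continuous_image) auto
  then obtain K where K': "\<forall>y\<in>(\<lambda>t. msum (a (x0 + of_real t * (x - x0)))) ` {0..1}. \<bar>y\<bar> \<le> K"
    unfolding bounded_real by blast
  have K: "msum (a (x0 + of_real t * (x - x0))) \<le> K" if "t \<in> {0..1}" for t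
    using K' that by auto
  have "norm (\<phi> (x0 + (x - x0))) \<le> norm (\<phi> x0) * exp (K * cmod (x - x0))"
    by (rule linear_ode_growth[OF der[OF seg] K])
  then show ?thesis using 0 by simp
qed

section \<open>Splitting off the zero of a vector-valued entire function\<close>

lemma holomorphic_divide_var:
  assumes "F holomorphic_on UNIV" "F 0 = 0"
  obtains F1 where "F1 holomorphic_on UNIV" "\<And>v. F v = v * F1 v"
proof
  define F1 where "F1 = (\<lambda>v. if v = 0 then deriv F 0 else F v / v)"
  show "F1 holomorphic_on UNIV"
    by (rule pole_theorem_0[OF assms(1), of 0]) (auto simp: F1_def assms)
  show "F v = v * F1 v" for v using assms(2) by (simp add: F1_def)
qed

text \<open>The order of the zero of one component bounds how often the whole vector can be divided
  by the variable. The division stops earlier if another component becomes nonzero at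
  \<open>0\<close>.\<close>

lemma vector_factor_zero_aux:
  fixes G :: "complex \<Rightarrow> complex ^ 'n" and g :: "complex \<Rightarrow> complex"
  assumes "\<And>i. (\<lambda>v. G v $ i) holomorphic_on UNIV"
    and "continuous_on (ball 0 r) g" "g 0 \<noteq> 0" "r > 0" "\<And>v. v \<in> ball 0 r - {0} \<Longrightarrow> G v $ i0 = v ^ N * g v"
  shows "\<exists>M H. (\<forall>i. (\<lambda>v. H v $ i) holomorphic_on UNIV) \<and> H 0 \<noteq> 0 \<and> (\<forall>v. G v = v ^ M *s H v)"
  using assms(1,5)
proof (induction N arbitrary: G)
  case 0
  have "G 0 $ i0 = g 0"
  proof -
    have c1: "((\<lambda>v. G v $ i0) \<longlongrightarrow> G 0 $ i0) (at 0)"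
      using holomorphic_on_imp_continuous_on[OF 0(1)] by (auto simp: continuous_on_eq_continuous_at isCont_def)
    have c2: "(g \<longlongrightarrow> g 0) (at 0)"
      using assms(2,4) by (auto simp: continuous_on_eq_continuous_at[OF open_ball] isCont_def)
    have "eventually (\<lambda>v. v \<in> ball 0 r - {0}) (at (0::complex))"
      using assms(4) eventually_at_ball[of r 0 UNIV] by (auto simp: eventually_at_filter elim: eventually_mono)
    then have "eventually (\<lambda>v. g v = G v $ i0) (at 0)"
      by (rule eventually_mono) (use 0(2) in auto)
    then show ?thesis
      using tendsto_unique[OF at_neq_bot c1 Lim_transform_eventually[OF c2]] by blast
  qed
  then show ?case using assms(3) 0(1)
    by (intro exI[of _ 0] exI[of _ G]) auto
next
  case (Suc N)
  show ?case
  proof (cases "G 0 = 0")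
    case False
    then show ?thesis using Suc.prems(1) by (intro exI[of _ 0] exI[of _ G]) auto
  next
    case True
    have "\<exists>F. F holomorphic_on UNIV \<and> (\<forall>v. G v $ i = v * F v)" for i
      using holomorphic_divide_var[OF Suc.prems(1)[of i]] True by (metis zero_index)
    then obtain F where F: "\<And>i. F i holomorphic_on UNIV" "\<And>i v. G v $ i = v * F i v" by metis
    define G1 where "G1 = (\<lambda>v. \<chi> i. F i v)"
    have "\<exists>M H. (\<forall>i. (\<lambda>v. H v $ i) holomorphic_on UNIV) \<and> H 0 \<noteq> 0 \<and> (\<forall>v. G1 v = v ^ M *s H v)"
    proof (rule Suc.IH)
      show "(\<lambda>v. G1 v $ i) holomorphic_on UNIV" for i using F by (simp add: G1_def)
      fix v :: complex assume v: "v \<in> ball 0 r - {0}"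
      then have "v * F i0 v = v ^ Suc N * g v" using Suc.prems(2) F(2) by metis
      then show "G1 v $ i0 = v ^ N * g v" using v by (simp add: G1_def)
    qed
    then obtain M H where H: "\<forall>i. (\<lambda>v. H v $ i) holomorphic_on UNIV" "H 0 \<noteq> 0" "\<forall>v. G1 v = v ^ M *s H v" by blast
    have "G v = v ^ Suc M *s H v" for v
    proof -
      have "G v = v *s G1 v" by (simp add: vec_eq_iff F(2) G1_def)
      then show ?thesis using H(3) by (simp add: vec_eq_iff)
    qed
    then show ?thesis using H(1,2) by blast
  qed
qed

lemma vector_factor_zero:
  fixes G :: "complex \<Rightarrow> complex ^ 'n"
  assumes G: "\<And>i. (\<lambda>v. G v $ i) holomorphic_on UNIV" and nz: "G v1 \<noteq> 0"
  obtains M H where "\<And>i. (\<lambda>v. H v $ i) holomorphic_on UNIV" "H 0 \<noteq> 0" "\<And>v. G v = v ^ M *s H v"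
proof -
  obtain i where i: "G v1 $ i \<noteq> 0" using nz by (auto simp: vec_eq_iff)
  have "\<exists>r g N. r > 0 \<and> continuous_on (ball 0 r) g \<and> g 0 \<noteq> 0 \<and> (\<forall>v\<in>ball 0 r - {0}. G v $ i = v ^ N * g v)"
  proof (cases "(\<lambda>v. G v $ i) constant_on UNIV")
    case True
    then have "\<forall>v. G v $ i = G v1 $ i" unfolding constant_on_def by (metis UNIV_I)
    then show ?thesis using i by (intro exI[of _ 1] exI[of _ "\<lambda>v. G v1 $ i"] exI[of _ 0]) auto
  next
    case False
    show ?thesis
    proof (cases "G 0 $ i = 0")
      case True
      from holomorphic_factor_zero_nonconstant[OF G open_UNIV connected_UNIV UNIV_I True False]
      show ?thesis
        by (metis DiffD1 centre_in_ball diff_zero holomorphic_on_imp_continuous_on)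
    next
      case False
      then show ?thesis using holomorphic_on_imp_continuous_on[OF G[of i]]
        by (intro exI[of _ 1] exI[of _ "\<lambda>v. G v $ i"] exI[of _ 0]) (auto intro: continuous_on_subset)
    qed
  qed
  then obtain r g N where "r > 0" "continuous_on (ball 0 r) g" "g 0 \<noteq> 0" "\<And>v. v \<in> ball 0 r - {0} \<Longrightarrow> G v $ i = v ^ N * g v"
    by blast
  from vector_factor_zero_aux[OF G this(2,3,1,4)] that show ?thesis by blast
qed

section \<open>Periodic solutions and their exponents\<close>

lemma periodic_int:
  assumes "\<And>x. f (x + w) = f x"
  shows "f (x + of_int k * w) = f (x :: complex)"
proof (induction k rule: int_induct[where k = 0])
  case (step1 k)
  then show ?case using assms[of "x + of_int k * w"] by (simp add: algebra_simps)
next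
  case (step2 k)
  then show ?case using assms[of "x + of_int (k - 1) * w"] by (simp add: algebra_simps)
qed simp

text \<open>Periodicity makes the choice of the logarithm irrelevant, although \<open>Ln\<close>
  itself jumps: near \<open>v0\<close> the branch \<open>Ln (v / v0) + Ln v0\<close> gives the same
  value and is holomorphic. The sign in \<open>exp (- x / of_nat n)\<close> moves the end
  \<open>Re x \<rightarrow> \<infinity>\<close> to the point \<open>v = 0\<close>.\<close>

lemma periodic_through_exp:
  fixes f :: "complex \<Rightarrow> complex"
  assumes n: "n > 0" and f: "f holomorphic_on UNIV" and per: "\<And>x. f (x + 2 * of_real pi * \<i> * of_nat n) = f x"
  shows "(\<lambda>v. f (- of_nat n * Ln v)) holomorphic_on - {0}"
    and "f (- of_nat n * Ln (exp (- x / of_nat n))) = f x"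
proof -
  have branch: "f (- of_nat n * l) = f (- of_nat n * Ln v)" if "exp l = v" for l v
  proof -
    have "v \<noteq> 0" using that by auto
    then have "exp l = exp (Ln v)" using that by simp
    then obtain k :: int where k: "l = Ln v + complex_of_real (real_of_int (2 * k) * pi) * \<i>"
      using exp_eq by blast
    have "- of_nat n * l = - of_nat n * Ln v + of_int (- k) * (2 * of_real pi * \<i> * of_nat n)"
      by (simp add: k algebra_simps)
    then show ?thesis using periodic_int[of f, OF per, of "- of_nat n * Ln v" "- k"] by simp
  qed
  show "f (- of_nat n * Ln (exp (- x / of_nat n))) = f x"
    using branch[OF refl, of "- x / of_nat n"] n by simp
  show "(\<lambda>v. f (- of_nat n * Ln v)) holomorphic_on - {0}"
    unfolding holomorphic_on_open[OF open_Compl[OF closed_singleton]]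
  proof
    fix v0 :: complex assume v0: "v0 \<in> - {0}"
    define l where "l = (\<lambda>v. Ln (v / v0) + Ln v0)"
    define U where "U = {v. Re (v / v0) > 0}"
    have "open U" unfolding U_def by (intro open_Collect_less continuous_intros) (use v0 in auto)
    have v0U: "v0 \<in> U" using v0 by (simp add: U_def)
    have "l holomorphic_on U"
      unfolding l_def by (intro holomorphic_intros) (use v0 in \<open>auto simp: U_def complex_nonpos_Reals_iff\<close>)
    then have "(\<lambda>v. f (- of_nat n * l v)) holomorphic_on U"
      by (intro holomorphic_on_compose_gen[OF _ f, unfolded o_def] holomorphic_intros) auto
    moreover have "f (- of_nat n * l v) = f (- of_nat n * Ln v)" if "v \<in> U" for v
    proof (rule branch)
      have "v / v0 \<noteq> 0" using that by (auto simp: U_def)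
      then show "exp (l v) = v" using v0 by (simp add: l_def exp_add)
    qed
    ultimately have "(\<lambda>v. f (- of_nat n * Ln v)) holomorphic_on U"
      by (rule holomorphic_transform)
    then show "\<exists>f'. ((\<lambda>v. f (- of_nat n * Ln v)) has_field_derivative f') (at v0)"
      using holomorphic_on_open[OF \<open>open U\<close>] v0U by blast
  qed
qed

text \<open>Floquet theory at a regular singular point. In the variable
  \<open>exp (- x / of_nat n)\<close> the solution is single-valued and, by Gronwall, of at most
  polynomial growth at \<open>0\<close>, so it has finite order there. Its leading coefficient
  survives the limit in the equation and is an eigenvector of \<open>a0\<close>, the eigenvalue
  being the pole order divided by \<open>n\<close>.\<close>

lemma linear_ode_periodic_aux:
  fixes \<phi> :: "complex \<Rightarrow> complex ^ 'n" and a :: "complex \<Rightarrow> complex ^ 'n ^ 'n"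
  assumes der: "\<And>x i. ((\<lambda>x. \<phi> x $ i) has_field_derivative (a x *v \<phi> x) $ i) (at x)"
    and lim: "\<And>e. e > 0 \<Longrightarrow> \<exists>R. \<forall>x. Re x \<ge> R \<longrightarrow> msum (a x - a0) < e"
    and per: "\<And>x. \<phi> (x + 2 * of_real pi * \<i> * of_nat n) = \<phi> x" and n: "n > 0"
    and nz: "\<phi> x1 \<noteq> 0"
  obtains k :: int and v where "v \<noteq> 0" "a0 *v v = (of_int k / of_nat n) *s v"
    "\<And>e. e > 0 \<Longrightarrow> \<exists>R. \<forall>x. Re x \<ge> R \<longrightarrow> norm (exp (- (of_int k / of_nat n) * x) *s \<phi> x - v) < e"
proof -
  define T where "T = 2 * pi * n"
  have T: "T > 0" using n by (simp add: T_def)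
  have \<phi>h: "(\<lambda>x. \<phi> x $ i) holomorphic_on UNIV" for i
    unfolding holomorphic_on_open[OF open_UNIV] using der by blast
  have \<phi>c: "continuous_on UNIV \<phi>"
  proof -
    have "continuous_on UNIV (\<lambda>x. \<chi> i. \<phi> x $ i)"
      by (intro continuous_on_vec_lambda holomorphic_on_imp_continuous_on \<phi>h)
    then show ?thesis by (simp add: vec_lambda_eta)
  qed
  obtain R0 where R0: "\<And>x. Re x \<ge> R0 \<Longrightarrow> msum (a x - a0) < 1" using lim[of 1] by auto
  define K where "K = msum a0 + 1"
  have K0: "K \<ge> 0" by (simp add: K_def add_nonneg_nonneg)
  have K: "msum (a x) \<le> K" if "Re x \<ge> R0" for x
    using R0[OF that] msum_triangle[of "a x - a0" a0] by (simp add: K_def)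
  have "bounded ((\<lambda>y. norm (\<phi> (Complex R0 y))) ` {0..T})"
  proof (intro compact_imp_bounded compact_continuous_image)
    have "continuous_on {0..T} (Complex R0)"
      unfolding Complex_eq by (intro continuous_intros)
    then show "continuous_on {0..T} (\<lambda>y. norm (\<phi> (Complex R0 y)))"
      by (intro continuous_intros continuous_on_compose2[OF \<phi>c]) auto
  qed auto
  then obtain C where C': "\<forall>y\<in>(\<lambda>y. norm (\<phi> (Complex R0 y))) ` {0..T}. \<bar>y\<bar> \<le> C"
    unfolding bounded_real by blast
  have C: "norm (\<phi> (Complex R0 y)) \<le> C" if "y \<in> {0..T}" for y using C' that by auto
  have C0: "C \<ge> 0" by (rule order_trans[OF norm_ge_zero C[of 0]]) (use T in simp)
  \<comment> \<open>Periodicity brings the imaginary part into one period, where the line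
    \<open>Re x = R0\<close> contributes a compact segment; from there the estimate runs along a
    horizontal segment, on which the coefficient is bounded by \<open>K\<close>.\<close>
  have growth: "norm (\<phi> x) \<le> C * exp (K * (Re x - R0))" if x: "Re x \<ge> R0" for x
  proof -
    define k where "k = \<lfloor>Im x / T\<rfloor>"
    define y where "y = Im x - k * T"
    have y: "y \<in> {0..T}"
    proof -
      have "k \<le> Im x / T" "Im x / T < k + 1" using floor_correct[of "Im x / T"] by (auto simp: k_def)
      then have "k * T \<le> Im x" "Im x < (k + 1) * T" using T by (simp_all add: field_simps)
      then show ?thesis by (simp add: y_def algebra_simps)
    qed
    have "\<phi> x = \<phi> (x + of_int (- k) * (2 * of_real pi * \<i> * of_nat n))"
      using periodic_int[of \<phi>, OF per, of x "- k"] by simp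
    also have "x + of_int (- k) * (2 * of_real pi * \<i> * of_nat n) = Complex R0 y + of_real (Re x - R0)"
      by (simp add: complex_eq_iff y_def T_def)
    finally have "norm (\<phi> x) = norm (\<phi> (Complex R0 y + of_real (Re x - R0)))" by simp
    also have "\<dots> \<le> norm (\<phi> (Complex R0 y)) * exp (K * cmod (of_real (Re x - R0)))"
    proof (rule linear_ode_growth[OF der K])
      fix t :: real assume "t \<in> {0..1}"
      then show "R0 \<le> Re (Complex R0 y + of_real t * of_real (Re x - R0))" using x by simp
    qed
    also have "\<dots> \<le> C * exp (K * (Re x - R0))"
      using C[OF y] x by (simp add: norm_of_real del: of_real_diff)
    finally show ?thesis .
  qed
  \<comment> \<open>The power \<open>v ^ \<kappa>\<close> outweighs the growth
    \<open>exp (K * Re x)\<close>; one further power of \<open>v\<close> makes the product tend to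
    \<open>0\<close>, so the singularity is removable with value \<open>0\<close>.\<close>
  obtain \<kappa> where \<kappa>: "real \<kappa> \<ge> K * n" using real_arch_simple by blast
  define g where "g = (\<lambda>v. v ^ Suc \<kappa> *s \<phi> (- of_nat n * Ln v))"
  define G where "G = (\<lambda>v. if v = 0 then 0 else g v)"
  have gh: "(\<lambda>v. g v $ i) holomorphic_on UNIV - {0}" for i
    using periodic_through_exp(1)[OF n \<phi>h, of i] per
    unfolding g_def by (auto intro!: holomorphic_intros simp: Compl_eq_Diff_UNIV[symmetric])
  define C2 where "C2 = C * exp (- K * R0)"
  have gb: "norm (g v) \<le> C2 * cmod v" if v: "v \<noteq> 0" "cmod v < 1" "cmod v < exp (- R0 / n)" for v
  proof -
    define x where "x = - of_nat n * Ln v"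
    have Rex: "Re x = - n * ln (cmod v)" using v by (simp add: x_def)
    have "ln (cmod v) < - R0 / n" using v(1,3) by (metis exp_less_cancel_iff exp_ln zero_less_norm_iff)
    then have "R0 \<le> Re x" using n by (simp add: Rex field_simps)
    then have "norm (\<phi> x) \<le> C * exp (K * (Re x - R0))" by (rule growth)
    also have "\<dots> = C2 * exp (- (K * n) * ln (cmod v))"
      by (simp add: C2_def Rex exp_add[symmetric] algebra_simps)
    finally have 1: "norm (\<phi> x) \<le> C2 * exp (- (K * n) * ln (cmod v))" .
    have "cmod v ^ \<kappa> = exp (\<kappa> * ln (cmod v))"
      using v(1) by (simp add: exp_of_nat_mult)
    then have "cmod v ^ \<kappa> * exp (- (K * n) * ln (cmod v)) = exp ((\<kappa> - K * n) * ln (cmod v))"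
      by (simp add: exp_add[symmetric] algebra_simps)
    also have "\<dots> \<le> 1"
      using \<kappa> v(1,2) by (simp add: mult_nonneg_nonpos)
    finally have 2: "cmod v ^ \<kappa> * exp (- (K * n) * ln (cmod v)) \<le> 1" .
    have nm: "norm (c *s w) = cmod c * norm w" for c and w :: "complex ^ 'n"
      by (simp add: norm_vec_def norm_mult L2_set_right_distrib)
    have "norm (g v) = cmod v ^ Suc \<kappa> * norm (\<phi> x)" by (simp only: g_def x_def nm norm_power)
    also have "\<dots> \<le> cmod v ^ Suc \<kappa> * (C2 * exp (- (K * n) * ln (cmod v)))"
      using 1 by (intro mult_left_mono) auto
    also have "\<dots> = C2 * cmod v * (cmod v ^ \<kappa> * exp (- (K * n) * ln (cmod v)))" by simp
    also have "\<dots> \<le> C2 * cmod v * 1"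
      using 2 C0 by (intro mult_left_mono) (auto simp: C2_def)
    finally show ?thesis by simp
  qed
  have Gh: "(\<lambda>v. G v $ i) holomorphic_on UNIV" for i
  proof -
    have "((\<lambda>v. g v $ i) \<longlongrightarrow> 0) (at 0)"
    proof (rule Lim_null_comparison)
      have "eventually (\<lambda>v. v \<in> ball 0 (min 1 (exp (- R0 / n))) - {0}) (at (0::complex))"
        using eventually_at_ball[of "min 1 (exp (- R0 / n))" 0 UNIV] by (auto simp: eventually_at_filter elim: eventually_mono)
      then show "eventually (\<lambda>v. norm (g v $ i) \<le> C2 * cmod v) (at 0)"
        by (rule eventually_mono)
          (use gb in \<open>auto intro: order_trans[OF Finite_Cartesian_Product.norm_nth_le]\<close>)
      have "((\<lambda>v::complex. C2 * cmod v) \<longlongrightarrow> C2 * cmod 0) (at 0)" by (intro tendsto_intros)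
      then show "((\<lambda>v::complex. C2 * cmod v) \<longlongrightarrow> 0) (at 0)" by simp
    qed
    from removable_singularity[OF gh open_UNIV this]
    have "(\<lambda>y. if y = 0 then 0 else g y $ i) holomorphic_on UNIV" .
    moreover have "(\<lambda>y. if y = 0 then 0 else g y $ i) = (\<lambda>v. G v $ i)" by (auto simp: G_def)
    ultimately show ?thesis by simp
  qed
  define w where "w = (\<lambda>x::complex. exp (- x / of_nat n))"
  have w: "w x \<noteq> 0" for x by (simp add: w_def)
  have G\<phi>: "G (w x) = w x ^ Suc \<kappa> *s \<phi> x" for x
  proof -
    have "\<phi> (- of_nat n * Ln (w x)) = \<phi> x"
      using periodic_through_exp(2)[OF n \<phi>h, of _ x] per by (simp add: w_def vec_eq_iff)
    then show ?thesis using w[of x] by (simp add: G_def g_def)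
  qed
  have "G (w x1) \<noteq> 0" using nz w[of x1] by (simp add: G\<phi>)
  have "\<exists>M H. (\<forall>i. (\<lambda>v. H v $ i) holomorphic_on UNIV) \<and> H 0 \<noteq> 0 \<and> (\<forall>v. G v = v ^ M *s H v)"
    by (rule vector_factor_zero[of G, OF Gh \<open>G (w x1) \<noteq> 0\<close>]; blast)
  then obtain M H where H: "\<And>i. (\<lambda>v. H v $ i) holomorphic_on UNIV" "H 0 \<noteq> 0" "\<And>v. G v = v ^ M *s H v"
    by blast
  \<comment> \<open>The pole order of the solution; it is negative if the solution has a
    zero.\<close>
  define k where "k = int (Suc \<kappa>) - int M"
  define \<alpha> where "\<alpha> = (of_int k / of_nat n :: complex)"
  have E: "exp (- \<alpha> * x) *s \<phi> x = H (w x)" for x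
  proof -
    have "exp (- \<alpha> * x) * w x ^ M = w x ^ Suc \<kappa>"
    proof -
      have "w x ^ j = exp (of_nat j * (- x / of_nat n))" for j
        unfolding w_def by (rule exp_of_nat_mult[symmetric])
      then have "exp (- \<alpha> * x) * w x ^ M = exp (- \<alpha> * x + of_nat M * (- x / of_nat n))"
        by (simp only: exp_add)
      also have "- \<alpha> * x + of_nat M * (- x / of_nat n) = of_nat (Suc \<kappa>) * (- x / of_nat n)"
        using n by (simp add: \<alpha>_def k_def field_simps)
      also have "exp \<dots> = w x ^ Suc \<kappa>" unfolding w_def by (rule exp_of_nat_mult)
      finally show ?thesis .
    qed
    moreover have "w x ^ M *s H (w x) = w x ^ Suc \<kappa> *s \<phi> x" using G\<phi>[of x] H(3) by simp
    ultimately have "w x ^ M *s H (w x) = w x ^ M *s (exp (- \<alpha> * x) *s \<phi> x)"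
      by (simp add: mult.commute)
    then show ?thesis using w[of x] by (simp add: vec_eq_iff)
  qed
  have Hc: "isCont H 0"
  proof -
    have "continuous_on UNIV (\<lambda>x. \<chi> i. H x $ i)"
      by (intro continuous_on_vec_lambda holomorphic_on_imp_continuous_on H)
    then show ?thesis by (simp add: vec_lambda_eta continuous_on_eq_continuous_at)
  qed
  have conv: "\<exists>R. \<forall>x. Re x \<ge> R \<longrightarrow> norm (exp (- \<alpha> * x) *s \<phi> x - H 0) < e" if e: "e > 0" for e
  proof -
    obtain \<delta> where \<delta>: "\<delta> > 0" "\<And>v. norm (v - 0) < \<delta> \<Longrightarrow> norm (H v - H 0) < e"
      using Hc e unfolding continuous_at_eps_delta by (metis dist_norm)
    show ?thesis
    proof (intro exI[of _ "- n * ln \<delta> + 1"] allI impI)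
      fix x assume "- n * ln \<delta> + 1 \<le> Re x"
      then have "- Re x / n < ln \<delta>" using n by (simp add: field_simps)
      then have "exp (- Re x / n) < \<delta>" using \<delta>(1) by (metis exp_less_cancel_iff exp_ln)
      moreover have "cmod (w x) = exp (- Re x / n)" by (simp add: w_def)
      ultimately show "norm (exp (- \<alpha> * x) *s \<phi> x - H 0) < e"
        unfolding E by (intro \<delta>(2)) simp
    qed
  qed
  have "(a0 *v H 0) $ i = (\<alpha> *s H 0) $ i" for i
  proof -
    \<comment> \<open>The differential equation in terms of the regularised function
      \<open>H\<close>. Its right-hand side carries the factor \<open>w x\<close>, which vanishes in
      the limit and leaves the eigenvalue equation.\<close>
    have eq: "(a x *v H (w x)) $ i - \<alpha> * H (w x) $ i = - (w x / of_nat n) * deriv (\<lambda>v. H v $ i) (w x)" for x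
    proof -
      have D1: "((\<lambda>x. exp (- \<alpha> * x) * \<phi> x $ i) has_field_derivative
          exp (- \<alpha> * x) * (a x *v \<phi> x) $ i + (exp (- \<alpha> * x) * (- \<alpha>)) * \<phi> x $ i) (at x)"
        by (auto intro!: derivative_eq_intros der)
      have e1: "exp (- \<alpha> * x) * (a x *v \<phi> x) $ i + (exp (- \<alpha> * x) * (- \<alpha>)) * \<phi> x $ i =
          (a x *v H (w x)) $ i - \<alpha> * H (w x) $ i"
        by (simp only: E[symmetric] vector_scalar_commute) simp
      have e2: "(\<lambda>x. exp (- \<alpha> * x) * \<phi> x $ i) = (\<lambda>x. H (w x) $ i)"
        by (simp add: fun_eq_iff E[symmetric])
      have d1: "((\<lambda>v. H v $ i) has_field_derivative deriv (\<lambda>v. H v $ i) (w x)) (at (w x))"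
        using holomorphic_derivI[OF H(1) open_UNIV UNIV_I] .
      have d2: "(w has_field_derivative - (w x / of_nat n)) (at x)"
        unfolding w_def using n by (auto intro!: derivative_eq_intros)
      have "((\<lambda>x. H (w x) $ i) has_field_derivative deriv (\<lambda>v. H v $ i) (w x) * (- (w x / of_nat n))) (at x)"
        using DERIV_chain2[where f = "\<lambda>v. H v $ i" and g = w, OF d1 d2] .
      from DERIV_unique[OF D1[unfolded e1 e2] this] show ?thesis by simp
    qed
    define X where "X = (\<lambda>N::nat. complex_of_real (real N))"
    have wl: "(\<lambda>N. w (X N)) \<longlonglongrightarrow> 0"
    proof (rule tendsto_norm_zero_cancel)
      have "(\<lambda>N. exp (- 1 / real n) ^ N) \<longlonglongrightarrow> 0" using n by (intro LIMSEQ_power_zero) simp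
      then show "(\<lambda>N. norm (w (X N))) \<longlonglongrightarrow> 0" by (simp add: w_def X_def exp_of_nat_mult[symmetric])
    qed
    have al: "(\<lambda>N. a (X N) $ p $ q) \<longlonglongrightarrow> a0 $ p $ q" for p q
    proof (rule LIMSEQ_I)
      fix e :: real assume "e > 0"
      then obtain R where R: "\<And>x. Re x \<ge> R \<Longrightarrow> msum (a x - a0) < e" using lim by blast
      obtain N0 where N0: "real N0 \<ge> R" using real_arch_simple by blast
      show "\<exists>no. \<forall>N\<ge>no. norm (a (X N) $ p $ q - a0 $ p $ q) < e"
      proof (intro exI[of _ N0] allI impI)
        fix N assume "N0 \<le> N"
        then have "msum (a (X N) - a0) < e" using R[of "X N"] N0 by (simp add: X_def)
        then show "norm (a (X N) $ p $ q - a0 $ p $ q) < e"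
          using msum_mat_le[of "a (X N) - a0" p q] by simp
      qed
    qed
    have Hl: "(\<lambda>N. H (w (X N)) $ j) \<longlonglongrightarrow> H 0 $ j" for j
      using isCont_tendsto_compose[OF Hc wl] by (rule tendsto_vec_nth)
    have Dl: "(\<lambda>N. deriv (\<lambda>v. H v $ i) (w (X N))) \<longlonglongrightarrow> deriv (\<lambda>v. H v $ i) 0"
    proof (rule isCont_tendsto_compose[OF _ wl])
      show "isCont (deriv (\<lambda>v. H v $ i)) 0"
        using holomorphic_on_imp_continuous_on[OF holomorphic_deriv[OF H(1) open_UNIV]]
        by (simp add: continuous_on_eq_continuous_at)
    qed
    have "(\<lambda>N. (a (X N) *v H (w (X N))) $ i - \<alpha> * H (w (X N)) $ i) \<longlonglongrightarrow> (a0 *v H 0) $ i - \<alpha> * H 0 $ i"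
      unfolding matrix_vector_mult_def by (simp, intro tendsto_intros al Hl)
    moreover have "(\<lambda>N. - (w (X N) / of_nat n) * deriv (\<lambda>v. H v $ i) (w (X N))) \<longlonglongrightarrow> - (0 / of_nat n) * deriv (\<lambda>v. H v $ i) 0"
      by (intro tendsto_intros wl Dl) (use n in auto)
    ultimately have "(a0 *v H 0) $ i - \<alpha> * H 0 $ i = - (0 / of_nat n) * deriv (\<lambda>v. H v $ i) 0"
      unfolding eq by (rule LIMSEQ_unique)
    then show ?thesis by simp
  qed
  then have "a0 *v H 0 = \<alpha> *s H 0" by (simp add: vec_eq_iff)
  then show ?thesis using that[of "H 0" k] H(2) conv unfolding \<alpha>_def by blast
qed

text \<open>Multiplication by \<open>exp (- \<alpha> * x)\<close>, with \<open>\<alpha>\<close> a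
  normalised logarithm of the multiplier \<open>d\<close>, makes the solution periodic and shifts
  \<open>a0\<close> by \<open>\<alpha>\<close>. The eigenvalue of the shifted matrix is a multiple
  of \<open>1 / n\<close>, which the final exponential does not see.\<close>

lemma linear_ode_quasiperiodic:
  fixes \<phi> :: "complex \<Rightarrow> complex ^ 'n" and a :: "complex \<Rightarrow> complex ^ 'n ^ 'n"
  assumes der: "\<And>x i. ((\<lambda>x. \<phi> x $ i) has_field_derivative (a x *v \<phi> x) $ i) (at x)"
    and lim: "\<And>e. e > 0 \<Longrightarrow> \<exists>R. \<forall>x. Re x \<ge> R \<longrightarrow> msum (a x - a0) < e"
    and per: "\<And>x. \<phi> (x + 2 * of_real pi * \<i> * of_nat n) = d *s \<phi> x" and n: "n > 0"
    and nz: "\<phi> x1 \<noteq> 0" "d \<noteq> 0"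
  shows "\<exists>\<alpha> v. v \<noteq> 0 \<and> a0 *v v = \<alpha> *s v \<and> exp (2 * of_real pi * \<i> * of_nat n * \<alpha>) = d"
proof -
  define \<alpha> where "\<alpha> = Ln d / (2 * of_real pi * \<i> * of_nat n)"
  have \<alpha>: "exp (2 * of_real pi * \<i> * of_nat n * \<alpha>) = d"
    using n nz(2) by (simp add: \<alpha>_def)
  define f where "f = (\<lambda>x. exp (- \<alpha> * x) *s \<phi> x)"
  have 1: "((\<lambda>x. f x $ i) has_field_derivative ((a x - mat \<alpha>) *v f x) $ i) (at x)" for x i
  proof -
    have "((\<lambda>x. exp (- \<alpha> * x) * \<phi> x $ i) has_field_derivative
        exp (- \<alpha> * x) * (a x *v \<phi> x) $ i + (exp (- \<alpha> * x) * (- \<alpha>)) * \<phi> x $ i) (at x)"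
      by (auto intro!: derivative_eq_intros der)
    moreover have "exp (- \<alpha> * x) * (a x *v \<phi> x) $ i + (exp (- \<alpha> * x) * (- \<alpha>)) * \<phi> x $ i =
        ((a x - mat \<alpha>) *v f x) $ i"
      by (simp add: f_def matrix_vector_mult_diff_rdistrib vector_scalar_commute)
    ultimately show ?thesis by (simp add: f_def)
  qed
  have 2: "f (x + 2 * of_real pi * \<i> * of_nat n) = f x" for x
  proof -
    have "exp (- \<alpha> * (x + 2 * of_real pi * \<i> * of_nat n)) * d = exp (- \<alpha> * x)"
      unfolding \<alpha>[symmetric] exp_add[symmetric] by (simp add: algebra_simps)
    then show ?thesis unfolding f_def per by (simp only: vector_smult_assoc)
  qed
  have 3: "f x1 \<noteq> 0" using nz by (simp add: f_def)
  have 4: "\<exists>R. \<forall>x. Re x \<ge> R \<longrightarrow> msum ((a x - mat \<alpha>) - (a0 - mat \<alpha>)) < e" if "e > 0" for e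
    using lim[OF that] by simp
  have "\<exists>(k::int) v. v \<noteq> 0 \<and> (a0 - mat \<alpha>) *v v = (of_int k / of_nat n) *s v"
    by (rule linear_ode_periodic_aux[of f "\<lambda>x. a x - mat \<alpha>", OF 1 4 2 n 3]; blast)
  then obtain k :: int and v where v: "v \<noteq> 0" "(a0 - mat \<alpha>) *v v = (of_int k / of_nat n) *s v" by blast
  have "a0 *v v = (\<alpha> + of_int k / of_nat n) *s v"
    using v(2) by (simp add: matrix_vector_mult_diff_rdistrib diff_eq_eq vector_sadd_rdistrib add.commute)
  moreover have "exp (2 * of_real pi * \<i> * of_nat n * (\<alpha> + of_int k / of_nat n)) = d"
  proof -
    have "2 * of_real pi * \<i> * of_nat n * (\<alpha> + of_int k / of_nat n) =
        2 * of_real pi * \<i> * of_nat n * \<alpha> + 2 * of_int k * of_real pi * \<i>"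
      using n by (simp add: field_simps)
    moreover have "exp (2 * of_int k * of_real pi * \<i>) = 1"
      unfolding exp_eq_1 by (auto intro!: exI[of _ k])
    ultimately show ?thesis by (simp only: exp_add \<alpha> mult_1_right)
  qed
  ultimately show ?thesis using v(1) by blast
qed

section \<open>Monodromy and residue\<close>

text \<open>In the coordinate \<open>x = log z\<close> the equation \<open>y' = - (\<Sum>q<m. z ^ q a\<^sub>q) y / z ^ m\<close> becomes
  linear with this coefficient matrix, which tends to \<open>- a\<^bsub>m - 1\<^esub>\<close> as \<open>Re x\<close> tends to infinity.\<close>

definition log_coeff :: "nat \<Rightarrow> (nat \<Rightarrow> complex ^ 'n ^ 'n) \<Rightarrow> complex \<Rightarrow> complex ^ 'n ^ 'n"
  where "log_coeff m aq x = mscale (- exp x / exp x ^ m) (\<Sum>q<m. mscale (exp x ^ q) (aq q))"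

lemma mscale_nth [simp]: "mscale c M $ i $ k = c * M $ i $ k"
  by (simp add: mscale_def)

lemma mscale_mscale: "mscale a (mscale b M) = mscale (a * b :: complex) M"
  by (simp add: vec_eq_iff)

lemma mscale_sum: "mscale (c :: complex) (\<Sum>i\<in>I. F i) = (\<Sum>i\<in>I. mscale c (F i))"
  by (simp add: vec_eq_iff sum_distrib_left)

lemma mscale_matvec: "mscale c M *v x = (c::complex) *s (M *v x)"
  by (simp add: vec_eq_iff matrix_vector_mult_def sum_distrib_left mult.assoc)

lemma msum_mscale: "msum (mscale c M) = cmod c * msum M"
  by (simp add: msum_def norm_mult sum_distrib_left)

lemma msum_sum: "msum (\<Sum>i\<in>I. F i) \<le> (\<Sum>i\<in>I. msum (F i))"
proof (induction I rule: infinite_finite_induct)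
  case (insert i I)
  then show ?case using msum_triangle[of "F i" "\<Sum>i\<in>I. F i"] by simp
qed (auto simp: msum_def)

text \<open>All terms but the one with \<open>q = m - 1\<close> retain at least one factor
  \<open>exp (- x)\<close>.\<close>

lemma log_coeff_limit:
  assumes m: "m \<ge> 1" and e: "e > 0"
  shows "\<exists>R. \<forall>x. Re x \<ge> R \<longrightarrow> msum (log_coeff m aq x - (- aq (m - 1))) < e"
proof -
  define C where "C = (\<Sum>q<m. msum (aq q)) + 1"
  have C: "C > 0" by (simp add: C_def sum_nonneg add_nonneg_pos)
  have b: "msum (log_coeff m aq x - (- aq (m - 1))) \<le> exp (- Re x) * C" if x: "Re x \<ge> 0" for x
  proof -
    obtain m' where m': "m = Suc m'" using m by (cases m) auto
    have c: "- exp x / exp x ^ m * exp x ^ q = - (exp (- x) ^ (m' - q))" if "q \<le> m'" for q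
    proof -
      have "exp x ^ m' = exp x ^ (m' - q) * exp x ^ q" using that by (simp add: power_add[symmetric])
      moreover have "exp (- x) ^ (m' - q) * exp x ^ (m' - q) = 1"
        by (simp add: power_mult_distrib[symmetric] exp_add[symmetric])
      ultimately show ?thesis by (simp add: m' field_simps)
    qed
    have "log_coeff m aq x = (\<Sum>q<Suc m'. mscale (- (exp (- x) ^ (m' - q))) (aq q))"
      unfolding log_coeff_def mscale_sum mscale_mscale m' by (intro sum.cong refl) (simp only: c[unfolded m'] lessThan_Suc_atMost atMost_iff)
    also have "\<dots> = (\<Sum>q<m'. mscale (- (exp (- x) ^ (m' - q))) (aq q)) + (- aq m')"
      by (simp add: vec_eq_iff)
    finally have "msum (log_coeff m aq x - (- aq (m - 1))) = msum (\<Sum>q<m'. mscale (- (exp (- x) ^ (m' - q))) (aq q))"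
      by (simp add: m')
    also have "\<dots> \<le> (\<Sum>q<m'. msum (mscale (- (exp (- x) ^ (m' - q))) (aq q)))"
      by (rule msum_sum)
    also have "\<dots> \<le> (\<Sum>q<m'. exp (- Re x) * msum (aq q))"
    proof (rule sum_mono)
      fix q assume "q \<in> {..<m'}"
      then have "exp (- Re x) ^ (m' - q) \<le> exp (- Re x) ^ 1"
        using x by (intro power_decreasing) auto
      then show "msum (mscale (- (exp (- x) ^ (m' - q))) (aq q)) \<le> exp (- Re x) * msum (aq q)"
        by (simp add: msum_mscale norm_power mult_right_mono)
    qed
    also have "\<dots> \<le> exp (- Re x) * C"
      by (simp add: C_def m' sum_distrib_left[symmetric] add_nonneg_nonneg)
    finally show ?thesis .
  qed
  show ?thesis
  proof (intro exI[of _ "max 0 (ln (C / e) + 1)"] allI impI)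
    fix x assume x: "max 0 (ln (C / e) + 1) \<le> Re x"
    then have "- Re x < - ln (C / e)" by simp
    also have "\<dots> = ln (e / C)" using C e by (simp add: ln_div)
    finally have "exp (- Re x) < e / C" using C e by (metis divide_pos_pos exp_less_cancel_iff exp_ln)
    then have "exp (- Re x) * C < e" using C by (simp add: field_simps)
    then show "msum (log_coeff m aq x - (- aq (m - 1))) < e" using b[of x] x by simp
  qed
qed

lemma log_coeff_periodic: "log_coeff m aq (x + of_int (2 * k) * of_real pi * \<i>) = log_coeff m aq x"
proof -
  have "exp (of_int (2 * k) * of_real pi * \<i> :: complex) = 1"
    unfolding exp_eq_1 by (auto intro!: exI[of _ k])
  then show ?thesis by (simp add: log_coeff_def exp_add)
qed

lemma continuous_on_log_coeff: "continuous_on S (log_coeff m aq)"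
proof -
  have "continuous_on S (\<lambda>x. \<chi> i j. log_coeff m aq x $ i $ j)"
    unfolding log_coeff_def mscale_nth sum_component
    by (intro continuous_on_vec_lambda continuous_intros) auto
  then show ?thesis by (simp add: vec_lambda_eta)
qed

lemma hol_exp_fst: "hol (\<lambda>p. exp (fst p)) U"
  by (rule hol_compose_outer[OF hol_fst, of exp UNIV]) (auto intro: holomorphic_intros)

text \<open>The numeral type \<open>1\<close> supplies a dummy base variable, so that the theorem
  with parameters also yields entire solutions of a single equation.\<close>

lemma log_coeff_solution:
  fixes aq :: "nat \<Rightarrow> complex ^ 'n ^ 'n"
  obtains \<phi> where "\<phi> x0 = c" "\<And>x i. ((\<lambda>x. \<phi> x $ i) has_field_derivative (log_coeff m aq x *v \<phi> x) $ i) (at x)"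
proof -
  have h: "mhol (\<lambda>p :: 1 point. log_coeff m aq (fst p)) (UNIV \<times> UNIV)"
    unfolding log_coeff_def by (intro mhol_intros hol_intros hol_exp_fst) auto
  have "\<exists>Y :: 1 point \<Rightarrow> complex ^ 'n. vhol Y (UNIV \<times> UNIV) \<and> (\<forall>b\<in>UNIV. Y (x0, b) = c) \<and>
      (\<forall>p\<in>UNIV \<times> UNIV. vpd None Y p = log_coeff m aq (fst p) *v Y p)"
    by (rule linear_ode_param[OF open_UNIV h, of "\<lambda>_. c" x0]) (auto intro: vhol_const)
  then obtain Y :: "1 point \<Rightarrow> complex ^ 'n" where Y: "vhol Y UNIV" "\<And>b. Y (x0, b) = c"
      "\<And>p. vpd None Y p = log_coeff m aq (fst p) *v Y p"
    by auto
  show ?thesis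
  proof (rule that[of "\<lambda>x. Y (x, 0)"])
    show "Y (x0, 0) = c" by (rule Y)
    fix x i
    have "hol (\<lambda>p. Y p $ i) UNIV" using Y(1) by (simp add: vhol_def)
    from hol_has_derivative[OF this, of "(0, 0)" None x]
    show "((\<lambda>x. Y (x, 0) $ i) has_field_derivative (log_coeff m aq x *v Y (x, 0)) $ i) (at x)"
      using Y(3)[of "(x, 0)"] by (simp add: dir_simps vpd_def vec_eq_iff)
  qed
qed

lemma log_coeff_unique:
  fixes \<phi> :: "complex \<Rightarrow> complex ^ 'n"
  assumes S: "convex S"
    and \<phi>: "\<And>x i. x \<in> S \<Longrightarrow> ((\<lambda>x. \<phi> x $ i) has_field_derivative (log_coeff m aq x *v \<phi> x) $ i) (at x)"
    and \<psi>: "\<And>x i. x \<in> S \<Longrightarrow> ((\<lambda>x. \<psi> x $ i) has_field_derivative (log_coeff m aq x *v \<psi> x) $ i) (at x)"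
    and x: "x0 \<in> S" "x \<in> S" and eq: "\<phi> x0 = \<psi> x0"
  shows "\<phi> x = \<psi> x"
proof -
  have d: "((\<lambda>x. (\<phi> x - \<psi> x) $ i) has_field_derivative (log_coeff m aq x *v (\<phi> x - \<psi> x)) $ i) (at x)"
    if "x \<in> S" for x i
    using DERIV_diff[OF \<phi>[OF that] \<psi>[OF that], of i i] by (simp add: matrix_vector_mult_diff_distrib)
  have "\<phi> x - \<psi> x = 0"
    using linear_ode_unique[where \<phi> = "\<lambda>x. \<phi> x - \<psi> x", OF S continuous_on_log_coeff d x] eq by simp
  then show ?thesis by simp
qed

lemma log_coeff_translate:
  fixes \<phi> :: "complex \<Rightarrow> complex ^ 'n"
  assumes "\<And>x i. ((\<lambda>x. \<phi> x $ i) has_field_derivative (log_coeff m aq x *v \<phi> x) $ i) (at x)"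
  shows "((\<lambda>x. \<phi> (x + of_int (2 * k) * of_real pi * \<i>) $ i) has_field_derivative
    (log_coeff m aq x *v \<phi> (x + of_int (2 * k) * of_real pi * \<i>)) $ i) (at x)"
  using assms[of i "x + of_int (2 * k) * of_real pi * \<i>"]
  unfolding DERIV_shift log_coeff_periodic .

lemma log_coeff_exp_compose:
  fixes w :: "complex \<Rightarrow> complex ^ 'n"
  assumes "\<And>i. ((\<lambda>z. w z $ i) has_field_derivative
    - ((\<Sum>q<m. mscale (exp x ^ q) (aq q)) *v w (exp x)) $ i / exp x ^ m) (at (exp x))"
  shows "((\<lambda>x. w (exp x) $ i) has_field_derivative (log_coeff m aq x *v w (exp x)) $ i) (at x)"
  using DERIV_chain2[where f = "\<lambda>z. w z $ i" and g = exp and x = x, OF assms[of i] DERIV_exp]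
  by (simp add: log_coeff_def mscale_matvec mult.commute)

lemma matvec_has_derivative:
  fixes Q :: "complex \<Rightarrow> complex ^ 'n ^ 'm" and w :: "complex \<Rightarrow> complex ^ 'n"
  assumes "\<And>i j. ((\<lambda>z. Q z $ i $ j) has_field_derivative Q' $ i $ j) (at z)"
    and "\<And>j. ((\<lambda>z. w z $ j) has_field_derivative w' $ j) (at z)"
  shows "((\<lambda>z. (Q z *v w z) $ i) has_field_derivative (Q' *v w z + Q z *v w') $ i) (at z)"
proof -
  have "((\<lambda>z. \<Sum>j\<in>UNIV. Q z $ i $ j * w z $ j) has_field_derivative
      (\<Sum>j\<in>UNIV. Q' $ i $ j * w z $ j + Q z $ i $ j * w' $ j)) (at z)"
    by (intro DERIV_sum) (auto intro!: derivative_eq_intros assms)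
  then show ?thesis by (simp add: matrix_vector_mult_def sum.distrib)
qed

text \<open>A gauge transformation carries horizontal sections to horizontal sections. The
  derivative of \<open>Q\<close> is not given directly and has to be extracted from the intertwining
  property.\<close>

lemma horizontal_gauge:
  fixes Q \<Phi> A A' :: "complex \<Rightarrow> complex ^ 'r ^ 'r"
  assumes Q: "\<And>i k. (\<lambda>z. Q z $ i $ k) holomorphic_on S" and S: "open S" "z \<in> S" and z: "z ^ m \<noteq> \<epsilon> ^ m"
    and hom: "horizontal_hom m \<epsilon> S A A' Q"
    and \<Phi>: "\<And>i k. (\<lambda>z. \<Phi> z $ i $ k) holomorphic_on U" "open U" "z \<in> U"
    and hor: "\<And>v. nabla m \<epsilon> A (\<lambda>x. \<Phi> x *v v) z = 0"
  shows "((\<lambda>z. (Q z *v (\<Phi> z *v c)) $ i) has_field_derivative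
    - (A' z *v (Q z *v (\<Phi> z *v c))) $ i / (z ^ m - \<epsilon> ^ m)) (at z)"
proof -
  define w where "w = (\<lambda>z. \<Phi> z *v c)"
  define Q' where "Q' = (\<chi> i j. deriv (\<lambda>z. Q z $ i $ j) z)"
  define w' where "w' = (\<chi> i. deriv (\<lambda>z. w z $ i) z)"
  have dQ: "((\<lambda>z. Q z $ i $ j) has_field_derivative Q' $ i $ j) (at z)" for i j
    using holomorphic_derivI[OF Q S] by (simp add: Q'_def)
  have dw: "((\<lambda>z. w z $ i) has_field_derivative w' $ i) (at z)" for i
  proof -
    have "(\<lambda>z. w z $ i) holomorphic_on U"
      unfolding w_def matrix_vector_mult_def by (simp, intro holomorphic_intros \<Phi>)
    from holomorphic_derivI[OF this \<Phi>(2,3)] show ?thesis by (simp add: w'_def)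
  qed
  have w'_eq: "w' $ i = - (A z *v w z) $ i / (z ^ m - \<epsilon> ^ m)" for i
  proof -
    have "nabla m \<epsilon> A w z $ i = 0" using hor[of c] by (simp add: w_def)
    then show ?thesis by (simp add: nabla_def w'_def add_eq_0_iff2)
  qed
  \<comment> \<open>Testing the intertwining property on constant sections isolates the derivative
    of \<open>Q\<close>.\<close>
  have Q'_eq: "(Q' *v u) $ i = (Q z *v (A z *v u)) $ i / (z ^ m - \<epsilon> ^ m) - (A' z *v (Q z *v u)) $ i / (z ^ m - \<epsilon> ^ m)" for u i
  proof -
    have "nabla m \<epsilon> A' (\<lambda>x. Q x *v u) z = Q z *v nabla m \<epsilon> A (\<lambda>_. u) z"
      using hom S(2) z unfolding horizontal_hom_def by (auto simp: holomorphic_on_const)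
    then have "nabla m \<epsilon> A' (\<lambda>x. Q x *v u) z $ i = (Q z *v nabla m \<epsilon> A (\<lambda>_. u) z) $ i" by simp
    moreover have "deriv (\<lambda>x. (Q x *v u) $ i) z = (Q' *v u) $ i"
      using matvec_has_derivative[where w = "\<lambda>_. u" and w' = 0, OF dQ] by (intro DERIV_imp_deriv) auto
    moreover have "nabla m \<epsilon> A (\<lambda>_. u) z = (1 / (z ^ m - \<epsilon> ^ m)) *s (A z *v u)"
      by (simp add: nabla_def vec_eq_iff)
    ultimately show ?thesis by (simp add: nabla_def vector_scalar_commute algebra_simps)
  qed
  define c' where "c' = - 1 / (z ^ m - \<epsilon> ^ m)"
  have "w' = c' *s (A z *v w z)"
    by (simp add: vec_eq_iff w'_eq c'_def)
  then have "(Q' *v w z + Q z *v w') $ i = (Q' *v w z) $ i + c' * (Q z *v (A z *v w z)) $ i"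
    by (simp add: vector_scalar_commute)
  then have "(Q' *v w z + Q z *v w') $ i = - (A' z *v (Q z *v w z)) $ i / (z ^ m - \<epsilon> ^ m)"
    by (simp add: Q'_eq c'_def)
  then show ?thesis
    using matvec_has_derivative[where w = w, OF dQ dw, of i] unfolding w_def by simp
qed

lemma diag_mat_matvec: "(diag_mat d *v x) $ i = d i * x $ i" for d :: "'n::finite \<Rightarrow> complex"
proof -
  have "(if i = j then d i else 0) * x $ j = (if j = i then d i * x $ i else 0)" for j
    by simp
  then show ?thesis by (simp add: matrix_vector_mult_def diag_mat_def)
qed

text \<open>The loop is lifted to the logarithm, where horizontal sections become entire functions
  and the monodromy becomes a translation by a multiple of \<open>2 \<pi> i\<close>. A basis that
  diagonalises the monodromy thus consists of quasi-periodic solutions, and each of them yields an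
  eigenvalue of the residue whose exponential is governed by its multiplier; distinct multipliers
  exclude integer differences.\<close>

lemma monodromy_eigenvectors:
  fixes aq :: "nat \<Rightarrow> complex ^ 'r::finite ^ 'r" and d :: "'r \<Rightarrow> complex"
  assumes m: "m \<ge> 1" and hor: "horizontal_along m 0 A g Y"
    and g: "continuous_on {0..1} g" "\<And>t. t \<in> {0..1} \<Longrightarrow> g t \<in> ball 0 1" "g 0 = g 1"
    and Y: "invertible (Y 0)" "Y 1 = Y 0 ** diag_mat d" and d: "inj d"
    and Q: "\<And>i k. (\<lambda>z. Q z $ i $ k) holomorphic_on ball 0 1" "invertible (Q (g 0))"
    and hom: "horizontal_hom m 0 (ball 0 1) A (\<lambda>z. \<Sum>q<m. mscale (z ^ q) (aq q)) Q"
    and r: "CARD('r) \<ge> 2"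
  shows "\<exists>(\<alpha> :: 'r \<Rightarrow> complex) v. (\<forall>k. v k \<noteq> 0 \<and> aq (m - 1) *v v k = \<alpha> k *s v k) \<and> (\<forall>k l. k \<noteq> l \<longrightarrow> \<alpha> k - \<alpha> l \<notin> \<int>)"
proof -
  have m0: "(0::complex) ^ m = 0" using m by (simp add: power_0_left)
  have loc: "\<exists>U \<Phi>. open U \<and> g t \<in> U \<and> (\<forall>i k. (\<lambda>z. \<Phi> z $ i $ k) holomorphic_on U) \<and>
      (\<forall>z\<in>U. z ^ m \<noteq> 0 ^ m \<and> (\<forall>v. nabla m 0 A (\<lambda>x. \<Phi> x *v v) z = 0)) \<and>
      (\<exists>\<delta>>0. \<forall>x\<in>{0..1}. \<bar>x - t\<bar> < \<delta> \<longrightarrow> g x \<in> U \<and> Y x = \<Phi> (g x))" if "t \<in> {0..1}" for t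
    using hor that unfolding horizontal_along_def by blast
  have g0: "g t \<noteq> 0" if "t \<in> {0..1}" for t
  proof
    assume "g t = 0"
    then have "(0::complex) ^ m \<noteq> 0 ^ m" using loc[OF that] by metis
    then show False by simp
  qed
  have "contractible {0..1::real}" by (intro convex_imp_contractible) auto
  \<comment> \<open>The loop is only continuous, so it is lifted through \<open>exp\<close>
    topologically; it avoids \<open>0\<close>, the pole of the connection.\<close>
  from continuous_logarithm_on_contractible[OF g(1) this g0]
  obtain \<theta> where \<theta>: "continuous_on {0..1} \<theta>" "\<And>t. t \<in> {0..1} \<Longrightarrow> g t = exp (\<theta> t)" by auto
  have "exp (\<theta> 1) = exp (\<theta> 0)" using \<theta>(2)[of 0] \<theta>(2)[of 1] g(3) by simp
  then obtain N :: int where N: "\<theta> 1 = \<theta> 0 + complex_of_real (real_of_int (2 * N) * pi) * \<i>" using exp_eq by blast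
  define y where "y = (\<lambda>c t. Q (g t) *v (Y t *v c))"
  have y0: "y c 0 \<noteq> 0" if "c \<noteq> 0" for c
    using that Y(1) Q(2) unfolding y_def invertible_iff_ker by metis
  have "\<forall>c. \<exists>\<phi>. \<phi> (\<theta> 0) = y c 0 \<and> (\<forall>x i. ((\<lambda>x. \<phi> x $ i) has_field_derivative (log_coeff m aq x *v \<phi> x) $ i) (at x))"
  proof
    fix c
    show "\<exists>\<phi>. \<phi> (\<theta> 0) = y c 0 \<and> (\<forall>x i. ((\<lambda>x. \<phi> x $ i) has_field_derivative (log_coeff m aq x *v \<phi> x) $ i) (at x))"
      by (rule log_coeff_solution[of "\<theta> 0" "y c 0" m aq]; blast)
  qed
  then obtain \<phi> where \<phi>: "\<And>c. \<phi> c (\<theta> 0) = y c 0"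
      "\<And>c x i. ((\<lambda>x. \<phi> c x $ i) has_field_derivative (log_coeff m aq x *v \<phi> c x) $ i) (at x)"
    by metis
  \<comment> \<open>Agreement of the continued section with the entire solution propagates along the
    path: both solve the same equation on a small ball in the logarithmic coordinate, so they agree
    at one point of the ball if and only if they agree at every one.\<close>
  have follow: "y c 1 = \<phi> c (\<theta> 1)" for c
  proof (rule connected_induction_simple[of "{0..1::real}" 0 1 "\<lambda>t. y c t = \<phi> c (\<theta> t)"])
    show "y c 0 = \<phi> c (\<theta> 0)" by (simp add: \<phi>)
    fix t :: real assume t: "t \<in> {0..1}"
    obtain U \<Phi> \<delta> where U: "open U" "g t \<in> U" "\<And>i k. (\<lambda>z. \<Phi> z $ i $ k) holomorphic_on U"
      "\<And>z. z \<in> U \<Longrightarrow> z ^ m \<noteq> 0 ^ m" "\<And>z v. z \<in> U \<Longrightarrow> nabla m 0 A (\<lambda>x. \<Phi> x *v v) z = 0"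
      "\<delta> > 0" "\<And>x. x \<in> {0..1} \<Longrightarrow> \<bar>x - t\<bar> < \<delta> \<Longrightarrow> g x \<in> U \<and> Y x = \<Phi> (g x)"
      using loc[OF t] by metis
    have "open (exp -` (U \<inter> ball 0 1))" by (intro open_vimage open_Int U(1) open_ball continuous_intros)
    moreover have "\<theta> t \<in> exp -` (U \<inter> ball 0 1)" using U(2) g(2)[OF t] \<theta>(2)[OF t] by auto
    ultimately obtain \<rho> where \<rho>: "\<rho> > 0" "ball (\<theta> t) \<rho> \<subseteq> exp -` (U \<inter> ball 0 1)"
      using open_contains_ball by blast
    define w where "w = (\<lambda>z. Q z *v (\<Phi> z *v c))"
    have dw: "((\<lambda>x. w (exp x) $ i) has_field_derivative (log_coeff m aq x *v w (exp x)) $ i) (at x)"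
      if "x \<in> ball (\<theta> t) \<rho>" for x i
    proof (rule log_coeff_exp_compose)
      fix i
      have e: "exp x \<in> U" "exp x \<in> ball 0 1" using that \<rho>(2) by auto
      show "((\<lambda>z. w z $ i) has_field_derivative
          - ((\<Sum>q<m. mscale (exp x ^ q) (aq q)) *v w (exp x)) $ i / exp x ^ m) (at (exp x))"
        using horizontal_gauge[OF Q(1) open_ball e(2) U(4)[OF e(1)] hom U(3,1) e(1) U(5)[OF e(1)], of c i]
        unfolding w_def m0 by simp
    qed
    have same: "w (exp x) = \<phi> c x \<longleftrightarrow> w (exp x') = \<phi> c x'" if "x \<in> ball (\<theta> t) \<rho>" "x' \<in> ball (\<theta> t) \<rho>" for x x'
      using log_coeff_unique[where \<phi> = "\<lambda>x. w (exp x)" and \<psi> = "\<phi> c", OF convex_ball dw \<phi>(2)] that by blast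
    obtain \<delta>' where \<delta>': "\<delta>' > 0" "\<And>s. s \<in> {0..1} \<Longrightarrow> dist s t < \<delta>' \<Longrightarrow> dist (\<theta> s) (\<theta> t) < \<rho>"
      using \<theta>(1) t \<rho>(1) unfolding continuous_on_iff by metis
    define T where "T = {0..1} \<inter> ball t (min \<delta> \<delta>')"
    have T: "y c s = \<phi> c (\<theta> s) \<longleftrightarrow> w (exp (\<theta> s)) = \<phi> c (\<theta> s)" "\<theta> s \<in> ball (\<theta> t) \<rho>" if "s \<in> T" for s
      using that U(7)[of s] \<delta>'(2)[of s] \<theta>(2)[of s]
      by (auto simp: T_def y_def w_def dist_real_def dist_commute abs_minus_commute)
    show "\<exists>T. openin (top_of_set {0..1}) T \<and> t \<in> T \<and>
        (\<forall>x\<in>T. \<forall>y'\<in>T. y c x = \<phi> c (\<theta> x) \<longrightarrow> y c y' = \<phi> c (\<theta> y'))"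
    proof (intro exI[of _ T] conjI ballI impI)
      show "openin (top_of_set {0..1}) T" unfolding T_def by (rule openin_open_Int) simp
      show "t \<in> T" using t U(6) \<delta>'(1) by (simp add: T_def)
      show "y c s' = \<phi> c (\<theta> s')" if "s \<in> T" "s' \<in> T" "y c s = \<phi> c (\<theta> s)" for s s'
        using T[OF that(1)] T[OF that(2)] that(3) same by blast
    qed
  qed auto
  define e where "e = (\<lambda>k::'r. axis k (1::complex))"
  have e: "e k \<noteq> 0" for k by (simp add: e_def axis_eq_0_iff)
  have y1: "y (e k) 1 = d k *s y (e k) 0" for k
  proof -
    have "diag_mat d *v e k = d k *s e k"
      by (simp add: e_def vec_eq_iff diag_mat_matvec axis_def)
    then show ?thesis
      by (simp add: y_def Y(2) g(3)[symmetric] matrix_vector_mul_assoc[symmetric] vector_scalar_commute)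
  qed
  have per: "\<phi> (e k) (x + of_int (2 * N) * of_real pi * \<i>) = d k *s \<phi> (e k) x" for k x
  proof (rule log_coeff_unique[where S = UNIV and ?x0.0 = "\<theta> 0" and m = m and aq = aq and
        \<phi> = "\<lambda>x. \<phi> (e k) (x + of_int (2 * N) * of_real pi * \<i>)" and \<psi> = "\<lambda>x. d k *s \<phi> (e k) x"])
    show "((\<lambda>x. \<phi> (e k) (x + of_int (2 * N) * of_real pi * \<i>) $ i) has_field_derivative
        (log_coeff m aq x *v \<phi> (e k) (x + of_int (2 * N) * of_real pi * \<i>)) $ i) (at x)" for x i
      by (rule log_coeff_translate[OF \<phi>(2)])
    show "((\<lambda>x. (d k *s \<phi> (e k) x) $ i) has_field_derivative (log_coeff m aq x *v (d k *s \<phi> (e k) x)) $ i) (at x)" for x i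
      using DERIV_cmult[OF \<phi>(2), of "d k"] by (simp add: vector_scalar_commute)
    show "\<phi> (e k) (\<theta> 0 + of_int (2 * N) * of_real pi * \<i>) = d k *s \<phi> (e k) (\<theta> 0)"
      using follow[of "e k"] y1[of k] N \<phi>(1) by simp
  qed auto
  have nz: "\<phi> (e k) x \<noteq> 0" for k x
  proof
    assume "\<phi> (e k) x = 0"
    then have "\<phi> (e k) (\<theta> 0) = 0"
      using log_coeff_unique[where S = UNIV and \<phi> = "\<phi> (e k)" and \<psi> = "\<lambda>_. 0" and ?x0.0 = x, OF convex_UNIV \<phi>(2)] by simp
    then show False using \<phi>(1) y0 e by simp
  qed
  have d0: "d k \<noteq> 0" for k using per[of k 0] nz[of k] by auto
  \<comment> \<open>A loop with winding number \<open>0\<close> would have trivial monodromy, which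
    is impossible with at least two distinct multipliers.\<close>
  have "N \<noteq> 0"
  proof
    assume "N = 0"
    then have "\<phi> (e k) 0 = d k *s \<phi> (e k) 0" for k using per[of k 0] by simp
    then have "d k = 1" for k using nz[of k 0] by (auto simp: vec_eq_iff)
    then have "inj_on (\<lambda>_::'r. 1::complex) UNIV" using d by (simp add: inj_on_def)
    then have "CARD('r) = card ((\<lambda>_::'r. 1::complex) ` UNIV)" by (simp only: card_image)
    then show False using r by simp
  qed
  define n where "n = nat \<bar>N\<bar>"
  have n: "n > 0" using \<open>N \<noteq> 0\<close> by (simp add: n_def)
  \<comment> \<open>For a negative winding number the direction is reversed, which inverts the
    multipliers and keeps them distinct.\<close>
  define d' where "d' = (\<lambda>k. if N > 0 then d k else inverse (d k))"
  have per': "\<phi> (e k) (x + 2 * of_real pi * \<i> * of_nat n) = d' k *s \<phi> (e k) x" for k x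
  proof (cases "N > 0")
    case True
    then show ?thesis using per[of k x] by (simp add: d'_def n_def mult_ac)
  next
    case False
    then have "x + 2 * of_real pi * \<i> * of_nat n + of_int (2 * N) * of_real pi * \<i> = x"
      by (simp add: n_def algebra_simps)
    then have "\<phi> (e k) x = d k *s \<phi> (e k) (x + 2 * of_real pi * \<i> * of_nat n)"
      using per[of k "x + 2 * of_real pi * \<i> * of_nat n"] by (simp only:)
    then show ?thesis using False d0 by (simp add: d'_def vector_smult_assoc)
  qed
  have "\<exists>\<alpha> v. v \<noteq> 0 \<and> - aq (m - 1) *v v = \<alpha> *s v \<and> exp (2 * of_real pi * \<i> * of_nat n * \<alpha>) = d' k" for k
    by (rule linear_ode_quasiperiodic[OF \<phi>(2) log_coeff_limit[OF m] per' n nz])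
      (use d0 in \<open>auto simp: d'_def\<close>)
  then obtain \<alpha> v where \<alpha>: "\<And>k. v k \<noteq> 0" "\<And>k. - aq (m - 1) *v v k = \<alpha> k *s v k"
      "\<And>k. exp (2 * of_real pi * \<i> * of_nat n * \<alpha> k) = d' k" by metis
  show ?thesis
  \<comment> \<open>The limit of \<open>log_coeff\<close> is minus the residue, hence the
    sign.\<close>
  proof (intro exI[of _ "\<lambda>k. - \<alpha> k"] exI[of _ v] conjI allI impI)
    show "v k \<noteq> 0" for k by (rule \<alpha>)
    have "- (aq (m - 1) *v v k) = \<alpha> k *s v k" for k
      using \<alpha>(2)[of k] matrix_vector_mult_diff_rdistrib[of 0 "aq (m - 1)" "v k"] by simp
    then show "aq (m - 1) *v v k = - \<alpha> k *s v k" for k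
      by (metis minus_equation_iff vector_sneg_minus1 vector_smult_assoc mult_minus1)
    fix k l :: 'r assume kl: "k \<noteq> l"
    show "- \<alpha> k - - \<alpha> l \<notin> \<int>"
    proof
      assume "- \<alpha> k - - \<alpha> l \<in> \<int>"
      then obtain j where j: "\<alpha> l = \<alpha> k + of_int j" by (auto elim!: Ints_cases simp: algebra_simps)
      have "exp (2 * of_real pi * \<i> * of_nat n * of_int j :: complex) = 1"
        unfolding exp_eq_1 by (auto intro!: exI[of _ "int n * j"])
      then have "d' l = d' k" unfolding \<alpha>(3)[symmetric] j by (simp add: ring_distribs exp_add)
      then have "d l = d k" by (auto simp: d'_def split: if_splits)
      then show False using d kl by (auto dest: injD)
    qed
  qed
qed

section \<open>Nonresonance and cyclic vectors\<close>

lemma eigenvectors_independent: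
  fixes A :: "complex ^ 'r ^ 'r" and v :: "'r \<Rightarrow> complex ^ 'r"
  assumes v: "\<And>k. v k \<noteq> 0" "\<And>k. A *v v k = \<alpha> k *s v k" and \<alpha>: "inj \<alpha>"
  shows "(\<Sum>k\<in>UNIV. x k *s v k) = 0 \<Longrightarrow> x k = 0"
proof -
  have main: "(\<Sum>k\<in>S. x k *s v k) = 0 \<Longrightarrow> k \<in> S \<Longrightarrow> x k = 0" if "finite S" for S x k
    using that
  proof (induction S arbitrary: x k rule: finite_induct)
    case (insert s S)
    have A: "A *v (\<Sum>k\<in>T. x k *s v k) = (\<Sum>k\<in>T. (x k * \<alpha> k) *s v k)" if "finite T" for T
      using that by (induction T) (auto simp: matrix_vector_right_distrib vector_scalar_commute v vector_smult_assoc)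
    have "(\<Sum>k\<in>S. (x k * (\<alpha> k - \<alpha> s)) *s v k) =
        A *v (\<Sum>k\<in>insert s S. x k *s v k) - \<alpha> s *s (\<Sum>k\<in>insert s S. x k *s v k)"
      unfolding A[OF finite.insertI[OF insert(1)]] using insert(1,2)
      by (simp add: vec_eq_iff sum_distrib_left algebra_simps sum_subtractf)
    then have "(\<Sum>k\<in>S. (x k * (\<alpha> k - \<alpha> s)) *s v k) = 0" using insert.prems by simp
    then have *: "x j * (\<alpha> j - \<alpha> s) = 0" if "j \<in> S" for j
      using insert.IH[of "\<lambda>j. x j * (\<alpha> j - \<alpha> s)"] that by blast
    have S0: "x j = 0" if "j \<in> S" for j
      using *[OF that] that insert(2) \<alpha> by (auto dest: injD)
    then have "x s *s v s = 0" using insert by simp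
    then have "x s = 0" using v(1)[of s] by (auto simp: vec_eq_iff)
    then show ?case using S0 insert.prems by auto
  qed simp
  assume "(\<Sum>k\<in>UNIV. x k *s v k) = 0"
  then show "x k = 0" by (rule main[OF finite_class.finite_UNIV _ UNIV_I])
qed

lemma matrix_inv_cancel: "invertible A \<Longrightarrow> A *v (matrix_inv A *v u) = (u :: complex ^ 'n)"
  for A :: "complex ^ 'n ^ 'n"
  by (simp add: matrix_vector_mul_assoc matrix_inv)

lemma matrix_mult_add_rdistrib: "(B + C) ** A = B ** A + C ** (A :: complex ^ 'n ^ 'm)"
  by (simp add: vec_eq_iff matrix_matrix_mult_def distrib_right sum.distrib)

lemma columns_matvec: "(\<chi> i k. v k $ i) *v x = (\<Sum>k\<in>UNIV. x $ k *s v k)" for x :: "complex ^ 'n"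
  by (simp add: vec_eq_iff matrix_vector_mult_def sum_component mult.commute)

lemma eigenvectors_invertible:
  fixes A :: "complex ^ 'r ^ 'r" and v :: "'r \<Rightarrow> complex ^ 'r"
  assumes "\<And>k. v k \<noteq> 0" "\<And>k. A *v v k = \<alpha> k *s v k" "inj \<alpha>"
  shows "invertible (\<chi> i k. v k $ i)"
  unfolding invertible_iff_ker columns_matvec
  using eigenvectors_independent[OF assms] by (metis vec_eq_iff zero_index)

lemma matrix_eq_0_on_columns:
  fixes X :: "complex ^ 'r ^ 'r" and v :: "'r \<Rightarrow> complex ^ 'r"
  assumes "invertible (\<chi> i k. v k $ i)" "\<And>k. X *v v k = 0"
  shows "X = 0"
proof -
  let ?P = "\<chi> i k. v k $ i"
  have "(X ** ?P) $ i $ k = (X *v v k) $ i" for i k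
    by (simp add: matrix_matrix_mult_def matrix_vector_mult_def)
  then have "X ** ?P = 0" using assms(2) by (simp add: vec_eq_iff)
  then have "(X ** ?P) ** matrix_inv ?P = 0" by simp
  then show ?thesis using matrix_inv(1)[OF assms(1)] by (simp add: matrix_mul_assoc[symmetric])
qed

text \<open>The eigenvalues of the adjoint action are the differences
  \<open>\<alpha> k - \<alpha> l\<close>: if \<open>commutator A X = mscale c X\<close>, then
  \<open>X\<close> sends \<open>v l\<close> to zero or to an eigenvector for
  \<open>\<alpha> l + c\<close>, and expansion in the basis \<open>v\<close> excludes the
  latter.\<close>

lemma ad_mat_nonresonant:
  fixes A :: "complex ^ 'r ^ 'r" and v :: "'r \<Rightarrow> complex ^ 'r"
  assumes v: "\<And>k. v k \<noteq> 0" "\<And>k. A *v v k = \<alpha> k *s v k" and \<alpha>: "inj \<alpha>"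
    and c: "\<And>k l. \<alpha> k - \<alpha> l \<noteq> c"
  shows "invertible (mat c - ad_mat A)"
  unfolding invertible_iff_ker
proof (intro allI impI)
  fix y assume y: "(mat c - ad_mat A) *v y = 0"
  define X where "X = unflatten y"
  have "flatten (commutator A X) = c *s y"
    using y ad_mat_flatten[of A X] by (simp add: matrix_vector_mult_diff_rdistrib X_def)
  then have com: "commutator A X = mscale c X"
    by (simp add: X_def vec_eq_iff flatten_def unflatten_def)
  let ?P = "\<chi> i k. v k $ i"
  have inv: "invertible ?P" by (rule eigenvectors_invertible[OF v \<alpha>])
  have "X *v v l = 0" for l
  proof -
    define w where "w = matrix_inv ?P *v (X *v v l)"
    have Xv: "X *v v l = (\<Sum>k\<in>UNIV. w $ k *s v k)"
      unfolding columns_matvec[symmetric] w_def by (rule matrix_inv_cancel[OF inv, symmetric])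
    have "commutator A X *v v l = A *v (X *v v l) - X *v (A *v v l)"
      by (simp add: commutator_def matrix_vector_mult_diff_rdistrib matrix_vector_mul_assoc)
    then have "A *v (X *v v l) = (\<alpha> l + c) *s (X *v v l)"
      by (simp add: com mscale_matvec v vector_scalar_commute vector_sadd_rdistrib algebra_simps)
    moreover have "A *v (X *v v l) = (\<Sum>k\<in>UNIV. (w $ k * \<alpha> k) *s v k)"
    proof -
      have "A *v (\<Sum>k\<in>T. w $ k *s v k) = (\<Sum>k\<in>T. (w $ k * \<alpha> k) *s v k)" if "finite T" for T
        using that by (induction T) (auto simp: matrix_vector_right_distrib vector_scalar_commute v vector_smult_assoc)
      then show ?thesis by (simp add: Xv)
    qed
    ultimately have "(\<Sum>k\<in>UNIV. (w $ k * (\<alpha> k - \<alpha> l - c)) *s v k) = 0"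
      by (simp add: Xv vec_eq_iff sum_component sum_distrib_left algebra_simps sum_subtractf sum.distrib)
    then have "w $ k * (\<alpha> k - \<alpha> l - c) = 0" for k
      using eigenvectors_independent[OF v \<alpha>, of "\<lambda>k. w $ k * (\<alpha> k - \<alpha> l - c)"] by blast
    then have "w $ k = 0" for k using c[of k l] by auto
    then show ?thesis by (simp add: Xv)
  qed
  then have "X = 0" by (rule matrix_eq_0_on_columns[OF inv])
  then show "y = 0" unfolding X_def by (metis flatten_unflatten(1) flatten_nth(2) vec_eq_iff zero_index prod.collapse)
qed

section \<open>Cyclic vectors and the commutant\<close>

lemma mat_power_simps [simp]: "mat_power M 0 = mat 1" "mat_power M (Suc n) = M ** mat_power M n"
  by (simp_all add: mat_power_def)

lemma mat_power_commute: "X ** A = A ** X \<Longrightarrow> X ** mat_power A n = mat_power A n ** X"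
  by (induction n) (simp_all add: matrix_mul_assoc, metis matrix_mul_assoc)

text \<open>\<open>h\<close> is meant to number the matrix indices by the exponents \<open>0\<close>
  to \<open>r - 1\<close>; invertibility then says that \<open>\<xi>\<close> is a cyclic vector of
  \<open>A\<close>.\<close>

definition krylov :: "('r \<Rightarrow> nat) \<Rightarrow> complex ^ 'r \<Rightarrow> complex ^ 'r ^ 'r \<Rightarrow> complex ^ 'r ^ 'r"
  where "krylov h \<xi> A = (\<chi> i k. (mat_power A (h k) *v \<xi>) $ i)"

definition cyclic_poly :: "('r \<Rightarrow> nat) \<Rightarrow> complex ^ 'r ^ 'r \<Rightarrow> complex ^ 'r \<Rightarrow> complex ^ 'r ^ 'r"
  where "cyclic_poly h A x = (\<Sum>k\<in>UNIV. mscale (x $ k) (mat_power A (h k)))"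

text \<open>The sum of eigenvectors with distinct eigenvalues is cyclic: a relation among the
  columns is a polynomial of degree below \<open>r\<close> that vanishes at all \<open>r\<close>
  eigenvalues.\<close>

lemma krylov_invertible:
  fixes A :: "complex ^ 'r ^ 'r" and v :: "'r \<Rightarrow> complex ^ 'r"
  assumes v: "\<And>k. v k \<noteq> 0" "\<And>k. A *v v k = \<alpha> k *s v k" and \<alpha>: "inj \<alpha>"
    and h: "inj h" "\<And>k. h k < CARD('r)"
  shows "invertible (krylov h (\<Sum>k\<in>UNIV. v k) A)"
  unfolding invertible_iff_ker
proof (intro allI impI)
  fix x assume x: "krylov h (\<Sum>k\<in>UNIV. v k) A *v x = 0"
  define p where "p = (\<Sum>k\<in>UNIV. monom (x $ k) (h k))"
  have pw: "mat_power A n *v v l = (\<alpha> l ^ n) *s v l" for n l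
    by (induction n) (simp_all add: matrix_vector_mul_assoc[symmetric] vector_scalar_commute v vector_smult_assoc mult.commute)
  have "krylov h (\<Sum>k\<in>UNIV. v k) A *v x = (\<Sum>k\<in>UNIV. x $ k *s (mat_power A (h k) *v (\<Sum>l\<in>UNIV. v l)))"
    unfolding krylov_def by (rule columns_matvec)
  also have "\<dots> = (\<Sum>l\<in>UNIV. poly p (\<alpha> l) *s v l)"
  proof -
    have 1: "mat_power A n *v (\<Sum>l\<in>UNIV. v l) = (\<Sum>l\<in>UNIV. \<alpha> l ^ n *s v l)" for n
    proof -
      have "mat_power A n *v (\<Sum>l\<in>T. v l) = (\<Sum>l\<in>T. \<alpha> l ^ n *s v l)" if "finite T" for T
        using that by (induction T) (auto simp: matrix_vector_right_distrib pw)
      then show ?thesis by simp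
    qed
    show ?thesis
      unfolding 1 vec_eq_iff
    proof
      fix i
      show "(\<Sum>k\<in>UNIV. x $ k *s (\<Sum>l\<in>UNIV. \<alpha> l ^ h k *s v l)) $ i = (\<Sum>l\<in>UNIV. poly p (\<alpha> l) *s v l) $ i"
        by (simp add: sum_component p_def poly_sum poly_monom sum_distrib_left sum_distrib_right mult.assoc)
          (rule sum.swap)
    qed
  qed
  finally have "(\<Sum>l\<in>UNIV. poly p (\<alpha> l) *s v l) = 0" using x by simp
  then have roots: "poly p (\<alpha> l) = 0" for l
    by (rule eigenvectors_independent[OF v \<alpha>])
  have "degree p < CARD('r)"
    unfolding p_def
  proof (rule degree_sum_less)
    show "degree (monom (x $ k) (h k)) < CARD('r)" for k
      using h(2)[of k] degree_monom_le[of "x $ k" "h k"] by linarith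
  qed (simp add: zero_less_card_finite)
  moreover have "CARD('r) \<le> card {z. poly p z = 0}" if "p \<noteq> 0"
  proof -
    have "CARD('r) = card (range \<alpha>)" using \<alpha> by (simp add: card_image)
    also have "\<dots> \<le> card {z. poly p z = 0}"
      using roots poly_roots_finite[OF that] by (intro card_mono) auto
    finally show ?thesis .
  qed
  moreover have "card {z. poly p z = 0} \<le> degree p" if "p \<noteq> 0"
    using card_poly_roots_bound[OF that] .
  ultimately have p0: "p = 0" by fastforce
  have "coeff p (h k) = x $ k" for k
    unfolding p_def coeff_sum coeff_monom using h(1) by (simp add: inj_eq)
  then show "x = 0" by (simp add: p0 vec_eq_iff)
qed

lemma cyclic_poly_commute: "A ** cyclic_poly h A x = cyclic_poly h A x ** A"
proof -
  have ml: "A ** (\<Sum>k\<in>T. F k) = (\<Sum>k\<in>T. A ** F k)" and mr: "(\<Sum>k\<in>T. F k) ** A = (\<Sum>k\<in>T. F k ** A)"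
    if "finite T" for T and F :: "'a \<Rightarrow> complex ^ 'a ^ 'a"
    using that by (induction T) (auto simp: matrix_add_ldistrib matrix_mult_add_rdistrib)
  have "A ** mscale c M = mscale c (A ** M)" "mscale c M ** A = mscale c (M ** A)" for c M
    by (simp_all add: vec_eq_iff matrix_matrix_mult_def sum_distrib_left mult_ac)
  then show ?thesis
    by (simp add: cyclic_poly_def ml mr mat_power_commute[OF refl])
qed

text \<open>A matrix that commutes with \<open>A\<close> is determined by its value on a cyclic
  vector, and some polynomial in \<open>A\<close> has the same value. The left-hand side makes sense
  for every \<open>X\<close> and always commutes with \<open>A\<close>; this is how elements of the
  commutant are extended to nearby \<open>A\<close>.\<close>

lemma commutant_cyclic:
  fixes A :: "complex ^ 'r ^ 'r"
  assumes inv: "invertible (krylov h \<xi> A)" and com: "A ** X = X ** A"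
  shows "cyclic_poly h A (matrix_inv (krylov h \<xi> A) *v (X *v \<xi>)) = X"
proof -
  define x where "x = matrix_inv (krylov h \<xi> A) *v (X *v \<xi>)"
  define Y where "Y = cyclic_poly h A x"
  have sv: "(\<Sum>k\<in>T. F k) *v \<xi> = (\<Sum>k\<in>T. F k *v \<xi>)" if "finite T" for T and F :: "'r \<Rightarrow> complex ^ 'r ^ 'r"
    using that by (induction T) (auto simp: matrix_vector_mult_add_rdistrib)
  have "Y *v \<xi> = krylov h \<xi> A *v x"
    unfolding krylov_def columns_matvec by (simp add: Y_def cyclic_poly_def sv mscale_matvec)
  also have "\<dots> = X *v \<xi>"
    by (simp add: x_def matrix_inv_cancel[OF inv])
  finally have Y\<xi>: "Y *v \<xi> = X *v \<xi>" .
  have "(Y - X) *v (mat_power A (h k) *v \<xi>) = 0" for k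
  proof -
    have "Y ** mat_power A (h k) = mat_power A (h k) ** Y" "X ** mat_power A (h k) = mat_power A (h k) ** X"
      using cyclic_poly_commute[of A h x] com by (auto intro!: mat_power_commute simp: Y_def)
    then have "Y *v (mat_power A (h k) *v \<xi>) = mat_power A (h k) *v (Y *v \<xi>)"
      "X *v (mat_power A (h k) *v \<xi>) = mat_power A (h k) *v (X *v \<xi>)"
      by (simp_all only: matrix_vector_mul_assoc)
    then show ?thesis
      by (simp add: matrix_vector_mult_diff_rdistrib Y\<xi>)
  qed
  then have "Y - X = 0"
    using matrix_eq_0_on_columns[of "\<lambda>k. mat_power A (h k) *v \<xi>" "Y - X"] inv by (simp add: krylov_def)
  then show ?thesis by (simp add: Y_def x_def)
qed

lemma eventually_invertible:
  fixes F :: "'a::t2_space \<Rightarrow> complex ^ 'n ^ 'n"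
  assumes "isCont F b" "invertible (F b)"
  shows "eventually (\<lambda>b. invertible (F b)) (nhds b)"
proof -
  have "isCont (\<lambda>b. det (F b)) b"
    unfolding det_def isCont_def using assms(1)[unfolded isCont_def]
    by (intro tendsto_intros)
  then have "((\<lambda>b. det (F b)) \<longlongrightarrow> det (F b)) (nhds b)"
    by (simp add: isCont_def tendsto_nhds_iff)
  moreover have "det (F b) \<noteq> 0" using assms(2) by (simp add: invertible_det_nz)
  ultimately have "eventually (\<lambda>b. det (F b) \<noteq> 0) (nhds b)"
    by (rule tendsto_imp_eventually_ne)
  then show ?thesis by (simp add: invertible_det_nz)
qed

lemma isCont_matrixI:
  fixes F :: "'a::t2_space \<Rightarrow> complex ^ 'n ^ 'm"
  assumes "\<And>i k. isCont (\<lambda>b. F b $ i $ k) b"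
  shows "isCont F b"
proof -
  have "isCont (\<lambda>b. \<chi> i k. F b $ i $ k) b"
    unfolding isCont_def by (intro tendsto_vec_lambda) (use assms in \<open>auto simp: isCont_def\<close>)
  then show ?thesis by (simp add: vec_lambda_eta)
qed

text \<open>Integers whose absolute value exceeds a norm bound cannot be eigenvalues, so
  nonresonance reduces to finitely many open conditions.\<close>

lemma eventually_nonresonant:
  fixes A :: "'a::t2_space \<Rightarrow> complex ^ 'r ^ 'r"
  assumes A: "\<And>i k. isCont (\<lambda>b. A b $ i $ k) b0"
    and inv: "\<And>n::int. n \<noteq> 0 \<Longrightarrow> invertible (mat (of_int n) - ad_mat (A b0))"
  shows "eventually (\<lambda>b. msum (ad_mat (A b)) \<le> msum (ad_mat (A b0)) + 1 \<and>
    (\<forall>n::int. n \<noteq> 0 \<longrightarrow> invertible (mat (of_int n) - ad_mat (A b)))) (nhds b0)"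
proof -
  define a where "a = msum (ad_mat (A b0)) + 1"
  have c: "isCont (\<lambda>b. ad_mat (A b) $ p $ q) b0" for p q
  proof -
    have "isCont (\<lambda>b. if c then A b $ i $ k else 0) b0" for c i k
      using A by (cases c) auto
    then show ?thesis unfolding ad_mat_def by (simp add: continuous_intros)
  qed
  have "isCont (\<lambda>b. msum (ad_mat (A b))) b0"
    unfolding msum_def by (intro continuous_intros c)
  then have "((\<lambda>b. msum (ad_mat (A b))) \<longlongrightarrow> msum (ad_mat (A b0))) (nhds b0)"
    by (simp add: isCont_def tendsto_nhds_iff)
  then have e1: "eventually (\<lambda>b. msum (ad_mat (A b)) < a) (nhds b0)"
    by (rule order_tendstoD) (simp add: a_def)
  have fin: "finite {n::int. n \<noteq> 0 \<and> \<bar>of_int n\<bar> \<le> a}"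
  proof (rule finite_subset)
    show "{n::int. n \<noteq> 0 \<and> \<bar>of_int n\<bar> \<le> a} \<subseteq> {- \<lceil>a\<rceil>..\<lceil>a\<rceil>}"
    proof
      fix n :: int assume "n \<in> {n. n \<noteq> 0 \<and> \<bar>of_int n\<bar> \<le> a}"
      then have "of_int n \<le> a" "- of_int n \<le> a" by (auto simp: abs_le_iff)
      then show "n \<in> {- \<lceil>a\<rceil>..\<lceil>a\<rceil>}" using le_of_int_ceiling[of a] by auto linarith+
    qed
  qed simp
  have e2: "eventually (\<lambda>b. \<forall>n\<in>{n::int. n \<noteq> 0 \<and> \<bar>of_int n\<bar> \<le> a}. invertible (mat (of_int n) - ad_mat (A b))) (nhds b0)"
  proof (rule eventually_ball_finite[OF fin], intro ballI)
    fix n :: int assume n: "n \<in> {n::int. n \<noteq> 0 \<and> \<bar>of_int n\<bar> \<le> a}"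
    have "isCont (\<lambda>b. mat (of_int n) - ad_mat (A b)) b0"
      by (rule isCont_diff[OF continuous_const isCont_matrixI[OF c]])
    then show "eventually (\<lambda>b. invertible (mat (of_int n) - ad_mat (A b))) (nhds b0)"
      using inv n by (intro eventually_invertible) auto
  qed
  show ?thesis
    using e1 e2
  proof eventually_elim
    case (elim b)
    have "invertible (mat (of_int n) - ad_mat (A b))" if n: "n \<noteq> 0" for n :: int
    proof (cases "\<bar>of_int n\<bar> \<le> a")
      case False
      show ?thesis
        unfolding invertible_iff_ker
      proof (intro allI impI)
        fix x assume "(mat (of_int n) - ad_mat (A b)) *v x = 0"
        then have "ad_mat (A b) *v x = of_int n *s x" by (simp add: matrix_vector_mult_diff_rdistrib)
        then have "\<bar>of_int n\<bar> * norm x \<le> msum (ad_mat (A b)) * norm x"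
          using norm_matvec_le[of "ad_mat (A b)" x]
          by (simp add: norm_vec_def norm_mult L2_set_right_distrib)
        moreover have "msum (ad_mat (A b)) < \<bar>of_int n\<bar>" using False elim(1) by simp
        ultimately show "x = 0"
          using mult_strict_right_mono[of "msum (ad_mat (A b))" "\<bar>real_of_int n\<bar>" "norm x"]
          by (cases "x = 0") auto
      qed
    qed (use elim n in auto)
    then show ?case using elim(1) by (auto simp: a_def)
  qed
qed

section \<open>The covariant derivative of a matrix\<close>

text \<open>The covariant derivative on endomorphisms, multiplied by
  \<open>z ^ m - \<epsilon> ^ m\<close>. For the \<open>dh\<close>-coefficient of the lift, flatness
  says that \<open>cov\<close> equals \<open>Xi_tilde\<close>.\<close>

definition cov :: "nat \<Rightarrow> 'b \<Rightarrow> (nat \<Rightarrow> complex ^ 'b \<Rightarrow> complex ^ 'r ^ 'r) \<Rightarrow>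
    ('b::finite point \<Rightarrow> complex ^ 'r ^ 'r) \<Rightarrow> 'b point \<Rightarrow> complex ^ 'r ^ 'r"
  where "cov m e Ai X p = mscale (fst p ^ m - (snd p $ e) ^ m) (mpd None X p)
    + commutator (Ainf_fun m Ai (fst p) (snd p)) (X p)"

lemma commutator_add: "commutator A (X + Y) = commutator A X + commutator A (Y :: complex ^ 'r ^ 'r)"
  and commutator_diff: "commutator A (X - Y) = commutator A X - commutator A Y"
  and commutator_mscale: "commutator A (mscale c X) = mscale c (commutator A X)"
  by (simp_all add: commutator_def vec_eq_iff matrix_matrix_mult_def sum_distrib_left algebra_simps
      sum.distrib sum_subtractf)

lemma commutator_mscale_left: "commutator (mscale c A) X = mscale c (commutator A (X :: complex ^ 'r ^ 'r))"
  and commutator_add_left: "commutator (A + B) X = commutator A X + commutator B X"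
  by (simp_all add: commutator_def vec_eq_iff matrix_matrix_mult_def sum_distrib_left algebra_simps
      sum.distrib sum_subtractf)

lemma commutator_sum_left: "commutator (\<Sum>i\<in>I. F i) (X :: complex ^ 'r ^ 'r) = (\<Sum>i\<in>I. commutator (F i) X)"
  by (induction I rule: infinite_finite_induct) (auto simp: commutator_add_left, auto simp: commutator_def)

lemma mscale_add: "mscale c (X + Y) = mscale c X + mscale (c::complex) Y"
  and mscale_diff: "mscale c (X - Y) = mscale c X - mscale c Y"
  by (simp_all add: vec_eq_iff algebra_simps)

lemma cov_add: "mhol X U \<Longrightarrow> mhol Y U \<Longrightarrow> p \<in> U \<Longrightarrow> cov m e Ai (\<lambda>p. X p + Y p) p = cov m e Ai X p + cov m e Ai Y p"
  by (simp add: cov_def mpd_add[where U=U] commutator_add mscale_add)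

lemma pd_None_snd: "pd None (\<lambda>p. f (snd p)) p = 0"
  by (simp add: pd_def dir_simps)

text \<open>Functions of the base are constants for the relative derivative, so powers of \<epsilon>
  pass through; this allows corrections order by order.\<close>

lemma cov_mscale:
  assumes "mhol X U" "p \<in> U"
  shows "cov m e Ai (\<lambda>p. mscale ((snd p $ e) ^ n) (X p)) p = mscale ((snd p $ e) ^ n) (cov m e Ai X p)"
proof -
  have "mpd None (\<lambda>p. mscale ((snd p $ e) ^ n) (X p)) p = mscale ((snd p $ e) ^ n) (mpd None X p)"
    using mpd_mscale[OF _ assms, of "\<lambda>p. (snd p $ e) ^ n" None] pd_None_snd[of "\<lambda>b. (b $ e) ^ n" p]
    by (simp add: hol_power hol_snd_nth vec_eq_iff)
  then show ?thesis
    by (simp add: cov_def commutator_mscale mscale_add mscale_mscale mult.commute)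
qed

lemma mpd_cong:
  assumes "open U" "p \<in> U" "\<And>p. p \<in> U \<Longrightarrow> F p = G p"
  shows "mpd k F p = mpd k G p"
proof -
  have "pd k (\<lambda>q. F q $ i $ j) p = pd k (\<lambda>q. G q $ i $ j) p" for i j
    by (rule pd_cong[OF assms(1,2)]) (use assms(3) in auto)
  then show ?thesis by (simp add: mpd_def)
qed

lemma cov_cong: "open U \<Longrightarrow> p \<in> U \<Longrightarrow> (\<And>p. p \<in> U \<Longrightarrow> F p = G p) \<Longrightarrow> cov m e Ai F p = cov m e Ai G p"
  unfolding cov_def by (simp cong: mpd_cong)

lemma mhol_Ainf: "(\<And>q. q < m \<Longrightarrow> mholo_base (Ai q) V) \<Longrightarrow> mhol (\<lambda>p. Ainf_fun m Ai (fst p) (snd p)) (UNIV \<times> V)"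
  unfolding Ainf_fun_def mholo_base_iff by (intro mhol_intros hol_intros) auto

lemma mhol_cov:
  assumes "open U" "U \<subseteq> UNIV \<times> V" "\<And>q. q < m \<Longrightarrow> mholo_base (Ai q) V" "mhol X U"
  shows "mhol (cov m e Ai X) U"
  unfolding cov_def[abs_def]
  by (intro mhol_intros hol_intros mhol_mpd assms mhol_subset[OF mhol_Ainf assms(2)])

section \<open>The slits\<close>

lemma Gam_iff: "(z, b) \<in> Gam m e V \<longleftrightarrow> b \<in> V \<and>
    (\<exists>t j. 0 \<le> t \<and> t \<le> 1 \<and> j \<in> {1..m} \<and> z = of_real t * exp (2 * of_real pi * \<i> / of_nat m) ^ j * b $ e)"
  unfolding Gam_def by auto

lemma exp_root: "cmod (exp (2 * of_real pi * \<i> / of_nat m) ^ j) = 1"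
  by (simp add: norm_power)

lemma Gam_norm_le: "(z, b) \<in> Gam m e V \<Longrightarrow> cmod z \<le> cmod (b $ e)"
  unfolding Gam_iff by (auto simp: norm_mult exp_root mult_left_le_one_le)

lemma Gam_zero: "m \<ge> 1 \<Longrightarrow> b \<in> V \<Longrightarrow> (0, b) \<in> Gam m e V"
proof -
  assume "m \<ge> 1" "b \<in> V"
  moreover have "0 = of_real 0 * exp (2 * of_real pi * \<i> / of_nat m) ^ 1 * b $ e" by simp
  ultimately show ?thesis unfolding Gam_iff by (metis atLeastAtMost_iff order_refl zero_le_one)
qed

text \<open>The slits are segments issuing from \<open>0\<close>, so in \<open>u = 1 / z\<close>
  their complement is star-shaped about infinity.\<close>

lemma Gam_scale:
  assumes "(of_real s * z, b) \<in> Gam m e V" "s \<ge> 1"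
  shows "(z, b) \<in> Gam m e V"
proof -
  obtain t j where t: "0 \<le> t" "t \<le> 1" "j \<in> {1..m}" "b \<in> V"
    "of_real s * z = of_real t * exp (2 * of_real pi * \<i> / of_nat m) ^ j * b $ e"
    using assms(1) unfolding Gam_iff by blast
  have "z = of_real (t / s) * exp (2 * of_real pi * \<i> / of_nat m) ^ j * b $ e"
    using t(5) assms(2) by (simp add: field_simps)
  moreover have "0 \<le> t / s" "t / s \<le> 1" using t assms(2) by (auto simp: field_simps)
  ultimately show ?thesis using t unfolding Gam_iff by blast
qed

text \<open>The divisor consists of the end points of the slits; hence the denominator
  \<open>z ^ m - \<epsilon> ^ m\<close> has no zero outside \<open>Gam\<close>.\<close>

lemma Gam_roots:
  assumes m: "m \<ge> 1" and b: "b \<in> V" and z: "z ^ m = (b $ e) ^ m"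
  shows "(z, b) \<in> Gam m e V"
proof (cases "b $ e = 0")
  case True
  then have "z = 0" using z m by (simp add: power_0_left)
  then show ?thesis using Gam_zero[OF m b] by simp
next
  case False
  then have "(z / b $ e) ^ m = 1" using z by (simp add: power_divide)
  then obtain j where j: "j < m" "z / b $ e = exp (2 * of_real pi * \<i> * of_nat j / of_nat m)"
    using complex_roots_unity[OF m] by blast
  have e: "exp (2 * of_real pi * \<i> * of_nat j / of_nat m) = exp (2 * of_real pi * \<i> / of_nat m) ^ j"
    by (simp add: exp_of_nat_mult[symmetric] mult_ac)
  have em: "exp (2 * of_real pi * \<i> / of_nat m) ^ m = 1"
    using m by (simp add: exp_of_nat_mult[symmetric])
  \<comment> \<open>The slits are numbered from \<open>1\<close> to \<open>m\<close>, the roots of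
    unity from \<open>0\<close> to \<open>m - 1\<close>.\<close>
  define j' where "j' = (if j = 0 then m else j)"
  have "exp (2 * of_real pi * \<i> / of_nat m) ^ j' = exp (2 * of_real pi * \<i> * of_nat j / of_nat m)"
    using em by (simp add: e j'_def)
  then have "z = of_real 1 * exp (2 * of_real pi * \<i> / of_nat m) ^ j' * b $ e"
    using j(2) False by (metis mult_1 nonzero_divide_eq_eq of_real_1)
  moreover have "j' \<in> {1..m}" using j m by (auto simp: j'_def)
  ultimately show ?thesis using b unfolding Gam_iff by (metis order_refl zero_le_one)
qed

text \<open>Without the condition on the base, each family of slits is the projection of a closed
  set along the compact parameter interval, hence closed.\<close>

lemma open_Gam_compl: "open V \<Longrightarrow> open (UNIV \<times> V - Gam m e V)"
proof -
  assume V: "open V"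
  define c where "c = (\<lambda>j. exp (2 * of_real pi * \<i> / of_nat m) ^ j :: complex)"
  have "closed {p. \<exists>t. t \<in> {0..1} \<and> (t, p) \<in> {(t, p). fst p = of_real t * c j * snd p $ e}}" for j
  proof (rule closed_compact_projection)
    show "closed {(t::real, p). fst p = of_real t * c j * snd p $ e}"
      unfolding case_prod_beta by (intro closed_Collect_eq continuous_intros)
  qed simp
  then have "closed (\<Union>j\<in>{1..m}. {p. \<exists>t. t \<in> {0..1} \<and> (t, p) \<in> {(t, p). fst p = of_real t * c j * snd p $ e}})"
    by (intro closed_UN) auto
  then have "open (UNIV \<times> V - (\<Union>j\<in>{1..m}. {p. \<exists>t. t \<in> {0..1} \<and> (t, p) \<in> {(t, p). fst p = of_real t * c j * snd p $ e}}))"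
    using V by (intro open_Diff open_Times) auto
  moreover have "UNIV \<times> V - Gam m e V = UNIV \<times> V - (\<Union>j\<in>{1..m}. {p. \<exists>t. t \<in> {0..1} \<and> (t, p) \<in> {(t, p). fst p = of_real t * c j * snd p $ e}})"
  proof (rule set_eqI)
    fix p :: "'a point"
    obtain z b where p: "p = (z, b)" by (cases p)
    have "(z, b) \<in> Gam m e V \<longleftrightarrow> b \<in> V \<and> (\<exists>j\<in>{1..m}. \<exists>t. t \<in> {0..1} \<and> z = of_real t * c j * b $ e)"
    proof -
      have gen: "(\<exists>t j. 0 \<le> t \<and> t \<le> 1 \<and> j \<in> J \<and> P t j) \<longleftrightarrow> (\<exists>j\<in>J. \<exists>t. t \<in> {0..1::real} \<and> P t j)"
        for P and J :: "nat set" by auto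
      show ?thesis unfolding Gam_iff c_def gen ..
    qed
    then show "p \<in> UNIV \<times> V - Gam m e V \<longleftrightarrow>
        p \<in> UNIV \<times> V - (\<Union>j\<in>{1..m}. {p. \<exists>t. t \<in> {0..1} \<and> (t, p) \<in> {(t, p). fst p = of_real t * c j * snd p $ e}})"
      by (cases "b \<in> V") (simp_all add: p)
  qed
  ultimately show ?thesis by simp
qed

section \<open>The chart at infinity\<close>

definition inf_chart :: "nat \<Rightarrow> 'b \<Rightarrow> (complex ^ 'b) set \<Rightarrow> 'b::finite point set"
  where "inf_chart m e V = {(u, b). b \<in> V \<and> (u = 0 \<or> (1 / u, b) \<notin> Gam m e V)}"

definition inv_chart :: "('b::finite point \<Rightarrow> 'a) \<Rightarrow> 'b point \<Rightarrow> 'a"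
  where "inv_chart G p = G (1 / fst p, snd p)"

lemma open_inf_chart:
  assumes V: "open V"
  shows "open (inf_chart m e V)"
proof -
  \<comment> \<open>A neighbourhood of \<open>u = 0\<close>: there \<open>cmod z\<close> exceeds
    \<open>cmod \<epsilon>\<close>, which keeps \<open>z\<close> off the slits. Together with
    \<open>W'\<close>, the part at finite \<open>z\<close>, it exhausts the chart.\<close>
  define W where "W = {p. snd p \<in> V \<and> cmod (fst p) * cmod (snd p $ e) < 1}"
  define W' where "W' = {p. fst p \<noteq> 0} \<inter> (\<lambda>p. (1 / fst p, snd p)) -` (UNIV \<times> V - Gam m e V)"
  have "open W"
  proof -
    have "W = (UNIV \<times> V) \<inter> {p. cmod (fst p) * cmod (snd p $ e) < 1}" by (auto simp: W_def)
    then show ?thesis using V by (auto intro!: open_Int open_Times open_Collect_less continuous_intros)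
  qed
  moreover have "open W'"
    unfolding W'_def
    by (intro continuous_open_preimage open_Gam_compl V continuous_intros open_Collect_neq) auto
  moreover have "inf_chart m e V = W \<union> W'"
  proof (intro equalityI subsetI)
    fix p assume p: "p \<in> inf_chart m e V"
    then show "p \<in> W \<union> W'" by (auto simp: inf_chart_def W_def W'_def)
  next
    fix p assume p: "p \<in> W \<union> W'"
    then show "p \<in> inf_chart m e V"
    proof
      assume p: "p \<in> W"
      have "(1 / fst p, snd p) \<notin> Gam m e V" if "fst p \<noteq> 0"
      proof
        assume "(1 / fst p, snd p) \<in> Gam m e V"
        then have "cmod (1 / fst p) \<le> cmod (snd p $ e)" by (rule Gam_norm_le)
        then have "1 \<le> cmod (fst p) * cmod (snd p $ e)" using that by (simp add: norm_divide field_simps)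
        then show False using p by (simp add: W_def)
      qed
      then show ?thesis using p by (auto simp: inf_chart_def W_def)
    qed (auto simp: inf_chart_def W'_def)
  qed
  ultimately show ?thesis by auto
qed

lemma ray_closed_inf_chart: "ray_closed (inf_chart m e V)"
  unfolding ray_closed_def
proof (intro ballI)
  fix p t assume p: "p \<in> inf_chart m e V" and t: "t \<in> {0..1::real}"
  show "ray t p \<in> inf_chart m e V"
  proof (cases "t = 0 \<or> fst p = 0")
    case True
    then show ?thesis using p by (auto simp: inf_chart_def ray_def)
  next
    case False
    have "(1 / (of_real t * fst p), snd p) \<notin> Gam m e V"
    proof
      assume "(1 / (of_real t * fst p), snd p) \<in> Gam m e V"
      moreover have "1 / (of_real t * fst p) = of_real (1 / t) * (1 / fst p)" by simp
      ultimately have "(of_real (1 / t) * (1 / fst p), snd p) \<in> Gam m e V" by (simp only:)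
      then have "(1 / fst p, snd p) \<in> Gam m e V"
        by (rule Gam_scale) (use t False in auto)
      then show False using p False by (auto simp: inf_chart_def)
    qed
    then show ?thesis using p by (auto simp: inf_chart_def ray_def)
  qed
qed

lemma hol_inv_chart:
  assumes f: "hol f W" and U: "\<And>p. p \<in> U \<Longrightarrow> fst p \<noteq> 0 \<and> (1 / fst p, snd p) \<in> W"
  shows "hol (inv_chart f) U"
  unfolding inv_chart_def[abs_def]
proof (rule hol_compose[OF f])
  show "continuous_on U (\<lambda>p. (1 / fst p, snd p))" using U by (intro continuous_intros) auto
  show "(1 / fst p, snd p) \<in> W" if "p \<in> U" for p using U[OF that] by blast
  fix p k assume p: "p \<in> U"
  show "\<exists>g k'. g field_differentiable at 0 \<and> g 0 = 0 \<and>
     (\<forall>\<^sub>F t in nhds 0. (1 / fst (p + dir k t), snd (p + dir k t)) = (1 / fst p, snd p) + dir k' (g t))"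
  proof (cases k)
    case None
    have "(\<lambda>t. 1 / (fst p + t) - 1 / fst p) field_differentiable at 0"
      using U[OF p] by (intro derivative_intros) auto
    then show ?thesis
      by (intro exI[of _ "\<lambda>t. 1 / (fst p + t) - 1 / fst p"] exI[of _ None]) (simp add: None dir_simps)
  next
    case (Some i)
    then show ?thesis
      by (intro exI[of _ "\<lambda>t. t"] exI[of _ k]) (simp add: dir_simps)
  qed
qed

lemma pd_inv_chart:
  assumes f: "hol f W" and p: "fst p \<noteq> 0" "(1 / fst p, snd p) \<in> W"
  shows "pd None (inv_chart f) p = - (1 / fst p ^ 2) * pd None f (1 / fst p, snd p)"
proof (rule pd_eqI)
  have 1: "((\<lambda>s. f ((0, snd p) + dir None s)) has_field_derivative pd None f (1 / fst p, snd p)) (at (1 / (fst p + 0)))"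
    using hol_has_derivative[OF f, of "(0, snd p)" None "1 / fst p"] p by (simp add: dir_simps)
  have 2: "((\<lambda>s. 1 / (fst p + s)) has_field_derivative - (1 / fst p ^ 2)) (at 0)"
    using p by (auto intro!: derivative_eq_intros simp: power2_eq_square)
  show "((\<lambda>s. inv_chart f (p + dir None s)) has_field_derivative - (1 / fst p ^ 2) * pd None f (1 / fst p, snd p)) (at 0)"
    using DERIV_chain2[where f = "\<lambda>s. f ((0, snd p) + dir None s)" and g = "\<lambda>s. 1 / (fst p + s)", OF 1 2]
    by (simp add: inv_chart_def dir_simps mult.commute)
qed

lemma Gam_compl_chart:
  assumes "m \<ge> 1" "p \<in> UNIV \<times> V - Gam m e V"
  shows "fst p \<noteq> 0" "(1 / fst p, snd p) \<in> inf_chart m e V"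
  using assms Gam_zero[of m "snd p" V e] by (auto simp: inf_chart_def)

lemma mhol_inv_chart:
  assumes "m \<ge> 1" "mhol G (inf_chart m e V)"
  shows "mhol (inv_chart G) (UNIV \<times> V - Gam m e V)"
  unfolding mhol_def
proof (intro allI)
  fix i k
  have "hol (inv_chart (\<lambda>p. G p $ i $ k)) (UNIV \<times> V - Gam m e V)"
    by (rule hol_inv_chart[OF hol_nth_nth[OF assms(2)]]) (intro conjI Gam_compl_chart[OF assms(1)])
  then show "hol (\<lambda>p. inv_chart G p $ i $ k) (UNIV \<times> V - Gam m e V)"
    by (simp add: inv_chart_def[abs_def])
qed

text \<open>\<open>G\<close> is the solution in the coordinate at infinity, regular at
  \<open>u = 0\<close>. The right-hand side has degree at most \<open>m - 2\<close> in z, so after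
  the change of coordinate it vanishes at \<open>u = 0\<close>.\<close>

definition sol_inf :: "nat \<Rightarrow> 'b \<Rightarrow> (nat \<Rightarrow> complex ^ 'b \<Rightarrow> complex ^ 'r ^ 'r) \<Rightarrow> (complex ^ 'b) set \<Rightarrow>
    (nat \<Rightarrow> complex ^ 'b \<Rightarrow> complex ^ 'r ^ 'r) \<Rightarrow> ('b::finite point \<Rightarrow> complex ^ 'r ^ 'r) \<Rightarrow> bool"
  where "sol_inf m e Ai V T G \<longleftrightarrow> mhol G (inf_chart m e V) \<and>
    (\<forall>p\<in>UNIV \<times> V - Gam m e V. cov m e Ai (inv_chart G) p = (\<Sum>s<m - 1. mscale (fst p ^ s) (T s (snd p))))"

text \<open>With \<open>z = 1 / u\<close> the equation becomes
  \<open>u d/du G = commutator A G + H\<close>, where \<open>A\<close> at \<open>u = 0\<close> is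
  the residue \<open>Ai (m - 1)\<close> and \<open>H\<close> vanishes there. The compatibility
  condition on the initial value is therefore membership in the commutant of the residue.\<close>

lemma solution_at_infinity:
  fixes Ai :: "nat \<Rightarrow> complex ^ 'b::finite \<Rightarrow> complex ^ 'r ^ 'r"
  assumes m: "m \<ge> 1" and V: "open V" and Ai: "\<And>q. q < m \<Longrightarrow> mholo_base (Ai q) V"
    and T: "\<And>s. s < m - 1 \<Longrightarrow> mholo_base (T s) V"
    and a0: "\<And>b. b \<in> V \<Longrightarrow> msum (ad_mat (Ai (m - 1) b)) \<le> a0"
    and nonres: "\<And>(n::int) b. n \<noteq> 0 \<Longrightarrow> b \<in> V \<Longrightarrow> invertible (mat (of_int n) - ad_mat (Ai (m - 1) b))"
    and C: "mholo_base C V" "\<And>b. b \<in> V \<Longrightarrow> commutator (Ai (m - 1) b) (C b) = 0"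
  shows "\<exists>G. sol_inf m e Ai V T G \<and> (\<forall>b\<in>V. G (0, b) = C b)"
proof -
  let ?D = "inf_chart m e V"
  have D: "open ?D" "ray_closed ?D" by (rule open_inf_chart[OF V], rule ray_closed_inf_chart)
  have DV: "?D \<subseteq> UNIV \<times> V" by (auto simp: inf_chart_def)
  \<comment> \<open>This is \<open>u ^ m * (z ^ m - \<epsilon> ^ m)\<close>, which stays regular and
    nonzero at infinity.\<close>
  define w where "w = (\<lambda>p::'b point. 1 - (snd p $ e * fst p) ^ m)"
  have w0: "w p \<noteq> 0" if p: "p \<in> ?D" for p
  proof (cases "fst p = 0")
    case True
    then show ?thesis using m by (simp add: w_def power_0_left)
  next
    case False
    have "(1 / fst p) ^ m \<noteq> (snd p $ e) ^ m"
      using Gam_roots[OF m, of "snd p" V "1 / fst p" e] p False by (auto simp: inf_chart_def)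
    then show ?thesis using False by (auto simp: w_def power_mult_distrib power_divide field_simps)
  qed
  define A where "A = (\<lambda>p. mscale (1 / w p) (\<Sum>q<m. mscale (fst p ^ (m - 1 - q)) (Ai q (snd p))))"
  define H where "H = (\<lambda>p. mscale (- 1 / w p) (\<Sum>s<m - 1. mscale (fst p ^ (m - 1 - s)) (T s (snd p))))"
  have wh: "hol w ?D" unfolding w_def by (intro hol_intros)
  have base: "mhol (\<lambda>p. F (snd p)) ?D" if "mholo_base F V" for F :: "complex ^ 'b \<Rightarrow> complex ^ 'r ^ 'r"
    using that DV mhol_subset unfolding mholo_base_iff by blast
  have Ah: "mhol A ?D" unfolding A_def by (intro mhol_intros hol_intros wh w0 base Ai) auto
  have Hh: "mhol H ?D" unfolding H_def by (intro mhol_intros hol_intros wh w0 base T) auto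
  have ray0: "A (ray 0 p) = Ai (m - 1) (snd p)" "H (ray 0 p) = 0" for p
  proof -
    obtain m' where m': "m = Suc m'" using m by (cases m) auto
    have "(\<Sum>q<m. mscale ((0::complex) ^ (m - 1 - q)) (Ai q (snd p))) = Ai m' (snd p)"
      unfolding m' by (simp add: vec_eq_iff power_0_left)
    then show "A (ray 0 p) = Ai (m - 1) (snd p)" using m by (simp add: A_def w_def power_0_left m' vec_eq_iff)
    have "(\<Sum>s<m - 1. mscale ((0::complex) ^ (m - 1 - s)) (T s (snd p))) = 0"
      by (rule sum.neutral) (auto simp: vec_eq_iff power_0_left)
    then show "H (ray 0 p) = 0" by (simp add: H_def vec_eq_iff)
  qed
  have "\<exists>Y. vhol Y ?D \<and> (\<forall>p\<in>?D. Y (ray 0 p) = flatten (C (snd p))) \<and>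
      (\<forall>p\<in>?D. fst p *s vpd None Y p = ad_mat (A p) *v Y p + flatten (H p))"
  proof (rule euler_ode[OF D mhol_ad_mat[OF Ah] vhol_flatten[OF Hh], of a0 "\<lambda>p. flatten (C (snd p))"])
    show "msum (ad_mat (A (ray 0 p))) \<le> a0" if "p \<in> ?D" for p
      using a0[of "snd p"] subsetD[OF DV that] by (simp add: ray0 mem_Times_iff)
    show "invertible (mat (of_nat n) - ad_mat (A (ray 0 p)))" if "1 \<le> n" "p \<in> ?D" for n p
      using nonres[of "int n" "snd p"] that(1) subsetD[OF DV that(2)] by (simp add: ray0 mem_Times_iff)
    show "vhol (\<lambda>p. flatten (C (snd p))) ?D" by (intro vhol_flatten base C)
    show "flatten (C (snd (ray 0 p))) = flatten (C (snd p))" for p by simp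
    show "ad_mat (A (ray 0 p)) *v flatten (C (snd p)) + flatten (H (ray 0 p)) = 0" if "p \<in> ?D" for p
    proof -
      have "commutator (Ai (m - 1) (snd p)) (C (snd p)) = 0"
        using that DV by (intro C(2)) (auto simp: mem_Times_iff)
      then show ?thesis by (simp only: ray0 ad_mat_flatten) (simp add: flatten_def vec_eq_iff)
    qed
  qed blast
  then obtain Y where Y: "vhol Y ?D" "\<And>p. p \<in> ?D \<Longrightarrow> Y (ray 0 p) = flatten (C (snd p))"
      "\<And>p. p \<in> ?D \<Longrightarrow> fst p *s vpd None Y p = ad_mat (A p) *v Y p + flatten (H p)" by blast
  define G where "G = (\<lambda>p. unflatten (Y p))"
  have G: "mhol G ?D" unfolding G_def by (rule mhol_unflatten[OF Y(1)])
  have ode: "mscale (fst p) (mpd None G p) = commutator (A p) (G p) + H p" if p: "p \<in> ?D" for p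
  proof -
    have "flatten (mscale (fst p) (mpd None G p)) = flatten (commutator (A p) (G p) + H p)"
      using Y(3)[OF p] ad_mat_flatten[of "A p" "G p"] unfolding G_def mpd_unflatten
      by (simp add: flatten_def unflatten_def vec_eq_iff)
    then show ?thesis by (metis flatten_unflatten(2))
  qed
  have "cov m e Ai (inv_chart G) p = (\<Sum>s<m - 1. mscale (fst p ^ s) (T s (snd p)))"
    if p: "p \<in> UNIV \<times> V - Gam m e V" for p
  proof -
    define q where "q = (1 / fst p, snd p)"
    have z: "fst p \<noteq> 0" and q: "q \<in> ?D" using Gam_compl_chart[OF m p] by (auto simp: q_def)
    define \<epsilon> where "\<epsilon> = snd p $ e"
    define c where "c = fst p ^ m - \<epsilon> ^ m"
    have wq: "w q = c / fst p ^ m"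
      using z by (simp add: w_def q_def c_def \<epsilon>_def power_divide diff_divide_distrib)
    have c0: "c \<noteq> 0" using w0[OF q] by (auto simp: wq)
    have pdG: "mpd None (inv_chart G) p = mscale (- (1 / fst p)) (mscale (1 / fst p) (mpd None G q))"
    proof -
      have "pd None (\<lambda>p. inv_chart G p $ i $ k) p = - (1 / fst p ^ 2) * pd None (\<lambda>p. G p $ i $ k) q" for i k
        using pd_inv_chart[OF hol_nth_nth[OF G, of i k] z] q by (simp add: inv_chart_def[abs_def] q_def)
      then show ?thesis by (simp add: mpd_def vec_eq_iff power2_eq_square)
    qed
    have pw: "c / fst p * ((1 / w q) * (1 / fst p) ^ (m - 1 - s)) = fst p ^ s" if "s < m" for s
    proof -
      have "fst p ^ m = fst p * fst p ^ (m - 1 - s) * fst p ^ s"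
        using that by (metis One_nat_def Suc_diff_Suc diff_Suc_eq_diff_pred le_add_diff_inverse2 less_or_eq_imp_le power_Suc power_add)
      then show ?thesis using z c0 by (simp add: wq power_divide field_simps)
    qed
    have Aq: "mscale (c / fst p) (A q) = Ainf_fun m Ai (fst p) (snd p)"
      unfolding A_def Ainf_fun_def mscale_sum mscale_mscale
      by (rule sum.cong) (use pw in \<open>auto simp: q_def\<close>)
    have Hq: "mscale (- (c / fst p)) (H q) = (\<Sum>s<m - 1. mscale (fst p ^ s) (T s (snd p)))"
      unfolding H_def mscale_sum mscale_mscale
    proof (rule sum.cong[OF refl])
      fix s assume "s \<in> {..<m - 1}"
      then have "- (c / fst p) * (- 1 / w q * (1 / fst p) ^ (m - 1 - s)) = fst p ^ s"
        using pw[of s] by simp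
      then show "mscale (- (c / fst p) * (- 1 / w q * fst q ^ (m - 1 - s))) (T s (snd q)) = mscale (fst p ^ s) (T s (snd p))"
        by (simp add: q_def)
    qed
    have "mscale c (mpd None (inv_chart G) p) = mscale (- (c / fst p)) (mscale (fst q) (mpd None G q))"
      by (simp add: pdG q_def mscale_mscale)
    also have "\<dots> = mscale (- (c / fst p)) (commutator (A q) (G q)) + mscale (- (c / fst p)) (H q)"
      by (simp add: ode[OF q] mscale_add)
    also have "mscale (- (c / fst p)) (commutator (A q) (G q)) = - commutator (mscale (c / fst p) (A q)) (G q)"
      by (simp add: commutator_mscale_left vec_eq_iff)
    finally have "mscale c (mpd None (inv_chart G) p) + commutator (Ainf_fun m Ai (fst p) (snd p)) (G q) =
        (\<Sum>s<m - 1. mscale (fst p ^ s) (T s (snd p)))"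
      by (simp add: Aq Hq)
    then show ?thesis by (simp add: cov_def c_def \<epsilon>_def inv_chart_def q_def)
  qed
  moreover have "G (0, b) = C b" if b: "b \<in> V" for b
    using Y(2)[of "(0, b)"] b by (simp add: G_def inf_chart_def ray_def)
  ultimately show ?thesis using G unfolding sol_inf_def by blast
qed

section \<open>Matching modulo powers of epsilon\<close>

text \<open>Retraction of the base onto \<epsilon> = 0; pulling back along it extends data given
  over that locus constantly in \<epsilon>.\<close>

definition slice0 :: "'b \<Rightarrow> complex ^ 'b \<Rightarrow> complex ^ 'b"
  where "slice0 e b = (\<chi> i. if i = e then 0 else b $ i)"

lemma slice0_simps: "slice0 e b $ e = 0" "b $ e = 0 \<Longrightarrow> slice0 e b = b"
  by (auto simp: slice0_def vec_eq_iff)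

lemma norm_slice0_le: "norm (slice0 e b) \<le> norm (b :: complex ^ 'b)"
  unfolding norm_vec_def by (intro L2_set_mono) (auto simp: slice0_def)

lemma hol_slice0:
  fixes f :: "'b::finite point \<Rightarrow> complex"
  assumes "hol f W" "\<And>p. p \<in> U \<Longrightarrow> (c, slice0 e (snd p)) \<in> W"
  shows "hol (\<lambda>p. f (c, slice0 e (snd p))) U"
proof (rule hol_compose[OF assms(1)])
  have "continuous_on U (\<lambda>p. if i = e then 0 else snd p $ i)" for i
    by (cases "i = e") (auto intro!: continuous_intros)
  then show "continuous_on U (\<lambda>p. (c, slice0 e (snd p)))"
    unfolding slice0_def by (intro continuous_intros continuous_on_vec_lambda)
  fix p :: "'b point" and k
  show "\<exists>g k'. g field_differentiable at 0 \<and> g 0 = 0 \<and>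
     (\<forall>\<^sub>F t in nhds 0. (c, slice0 e (snd (p + dir k t))) = (c, slice0 e (snd p)) + dir k' (g t))"
  proof (cases "k = None \<or> k = Some e")
    case True
    then have "slice0 e (snd (p + dir k t)) = slice0 e (snd p)" for t
      by (auto simp: slice0_def dir_simps vec_eq_iff axis_def)
    then show ?thesis by (intro exI[of _ "\<lambda>_. 0"] exI[of _ k]) simp
  next
    case False
    then obtain i where i: "k = Some i" "i \<noteq> e" by (cases k) auto
    then have "slice0 e (snd (p + dir k t)) = slice0 e (snd p) + axis i t" for t
      by (auto simp: slice0_def dir_simps vec_eq_iff axis_def)
    then show ?thesis by (intro exI[of _ "\<lambda>t. t"] exI[of _ k]) (simp add: i dir_simps)
  qed
qed (use assms in auto)

lemma ad_mat_add: "ad_mat (A + B) = ad_mat A + ad_mat B"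
  and ad_mat_mscale: "ad_mat (mscale c A) = mscale c (ad_mat A)"
  by (simp_all add: ad_mat_def vec_eq_iff algebra_simps)

lemma ad_mat_Ainf: "(\<Sum>q<m. mscale (z ^ q) (ad_mat (Ai q b))) = ad_mat (Ainf_fun m Ai z b)"
proof -
  have "ad_mat 0 = 0" by (simp add: ad_mat_def vec_eq_iff)
  then show ?thesis
    unfolding Ainf_fun_def by (induction m) (simp_all add: ad_mat_add ad_mat_mscale)
qed

text \<open>Over \<epsilon> = 0 the factor \<open>z ^ m - \<epsilon> ^ m\<close> is
  \<open>z ^ m\<close>, and horizontality takes the form treated by \<open>log_coeff\<close>, with
  adjoint coefficients.\<close>

lemma cov_zero_log_ode:
  fixes X :: "'b::finite point \<Rightarrow> complex ^ 'r ^ 'r"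
  assumes m: "m \<ge> 1" and X: "mhol X U" and p: "(exp x, b) \<in> U" and b: "b $ e = 0"
    and cov: "cov m e Ai X (exp x, b) = 0"
  shows "((\<lambda>x. flatten (X (exp x, b)) $ i) has_field_derivative
    (log_coeff m (\<lambda>q. ad_mat (Ai q b)) x *v flatten (X (exp x, b))) $ i) (at x)"
proof (rule log_coeff_exp_compose[where w = "\<lambda>z. flatten (X (z, b))"])
  fix ik :: "'r \<times> 'r"
  obtain i k where ik: "ik = (i, k)" by (cases ik)
  have "((\<lambda>s. X ((0, b) + dir None s) $ i $ k) has_field_derivative pd None (\<lambda>p. X p $ i $ k) (exp x, b)) (at (exp x))"
    using hol_has_derivative[OF hol_nth_nth[OF X, of i k], of "(0, b)" None "exp x"] p by (simp add: dir_simps)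
  then have d: "((\<lambda>z. X (z, b) $ i $ k) has_field_derivative mpd None X (exp x, b) $ i $ k) (at (exp x))"
    by (simp add: dir_simps mpd_def)
  have "exp x ^ m * mpd None X (exp x, b) $ i $ k + commutator (Ainf_fun m Ai (exp x) b) (X (exp x, b)) $ i $ k = 0"
    using arg_cong[OF cov, of "\<lambda>M. M $ i $ k"] b m by (simp add: cov_def power_0_left)
  then have "mpd None X (exp x, b) $ i $ k = - commutator (Ainf_fun m Ai (exp x) b) (X (exp x, b)) $ i $ k / exp x ^ m"
    by (simp add: field_simps eq_neg_iff_add_eq_0)
  with d show "((\<lambda>z. flatten (X (z, b)) $ ik) has_field_derivative
      - ((\<Sum>q<m. mscale (exp x ^ q) (ad_mat (Ai q b))) *v flatten (X (exp x, b))) $ ik / exp x ^ m) (at (exp x))"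
    by (simp add: ad_mat_Ainf ad_mat_flatten ik)
qed

text \<open>The leading exponent of a periodic solution is an integer eigenvalue of minus the
  residue, and nonresonance leaves only \<open>0\<close>; so the leading coefficient is a genuine
  limit.\<close>

lemma nonresonant_periodic_limit:
  fixes \<phi> :: "complex \<Rightarrow> complex ^ 'n"
  assumes m: "m \<ge> 1"
    and \<phi>: "\<And>x i. ((\<lambda>x. \<phi> x $ i) has_field_derivative (log_coeff m aq x *v \<phi> x) $ i) (at x)"
    and per: "\<And>x. \<phi> (x + 2 * of_real pi * \<i>) = \<phi> x"
    and nonres: "\<And>n::int. n \<noteq> 0 \<Longrightarrow> invertible (mat (of_int n) - aq (m - 1))"
    and nz: "\<phi> x1 \<noteq> 0"
  shows "\<exists>v. v \<noteq> 0 \<and> aq (m - 1) *v v = 0 \<and> (\<forall>e>0. \<exists>R. \<forall>x. Re x \<ge> R \<longrightarrow> norm (\<phi> x - v) < e)"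
proof -
  have per': "\<phi> (x + 2 * of_real pi * \<i> * of_nat 1) = \<phi> x" for x using per by simp
  have "\<exists>(k::int) v. v \<noteq> 0 \<and> - aq (m - 1) *v v = (of_int k / of_nat 1) *s v \<and>
      (\<forall>e>0. \<exists>R. \<forall>x. Re x \<ge> R \<longrightarrow> norm (exp (- (of_int k / of_nat 1) * x) *s \<phi> x - v) < e)"
    by (rule linear_ode_periodic_aux[of \<phi> "log_coeff m aq", OF \<phi> log_coeff_limit[OF m] per' zero_less_one nz]; blast)
  then obtain k :: int and v where v: "v \<noteq> 0" "- aq (m - 1) *v v = (of_int k / of_nat 1) *s v"
      "\<forall>e>0. \<exists>R. \<forall>x. Re x \<ge> R \<longrightarrow> norm (exp (- (of_int k / of_nat 1) * x) *s \<phi> x - v) < e" by blast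
  have neg: "(- aq (m - 1)) *v v = - (aq (m - 1) *v v)"
    using matrix_vector_mult_diff_rdistrib[of 0 "aq (m - 1)" v] by simp
  have "k = 0"
  proof (rule ccontr)
    assume "k \<noteq> 0"
    then have inv: "invertible (mat (of_int (- k)) - aq (m - 1))" by (intro nonres) simp
    have "(mat (of_int (- k)) - aq (m - 1)) *v v = 0"
      using v(2) neg by (simp add: matrix_vector_mult_diff_rdistrib vec_eq_iff)
    then show False using inv v(1) unfolding invertible_iff_ker by blast
  qed
  then have "aq (m - 1) *v v = 0" using v(2) neg by simp
  then show ?thesis using v(1,3) \<open>k = 0\<close> by auto
qed

text \<open>A nonzero solution of this kind has a nonzero limit at infinity. This is the uniqueness
  that identifies two single-valued solutions with equal limits.\<close>

lemma nonresonant_periodic_zero: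
  fixes \<phi> :: "complex \<Rightarrow> complex ^ 'n"
  assumes m: "m \<ge> 1"
    and \<phi>: "\<And>x i. ((\<lambda>x. \<phi> x $ i) has_field_derivative (log_coeff m aq x *v \<phi> x) $ i) (at x)"
    and per: "\<And>x. \<phi> (x + 2 * of_real pi * \<i>) = \<phi> x"
    and nonres: "\<And>n::int. n \<noteq> 0 \<Longrightarrow> invertible (mat (of_int n) - aq (m - 1))"
    and lim: "\<And>e. e > 0 \<Longrightarrow> \<exists>R. \<forall>x. Re x \<ge> R \<longrightarrow> norm (\<phi> x) < e"
  shows "\<phi> x = 0"
proof (rule ccontr)
  assume "\<phi> x \<noteq> 0"
  from nonresonant_periodic_limit[OF m \<phi> per nonres this]
  obtain v where v: "v \<noteq> 0" "\<forall>e>0. \<exists>R. \<forall>x. Re x \<ge> R \<longrightarrow> norm (\<phi> x - v) < e" by blast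
  define d where "d = norm v / 2"
  have d: "d > 0" using v(1) by (simp add: d_def)
  obtain R1 where R1: "\<And>x. Re x \<ge> R1 \<Longrightarrow> norm (\<phi> x - v) < d" using v(2) d by blast
  obtain R2 where R2: "\<And>x. Re x \<ge> R2 \<Longrightarrow> norm (\<phi> x) < d" using lim[OF d] by blast
  define x where "x = complex_of_real (max R1 R2)"
  have "norm v \<le> norm (\<phi> x) + norm (\<phi> x - v)"
    using norm_triangle_ineq4[of "\<phi> x" "\<phi> x - v"] by simp
  also have "\<dots> < d + d" using R1[of x] R2[of x] by (intro add_strict_mono) (auto simp: x_def)
  finally show False by (simp add: d_def)
qed

text \<open>The mean over a period does not depend on the starting point, because its derivative
  integrates to the difference of two values one period apart; moving the starting point to infinity
  identifies it with the limit. An integral over a compact path depends holomorphically on the base,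
  which is not evident for a limit.\<close>

lemma periodic_mean_limit:
  fixes f :: "'b::finite point \<Rightarrow> complex"
  assumes V: "open V" and f: "hol f (UNIV \<times> V)" and b: "b \<in> V"
    and per: "\<And>x. f (x + 2 * of_real pi * \<i>, b) = f (x, b)"
    and lim: "\<And>e. e > 0 \<Longrightarrow> \<exists>R. \<forall>x. Re x \<ge> R \<longrightarrow> cmod (f (x, b) - v) < e"
  shows "integral {0..1} (\<lambda>t. f (x0 + of_real t * (2 * of_real pi * \<i>), b)) = v"
proof -
  let ?D = "UNIV \<times> V :: 'b point set"
  have D: "open ?D" using V by (intro open_Times) auto
  define \<omega> where "\<omega> = 2 * complex_of_real pi * \<i>"
  have \<omega>: "\<omega> \<noteq> 0" by (simp add: \<omega>_def)
  define h where "h = (\<lambda>t p. f (p + (of_real t * \<omega>, 0)))"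
  have hh: "hol (h t) ?D" for t
    unfolding h_def by (rule hol_translate[OF f]) auto
  have hc: "continuous_on ({0..1} \<times> ?D) (\<lambda>(t, p). h t p)"
    unfolding case_prod_beta h_def
    by (intro continuous_on_compose2[OF hol_continuous[OF f]] continuous_intros) auto
  define F where "F = (\<lambda>p. integral {0..1} (\<lambda>t. h t p))"
  have Fh: "hol F ?D" unfolding F_def by (rule hol_integral[OF D hc hh])
  have pd0: "pd None F (x, b) = 0" for x
  proof -
    have "pd None F (x, b) = integral {0..1} (\<lambda>t. pd None (h t) (x, b))"
      unfolding F_def by (rule pd_integral[OF D hc hh]) (use b in auto)
    also have "(\<lambda>t. pd None (h t) (x, b)) = (\<lambda>t. pd None f (x + of_real t * \<omega>, b))"
      by (simp add: h_def pd_def dir_simps add_ac)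
    finally have 1: "pd None F (x, b) = integral {0..1} (\<lambda>t. pd None f (x + of_real t * \<omega>, b))" .
    have "((\<lambda>t. f (x + of_real t * \<omega>, b)) has_vector_derivative \<omega> * pd None f (x + of_real t * \<omega>, b)) (at t within {0..1})" for t
    proof -
      have "((\<lambda>s. f ((0, b) + dir None s)) has_field_derivative pd None f (x + of_real t * \<omega>, b)) (at (x + of_real t * \<omega>))"
        using hol_has_derivative[OF f, of "(0, b)" None "x + of_real t * \<omega>"] b by (simp add: dir_simps)
      moreover have "((\<lambda>t. x + of_real t * \<omega>) has_vector_derivative \<omega>) (at t within {0..1})"
        by (auto intro!: derivative_eq_intros simp: scaleR_conv_of_real)
      ultimately have "((\<lambda>s. f ((0, b) + dir None s)) \<circ> (\<lambda>t. x + of_real t * \<omega>) has_vector_derivative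
          \<omega> * pd None f (x + of_real t * \<omega>, b)) (at t within {0..1})"
        using field_vector_diff_chain_within[where f = "\<lambda>t. x + of_real t * \<omega>" and x = t
                and g = "\<lambda>s. f ((0, b) + dir None s)" and S = "{0..1}"] has_field_derivative_at_within by blast
      then show ?thesis by (simp add: o_def dir_simps)
    qed
    then have "((\<lambda>t. \<omega> * pd None f (x + of_real t * \<omega>, b)) has_integral f (x + of_real 1 * \<omega>, b) - f (x + of_real 0 * \<omega>, b)) {0..1}"
      by (intro fundamental_theorem_of_calculus) auto
    then have "integral {0..1} (\<lambda>t. \<omega> * pd None f (x + of_real t * \<omega>, b)) =
        f (x + of_real 1 * \<omega>, b) - f (x + of_real 0 * \<omega>, b)"
      by (rule integral_unique)
    then have "integral {0..1} (\<lambda>t. \<omega> * pd None f (x + of_real t * \<omega>, b)) = f (x + \<omega>, b) - f (x, b)"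
      by (simp only: of_real_1 of_real_0 mult_1 mult_zero_left add_0_right)
    then have "\<omega> * integral {0..1} (\<lambda>t. pd None f (x + of_real t * \<omega>, b)) = 0"
      using per[of x] unfolding \<omega>_def[symmetric] by (simp only: integral_mult_right diff_self)
    then show ?thesis using 1 \<omega> by simp
  qed
  have "\<exists>c. \<forall>x\<in>UNIV. F (x, b) = c"
  proof (rule has_field_derivative_zero_constant)
    fix x :: complex
    show "((\<lambda>x. F (x, b)) has_field_derivative 0) (at x within UNIV)"
      using hol_has_derivative[OF Fh, of "(0, b)" None x] pd0[of x] b by (simp add: dir_simps)
  qed simp
  then obtain c where c: "\<And>x. F (x, b) = c" by blast
  have "cmod (c - v) \<le> e" if e: "e > 0" for e
  proof -
    obtain R where R: "\<And>x. Re x \<ge> R \<Longrightarrow> cmod (f (x, b) - v) < e" using lim[OF e] by blast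
    have co: "continuous_on {0..1} (\<lambda>t. f (of_real R + of_real t * \<omega>, b))"
      by (intro continuous_on_compose2[OF hol_continuous[OF f]] continuous_intros) (use b in auto)
    have "c - v = integral {0..1} (\<lambda>t. f (of_real R + of_real t * \<omega>, b)) - integral {0..1} (\<lambda>t::real. v)"
      using c[of "of_real R"] by (simp add: F_def h_def)
    also have "\<dots> = integral {0..1} (\<lambda>t. f (of_real R + of_real t * \<omega>, b) - v)"
      by (intro integral_diff[symmetric] integrable_continuous_interval co) auto
    also have "cmod \<dots> \<le> integral {0..1} (\<lambda>t::real. e)"
    proof (rule integral_norm_bound_integral)
      show "(\<lambda>t. f (of_real R + of_real t * \<omega>, b) - v) integrable_on {0..1}"
        by (intro integrable_continuous_interval continuous_intros co)
      show "cmod (f (of_real R + of_real t * \<omega>, b) - v) \<le> e" for t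
        by (rule less_imp_le[OF R]) (simp add: \<omega>_def)
    qed auto
    finally show ?thesis by simp
  qed
  from this[of "cmod (c - v) / 2"] have "c = v" by (cases "c = v") auto
  then show ?thesis using c[of x0] by (simp add: F_def h_def \<omega>_def)
qed

lemma log_coeff_param_hol:
  assumes "\<And>q. q < m \<Longrightarrow> mhol (\<lambda>p. aq q p) U"
  shows "mhol (\<lambda>p. log_coeff m (\<lambda>q. aq q p) (fst p)) U"
  unfolding log_coeff_def by (intro mhol_intros hol_intros hol_exp_fst assms) auto

text \<open>Over \<open>\<epsilon> = 0\<close>, the section \<open>X\<close> continues to an entire \<open>2 \<pi> i\<close>-periodic solution in \<open>log z\<close>. By
  nonresonance it has a limit at infinity, which commutes with the residue and depends
  holomorphically on the base, being also the mean over a period. Written as a polynomial in the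
  residue, by means of the cyclic vector \<open>\<xi>\<close>, the limit extends to \<open>\<epsilon> \<noteq> 0\<close> as an element of the
  commutant; \<open>G\<close> is the solution with this value at infinity.\<close>

lemma matching_step:
  fixes Ai :: "nat \<Rightarrow> complex ^ 'b::finite \<Rightarrow> complex ^ 'r ^ 'r" and h :: "'r \<Rightarrow> nat"
  assumes m: "m \<ge> 1" and V: "open V" and \<rho>: "\<rho> > 0" and Ai: "\<And>q. q < m \<Longrightarrow> mholo_base (Ai q) V"
    and a0: "\<And>b. b \<in> V \<Longrightarrow> msum (ad_mat (Ai (m - 1) b)) \<le> a0"
    and nonres: "\<And>(n::int) b. n \<noteq> 0 \<Longrightarrow> b \<in> V \<Longrightarrow> invertible (mat (of_int n) - ad_mat (Ai (m - 1) b))"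
    and slice: "\<And>b. b \<in> V \<Longrightarrow> slice0 e b \<in> V"
    and kry: "\<And>b. b \<in> V \<Longrightarrow> invertible (krylov h \<xi> (Ai (m - 1) b))"
    and X: "mhol X (ball 0 \<rho> \<times> V - Gam m e V)"
    and cov: "\<And>p. p \<in> ball 0 \<rho> \<times> V - Gam m e V \<Longrightarrow> snd p $ e = 0 \<Longrightarrow> cov m e Ai X p = 0"
  shows "\<exists>G X'. sol_inf m e Ai V (\<lambda>_ _. 0) G \<and> mhol X' (ball 0 \<rho> \<times> V - Gam m e V) \<and>
    (\<forall>p\<in>ball 0 \<rho> \<times> V - Gam m e V. X p = inv_chart G p + mscale (snd p $ e) (X' p))"
proof -
  let ?\<Omega> = "ball 0 \<rho> \<times> V - Gam m e V" and ?D = "UNIV \<times> V :: 'b point set"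
  have D: "open ?D" using V by (intro open_Times) auto
  have \<Omega>: "open ?\<Omega>"
  proof -
    have "?\<Omega> = (ball 0 \<rho> \<times> UNIV) \<inter> (?D - Gam m e V)" by auto
    then show ?thesis using open_Gam_compl[OF V] by (auto intro!: open_Int open_Times)
  qed
  have notGam: "(z, b) \<notin> Gam m e V" if "b $ e = 0" "z \<noteq> 0" for z b
    using Gam_norm_le[of z b m e V] that by auto
  have in\<Omega>: "(z, b) \<in> ?\<Omega>" if "b \<in> V" "b $ e = 0" "z \<noteq> 0" "cmod z < \<rho>" for z b
    using notGam that by auto
  \<comment> \<open>The logarithm of \<open>\<rho> / 2\<close>, a point of the punctured disc on
    which \<open>X\<close> is given.\<close>
  define x0 where "x0 = complex_of_real (ln (\<rho> / 2))"
  have ex0: "exp x0 = of_real (\<rho> / 2)" using \<rho> unfolding x0_def exp_of_real by simp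
  have sl\<Omega>: "(exp x0, slice0 e b) \<in> ?\<Omega>" if "b \<in> V" for b
    using \<rho> slice[OF that] by (intro in\<Omega>) (auto simp: ex0 slice0_simps)
  have base: "mhol (\<lambda>p. F (slice0 e (snd p))) ?D" if "mholo_base F V" for F :: "complex ^ 'b \<Rightarrow> complex ^ 'r ^ 'r"
    using that slice unfolding mholo_base_iff mhol_def
    by (auto intro!: hol_slice0[where W = ?D and f = "\<lambda>p. F (snd p) $ _ $ _" and c = 0, simplified])
  \<comment> \<open>All coefficients are frozen at \<epsilon> = 0, so that \<open>Y\<close> is
    defined over the whole of \<open>V\<close>, including points where \<open>X\<close> is not
    horizontal.\<close>
  define aq where "aq = (\<lambda>b q. ad_mat (Ai q (slice0 e b)))"
  have ah: "mhol (\<lambda>p. log_coeff m (aq (snd p)) (fst p)) ?D"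
    using log_coeff_param_hol[where aq = "\<lambda>q p. aq (snd p) q" and m = m] mhol_ad_mat[OF base[OF Ai]]
    unfolding aq_def by blast
  have yh: "vhol (\<lambda>p. flatten (X (exp x0, slice0 e (snd p)))) ?D"
  proof (rule vhol_flatten)
    show "mhol (\<lambda>p. X (exp x0, slice0 e (snd p))) ?D"
      unfolding mhol_def using hol_slice0[OF hol_nth_nth[OF X], of ?D "exp x0" e] sl\<Omega> by fastforce
  qed
  have "\<exists>Y. vhol Y ?D \<and> (\<forall>b\<in>V. Y (x0, b) = flatten (X (exp x0, slice0 e b))) \<and>
      (\<forall>p\<in>?D. vpd None Y p = log_coeff m (aq (snd p)) (fst p) *v Y p)"
    by (rule linear_ode_param[OF V ah yh, of x0]; blast)
  then obtain Y where Y: "vhol Y ?D" "\<And>b. b \<in> V \<Longrightarrow> Y (x0, b) = flatten (X (exp x0, slice0 e b))"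
      "\<And>p. p \<in> ?D \<Longrightarrow> vpd None Y p = log_coeff m (aq (snd p)) (fst p) *v Y p" by blast
  have Yd: "((\<lambda>x. Y (x, b) $ i) has_field_derivative (log_coeff m (aq b) x *v Y (x, b)) $ i) (at x)" if "b \<in> V" for b x i
  proof -
    have "pd None (\<lambda>p. Y p $ i) (x, b) = vpd None Y (x, b) $ i" by (simp add: vpd_def)
    then show ?thesis
      using hol_has_derivative[OF hol_nth[OF Y(1), of i], of "(0, b)" None x] Y(3)[of "(x, b)"] that
      by (simp add: dir_simps)
  qed
  \<comment> \<open>The half-plane is the preimage under \<open>exp\<close> of the punctured disc of
    radius \<open>\<rho>\<close>; there the entire solution is \<open>X\<close> read in the
    logarithm. Its periodicity follows from this.\<close>
  have strip: "Y (x, b) = flatten (X (exp x, slice0 e b))" if b: "b \<in> V" and x: "Re x < ln \<rho>" for x b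
  proof (rule log_coeff_unique[where S = "{x. Re x < ln \<rho>}" and ?x0.0 = x0 and \<phi> = "\<lambda>x. Y (x, b)"
        and \<psi> = "\<lambda>x. flatten (X (exp x, slice0 e b))" and m = m and aq = "aq b"])
    show "convex {x. Re x < ln \<rho>}" by (rule convex_halfspace_Re_lt)
    show "((\<lambda>x. Y (x, b) $ i) has_field_derivative (log_coeff m (aq b) x *v Y (x, b)) $ i) (at x)" for x i
      by (rule Yd[OF b])
    show "((\<lambda>x. flatten (X (exp x, slice0 e b)) $ i) has_field_derivative
        (log_coeff m (aq b) x *v flatten (X (exp x, slice0 e b))) $ i) (at x)" if "x \<in> {x. Re x < ln \<rho>}" for x i
    proof -
      have "exp (Re x) < exp (ln \<rho>)" using that by simp
      then have "cmod (exp x) < \<rho>" using \<rho> by simp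
      then have "(exp x, slice0 e b) \<in> ?\<Omega>" using slice[OF b] by (intro in\<Omega>) (auto simp: slice0_simps)
      then show ?thesis
        unfolding aq_def by (intro cov_zero_log_ode[OF m X, where e = e] cov) (auto simp: slice0_simps)
    qed
    show "x0 \<in> {x. Re x < ln \<rho>}" using \<rho> by (simp add: x0_def)
  qed (use x Y(2)[OF b] in auto)
  have per: "Y (x + 2 * of_real pi * \<i>, b) = Y (x, b)" if b: "b \<in> V" for x b
  proof (rule log_coeff_unique[where S = UNIV and ?x0.0 = x0 and \<phi> = "\<lambda>x. Y (x + 2 * of_real pi * \<i>, b)"
        and \<psi> = "\<lambda>x. Y (x, b)" and m = m and aq = "aq b"])
    show "((\<lambda>x. Y (x + 2 * of_real pi * \<i>, b) $ i) has_field_derivative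
        (log_coeff m (aq b) x *v Y (x + 2 * of_real pi * \<i>, b)) $ i) (at x)" for x i
      using log_coeff_translate[where \<phi> = "\<lambda>x. Y (x, b)" and k = 1 and i = i and x = x, OF Yd[OF b]] by simp
    have "exp (x0 + 2 * of_real pi * \<i>) = exp x0" by (simp add: exp_add)
    then show "Y (x0 + 2 * of_real pi * \<i>, b) = Y (x0, b)"
      using \<rho> by (simp add: strip[OF b] x0_def)
  qed (use Yd[OF b] in auto)
  define v0 where "v0 = (\<lambda>b. \<chi> i. integral {0..1} (\<lambda>t. Y (x0 + of_real t * (2 * of_real pi * \<i>), b) $ i))"
  have v0h: "vhol (\<lambda>p. v0 (snd p)) ?D"
    unfolding vhol_def
  proof
    fix i
    have "hol (\<lambda>p. integral {0..1} (\<lambda>t. Y (x0 + of_real t * (2 * of_real pi * \<i>), snd p) $ i)) ?D"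
    proof (rule hol_integral[OF D])
      show "continuous_on ({0..1} \<times> ?D) (\<lambda>(t, p). Y (x0 + of_real t * (2 * of_real pi * \<i>), snd p) $ i)"
        unfolding case_prod_beta
        by (intro continuous_on_compose2[OF hol_continuous[OF hol_nth[OF Y(1)]]] continuous_intros) auto
      show "hol (\<lambda>p. Y (x0 + of_real t * (2 * of_real pi * \<i>), snd p) $ i) ?D" for t
      proof (rule hol_compose[OF hol_nth[OF Y(1), of i], where \<phi> = "\<lambda>p. (x0 + of_real t * (2 * of_real pi * \<i>), snd p)"])
        fix p :: "'b point" and k
        show "\<exists>g k'. g field_differentiable at 0 \<and> g 0 = 0 \<and>
           (\<forall>\<^sub>F s in nhds 0. (x0 + of_real t * (2 * of_real pi * \<i>), snd (p + dir k s)) =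
             (x0 + of_real t * (2 * of_real pi * \<i>), snd p) + dir k' (g s))"
        proof (cases k)
          case None
          then show ?thesis by (intro exI[of _ "\<lambda>_. 0"] exI[of _ None]) (simp add: dir_simps)
        next
          case (Some i)
          then show ?thesis by (intro exI[of _ "\<lambda>t. t"] exI[of _ k]) (simp add: dir_simps)
        qed
      qed (auto intro!: continuous_intros)
    qed
    then show "hol (\<lambda>p. v0 (snd p) $ i) ?D" by (simp add: v0_def)
  qed
  have nonres': "invertible (mat (of_int n) - aq b (m - 1))" if "n \<noteq> 0" "b \<in> V" for n :: int and b
    unfolding aq_def by (intro nonres that slice)
  have lim: "aq b (m - 1) *v v0 b = 0 \<and> (\<forall>e>0. \<exists>R. \<forall>x. Re x \<ge> R \<longrightarrow> norm (Y (x, b) - v0 b) < e)" if b: "b \<in> V" for b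
  proof -
    have "\<exists>v. aq b (m - 1) *v v = 0 \<and> (\<forall>e>0. \<exists>R. \<forall>x. Re x \<ge> R \<longrightarrow> norm (Y (x, b) - v) < e)"
    proof (cases "\<exists>x1. Y (x1, b) \<noteq> 0")
      case True
      then obtain x1 where x1: "Y (x1, b) \<noteq> 0" by blast
      from nonresonant_periodic_limit[where \<phi> = "\<lambda>x. Y (x, b)", OF m Yd[OF b] per[OF b] nonres'[OF _ b] x1]
      show ?thesis by blast
    qed (auto intro!: exI[of _ 0])
    then obtain v where v: "aq b (m - 1) *v v = 0" "\<And>e. e > 0 \<Longrightarrow> \<exists>R. \<forall>x. Re x \<ge> R \<longrightarrow> norm (Y (x, b) - v) < e" by blast
    have "v0 b $ i = v $ i" for i
      unfolding v0_def vec_lambda_beta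
    proof (rule periodic_mean_limit[OF V hol_nth[OF Y(1), of i] b])
      show "Y (x + 2 * of_real pi * \<i>, b) $ i = Y (x, b) $ i" for x using per[OF b] by simp
      fix e :: real assume "e > 0"
      then obtain R where R: "\<And>x. Re x \<ge> R \<Longrightarrow> norm (Y (x, b) - v) < e" using v(2) by blast
      have "cmod (Y (x, b) $ i - v $ i) < e" if "Re x \<ge> R" for x
        using Finite_Cartesian_Product.norm_nth_le[of "Y (x, b) - v" i] R[OF that] by simp
      then show "\<exists>R. \<forall>x. Re x \<ge> R \<longrightarrow> cmod (Y (x, b) $ i - v $ i) < e" by blast
    qed
    then have "v0 b = v" by (simp add: vec_eq_iff)
    then show ?thesis using v by blast
  qed
  define C where "C = (\<lambda>b. cyclic_poly h (Ai (m - 1) b)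
    (matrix_inv (krylov h \<xi> (Ai (m - 1) b)) *v (unflatten (v0 b) *v \<xi>)))"
  have Am: "mhol (\<lambda>p. Ai (m - 1) (snd p)) ?D" using Ai[of "m - 1"] m unfolding mholo_base_iff by simp
  have kh: "mhol (\<lambda>p. krylov h \<xi> (Ai (m - 1) (snd p))) ?D"
  proof -
    have "vhol (\<lambda>p. mat_power (Ai (m - 1) (snd p)) n *v \<xi>) ?D" for n
      by (intro vhol_matvec mhol_mat_power Am vhol_const)
    then show ?thesis unfolding krylov_def mhol_def vhol_def by simp
  qed
  have Ch: "mholo_base C V"
    unfolding mholo_base_iff C_def cyclic_poly_def
    by (intro mhol_sum mhol_mscale mhol_mat_power Am hol_nth vhol_matvec mhol_matrix_inv D kh kry
        mhol_unflatten v0h vhol_const) auto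
  have Cc: "commutator (Ai (m - 1) b) (C b) = 0" for b
    using cyclic_poly_commute[of "Ai (m - 1) b"] by (simp add: commutator_def C_def)
  have C0: "flatten (C b) = v0 b" if b: "b \<in> V" "b $ e = 0" for b
  proof -
    have "ad_mat (Ai (m - 1) b) *v flatten (unflatten (v0 b)) = 0"
      using lim[OF b(1)] by (simp add: aq_def slice0_simps(2)[OF b(2)])
    then have "commutator (Ai (m - 1) b) (unflatten (v0 b)) = 0"
      unfolding ad_mat_flatten by (simp add: flatten_def vec_eq_iff)
    then have "Ai (m - 1) b ** unflatten (v0 b) = unflatten (v0 b) ** Ai (m - 1) b"
      by (simp add: commutator_def)
    then show ?thesis unfolding C_def using commutant_cyclic[OF kry[OF b(1)]] by simp
  qed
  have T0: "mholo_base (\<lambda>_. 0) V" unfolding mholo_base_iff by (rule mhol_const)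
  obtain G where G: "sol_inf m e Ai V (\<lambda>_ _. 0) G" "\<And>b. b \<in> V \<Longrightarrow> G (0, b) = C b"
    using solution_at_infinity[where C = C and e = e and m = m and V = V and Ai = Ai and T = "\<lambda>_ _. 0" and ?a0.0 = a0,
        OF m V Ai T0 a0 nonres Ch Cc] by blast
  have Gh: "mhol G (inf_chart m e V)" and Gc: "\<And>p. p \<in> ?D - Gam m e V \<Longrightarrow> cov m e Ai (inv_chart G) p = 0"
    using G(1) by (auto simp: sol_inf_def vec_eq_iff)
  have Sh: "mhol (inv_chart G) (?D - Gam m e V)" by (rule mhol_inv_chart[OF m Gh])
  \<comment> \<open>Both functions are periodic solutions over \<epsilon> = 0 with the same limit at
    infinity, so their difference vanishes by nonresonance.\<close>
  have agree: "Y (x, b) = flatten (inv_chart G (exp x, b))" if b: "b \<in> V" "b $ e = 0" for x b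
  proof -
    have aqb: "aq b = (\<lambda>q. ad_mat (Ai q b))" by (simp add: aq_def slice0_simps(2)[OF b(2)])
    have pD: "(exp x, b) \<in> ?D - Gam m e V" for x using notGam[of b "exp x"] b by auto
    define \<psi> where "\<psi> = (\<lambda>x. flatten (inv_chart G (exp x, b)))"
    have \<psi>d: "((\<lambda>x. \<psi> x $ i) has_field_derivative (log_coeff m (aq b) x *v \<psi> x) $ i) (at x)" for x i
      unfolding \<psi>_def aqb by (rule cov_zero_log_ode[OF m Sh pD b(2) Gc[OF pD]])
    have "Y (x, b) - \<psi> x = 0"
    proof (rule nonresonant_periodic_zero[where \<phi> = "\<lambda>x. Y (x, b) - \<psi> x", OF m])
      show "((\<lambda>x. (Y (x, b) - \<psi> x) $ i) has_field_derivative (log_coeff m (aq b) x *v (Y (x, b) - \<psi> x)) $ i) (at x)" for x i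
        using DERIV_diff[OF Yd[OF b(1)] \<psi>d] by (simp add: matrix_vector_mult_diff_distrib)
      show "Y (x + 2 * of_real pi * \<i>, b) - \<psi> (x + 2 * of_real pi * \<i>) = Y (x, b) - \<psi> x" for x
        using per[OF b(1)] by (simp add: \<psi>_def exp_add)
      show "invertible (mat (of_int n) - aq b (m - 1))" if "n \<noteq> 0" for n :: int by (rule nonres'[OF that b(1)])
      fix \<eta> :: real assume \<eta>: "\<eta> > 0"
      obtain R1 where R1: "\<And>x. Re x \<ge> R1 \<Longrightarrow> norm (Y (x, b) - v0 b) < \<eta> / 2"
        using lim[OF b(1)] half_gt_zero[OF \<eta>] by blast
      have i0: "(0, b) \<in> inf_chart m e V" using b by (simp add: inf_chart_def)
      have "continuous_on (inf_chart m e V) (\<lambda>p. flatten (G p))"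
        by (rule vhol_continuous[OF vhol_flatten[OF Gh]])
      then have "isCont (\<lambda>p. flatten (G p)) (0, b)"
        using continuous_on_eq_continuous_at[OF open_inf_chart[OF V]] i0 by blast
      then have "\<exists>\<delta>>0. \<forall>p. dist p (0, b) < \<delta> \<longrightarrow> dist (flatten (G p)) (flatten (G (0, b))) < \<eta> / 2"
        using half_gt_zero[OF \<eta>] unfolding continuous_at_eps_delta dist_norm by blast
      then obtain \<delta> where \<delta>: "\<delta> > 0" "\<And>p. dist p (0, b) < \<delta> \<Longrightarrow> dist (flatten (G p)) (flatten (G (0, b))) < \<eta> / 2"
        by blast
      show "\<exists>R. \<forall>x. Re x \<ge> R \<longrightarrow> norm (Y (x, b) - \<psi> x) < \<eta>"
      proof (intro exI[of _ "max R1 (- ln \<delta> + 1)"] allI impI)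
        fix x assume x: "max R1 (- ln \<delta> + 1) \<le> Re x"
        have "- Re x < ln \<delta>" using x by simp
        then have "exp (- Re x) < exp (ln \<delta>)" by (simp only: exp_less_cancel_iff)
        then have "exp (- Re x) < \<delta>" using \<delta>(1) by simp
        then have "dist (1 / exp x, b) (0, b) < \<delta>"
          by (simp add: dist_Pair_Pair real_sqrt_abs norm_divide exp_minus inverse_eq_divide)
        then have "norm (\<psi> x - v0 b) < \<eta> / 2"
          using \<delta>(2)[of "(1 / exp x, b)"] G(2)[OF b(1)] C0[OF b] by (simp add: \<psi>_def inv_chart_def dist_norm)
        moreover have "norm (Y (x, b) - v0 b) < \<eta> / 2" using R1 x by simp
        ultimately show "norm (Y (x, b) - \<psi> x) < \<eta>"
          using norm_triangle_ineq4[of "Y (x, b) - v0 b" "\<psi> x - v0 b"] by simp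
      qed
    qed
    then show ?thesis by (simp add: \<psi>_def)
  qed
  have Sh': "mhol (inv_chart G) ?\<Omega>" by (rule mhol_subset[OF Sh]) auto
  have dh: "mhol (\<lambda>p. X p - inv_chart G p) ?\<Omega>" by (intro mhol_diff X Sh')
  have dz: "X p - inv_chart G p = 0" if p: "p \<in> ?\<Omega>" "crd (Some e) p = 0" for p
  proof -
    obtain z b where zb: "p = (z, b)" by (cases p)
    have b: "b \<in> V" "b $ e = 0" and z: "cmod z < \<rho>" "z \<noteq> 0"
      using p Gam_zero[OF m, of b V e] by (auto simp: zb)
    \<comment> \<open>Every point of the punctured disc has its principal logarithm in the
      half-plane of \<open>strip\<close>.\<close>
    have "exp (Ln z) = z" using z by simp
    moreover have "Re (Ln z) < ln \<rho>" using z \<rho> by (simp add: ln_less_cancel_iff)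
    ultimately have "Y (Ln z, b) = flatten (X (z, b))"
      using strip[OF b(1), of "Ln z"] by (simp add: slice0_simps(2)[OF b(2)])
    then have "flatten (X (z, b)) = flatten (inv_chart G (z, b))"
      using agree[OF b, of "Ln z"] \<open>exp (Ln z) = z\<close> by simp
    then have "X (z, b) = inv_chart G (z, b)" by (metis flatten_unflatten(2))
    then show ?thesis by (simp add: zb)
  qed
  have "\<exists>X'. mhol X' ?\<Omega> \<and> (\<forall>p\<in>?\<Omega>. X p - inv_chart G p = mscale (crd (Some e) p) (X' p))"
    by (rule mhol_coord_quotient[OF \<Omega> dh dz]; blast)
  then obtain X' where "mhol X' ?\<Omega>" "\<And>p. p \<in> ?\<Omega> \<Longrightarrow> X p - inv_chart G p = mscale (snd p $ e) (X' p)"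
    by auto
  then show ?thesis using G(1) by (intro exI[of _ G] exI[of _ X']) (auto simp: algebra_simps)
qed

lemma sol_inf_add:
  fixes Ai :: "nat \<Rightarrow> complex ^ 'b::finite \<Rightarrow> complex ^ 'r ^ 'r"
  assumes m: "m \<ge> 1" and V: "open V" and G: "sol_inf m e Ai V T G" and G': "sol_inf m e Ai V (\<lambda>_ _. 0) G'"
  shows "sol_inf m e Ai V T (\<lambda>p. G p + mscale ((snd p $ e) ^ n) (G' p))"
proof -
  have h: "mhol G (inf_chart m e V)" "mhol G' (inf_chart m e V)"
    using G G' by (auto simp: sol_inf_def)
  have "cov m e Ai (inv_chart (\<lambda>p. G p + mscale ((snd p $ e) ^ n) (G' p))) p = (\<Sum>s<m - 1. mscale (fst p ^ s) (T s (snd p)))"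
    if p: "p \<in> UNIV \<times> V - Gam m e V" for p
  proof -
    have i: "mhol (inv_chart G) (UNIV \<times> V - Gam m e V)" "mhol (inv_chart G') (UNIV \<times> V - Gam m e V)"
      by (intro mhol_inv_chart[OF m] h)+
    have "inv_chart (\<lambda>p. G p + mscale ((snd p $ e) ^ n) (G' p)) = (\<lambda>p. inv_chart G p + mscale ((snd p $ e) ^ n) (inv_chart G' p))"
      by (simp add: inv_chart_def fun_eq_iff)
    then have "cov m e Ai (inv_chart (\<lambda>p. G p + mscale ((snd p $ e) ^ n) (G' p))) p =
        cov m e Ai (inv_chart G) p + mscale ((snd p $ e) ^ n) (cov m e Ai (inv_chart G') p)"
      using cov_add[OF i(1) _ p, of "\<lambda>p. mscale ((snd p $ e) ^ n) (inv_chart G' p)"] cov_mscale[OF i(2) p]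
      by (simp add: mhol_mscale hol_power hol_snd_nth i)
    then show ?thesis using G G' p by (simp add: sol_inf_def vec_eq_iff)
  qed
  then show ?thesis
    unfolding sol_inf_def by (intro conjI ballI mhol_add mhol_mscale hol_power hol_snd_nth h)
qed

theorem matching:
  fixes Ai :: "nat \<Rightarrow> complex ^ 'b::finite \<Rightarrow> complex ^ 'r ^ 'r" and h :: "'r \<Rightarrow> nat"
  assumes m: "m \<ge> 1" and V: "open V" and \<rho>: "\<rho> > 0" and Ai: "\<And>q. q < m \<Longrightarrow> mholo_base (Ai q) V"
    and T: "\<And>s. s < m - 1 \<Longrightarrow> mholo_base (T s) V"
    and a0: "\<And>b. b \<in> V \<Longrightarrow> msum (ad_mat (Ai (m - 1) b)) \<le> a0"
    and nonres: "\<And>(n::int) b. n \<noteq> 0 \<Longrightarrow> b \<in> V \<Longrightarrow> invertible (mat (of_int n) - ad_mat (Ai (m - 1) b))"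
    and slice: "\<And>b. b \<in> V \<Longrightarrow> slice0 e b \<in> V"
    and kry: "\<And>b. b \<in> V \<Longrightarrow> invertible (krylov h \<xi> (Ai (m - 1) b))"
    and B: "mhol B (ball 0 \<rho> \<times> V - Gam m e V)" and K: "mhol K (ball 0 \<rho> \<times> V - Gam m e V)"
    and cov: "\<And>p. p \<in> ball 0 \<rho> \<times> V - Gam m e V \<Longrightarrow> cov m e Ai B p =
      (\<Sum>s<m - 1. mscale (fst p ^ s) (T s (snd p))) + mscale ((snd p $ e) ^ m) (K p)"
  shows "\<exists>G X. sol_inf m e Ai V T G \<and> mhol X (ball 0 \<rho> \<times> V - Gam m e V) \<and>
    (\<forall>p\<in>ball 0 \<rho> \<times> V - Gam m e V. B p = inv_chart G p + mscale ((snd p $ e) ^ m) (X p))"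
proof -
  let ?\<Omega> = "ball 0 \<rho> \<times> V - Gam m e V"
  have \<Omega>: "open ?\<Omega>"
  proof -
    have "?\<Omega> = (ball 0 \<rho> \<times> UNIV) \<inter> (UNIV \<times> V - Gam m e V)" by auto
    then show ?thesis using open_Gam_compl[OF V] by (auto intro!: open_Int open_Times)
  qed
  have inv: "mhol (inv_chart G) ?\<Omega>" if "sol_inf m e Ai V S G" for S G
    using that mhol_subset[OF mhol_inv_chart[OF m], of G e V ?\<Omega>] unfolding sol_inf_def by blast
  have "n \<le> m \<Longrightarrow> \<exists>G X. sol_inf m e Ai V T G \<and> mhol X ?\<Omega> \<and>
      (\<forall>p\<in>?\<Omega>. B p = inv_chart G p + mscale ((snd p $ e) ^ n) (X p))" for n
  proof (induction n)
    \<comment> \<open>Any solution will do as a start; the value \<open>0\<close> at infinity lies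
      in every commutant.\<close>
    case 0
    have z: "mholo_base (\<lambda>_. 0) V" unfolding mholo_base_iff by (rule mhol_const)
    have c0: "commutator (Ai (m - 1) b) 0 = 0" for b by (simp add: commutator_def)
    obtain G where G: "sol_inf m e Ai V T G"
      using solution_at_infinity[where C = "\<lambda>_. 0" and e = e and m = m and V = V and Ai = Ai and T = T and ?a0.0 = a0,
        OF m V Ai T a0 nonres z c0] by blast
    have "mhol (\<lambda>p. B p - inv_chart G p) ?\<Omega>" by (intro mhol_diff B inv[OF G])
    then show ?case using G by (intro exI[of _ G] exI[of _ "\<lambda>p. B p - inv_chart G p"]) (auto simp: vec_eq_iff)
  next
    case (Suc n)
    then obtain G X where G: "sol_inf m e Ai V T G" and X: "mhol X ?\<Omega>"
      and BX: "\<And>p. p \<in> ?\<Omega> \<Longrightarrow> B p = inv_chart G p + mscale ((snd p $ e) ^ n) (X p)" by auto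
    define E where "E = (\<lambda>p. mscale ((snd p $ e) ^ (m - n)) (K p))"
    have Eh: "mhol E ?\<Omega>" unfolding E_def by (intro mhol_mscale hol_power hol_snd_nth K)
    \<comment> \<open>\<open>B\<close> and the solution satisfy the same equation up to
      \<open>\<epsilon> ^ m\<close>, so the quotient \<open>X\<close> of their difference by
      \<open>\<epsilon> ^ n\<close> is horizontal up to \<open>\<epsilon> ^ (m - n)\<close>.
      Cancelling \<open>\<epsilon> ^ n\<close> is possible off \<epsilon> = 0 and extends by
      density; as \<open>n < m\<close>, \<open>X\<close> is horizontal over \<epsilon> = 0.\<close>
    have covX: "cov m e Ai X p = E p" if p: "p \<in> ?\<Omega>" for p
    proof (rule coord_nonzero_dense[OF \<Omega> _ _ _ p, of _ _ "Some e"])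
      show "continuous_on ?\<Omega> (cov m e Ai X)"
        by (rule mhol_continuous[OF mhol_cov[OF \<Omega> _ Ai X]]) auto
      show "continuous_on ?\<Omega> E" by (rule mhol_continuous[OF Eh])
      fix q assume q: "q \<in> ?\<Omega>" "crd (Some e) q \<noteq> 0"
      have q': "q \<in> UNIV \<times> V - Gam m e V" using q by auto
      have "cov m e Ai B q = cov m e Ai (\<lambda>p. inv_chart G p + mscale ((snd p $ e) ^ n) (X p)) q"
        by (rule cov_cong[OF \<Omega> q(1) BX])
      also have "\<dots> = cov m e Ai (inv_chart G) q + mscale ((snd q $ e) ^ n) (cov m e Ai X q)"
        using cov_add[OF inv[OF G] _ q(1), of "\<lambda>p. mscale ((snd p $ e) ^ n) (X p)"] cov_mscale[OF X q(1)]
        by (simp add: mhol_mscale hol_power hol_snd_nth X)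
      finally have "mscale ((snd q $ e) ^ m) (K q) = mscale ((snd q $ e) ^ n) (cov m e Ai X q)"
        using cov[OF q(1)] G q' by (simp add: sol_inf_def)
      moreover have "(snd q $ e) ^ m = (snd q $ e) ^ n * (snd q $ e) ^ (m - n)"
        using Suc.prems by (simp add: power_add[symmetric])
      ultimately have "mscale ((snd q $ e) ^ n) (E q) = mscale ((snd q $ e) ^ n) (cov m e Ai X q)"
        by (simp add: E_def mscale_mscale)
      then show "cov m e Ai X q = E q" using q(2) by (simp add: vec_eq_iff)
    qed
    have "cov m e Ai X p = 0" if "p \<in> ?\<Omega>" "snd p $ e = 0" for p
      using covX[OF that(1)] that(2) Suc.prems by (simp add: E_def vec_eq_iff power_0_left)
    from matching_step[OF m V \<rho> Ai a0 nonres slice kry X this]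
    obtain G' X' where G': "sol_inf m e Ai V (\<lambda>_ _. 0) G'" and X': "mhol X' ?\<Omega>"
      and XX: "\<And>p. p \<in> ?\<Omega> \<Longrightarrow> X p = inv_chart G' p + mscale (snd p $ e) (X' p)" by blast
    have "B p = inv_chart (\<lambda>p. G p + mscale ((snd p $ e) ^ n) (G' p)) p + mscale ((snd p $ e) ^ Suc n) (X' p)"
      if "p \<in> ?\<Omega>" for p
      using BX[OF that] XX[OF that] by (simp add: inv_chart_def mscale_add mscale_mscale mult.commute add.assoc)
    then show ?case using sol_inf_add[OF m V G G'] X' by blast
  qed
  from this[OF order_refl] show ?thesis .
qed

section \<open>Congruences for Xi\<close>

definition mcong :: "'b::finite point set \<Rightarrow> ('b point \<Rightarrow> complex) \<Rightarrow> ('b point \<Rightarrow> complex ^ 'n ^ 'n) \<Rightarrow>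
    ('b point \<Rightarrow> complex ^ 'n ^ 'n) \<Rightarrow> bool"
  where "mcong U h F G \<longleftrightarrow> (\<exists>H. mhol H U \<and> (\<forall>p\<in>U. F p - G p = mscale (h p) (H p)))"

lemma cong_total_iff: "cong_total U h F G \<longleftrightarrow> mcong U (\<lambda>p. h (fst p) (snd p)) (\<lambda>p. F (fst p) (snd p)) (\<lambda>p. G (fst p) (snd p))"
proof
  assume "cong_total U h F G"
  then obtain H where "mholo_total H U" "\<forall>(z, b)\<in>U. F z b - G z b = mscale (h z b) (H z b)"
    unfolding cong_total_def by blast
  then show "mcong U (\<lambda>p. h (fst p) (snd p)) (\<lambda>p. F (fst p) (snd p)) (\<lambda>p. G (fst p) (snd p))"
    unfolding mcong_def mholo_total_iff by (intro exI[of _ "\<lambda>p. H (fst p) (snd p)"]) auto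
next
  assume "mcong U (\<lambda>p. h (fst p) (snd p)) (\<lambda>p. F (fst p) (snd p)) (\<lambda>p. G (fst p) (snd p))"
  then obtain H where "mhol H U" "\<forall>p\<in>U. F (fst p) (snd p) - G (fst p) (snd p) = mscale (h (fst p) (snd p)) (H p)"
    unfolding mcong_def by blast
  then show "cong_total U h F G"
    unfolding cong_total_def mholo_total_iff by (intro exI[of _ "\<lambda>z b. H (z, b)"]) auto
qed

lemma mcong_subset: "mcong U h F G \<Longrightarrow> V \<subseteq> U \<Longrightarrow> mcong V h F G"
  unfolding mcong_def by (meson mhol_subset subsetD)

lemma mcong_refl: "mcong U h F F"
  unfolding mcong_def by (intro exI[of _ "\<lambda>_. 0"]) (auto simp: mhol_const vec_eq_iff)

lemma mcong_trans:
  assumes "mcong U h F G" "mcong U h G K"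
  shows "mcong U h F K"
proof -
  obtain H H' where "mhol H U" "\<forall>p\<in>U. F p - G p = mscale (h p) (H p)" "mhol H' U" "\<forall>p\<in>U. G p - K p = mscale (h p) (H' p)"
    using assms unfolding mcong_def by blast
  then show ?thesis
    unfolding mcong_def by (intro exI[of _ "\<lambda>p. H p + H' p"]) (simp add: mhol_add mscale_add algebra_simps)
qed

lemma mcong_add:
  assumes "mcong U h F G" "mcong U h F' G'"
  shows "mcong U h (\<lambda>p. F p + F' p) (\<lambda>p. G p + G' p)"
proof -
  obtain H H' where "mhol H U" "\<forall>p\<in>U. F p - G p = mscale (h p) (H p)" "mhol H' U" "\<forall>p\<in>U. F' p - G' p = mscale (h p) (H' p)"
    using assms unfolding mcong_def by blast
  moreover from this have "F p + F' p - (G p + G' p) = mscale (h p) (H p + H' p)" if "p \<in> U" for p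
    using that unfolding mscale_add by (simp add: add_diff_add)
  ultimately show ?thesis
    unfolding mcong_def by (intro exI[of _ "\<lambda>p. H p + H' p"]) (simp add: mhol_add)
qed

lemma mcong_sum: "(\<And>i. i \<in> I \<Longrightarrow> mcong U h (F i) (G i)) \<Longrightarrow> mcong U h (\<lambda>p. \<Sum>i\<in>I. F i p) (\<lambda>p. \<Sum>i\<in>I. G i p)"
  by (induction I rule: infinite_finite_induct) (auto intro: mcong_refl mcong_add)

lemma mcong_mscale:
  assumes "mcong U h F G" "hol f U"
  shows "mcong U h (\<lambda>p. mscale (f p) (F p)) (\<lambda>p. mscale (f p) (G p))"
proof -
  obtain H where "mhol H U" "\<forall>p\<in>U. F p - G p = mscale (h p) (H p)"
    using assms unfolding mcong_def by blast
  then show ?thesis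
    unfolding mcong_def using assms(2)
    by (intro exI[of _ "\<lambda>p. mscale (f p) (H p)"]) (simp add: mhol_mscale mscale_diff[symmetric] mscale_mscale mult.commute)
qed

lemma matrix_mult_mscale: "mscale c A ** B = mscale c (A ** B)" "A ** mscale c B = mscale (c::complex) (A ** B)"
  by (simp_all add: vec_eq_iff matrix_matrix_mult_def sum_distrib_left mult_ac)

lemma matrix_mult_diff: "(A - B) ** C = A ** C - B ** C" "C ** (A - B) = C ** A - C ** B"
  for A B C :: "complex ^ 'n ^ 'n"
  by (simp_all add: vec_eq_iff matrix_matrix_mult_def algebra_simps sum_subtractf)

lemma mcong_mult:
  assumes "mcong U h F G" "mcong U h F' G'" "mhol F' U" "mhol G U"
  shows "mcong U h (\<lambda>p. F p ** F' p) (\<lambda>p. G p ** G' p)"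
proof -
  obtain H H' where H: "mhol H U" "\<forall>p\<in>U. F p - G p = mscale (h p) (H p)" "mhol H' U" "\<forall>p\<in>U. F' p - G' p = mscale (h p) (H' p)"
    using assms unfolding mcong_def by blast
  have "F p ** F' p - G p ** G' p = mscale (h p) (H p ** F' p + G p ** H' p)" if "p \<in> U" for p
  proof -
    have "F p ** F' p - G p ** G' p = (F p - G p) ** F' p + G p ** (F' p - G' p)"
      by (simp add: matrix_mult_diff)
    then show ?thesis using H that by (simp add: matrix_mult_mscale mscale_add)
  qed
  then show ?thesis
    unfolding mcong_def using H assms by (intro exI[of _ "\<lambda>p. H p ** F' p + G p ** H' p"]) (simp add: mhol_add mhol_mult)
qed

lemma mcong_mat_power:
  assumes "mcong U h F G" "mhol F U" "mhol G U"
  shows "mcong U h (\<lambda>p. mat_power (F p) n) (\<lambda>p. mat_power (G p) n)"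
proof (induction n)
  case 0
  show ?case by (simp add: mcong_refl)
next
  case (Suc n)
  show ?case
    unfolding mat_power_simps by (rule mcong_mult[OF assms(1) Suc mhol_mat_power[OF assms(2)] assms(3)])
qed

lemma mcong_eval_T:
  assumes "mcong U h F G" "mhol F U" "mhol G U" "\<And>i. i < CARD('r) \<Longrightarrow> hol (a i) U"
  shows "mcong U h (\<lambda>p. eval_T (\<lambda>i. a i p) (F p :: complex ^ 'r ^ 'r)) (\<lambda>p. eval_T (\<lambda>i. a i p) (G p))"
  unfolding eval_T_def by (intro mcong_sum mcong_mscale mcong_mat_power assms) auto

lemma mhol_eval_T:
  assumes "mhol F U" "\<And>i. i < CARD('r) \<Longrightarrow> hol (a i) U"
  shows "mhol (\<lambda>p. eval_T (\<lambda>i. a i p) (F p :: complex ^ 'r ^ 'r)) U"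
  unfolding eval_T_def by (intro mhol_sum mhol_mscale mhol_mat_power assms) auto

lemma conj_mat_power:
  fixes P :: "complex ^ 'r ^ 'r"
  assumes "invertible P"
  shows "mat_power (P ** M ** matrix_inv P) n = P ** mat_power M n ** matrix_inv P"
proof (induction n)
  case (Suc n)
  have "(P ** M ** matrix_inv P) ** (P ** mat_power M n ** matrix_inv P) =
      P ** M ** (matrix_inv P ** P) ** mat_power M n ** matrix_inv P"
    by (simp add: matrix_mul_assoc)
  then show ?case using assms by (simp add: Suc matrix_inv matrix_mul_assoc)
qed (simp add: matrix_inv assms)

lemma conj_eval_T:
  fixes P :: "complex ^ 'r ^ 'r"
  assumes "invertible P"
  shows "eval_T a (P ** M ** matrix_inv P) = P ** eval_T a M ** matrix_inv P"
proof -
  have s: "P ** (\<Sum>i\<in>I. F i) ** matrix_inv P = (\<Sum>i\<in>I. P ** F i ** matrix_inv P)" if "finite I"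
    for I :: "nat set" and F :: "nat \<Rightarrow> complex ^ 'r ^ 'r"
    using that by (induction I) (auto simp: matrix_add_ldistrib matrix_mult_add_rdistrib)
  show ?thesis
    unfolding eval_T_def conj_mat_power[OF assms] by (subst s) (auto simp: matrix_mult_mscale)
qed

lemma diag_mat_mult: "diag_mat d ** diag_mat d' = diag_mat (\<lambda>k. d k * d' k :: complex)"
proof -
  have "(diag_mat d ** M) $ i $ k = d i * M $ i $ k" for M :: "complex ^ 'a ^ 'a" and i k
  proof -
    have "(if i = j then d i else 0) * M $ j $ k = (if j = i then d i * M $ i $ k else 0)" for j by simp
    then show ?thesis by (simp add: matrix_matrix_mult_def diag_mat_def)
  qed
  then show ?thesis by (simp add: vec_eq_iff) (simp add: diag_mat_def)
qed

lemma diag_mat_power: "mat_power (diag_mat d) n = diag_mat (\<lambda>k. d k ^ n :: complex)"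
  by (induction n) (simp_all add: diag_mat_mult, simp add: diag_mat_def mat_def vec_eq_iff)

section \<open>Polynomials with holomorphic coefficients and the substitution for z^m\<close>

definition polyhol :: "(complex ^ 'b::finite) set \<Rightarrow> (complex ^ 'b \<Rightarrow> complex poly) \<Rightarrow> bool"
  where "polyhol V p \<longleftrightarrow> (\<exists>d. \<forall>b\<in>V. degree (p b) \<le> d) \<and> (\<forall>n. holo_base (\<lambda>b. coeff (p b) n) V)"

lemma holo_base_add: "holo_base f V \<Longrightarrow> holo_base g V \<Longrightarrow> holo_base (\<lambda>b. f b + g b) V"
  and holo_base_mult: "holo_base f V \<Longrightarrow> holo_base g V \<Longrightarrow> holo_base (\<lambda>b. f b * g b) V"
  and holo_base_const: "holo_base (\<lambda>b. c) V"
  and holo_base_sum: "(\<And>i. i \<in> I \<Longrightarrow> holo_base (F i) V) \<Longrightarrow> holo_base (\<lambda>b. \<Sum>i\<in>I. F i b) V"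
  unfolding holo_base_iff by (intro hol_intros; assumption)+

lemma polyhol_const: "polyhol V (\<lambda>b. p)"
  unfolding polyhol_def by (auto simp: holo_base_const)

lemma polyhol_monom: "holo_base f V \<Longrightarrow> polyhol V (\<lambda>b. monom (f b) q)"
proof -
  assume f: "holo_base f V"
  have "holo_base (\<lambda>b. if q = n then f b else 0) V" for n
    using f by (cases "q = n") (auto simp: holo_base_const)
  then show ?thesis unfolding polyhol_def using degree_monom_le by auto
qed

lemma polyhol_add: "polyhol V p \<Longrightarrow> polyhol V q \<Longrightarrow> polyhol V (\<lambda>b. p b + q b)"
proof -
  assume p: "polyhol V p" and q: "polyhol V q"
  obtain d d' where "\<forall>b\<in>V. degree (p b) \<le> d" "\<forall>b\<in>V. degree (q b) \<le> d'"
    using p q unfolding polyhol_def by blast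
  then have "\<forall>b\<in>V. degree (p b + q b) \<le> max d d'"
    by (meson degree_add_le max.coboundedI1 max.coboundedI2)
  then show ?thesis using p q unfolding polyhol_def by (auto intro: holo_base_add)
qed

lemma polyhol_mult: "polyhol V p \<Longrightarrow> polyhol V q \<Longrightarrow> polyhol V (\<lambda>b. p b * q b)"
proof -
  assume p: "polyhol V p" and q: "polyhol V q"
  obtain d d' where d: "\<forall>b\<in>V. degree (p b) \<le> d" "\<forall>b\<in>V. degree (q b) \<le> d'"
    using p q unfolding polyhol_def by blast
  have "\<forall>b\<in>V. degree (p b * q b) \<le> d + d'"
  proof
    fix b assume "b \<in> V"
    then have "degree (p b) + degree (q b) \<le> d + d'" using d by (intro add_mono) auto
    then show "degree (p b * q b) \<le> d + d'" using degree_mult_le[of "p b" "q b"] by linarith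
  qed
  then show ?thesis
    using p q unfolding polyhol_def coeff_mult by (auto intro!: holo_base_sum holo_base_mult)
qed

lemma polyhol_sum: "(\<And>i. i \<in> I \<Longrightarrow> polyhol V (F i)) \<Longrightarrow> polyhol V (\<lambda>b. \<Sum>i\<in>I. F i b)"
  by (induction I rule: infinite_finite_induct) (auto intro: polyhol_const polyhol_add)

lemma mpolyhol_mult:
  assumes "\<And>i k. polyhol V (\<lambda>b. X b $ i $ k)" "\<And>i k. polyhol V (\<lambda>b. Y b $ i $ k)"
  shows "polyhol V (\<lambda>b. (X b ** Y b) $ i $ k)"
  unfolding matrix_matrix_mult_def by (simp, intro polyhol_sum polyhol_mult assms)

lemma mpolyhol_power:
  fixes X :: "complex ^ 'b::finite \<Rightarrow> complex poly ^ 'r ^ 'r"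
  assumes "\<And>i k. polyhol V (\<lambda>b. X b $ i $ k)"
  shows "polyhol V (\<lambda>b. mat_power (X b) n $ i $ k)"
proof (induction n arbitrary: i k)
  case 0
  then show ?case by (simp add: polyhol_const)
next
  case (Suc n)
  then show ?case by (simp add: mpolyhol_mult assms)
qed

text \<open>Reduction replaces \<open>z ^ n\<close> by \<open>a ^ (n div m) * z ^ (n mod m)\<close>;
  the difference contains \<open>(z ^ m) ^ k - (\<epsilon> ^ m) ^ k\<close>, whose geometric
  factorisation supplies the quotient. The uniform degree bound in \<open>polyhol\<close> turns all
  sums into sums over a fixed range, whence holomorphy in the base.\<close>

lemma subst_zm_polyhol:
  fixes p :: "complex ^ 'b::finite \<Rightarrow> complex poly"
  assumes m: "m \<ge> 1" and V: "open V" and p: "polyhol V p"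
  shows "holo_base (\<lambda>b. coeff (subst_zm m ((b $ e) ^ m) (p b)) s) V"
    and "s \<ge> m \<Longrightarrow> coeff (subst_zm m a q) s = 0"
    and "\<exists>Q. hol Q (UNIV \<times> V) \<and> (\<forall>z. \<forall>b\<in>V. poly (p b) z - poly (subst_zm m ((b $ e) ^ m) (p b)) z = (z ^ m - (b $ e) ^ m) * Q (z, b))"
proof -
  obtain d where d: "\<And>b. b \<in> V \<Longrightarrow> degree (p b) \<le> d" using p unfolding polyhol_def by blast
  have ph: "hol (\<lambda>x. coeff (p (snd x)) n) (UNIV \<times> V)" for n using p unfolding polyhol_def holo_base_iff by blast
  have s: "subst_zm m a (p b) = (\<Sum>n\<le>d. monom (coeff (p b) n * a ^ (n div m)) (n mod m))" if "b \<in> V" for a b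
    unfolding subst_zm_def
    by (rule sum.mono_neutral_left) (use d[OF that] in \<open>auto simp: coeff_eq_0\<close>)
  define F where "F = (\<lambda>b. \<Sum>n\<le>d. if n mod m = s then coeff (p b) n * ((b $ e) ^ m) ^ (n div m) else 0)"
  have Fh: "hol (\<lambda>x. F (snd x)) (UNIV \<times> V)"
    unfolding F_def
  proof (rule hol_sum)
    fix n
    show "hol (\<lambda>x. if n mod m = s then coeff (p (snd x)) n * ((snd x $ e) ^ m) ^ (n div m) else 0) (UNIV \<times> V)"
      by (cases "n mod m = s") (auto intro!: hol_mult hol_power hol_snd_nth ph)
  qed
  have cF: "F b = coeff (subst_zm m ((b $ e) ^ m) (p b)) s" if "b \<in> V" for b
    unfolding s[OF that] F_def coeff_sum by (rule sum.cong) auto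
  show "holo_base (\<lambda>b. coeff (subst_zm m ((b $ e) ^ m) (p b)) s) V"
    unfolding holo_base_iff by (rule hol_cong[OF open_Times[OF open_UNIV V] Fh]) (use cF in auto)
  show "s \<ge> m \<Longrightarrow> coeff (subst_zm m a q) s = 0"
  proof -
    assume sm: "s \<ge> m"
    have "n mod m \<noteq> s" for n using mod_less_divisor[of m n] m sm by linarith
    then show ?thesis unfolding subst_zm_def coeff_sum by (simp add: sum.neutral)
  qed
  define Q where "Q = (\<lambda>x::'b point. \<Sum>n\<le>d. coeff (p (snd x)) n * fst x ^ (n mod m) *
     (\<Sum>i<n div m. ((snd x $ e) ^ m) ^ (n div m - Suc i) * (fst x ^ m) ^ i))"
  have Qh: "hol Q (UNIV \<times> V)"
    unfolding Q_def by (intro hol_sum hol_mult hol_power hol_fst hol_snd_nth ph)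
  have "poly (p b) z - poly (subst_zm m ((b $ e) ^ m) (p b)) z = (z ^ m - (b $ e) ^ m) * Q (z, b)" if b: "b \<in> V" for z b
  proof -
    have pz: "poly (p b) z = (\<Sum>n\<le>d. coeff (p b) n * z ^ n)"
      unfolding poly_altdef by (rule sum.mono_neutral_left) (use d[OF b] in \<open>auto simp: coeff_eq_0\<close>)
    have ps: "poly (subst_zm m ((b $ e) ^ m) (p b)) z = (\<Sum>n\<le>d. coeff (p b) n * ((b $ e) ^ m) ^ (n div m) * z ^ (n mod m))"
      unfolding s[OF b] poly_sum poly_monom ..
    have "poly (p b) z - poly (subst_zm m ((b $ e) ^ m) (p b)) z =
        (\<Sum>n\<le>d. coeff (p b) n * z ^ (n mod m) * ((z ^ m) ^ (n div m) - ((b $ e) ^ m) ^ (n div m)))"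
      unfolding pz ps sum_subtractf[symmetric]
    proof (intro sum.cong refl)
      fix n
      have "z ^ n = z ^ (n mod m) * (z ^ m) ^ (n div m)"
        by (metis mult.commute div_mult_mod_eq power_add power_mult)
      then show "coeff (p b) n * z ^ n - coeff (p b) n * ((b $ e) ^ m) ^ (n div m) * z ^ (n mod m) =
          coeff (p b) n * z ^ (n mod m) * ((z ^ m) ^ (n div m) - ((b $ e) ^ m) ^ (n div m))"
        by (simp add: algebra_simps)
    qed
    also have "\<dots> = (z ^ m - (b $ e) ^ m) * Q (z, b)"
      unfolding Q_def sum_distrib_left power_diff_sumr2
      by (rule sum.cong) (simp_all add: mult_ac sum_distrib_left)
    finally show ?thesis .
  qed
  then show "\<exists>Q. hol Q (UNIV \<times> V) \<and> (\<forall>z. \<forall>b\<in>V. poly (p b) z - poly (subst_zm m ((b $ e) ^ m) (p b)) z = (z ^ m - (b $ e) ^ m) * Q (z, b))"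
    using Qh by blast
qed

lemma mpoly_eval_mult: "mpoly_eval (X ** Y) z = mpoly_eval X z ** mpoly_eval Y z"
  by (simp add: mpoly_eval_def matrix_matrix_mult_def vec_eq_iff poly_sum)

lemma mpoly_eval_mscale: "mpoly_eval (mscale p X) z = mscale (poly p z) (mpoly_eval X z)"
  by (simp add: mpoly_eval_def vec_eq_iff)

lemma mpoly_eval_sum: "mpoly_eval (\<Sum>i\<in>I. F i) z = (\<Sum>i\<in>I. mpoly_eval (F i) z)"
  by (simp add: mpoly_eval_def vec_eq_iff poly_sum)

lemma mpoly_eval_power: "mpoly_eval (mat_power X n) z = mat_power (mpoly_eval X z) n"
proof (induction n)
  case 0
  show ?case by (auto simp: mpoly_eval_def vec_eq_iff mat_def)
qed (simp add: mpoly_eval_mult)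

lemma Xi_properties:
  fixes Ai :: "nat \<Rightarrow> complex ^ 'b::finite \<Rightarrow> complex ^ 'r::finite ^ 'r"
  assumes m: "m \<ge> 1" and V: "open V" and Ai: "\<And>q. q < m \<Longrightarrow> mholo_base (Ai q) V"
    and \<psi>: "\<And>i q. i < CARD('r) \<Longrightarrow> q < m \<Longrightarrow> holo_base (\<psi> i q) V"
  shows "mholo_base (\<lambda>b. mcoeff (Xi m e \<psi> Ai l j b) s) V"
    and "mpoly_eval (Xi m e \<psi> Ai l j b) z = (\<Sum>s<m. mscale (z ^ s) (mcoeff (Xi m e \<psi> Ai l j b) s))"
    and "mcong (UNIV \<times> V) (\<lambda>p. fst p ^ m - (snd p $ e) ^ m)
      (\<lambda>p. mscale (fst p ^ j) (mat_power (eval_T (\<lambda>i. \<Sum>q<m. \<psi> i q (snd p) * fst p ^ q) (Ainf_fun m Ai (fst p) (snd p))) l))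
      (\<lambda>p. mpoly_eval (Xi m e \<psi> Ai l j (snd p)) (fst p))"
proof -
  define Ap where "Ap = (\<lambda>b. \<chi> i k. \<Sum>q<m. monom (Ai q b $ i $ k) q)"
  define M where "M = (\<lambda>b. mscale (monom 1 j) (mat_power (eval_T (\<lambda>i. \<Sum>q<m. monom (\<psi> i q b) q) (Ap b)) l))"
  have Xi: "Xi m e \<psi> Ai l j b $ i $ k = subst_zm m ((b $ e) ^ m) (M b $ i $ k)" for b i k
    by (simp add: Xi_def Let_def M_def Ap_def)
  have Aph: "polyhol V (\<lambda>b. Ap b $ i $ k)" for i k
    unfolding Ap_def using Ai by (auto simp: mholo_base_def intro!: polyhol_sum polyhol_monom)
  have Th: "polyhol V (\<lambda>b. eval_T (\<lambda>i. \<Sum>q<m. monom (\<psi> i q b) q) (Ap b) $ i $ k)" for i k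
    unfolding eval_T_def using \<psi>
    by (auto intro!: polyhol_sum polyhol_mult polyhol_monom mpolyhol_power Aph)
  have Mh: "polyhol V (\<lambda>b. M b $ i $ k)" for i k
    unfolding M_def by (simp, intro polyhol_mult polyhol_const mpolyhol_power Th)
  show "mholo_base (\<lambda>b. mcoeff (Xi m e \<psi> Ai l j b) s) V"
    unfolding mholo_base_def mcoeff_def using subst_zm_polyhol(1)[OF m V Mh] by (simp add: Xi)
  show "mpoly_eval (Xi m e \<psi> Ai l j b) z = (\<Sum>s<m. mscale (z ^ s) (mcoeff (Xi m e \<psi> Ai l j b) s))"
  proof -
    have "poly p z = (\<Sum>s<m. z ^ s * coeff p s)" if "\<And>s. s \<ge> m \<Longrightarrow> coeff p s = 0" for p :: "complex poly"
    proof -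
      have "poly p z = (\<Sum>s\<le>degree p. coeff p s * z ^ s)" by (rule poly_altdef)
      also have "\<dots> = (\<Sum>s\<in>{..degree p} \<inter> {..<m}. coeff p s * z ^ s)"
        by (rule sum.mono_neutral_right) (use that in \<open>auto simp: not_less\<close>)
      also have "\<dots> = (\<Sum>s<m. coeff p s * z ^ s)"
        by (rule sum.mono_neutral_left) (auto simp: coeff_eq_0)
      finally show ?thesis by (simp add: mult.commute)
    qed
    then show ?thesis
      using subst_zm_polyhol(2)[OF m V Mh] by (simp add: mpoly_eval_def mcoeff_def vec_eq_iff Xi)
  qed
  have eA: "mpoly_eval (Ap b) z = Ainf_fun m Ai z b" for b z
    by (simp add: mpoly_eval_def Ap_def Ainf_fun_def vec_eq_iff poly_sum poly_monom mult.commute)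
  have eM: "mpoly_eval (M b) z = mscale (z ^ j) (mat_power (eval_T (\<lambda>i. \<Sum>q<m. \<psi> i q b * z ^ q) (Ainf_fun m Ai z b)) l)" for b z
    by (simp add: M_def eval_T_def mpoly_eval_mscale mpoly_eval_power mpoly_eval_sum eA poly_sum poly_monom)
  have "\<exists>Q. hol Q (UNIV \<times> V) \<and> (\<forall>z. \<forall>b\<in>V. poly (M b $ i $ k) z - poly (Xi m e \<psi> Ai l j b $ i $ k) z =
      (z ^ m - (b $ e) ^ m) * Q (z, b))" for i k
    unfolding Xi by (rule subst_zm_polyhol(3)[OF m V Mh])
  then obtain Q where Q: "\<And>i k. hol (Q i k) (UNIV \<times> V)"
    "\<And>i k z b. b \<in> V \<Longrightarrow> poly (M b $ i $ k) z - poly (Xi m e \<psi> Ai l j b $ i $ k) z = (z ^ m - (b $ e) ^ m) * Q i k (z, b)"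
    by metis
  show "mcong (UNIV \<times> V) (\<lambda>p. fst p ^ m - (snd p $ e) ^ m)
      (\<lambda>p. mscale (fst p ^ j) (mat_power (eval_T (\<lambda>i. \<Sum>q<m. \<psi> i q (snd p) * fst p ^ q) (Ainf_fun m Ai (fst p) (snd p))) l))
      (\<lambda>p. mpoly_eval (Xi m e \<psi> Ai l j (snd p)) (fst p))"
    unfolding mcong_def eM[symmetric]
    by (rule exI[of _ "\<lambda>p. \<chi> i k. Q i k p"]) (auto simp: mhol_def Q mpoly_eval_def vec_eq_iff)
qed

text \<open>Along the divisor \<open>Ainf_fun\<close> is conjugate by \<open>P\<close> to
  \<open>N\<close>, which \<open>\<psi>\<close> maps to the diagonal matrix of the
  \<open>\<mu> k\<close>. Polynomials commute with conjugation, so the \<open>l\<close>-th power of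
  \<open>\<psi>\<close> at \<open>Ainf_fun\<close> becomes that of \<open>\<mu>\<close>, and
  reducing \<open>z ^ m\<close> to \<open>\<epsilon> ^ m\<close> changes nothing along the
  divisor.\<close>

lemma Xi_cong_diagonal:
  fixes Ai :: "nat \<Rightarrow> complex ^ 'b::finite \<Rightarrow> complex ^ 'r::finite ^ 'r" and P :: "'b point \<Rightarrow> complex ^ 'r ^ 'r"
  assumes m: "m \<ge> 1" and V: "open V" and U: "open U" "U \<subseteq> UNIV \<times> V"
    and Ai: "\<And>q. q < m \<Longrightarrow> mholo_base (Ai q) V"
    and \<psi>: "\<And>i q. i < CARD('r) \<Longrightarrow> q < m \<Longrightarrow> holo_base (\<psi> i q) V"
    and P: "mhol P U" "\<And>p. p \<in> U \<Longrightarrow> invertible (P p)"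
    and N: "mhol N U"
    and AN: "mcong U (\<lambda>p. fst p ^ m - (snd p $ e) ^ m) (\<lambda>p. matrix_inv (P p) ** Ainf_fun m Ai (fst p) (snd p) ** P p) N"
    and inv: "mcong U (\<lambda>p. fst p ^ m - (snd p $ e) ^ m) (\<lambda>p. eval_T (\<lambda>i. \<Sum>q<m. \<psi> i q (snd p) * fst p ^ q) (N p)) (\<lambda>p. diag_mat \<mu>)"
  shows "mcong U (\<lambda>p. fst p ^ m - (snd p $ e) ^ m)
    (\<lambda>p. P p ** diag_mat (\<lambda>k. \<mu> k ^ l * fst p ^ j) ** matrix_inv (P p))
    (\<lambda>p. mpoly_eval (Xi m e \<psi> Ai l j (snd p)) (fst p))"
proof -
  let ?c = "\<lambda>p::'b point. fst p ^ m - (snd p $ e) ^ m"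
  let ?A = "\<lambda>p. Ainf_fun m Ai (fst p) (snd p)"
  let ?a = "\<lambda>i p. \<Sum>q<m. \<psi> i q (snd p) * fst p ^ q"
  have Pi: "mhol (\<lambda>p. matrix_inv (P p)) U" by (rule mhol_matrix_inv[OF U(1) P])
  have Ah: "mhol ?A U" by (rule mhol_subset[OF mhol_Ainf[OF Ai] U(2)]) auto
  have ah: "hol (?a i) U" if "i < CARD('r)" for i
  proof (intro hol_sum hol_mult hol_power hol_fst)
    fix q assume "q \<in> {..<m}"
    then show "hol (\<lambda>p. \<psi> i q (snd p)) U"
      using \<psi>[OF that, of q] U(2) hol_subset unfolding holo_base_iff by blast
  qed
  have mc: "mcong U ?c F G \<Longrightarrow> (\<And>p. p \<in> U \<Longrightarrow> F p = F' p) \<Longrightarrow> (\<And>p. p \<in> U \<Longrightarrow> G p = G' p) \<Longrightarrow> mcong U ?c F' G'"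
    for F G F' G' :: "'b point \<Rightarrow> complex ^ 'r ^ 'r"
    unfolding mcong_def by metis
  have sand: "mcong U ?c (\<lambda>p. P p ** F p ** matrix_inv (P p)) (\<lambda>p. P p ** G p ** matrix_inv (P p))"
    if "mcong U ?c F G" "mhol F U" "mhol G U" for F G
    by (intro mcong_mult mcong_refl mhol_mult that P Pi)
  have 1: "mcong U ?c ?A (\<lambda>p. P p ** N p ** matrix_inv (P p))"
  proof (rule mc[OF sand[OF AN _ N]])
    show "mhol (\<lambda>p. matrix_inv (P p) ** ?A p ** P p) U" by (intro mhol_mult Pi Ah P)
    fix p assume p: "p \<in> U"
    have "P p ** (matrix_inv (P p) ** ?A p ** P p) ** matrix_inv (P p) =
        (P p ** matrix_inv (P p)) ** ?A p ** (P p ** matrix_inv (P p))"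
      by (simp add: matrix_mul_assoc)
    then show "P p ** (matrix_inv (P p) ** ?A p ** P p) ** matrix_inv (P p) = ?A p"
      by (simp add: matrix_inv P(2)[OF p])
  qed auto
  have Nh: "mhol (\<lambda>p. P p ** N p ** matrix_inv (P p)) U" by (intro mhol_mult P Pi N)
  have 2: "mcong U ?c (\<lambda>p. eval_T (\<lambda>i. ?a i p) (?A p)) (\<lambda>p. eval_T (\<lambda>i. ?a i p) (P p ** N p ** matrix_inv (P p)))"
    by (rule mcong_eval_T[OF 1 Ah Nh ah])
  have TN: "mhol (\<lambda>p. eval_T (\<lambda>i. ?a i p) (N p)) U" by (rule mhol_eval_T[OF N ah])
  have 3: "mcong U ?c (\<lambda>p. eval_T (\<lambda>i. ?a i p) (P p ** N p ** matrix_inv (P p))) (\<lambda>p. P p ** diag_mat \<mu> ** matrix_inv (P p))"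
    by (rule mc[OF sand[OF inv TN mhol_const]]) (simp_all add: conj_eval_T P(2))
  have TA: "mhol (\<lambda>p. eval_T (\<lambda>i. ?a i p) (?A p)) U" by (rule mhol_eval_T[OF Ah ah])
  have PD: "mhol (\<lambda>p. P p ** diag_mat \<mu> ** matrix_inv (P p)) U" by (intro mhol_mult P Pi mhol_const)
  have 4: "mcong U ?c (\<lambda>p. mscale (fst p ^ j) (mat_power (eval_T (\<lambda>i. ?a i p) (?A p)) l))
      (\<lambda>p. mscale (fst p ^ j) (mat_power (P p ** diag_mat \<mu> ** matrix_inv (P p)) l))"
    by (intro mcong_mscale mcong_mat_power mcong_trans[OF 2 3] TA PD hol_power hol_fst)
  have sym: "mcong U ?c G F" if FG: "mcong U ?c F G" for F G :: "'b point \<Rightarrow> complex ^ 'r ^ 'r"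
  proof -
    obtain H where H: "mhol H U" "\<forall>p\<in>U. F p - G p = mscale (?c p) (H p)" using FG unfolding mcong_def by blast
    have "G p - F p = mscale (?c p) (- H p)" if "p \<in> U" for p
    proof -
      have "G p - F p = - (F p - G p)" by simp
      also have "\<dots> = mscale (?c p) (- H p)" unfolding bspec[OF H(2) that] by (simp add: vec_eq_iff)
      finally show ?thesis .
    qed
    then show ?thesis unfolding mcong_def using H(1) by (intro exI[of _ "\<lambda>p. - H p"]) (simp add: mhol_uminus)
  qed
  have "mscale (fst p ^ j) (mat_power (P p ** diag_mat \<mu> ** matrix_inv (P p)) l) =
      P p ** diag_mat (\<lambda>k. \<mu> k ^ l * fst p ^ j) ** matrix_inv (P p)" if "p \<in> U" for p
  proof -
    have "diag_mat (\<lambda>k. \<mu> k ^ l * fst p ^ j) = mscale (fst p ^ j) (diag_mat (\<lambda>k. \<mu> k ^ l))"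
      by (simp add: vec_eq_iff diag_mat_def)
    then show ?thesis by (simp add: conj_mat_power P(2)[OF that] diag_mat_power matrix_mult_mscale)
  qed
  then have 5: "mcong U ?c (\<lambda>p. P p ** diag_mat (\<lambda>k. \<mu> k ^ l * fst p ^ j) ** matrix_inv (P p))
      (\<lambda>p. mscale (fst p ^ j) (mat_power (eval_T (\<lambda>i. ?a i p) (?A p)) l))"
    by (intro mc[OF sym[OF 4]]) auto
  have 6: "mcong U ?c (\<lambda>p. mscale (fst p ^ j) (mat_power (eval_T (\<lambda>i. ?a i p) (?A p)) l))
      (\<lambda>p. mpoly_eval (Xi m e \<psi> Ai l j (snd p)) (fst p))"
    by (rule mcong_subset[OF Xi_properties(3)[where Ai = Ai and \<psi> = \<psi> and e = e, OF m V Ai \<psi>] U(2)])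
  show ?thesis by (rule mcong_trans[OF 5 6])
qed

section \<open>Coefficients as contour integrals\<close>

lemma hol_fix_fst:
  fixes f :: "'b::finite point \<Rightarrow> complex"
  assumes "hol f W" "\<And>p. p \<in> U \<Longrightarrow> (c, snd p) \<in> W"
  shows "hol (\<lambda>p. f (c, snd p)) U"
proof (rule hol_compose[OF assms(1)])
  fix p :: "'b point" and k
  show "\<exists>g k'. g field_differentiable at 0 \<and> g 0 = 0 \<and>
     (\<forall>\<^sub>F t in nhds 0. (c, snd (p + dir k t)) = (c, snd p) + dir k' (g t))"
  proof (cases k)
    case None
    then show ?thesis by (intro exI[of _ "\<lambda>_. 0"] exI[of _ k]) (simp add: dir_simps)
  next
    case (Some i)
    then show ?thesis by (intro exI[of _ "\<lambda>t. t"] exI[of _ k]) (simp add: dir_simps)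
  qed
qed (use assms in \<open>auto intro!: continuous_intros\<close>)

lemma monomial_contour_integral:
  assumes "r > 0"
  shows "((\<lambda>u. u ^ k / u ^ Suc s) has_contour_integral (if k = s then 2 * pi * \<i> else 0)) (circlepath 0 r)"
proof -
  have "(deriv ^^ s) (\<lambda>u. u ^ k) 0 = (if k = s then fact s else 0 :: complex)"
  proof -
    have "(deriv ^^ s) (\<lambda>u. u ^ k) 0 = pochhammer (of_nat (Suc k - s)) s * (0::complex) ^ (k - s)"
      using higher_deriv_power[of s "0::complex" k 0] by simp
    also have "\<dots> = (if k = s then fact s else 0)"
      by (cases "k < s") (auto simp: pochhammer_fact pochhammer_0_left power_0_left)
    finally show ?thesis .
  qed
  then have "2 * pi * \<i> / fact s * (deriv ^^ s) (\<lambda>u. u ^ k) 0 = (if k = s then 2 * pi * \<i> else 0)"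
    by simp
  moreover have "((\<lambda>u. u ^ k / (u - 0) ^ Suc s) has_contour_integral
      2 * pi * \<i> / fact s * (deriv ^^ s) (\<lambda>u. u ^ k) 0) (circlepath 0 r)"
    by (rule Cauchy_has_contour_integral_higher_derivative_circlepath)
      (use assms in \<open>auto intro!: continuous_intros holomorphic_intros\<close>)
  ultimately show ?thesis by (simp only: diff_zero)
qed

text \<open>The coefficients of the polynomial are Cauchy integrals over a fixed circle. The term
  \<open>z ^ m * g b z\<close> has no coefficient below \<open>m\<close>, so what remains is
  \<open>\<eta> b\<close> times a Laurent coefficient of \<open>H\<close>. Joint holomorphy matters
  only for \<open>H\<close>, and only on the circle; \<open>g\<close> has to be holomorphic in z for
  each \<open>b\<close>.\<close>

lemma coefficients_divisible:
  fixes Q :: "nat \<Rightarrow> complex ^ 'b::finite \<Rightarrow> complex" and H :: "'b point \<Rightarrow> complex"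
  assumes V: "open V" and \<rho>: "\<rho> > 0" and H: "hol H (ball 0 \<rho> \<times> V - {p. fst p = 0})"
    and g: "\<And>b. b \<in> V \<Longrightarrow> g b holomorphic_on ball 0 \<rho>"
    and eq: "\<And>z b. b \<in> V \<Longrightarrow> z \<noteq> 0 \<Longrightarrow> cmod z < \<rho> \<Longrightarrow> (\<Sum>k<m. z ^ k * Q k b) = z ^ m * g b z + \<eta> b * H (z, b)"
    and s: "s < m"
  shows "\<exists>M. holo_base M V \<and> (\<forall>b\<in>V. Q s b = \<eta> b * M b)"
proof -
  define r where "r = \<rho> / 2"
  have r: "r > 0" "r < \<rho>" using \<rho> by (auto simp: r_def)
  let ?c = "circlepath 0 r"
  have cn: "cmod (?c t) = r" for t
    using r by (simp add: circlepath_def part_circlepath_def norm_mult)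
  then have c0: "?c t \<noteq> 0" for t using r by (metis norm_zero less_irrefl)
  define M where "M = (\<lambda>b. contour_integral ?c (\<lambda>z. H (z, b) / z ^ Suc s) / (2 * pi * \<i>))"
  have "hol (\<lambda>p::'b point. integral {0..1} (\<lambda>t. H (?c t, snd p) / ?c t ^ Suc s * (2 * pi * \<i> * r * exp (2 * of_real pi * \<i> * t)))) (UNIV \<times> V)"
  proof (rule hol_integral)
    show "open (UNIV \<times> V)" using V by (intro open_Times) auto
    have cc: "continuous_on A ?c" for A
      unfolding circlepath_def part_circlepath_def linepath_def by (intro continuous_intros)
    have a: "continuous_on ({0..1} \<times> UNIV \<times> V) (\<lambda>x::real \<times> 'b point. H (?c (fst x), snd (snd x)))"
      by (rule continuous_on_compose2[OF hol_continuous[OF H]])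
        (use cn c0 r in \<open>auto intro!: continuous_intros continuous_on_compose2[OF cc[of UNIV]]\<close>)
    have b: "continuous_on ({0..1} \<times> UNIV \<times> V) (\<lambda>x::real \<times> 'b point. ?c (fst x))"
      by (rule continuous_on_compose2[OF cc[of UNIV]]) (auto intro!: continuous_intros)
    have d: "continuous_on ({0..1} \<times> UNIV \<times> V) (\<lambda>x::real \<times> 'b point. H (?c (fst x), snd (snd x)) / ?c (fst x) ^ Suc s)"
      by (rule continuous_on_divide[OF a continuous_on_power[OF b]]) (use c0 in simp)
    show "continuous_on ({0..1} \<times> UNIV \<times> V)
        (\<lambda>(t, p::'b point). H (?c t, snd p) / ?c t ^ Suc s * (2 * pi * \<i> * r * exp (2 * of_real pi * \<i> * t)))"
      unfolding case_prod_beta by (rule continuous_on_mult[OF d]) (intro continuous_intros)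
    fix t :: real
    show "hol (\<lambda>p::'b point. H (?c t, snd p) / ?c t ^ Suc s * (2 * pi * \<i> * r * exp (2 * of_real pi * \<i> * t))) (UNIV \<times> V)"
      by (intro hol_mult hol_divide hol_const hol_fix_fst[OF H]) (use cn c0 r in auto)
  qed
  then have "hol (\<lambda>p::'b point. M (snd p)) (UNIV \<times> V)"
    unfolding M_def contour_integral_circlepath_0 by (intro hol_divide hol_const) auto
  moreover have "Q s b = \<eta> b * M b" if b: "b \<in> V" for b
  proof -
    have "((\<lambda>z. \<Sum>k<m. Q k b * (z ^ k / z ^ Suc s)) has_contour_integral (\<Sum>k<m. Q k b * (if k = s then 2 * pi * \<i> else 0))) ?c"
      by (intro has_contour_integral_sum has_contour_integral_lmul monomial_contour_integral r(1)) auto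
    then have 1: "((\<lambda>z. \<Sum>k<m. Q k b * (z ^ k / z ^ Suc s)) has_contour_integral Q s b * (2 * pi * \<i>)) ?c"
      using s by (simp add: if_distrib sum.delta cong: if_cong)
    have 2: "((\<lambda>z. z ^ (m - Suc s) * g b z) has_contour_integral 0) ?c"
      by (rule Cauchy_theorem_convex_simple[of _ "ball 0 \<rho>"])
        (use g[OF b] r cn in \<open>auto intro!: holomorphic_intros simp: path_image_def\<close>)
    have "((\<lambda>z. \<eta> b * (H (z, b) / z ^ Suc s)) has_contour_integral Q s b * (2 * pi * \<i>) - 0) ?c"
    proof (rule has_contour_integral_eq[OF has_contour_integral_diff[OF 1 2]])
      fix z assume "z \<in> path_image ?c"
      then have z: "z \<noteq> 0" "cmod z < \<rho>" using c0 cn r by (auto simp: path_image_def)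
      have "(\<Sum>k<m. Q k b * (z ^ k / z ^ Suc s)) = (\<Sum>k<m. z ^ k * Q k b) / z ^ Suc s"
        by (simp add: sum_divide_distrib mult.commute)
      moreover have "z ^ (m - Suc s) = z ^ m / z ^ Suc s"
        using z s by (simp add: power_diff del: power_Suc)
      ultimately show "(\<Sum>k<m. Q k b * (z ^ k / z ^ Suc s)) - z ^ (m - Suc s) * g b z = \<eta> b * (H (z, b) / z ^ Suc s)"
        using eq[OF b z] by (simp add: add_divide_distrib del: power_Suc)
    qed
    then have c: "contour_integral ?c (\<lambda>z. \<eta> b * (H (z, b) / z ^ Suc s)) = Q s b * (2 * pi * \<i>)"
      using contour_integral_unique by fastforce
    have "contour_integral ?c (\<lambda>z. \<eta> b * (H (z, b) / z ^ Suc s)) = \<eta> b * contour_integral ?c (\<lambda>z. H (z, b) / z ^ Suc s)"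
      unfolding contour_integral_circlepath_0 integral_mult_right[symmetric] by (simp only: mult.assoc)
    with c show ?thesis by (simp add: M_def field_simps)
  qed
  ultimately show ?thesis unfolding holo_base_iff by blast
qed

lemma mcoefficients_divisible:
  fixes Q :: "nat \<Rightarrow> complex ^ 'b::finite \<Rightarrow> complex ^ 'r ^ 'r" and H :: "'b point \<Rightarrow> complex ^ 'r ^ 'r"
  assumes V: "open V" and \<rho>: "\<rho> > 0" and H: "mhol H (ball 0 \<rho> \<times> V - {p. fst p = 0})"
    and g: "\<And>b i k. b \<in> V \<Longrightarrow> (\<lambda>z. g b z $ i $ k) holomorphic_on ball 0 \<rho>"
    and eq: "\<And>z b. b \<in> V \<Longrightarrow> z \<noteq> 0 \<Longrightarrow> cmod z < \<rho> \<Longrightarrow>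
      (\<Sum>k<m. mscale (z ^ k) (Q k b)) = mscale (z ^ m) (g b z) + mscale (\<eta> b) (H (z, b))"
    and s: "s < m"
  shows "\<exists>M. mholo_base M V \<and> (\<forall>b\<in>V. Q s b = mscale (\<eta> b) (M b))"
proof -
  have "\<exists>M. holo_base M V \<and> (\<forall>b\<in>V. Q s b $ i $ k = \<eta> b * M b)" for i k
  proof (rule coefficients_divisible[OF V \<rho> _ g[of _ i k] _ s])
    show "hol (\<lambda>p. H p $ i $ k) (ball 0 \<rho> \<times> V - {p. fst p = 0})" using H by (simp add: mhol_def)
    fix z b assume "b \<in> V" "z \<noteq> 0" "cmod z < \<rho>"
    from arg_cong[OF eq[OF this], of "\<lambda>X. X $ i $ k"]
    show "(\<Sum>k'<m. z ^ k' * Q k' b $ i $ k) = z ^ m * g b z $ i $ k + \<eta> b * H (z, b) $ i $ k"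
      by simp
  qed
  then obtain M where "\<And>i k. holo_base (M i k) V" "\<And>i k b. b \<in> V \<Longrightarrow> Q s b $ i $ k = \<eta> b * M i k b"
    by metis
  then show ?thesis
    by (intro exI[of _ "\<lambda>b. \<chi> i k. M i k b"]) (auto simp: mholo_base_def vec_eq_iff)
qed

section \<open>Nonresonance near the origin\<close>

text \<open>Only the fibre over the origin of the base enters: there \<epsilon> = 0, and
  \<open>z = 0\<close> is the single finite pole. Persistence nearby is a separate open
  condition.\<close>

lemma residue_nonresonant:
  fixes Ai :: "nat \<Rightarrow> complex ^ 'b::finite \<Rightarrow> complex ^ 'r::finite ^ 'r"
  assumes m: "m \<ge> 1" and loop: "loop_family m e \<gamma> W" and mono: "distinct_monodromy m e \<gamma> A"
    and V: "0 \<in> V" and ext: "extends_to_P1 m e A V Ai"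
  shows "\<exists>(\<alpha> :: 'r \<Rightarrow> complex) v. (\<forall>k. v k \<noteq> 0 \<and> Ai (m - 1) 0 *v v k = \<alpha> k *s v k) \<and> (\<forall>k l. k \<noteq> l \<longrightarrow> \<alpha> k - \<alpha> l \<notin> \<int>)"
proof (cases "CARD('r) \<ge> 2")
  case True
  have 0: "0 \<in> (polydisc :: (complex ^ 'b) set)" by (simp add: polydisc_def)
  obtain d :: "'r \<Rightarrow> complex ^ 'b \<Rightarrow> complex" where d: "inj (\<lambda>k. d k 0)"
    and mm: "monodromy_matrix m ((0 :: complex ^ 'b) $ e) (\<lambda>z. A z 0) (\<lambda>t. \<gamma> t 0) (diag_mat (\<lambda>k. d k 0))"
    using mono 0 unfolding distinct_monodromy_def by metis
  then obtain Y where Y: "horizontal_along m 0 (\<lambda>z. A z 0) (\<lambda>t. \<gamma> t 0) Y" "invertible (Y 0)"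
     "Y 1 = Y 0 ** diag_mat (\<lambda>k. d k 0)"
    unfolding monodromy_matrix_def by auto
  obtain Q where Q: "mholo_total Q (ball 0 1 \<times> V)" "\<And>z b. z \<in> ball 0 1 \<Longrightarrow> b \<in> V \<Longrightarrow> invertible (Q z b)"
    "\<And>b. b \<in> V \<Longrightarrow> horizontal_hom m (b $ e) (ball 0 1) (\<lambda>z. A z b) (\<lambda>z. Ainf_fun m Ai z b) (\<lambda>z. Q z b)"
    using ext unfolding extends_to_P1_def by blast
  have g: "\<gamma> t 0 \<in> ball 0 1" if "t \<in> {0..1}" for t
    using loop 0 that unfolding loop_family_def by blast
  have gc: "continuous_on {0..1} (\<lambda>t. \<gamma> t 0)"
  proof -
    have "continuous_on ({0..1} \<times> polydisc) (\<lambda>(t, b). \<gamma> t b)" using loop unfolding loop_family_def by blast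
    then have "continuous_on {0..1} (\<lambda>t. (\<lambda>(t, b). \<gamma> t b) (t, 0))"
      by (rule continuous_on_compose2) (use 0 in \<open>auto intro!: continuous_intros\<close>)
    then show ?thesis by simp
  qed
  have Qh: "(\<lambda>z. Q z 0 $ i $ k) holomorphic_on ball 0 1" for i k
    using Q(1) V unfolding mholo_total_def holo_total_def
    by (auto simp: holomorphic_on_open field_differentiable_def)
  have hom: "horizontal_hom m 0 (ball 0 1) (\<lambda>z. A z 0) (\<lambda>z. \<Sum>q<m. mscale (z ^ q) (Ai q 0)) (\<lambda>z. Q z 0)"
    using Q(3)[OF V] by (simp add: Ainf_fun_def)
  have g01: "\<gamma> 0 0 = \<gamma> 1 0" using loop 0 unfolding loop_family_def by blast
  have inv: "invertible (Q (\<gamma> 0 0) 0)" using Q(2)[OF g V, of 0] by simp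
  show ?thesis
    by (rule monodromy_eigenvectors[where aq = "\<lambda>q. Ai q 0" and g = "\<lambda>t. \<gamma> t 0", OF m Y(1) gc g g01 Y(2,3) d Qh inv hom True])
next
  \<comment> \<open>In rank one every nonzero vector is an eigenvector, and there are no two
    distinct indices.\<close>
  case False
  then have "CARD('r) = 1" using zero_less_card_finite[where 'a='r] by linarith
  then obtain x where x: "(UNIV :: 'r set) = {x}" by (auto simp: card_1_singleton_iff)
  then have eq: "k = x" for k by auto
  show ?thesis
    by (rule exI[of _ "\<lambda>k. Ai (m - 1) 0 $ k $ k"], rule exI[of _ "\<lambda>k. 1"])
      (auto simp: vec_eq_iff matrix_vector_mult_def x; metis eq)
qed

lemma nonresonant_neighbourhood:
  fixes Ai :: "nat \<Rightarrow> complex ^ 'b::finite \<Rightarrow> complex ^ 'r::finite ^ 'r"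
  assumes m: "m \<ge> 1" and loop: "loop_family m e \<gamma> W" and mono: "distinct_monodromy m e \<gamma> A"
    and V: "open V" "0 \<in> V" and ext: "extends_to_P1 m e A V Ai"
  shows "\<exists>a0 (h :: 'r \<Rightarrow> nat) \<xi>. eventually (\<lambda>b. msum (ad_mat (Ai (m - 1) b)) \<le> a0 \<and>
      (\<forall>n::int. n \<noteq> 0 \<longrightarrow> invertible (mat (of_int n) - ad_mat (Ai (m - 1) b))) \<and>
      invertible (krylov h \<xi> (Ai (m - 1) b))) (nhds 0)"
proof -
  let ?A = "Ai (m - 1)"
  obtain \<alpha> :: "'r \<Rightarrow> complex" and v where v: "\<And>k. v k \<noteq> 0" "\<And>k. ?A 0 *v v k = \<alpha> k *s v k"
    and \<alpha>: "\<And>k l. k \<noteq> l \<Longrightarrow> \<alpha> k - \<alpha> l \<notin> \<int>"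
    using residue_nonresonant[OF m loop mono V(2) ext] by blast
  have inj: "inj \<alpha>"
    using \<alpha> by (intro injI) (metis Ints_0 diff_self)
  have c: "isCont (\<lambda>b. ?A b $ i $ k) 0" for i k
  proof -
    have "mholo_base ?A V" using ext m unfolding extends_to_P1_def by auto
    then show ?thesis unfolding mholo_base_def holo_base_def using V
      by (auto simp: continuous_on_eq_continuous_at)
  qed
  have nr: "invertible (mat (of_int n) - ad_mat (?A 0))" if "n \<noteq> 0" for n :: int
  proof (rule ad_mat_nonresonant[OF v inj])
    fix k l
    show "\<alpha> k - \<alpha> l \<noteq> of_int n"
      using \<alpha>[of k l] that by (cases "k = l") auto
  qed
  obtain h :: "'r \<Rightarrow> nat" where h: "bij_betw h UNIV {..<CARD('r)}"
    using ex_bij_betw_finite_nat[of "UNIV :: 'r set"] by (auto simp: atLeast0LessThan)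
  have hi: "inj h" "\<And>k. h k < CARD('r)"
    using h by (auto simp: bij_betw_def)
  define \<xi> where "\<xi> = (\<Sum>k\<in>UNIV. v k)"
  have kr: "invertible (krylov h \<xi> (?A 0))"
    unfolding \<xi>_def by (rule krylov_invertible[OF v inj hi])
  have "isCont (\<lambda>b. krylov h \<xi> (?A b)) 0"
  proof (rule isCont_matrixI)
    have p: "isCont (\<lambda>b. mat_power (?A b) n $ i $ k) 0" for n i k
    proof (induction n arbitrary: i k)
      case (Suc n)
      have "isCont (\<lambda>b. \<Sum>j\<in>UNIV. ?A b $ i $ j * mat_power (?A b) n $ j $ k) 0"
        using Suc c unfolding isCont_def by (intro tendsto_sum tendsto_mult) blast+
      then show ?case by (simp add: matrix_matrix_mult_def)
    qed (simp add: mat_def)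
    show "isCont (\<lambda>b. krylov h \<xi> (?A b) $ i $ k) 0" for i k
    proof -
      have "isCont (\<lambda>b. \<Sum>j\<in>UNIV. mat_power (?A b) (h k) $ i $ j * \<xi> $ j) 0"
        using p unfolding isCont_def by (intro tendsto_sum tendsto_mult tendsto_const) blast
      then show ?thesis by (simp add: krylov_def matrix_vector_mult_def)
    qed
  qed
  from eventually_conj[OF eventually_nonresonant[where A = ?A, OF c nr] eventually_invertible[OF this kr]]
  show ?thesis by (intro exI[of _ "msum (ad_mat (?A 0)) + 1"] exI[of _ h] exI[of _ \<xi>]) (simp add: conj_assoc)
qed

section \<open>Comparison of coefficients\<close>

text \<open>With \<open>F q n\<close> the product of the coefficients of index \<open>q\<close> and
  \<open>n\<close> of two polynomials of degree below \<open>m\<close>, \<open>conv_low\<close> is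
  the coefficient of \<open>z ^ s\<close> in their product and \<open>conv_high\<close> that of
  \<open>z ^ (m + s)\<close>. The two sums in \<open>Xi_tilde\<close> are assembled from
  these.\<close>

definition conv_low :: "nat \<Rightarrow> (nat \<Rightarrow> nat \<Rightarrow> 'a::comm_monoid_add) \<Rightarrow> nat \<Rightarrow> 'a"
  where "conv_low m F s = (\<Sum>q<m. \<Sum>n | n < m \<and> q + n = s. F q n)"

definition conv_high :: "nat \<Rightarrow> (nat \<Rightarrow> nat \<Rightarrow> 'a::comm_monoid_add) \<Rightarrow> nat \<Rightarrow> 'a"
  where "conv_high m F s = (\<Sum>q<m. \<Sum>n | n < m \<and> q + n = m + s. F q n)"

lemma mscale_sum_right: "mscale a (\<Sum>i\<in>I. F i) = (\<Sum>i\<in>I. mscale (a::complex) (F i))"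
  by (simp add: vec_eq_iff sum_distrib_left)

lemma mscale_one [simp]: "mscale (1::complex) X = X"
  and mscale_zero [simp]: "mscale (0::complex) X = 0"
  and mscale_zero_right [simp]: "mscale (a::complex) 0 = 0"
  by (simp_all add: vec_eq_iff)

lemma sum_fibre:
  fixes G :: "nat \<Rightarrow> nat \<Rightarrow> 'a::comm_monoid_add"
  assumes "\<And>n. n < m \<Longrightarrow> P n \<longleftrightarrow> (\<exists>s<m. R n s)" "\<And>n s. n < m \<Longrightarrow> s < m \<Longrightarrow> R n s \<longleftrightarrow> P n \<and> s = f n"
  shows "(\<Sum>s<m. \<Sum>n | n < m \<and> R n s. G n s) = (\<Sum>n | n < m \<and> P n. G n (f n))"
proof -
  have "(\<Sum>s<m. \<Sum>n | n < m \<and> R n s. G n s) = (\<Sum>s<m. \<Sum>n<m. if R n s then G n s else 0)"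
    by (simp add: sum.inter_filter[symmetric] lessThan_def)
  also have "\<dots> = (\<Sum>n<m. \<Sum>s<m. if R n s then G n s else 0)" by (rule sum.swap)
  also have "\<dots> = (\<Sum>n<m. if P n then G n (f n) else 0)"
  proof (rule sum.cong)
    fix n assume "n \<in> {..<m}"
    then have n: "n < m" by simp
    show "(\<Sum>s<m. if R n s then G n s else 0) = (if P n then G n (f n) else 0)"
    proof (cases "P n")
      case True
      then have f: "f n < m" using assms n by metis
      have "(\<Sum>s<m. if R n s then G n s else 0) = (\<Sum>s<m. if s = f n then G n s else 0)"
        by (rule sum.cong) (use assms(2)[OF n] True in auto)
      then show ?thesis using True f by simp
    next
      case False
      then show ?thesis using assms(2)[OF n] by (auto intro!: sum.neutral)
    qed
  qed simp
  also have "\<dots> = (\<Sum>n | n < m \<and> P n. G n (f n))" by (simp add: sum.inter_filter[symmetric] lessThan_def)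
  finally show ?thesis .
qed

lemma conv_low_eval:
  fixes F :: "nat \<Rightarrow> nat \<Rightarrow> complex ^ 'r ^ 'r"
  assumes "m \<ge> 1"
  shows "(\<Sum>q<m. \<Sum>n | n < m \<and> q + n \<le> m - 1. mscale (z ^ (q + n)) (F q n)) =
    (\<Sum>s<m. mscale (z ^ s) (conv_low m F s))"
proof -
  have "(\<Sum>s<m. mscale (z ^ s) (conv_low m F s)) =
      (\<Sum>q<m. \<Sum>s<m. \<Sum>n | n < m \<and> q + n = s. mscale (z ^ s) (F q n))"
    unfolding conv_low_def mscale_sum_right by (rule sum.swap)
  also have "\<dots> = (\<Sum>q<m. \<Sum>n | n < m \<and> q + n \<le> m - 1. mscale (z ^ (q + n)) (F q n))"
    using assms by (intro sum.cong refl sum_fibre) auto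
  finally show ?thesis by simp
qed

lemma conv_high_eval:
  fixes F :: "nat \<Rightarrow> nat \<Rightarrow> complex ^ 'r ^ 'r"
  shows "(\<Sum>q<m. \<Sum>n | n < m \<and> q + n \<ge> m. mscale (w * z ^ (q + n - m)) (F q n)) =
    (\<Sum>s<m. mscale (w * z ^ s) (conv_high m F s))"
proof -
  have "(\<Sum>s<m. mscale (w * z ^ s) (conv_high m F s)) =
      (\<Sum>q<m. \<Sum>s<m. \<Sum>n | n < m \<and> q + n = m + s. mscale (w * z ^ s) (F q n))"
    unfolding conv_high_def mscale_sum_right by (rule sum.swap)
  also have "\<dots> = (\<Sum>q<m. \<Sum>n | n < m \<and> q + n \<ge> m. mscale (w * z ^ (q + n - m)) (F q n))"
  proof (rule sum.cong)
    fix q assume "q \<in> {..<m}"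
    then have q: "q < m" by simp
    show "(\<Sum>s<m. \<Sum>n | n < m \<and> q + n = m + s. mscale (w * z ^ s) (F q n)) =
        (\<Sum>n | n < m \<and> q + n \<ge> m. mscale (w * z ^ (q + n - m)) (F q n))"
    proof (rule sum_fibre)
      fix n assume n: "n < m"
      show "m \<le> q + n \<longleftrightarrow> (\<exists>s<m. q + n = m + s)"
        using q n by (auto intro!: exI[of _ "q + n - m"])
    qed auto
  qed simp
  finally show ?thesis by simp
qed

lemma conv_product:
  fixes F :: "nat \<Rightarrow> nat \<Rightarrow> complex ^ 'r ^ 'r"
  assumes m: "m \<ge> 1"
  shows "(\<Sum>q<m. \<Sum>n<m. mscale (z ^ (q + n)) (F q n)) =
    (\<Sum>s<m. mscale (z ^ s) (conv_low m F s)) + mscale (z ^ m) (\<Sum>s<m. mscale (z ^ s) (conv_high m F s))"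
proof -
  have "(\<Sum>n<m. mscale (z ^ (q + n)) (F q n)) =
      (\<Sum>n | n < m \<and> q + n \<le> m - 1. mscale (z ^ (q + n)) (F q n)) +
      (\<Sum>n | n < m \<and> q + n \<ge> m. mscale (z ^ m * z ^ (q + n - m)) (F q n))" for q
  proof -
    have split: "{..<m} = {n. n < m \<and> q + n \<le> m - 1} \<union> {n. n < m \<and> q + n \<ge> m}" using m by auto
    have "(\<Sum>n<m. mscale (z ^ (q + n)) (F q n)) =
        (\<Sum>n | n < m \<and> q + n \<le> m - 1. mscale (z ^ (q + n)) (F q n)) +
        (\<Sum>n | n < m \<and> q + n \<ge> m. mscale (z ^ (q + n)) (F q n))"
      unfolding split by (rule sum.union_disjoint) (use m in auto)
    moreover have "(\<Sum>n | n < m \<and> q + n \<ge> m. mscale (z ^ (q + n)) (F q n)) =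
        (\<Sum>n | n < m \<and> q + n \<ge> m. mscale (z ^ m * z ^ (q + n - m)) (F q n))"
      by (rule sum.cong) (simp_all flip: power_add)
    ultimately show ?thesis by simp
  qed
  then show ?thesis
    unfolding mscale_sum_right mscale_mscale
    by (simp only: sum.distrib conv_low_eval[OF m] conv_high_eval)
qed

lemma conv_low_add: "conv_low m (\<lambda>q n. F q n + G q n) s = conv_low m F s + conv_low m G s"
  by (simp add: conv_low_def sum.distrib)

lemma conv_low_mscale: "conv_low m (\<lambda>q n. mscale (a::complex) (F q n)) s = mscale a (conv_low m F s)"
  by (simp add: conv_low_def mscale_sum_right)

lemma conv_low_cong: "(\<And>q n. q < m \<Longrightarrow> n < m \<Longrightarrow> F q n = G q n) \<Longrightarrow> conv_low m F s = conv_low m G s"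
  unfolding conv_low_def by (intro sum.cong) auto

lemma mholo_base_conv:
  assumes "\<And>q n. q < m \<Longrightarrow> n < m \<Longrightarrow> mholo_base (F q n) V"
  shows "mholo_base (\<lambda>b. conv_low m (\<lambda>q n. F q n b) s) V"
    and "mholo_base (\<lambda>b. conv_high m (\<lambda>q n. F q n b) s) V"
  using assms unfolding mholo_base_iff conv_low_def conv_high_def by (auto intro!: mhol_sum)

text \<open>Identifies the sum in the condition on adjusting data as the coefficient of
  \<open>z ^ (m - 1)\<close> of a product.\<close>

lemma conv_low_top:
  assumes "m \<ge> 1"
  shows "conv_low m (F :: nat \<Rightarrow> nat \<Rightarrow> 'a::comm_monoid_add) (m - 1) = (\<Sum>n<m. F (m - n - 1) n)"
proof -
  have "conv_low m F (m - 1) = (\<Sum>q<m. F q (m - q - 1))"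
    unfolding conv_low_def
  proof (rule sum.cong)
    fix q assume "q \<in> {..<m}"
    then have "{n. n < m \<and> q + n = m - 1} = {m - q - 1}" by auto
    then show "(\<Sum>n | n < m \<and> q + n = m - 1. F q n) = F q (m - q - 1)" by simp
  qed simp
  also have "\<dots> = (\<Sum>n<m. F (m - n - 1) n)"
    by (rule sum.reindex_bij_witness[of _ "\<lambda>n. m - n - 1" "\<lambda>n. m - n - 1"]) auto
  finally show ?thesis .
qed

lemma conv_high_top: "m \<ge> 1 \<Longrightarrow> conv_high m F (m - 1) = 0"
  unfolding conv_high_def by (intro sum.neutral ballI) (auto intro!: sum.neutral)

text \<open>The tail of the series divided by \<open>z ^ m\<close> is again a convergent power
  series. Only the first \<open>m\<close> coefficients can interact with the polynomials being
  compared.\<close>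

lemma mseries_tail:
  fixes S :: "nat \<Rightarrow> complex ^ 'b::finite \<Rightarrow> complex ^ 'r::finite ^ 'r"
  assumes S: "\<And>z i k. cmod z < \<rho> \<Longrightarrow> summable (\<lambda>n. S n b $ i $ k * z ^ n)"
  shows "\<exists>t. (\<forall>i k. (\<lambda>z. t z $ i $ k) holomorphic_on ball 0 \<rho>) \<and>
    (\<forall>z\<in>ball 0 \<rho>. mseries S z b = (\<Sum>n<m. mscale (z ^ n) (S n b)) + mscale (z ^ m) (t z))"
proof -
  define t where "t = (\<lambda>z. \<chi> i k. \<Sum>n. S (n + m) b $ i $ k * z ^ n)"
  have sm: "summable (\<lambda>n. S (n + m) b $ i $ k * z ^ n)" if "cmod z < \<rho>" for z i k
  proof (cases "z = 0")
    case False
    have "summable (\<lambda>n. S (n + m) b $ i $ k * z ^ (n + m) / z ^ m)"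
      by (rule summable_divide[OF summable_ignore_initial_segment[OF S[OF that]]])
    then show ?thesis using False by (simp add: power_add)
  qed simp
  have "(\<lambda>z. t z $ i $ k) holomorphic_on ball 0 \<rho>" for i k
    by (rule power_series_holomorphic[of _ _ "\<lambda>n. S (n + m) b $ i $ k"])
      (use sm in \<open>auto simp: t_def intro: summable_sums\<close>)
  moreover have "mseries S z b = (\<Sum>n<m. mscale (z ^ n) (S n b)) + mscale (z ^ m) (t z)" if "z \<in> ball 0 \<rho>" for z
  proof -
    have "(\<Sum>n. S n b $ i $ k * z ^ n) = z ^ m * (\<Sum>n. S (n + m) b $ i $ k * z ^ n) + (\<Sum>n<m. S n b $ i $ k * z ^ n)" for i k
    proof -
      have "(\<Sum>n. S n b $ i $ k * z ^ n) = (\<Sum>n. S (n + m) b $ i $ k * z ^ (n + m)) + (\<Sum>n<m. S n b $ i $ k * z ^ n)"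
        by (rule suminf_split_initial_segment[OF S]) (use that in simp)
      also have "(\<Sum>n. S (n + m) b $ i $ k * z ^ (n + m)) = (\<Sum>n. z ^ m * (S (n + m) b $ i $ k * z ^ n))"
        by (simp add: power_add algebra_simps)
      also have "\<dots> = z ^ m * (\<Sum>n. S (n + m) b $ i $ k * z ^ n)"
        by (rule suminf_mult[OF sm]) (use that in simp)
      finally show ?thesis .
    qed
    then show ?thesis by (simp add: mseries_def t_def vec_eq_iff mult.commute)
  qed
  ultimately show ?thesis by blast
qed

section \<open>The defect of the primitive\<close>

text \<open>One matrix entry of the identity in \<open>B0_congruence\<close>, with
  \<open>Z = z ^ m\<close>, \<open>E = \<epsilon> ^ m\<close>, \<open>\<phi>\<close> the scalar
  primitive and \<open>g\<close> its derivative; \<open>x\<close>, \<open>y\<close>,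
  \<open>k\<close> stand for the conjugated diagonal matrix, its derivative and its commutator with
  the connection matrix. The error terms sort into multiples of \<open>Z\<close> that avoid the
  singular \<open>\<phi>\<close> and multiples of \<open>E\<close>.\<close>

lemma B0_primitive_identity:
  fixes x :: complex
  assumes "zj * x = X + (Z - E) * h" "(Z - E) * y + k = (Z - E)\<^sup>2 * w" "\<phi> * Z = - u" "Z * g = zj"
  shows "Z * (g * x + \<phi> * y) + \<phi> * k = X + Z * (h - u * w) + E * (\<phi> * ((E - 2 * Z) * w + y) - h)"
proof -
  have "Z * (g * x + \<phi> * y) + \<phi> * k = zj * x + \<phi> * ((Z - E) * y + k) + \<phi> * (E * y)"
    by (simp add: assms(4)[symmetric] algebra_simps)
  also have "\<dots> = X + (Z - E) * h + \<phi> * ((Z - E)\<^sup>2 * w) + \<phi> * (E * y)"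
    unfolding assms(1,2) by simp
  also have "\<phi> * ((Z - E)\<^sup>2 * w) = (\<phi> * Z) * Z * w + E * (\<phi> * ((E - 2 * Z) * w))"
    by (simp add: power2_eq_square algebra_simps)
  also have "X + (Z - E) * h + (\<phi> * Z * Z * w + E * (\<phi> * ((E - 2 * Z) * w))) + \<phi> * (E * y) =
      X + Z * (h - u * w) + E * (\<phi> * ((E - 2 * Z) * w + y) - h)"
    unfolding assms(3) by (simp add: algebra_simps)
  finally show ?thesis .
qed

lemma commutator_conj:
  fixes P :: "complex ^ 'r::finite ^ 'r"
  assumes "invertible P"
  shows "commutator (P ** X ** matrix_inv P) (P ** Y ** matrix_inv P) = P ** commutator X Y ** matrix_inv P"
proof -
  have "P ** X ** matrix_inv P ** (P ** Y ** matrix_inv P) = P ** (X ** Y) ** matrix_inv P" for X Y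
  proof -
    have "P ** X ** matrix_inv P ** (P ** Y ** matrix_inv P) = P ** X ** (matrix_inv P ** P) ** Y ** matrix_inv P"
      by (simp add: matrix_mul_assoc)
    then show ?thesis by (simp add: matrix_inv[OF assms] matrix_mul_assoc)
  qed
  then show ?thesis
    by (simp add: commutator_def matrix_mult_diff)
qed

text \<open>Differentiating the relation of \<open>P p ** D ** matrix_inv (P p)\<close> times
  \<open>P p\<close> with \<open>P p ** D\<close> avoids the derivative of the inverse
  matrix.\<close>

lemma conj_derivative:
  fixes P :: "'b::finite point \<Rightarrow> complex ^ 'r::finite ^ 'r"
  assumes U: "open U" and P: "mhol P U" "\<And>p. p \<in> U \<Longrightarrow> invertible (P p)" and p: "p \<in> U"
  shows "mpd k (\<lambda>p. P p ** D ** matrix_inv (P p)) p =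
    commutator (mpd k P p ** matrix_inv (P p)) (P p ** D ** matrix_inv (P p))"
proof -
  let ?C = "\<lambda>p. P p ** D ** matrix_inv (P p)"
  have Ch: "mhol ?C U" by (intro mhol_mult P(1) mhol_matrix_inv[OF U P] mhol_const)
  have CP: "?C p ** P p = P p ** D" if "p \<in> U" for p
    by (simp add: matrix_mul_assoc[symmetric] matrix_inv P(2)[OF that])
  have "mpd k (\<lambda>p. ?C p ** P p) p = mpd k (\<lambda>p. P p ** D) p"
    by (rule mpd_cong[OF U p CP])
  moreover have "mpd k (\<lambda>p. P p ** D) p = mpd k P p ** D"
  proof -
    have "mpd k (\<lambda>p. D) p = 0" by (simp add: mpd_def vec_eq_iff)
    then show ?thesis using mpd_mult[OF P(1) mhol_const[of D] p, of k] by simp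
  qed
  ultimately have eq: "mpd k ?C p ** P p + ?C p ** mpd k P p = mpd k P p ** D"
    using mpd_mult[OF Ch P(1) p, of k] by simp
  have "mpd k ?C p = (mpd k ?C p ** P p) ** matrix_inv (P p)"
    by (simp add: matrix_mul_assoc[symmetric] matrix_inv P(2)[OF p])
  also have "mpd k ?C p ** P p = mpd k P p ** D - ?C p ** mpd k P p" using eq by (simp add: eq_diff_eq)
  also have "(mpd k P p ** D - ?C p ** mpd k P p) ** matrix_inv (P p) =
      mpd k P p ** D ** matrix_inv (P p) - ?C p ** (mpd k P p ** matrix_inv (P p))"
    by (simp add: matrix_mult_diff matrix_mul_assoc)
  also have "mpd k P p ** D ** matrix_inv (P p) = mpd k P p ** (matrix_inv (P p) ** P p) ** D ** matrix_inv (P p)"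
    by (simp add: matrix_inv P(2)[OF p])
  also have "\<dots> = mpd k P p ** matrix_inv (P p) ** ?C p"
    by (simp add: matrix_mul_assoc)
  finally show ?thesis by (simp add: commutator_def)
qed

text \<open>The conjugate \<open>C\<close> of a constant diagonal matrix is horizontal up to the
  square of \<open>z ^ m - \<epsilon> ^ m\<close>, because diagonal matrices commute with the
  diagonalised connection matrix. \<open>B0\<close> is \<open>C\<close> times a scalar primitive,
  whose derivative contributes \<open>z ^ j\<close> times \<open>C\<close>, and this agrees with
  \<open>Xi\<close> along the divisor. The resulting multiple of
  \<open>z ^ m - \<epsilon> ^ m\<close> is split into a part with \<open>z ^ m\<close> and regular
  cofactor and a part with \<open>\<epsilon> ^ m\<close>.\<close>

lemma B0_congruence:
  fixes Ai :: "nat \<Rightarrow> complex ^ 'b::finite \<Rightarrow> complex ^ 'r::finite ^ 'r" and P :: "('b, 'r) matfun"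
    and \<nu> :: "'r \<Rightarrow> complex \<Rightarrow> complex ^ 'b \<Rightarrow> complex" and l j :: nat
  assumes m: "m \<ge> 2" and j: "j \<le> m - 2" and V: "open V" and U: "open U" "U \<subseteq> UNIV \<times> V"
    and Ai: "\<And>q. q < m \<Longrightarrow> mholo_base (Ai q) V"
    and \<psi>: "\<And>i q. i < CARD('r) \<Longrightarrow> q < m \<Longrightarrow> holo_base (\<psi> i q) V"
    and P: "mhol (\<lambda>p. P (fst p) (snd p)) U" "\<And>p. p \<in> U \<Longrightarrow> invertible (P (fst p) (snd p))"
    and N: "mhol (\<lambda>p. diag_mat (\<lambda>k. \<nu> k (fst p) (snd p))) U"
    and diag: "cong_total U (\<lambda>z b. (z ^ m - (b $ e) ^ m)\<^sup>2)
        (\<lambda>z b. mscale (z ^ m - (b $ e) ^ m) (matrix_inv (P z b) ** mderiv P z b)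
               + matrix_inv (P z b) ** Ainf_fun m Ai z b ** P z b)
        (\<lambda>z b. diag_mat (\<lambda>k. \<nu> k z b))"
    and inv: "cong_total U (\<lambda>z b. z ^ m - (b $ e) ^ m)
      (\<lambda>z b. eval_T (\<lambda>i. \<Sum>q<m. \<psi> i q b * z ^ q) (diag_mat (\<lambda>k. \<nu> k z b)))
      (\<lambda>z b. diag_mat \<mu>)"
  defines "B \<equiv> \<lambda>p. B0 m \<mu> P l j (fst p) (snd p)"
  shows "mhol B (U - {p. fst p = 0})"
    and "\<exists>h H. mhol h U \<and> mhol H (U - {p. fst p = 0}) \<and> (\<forall>p\<in>U - {p. fst p = 0}.
      mscale (fst p ^ m) (mpd None B p) + commutator (Ainf_fun m Ai (fst p) (snd p)) (B p) =
      mpoly_eval (Xi m e \<psi> Ai l j (snd p)) (fst p) + mscale (fst p ^ m) (h p) + mscale ((snd p $ e) ^ m) (H p))"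
proof -
  let ?P = "\<lambda>p. P (fst p) (snd p)" and ?A = "\<lambda>p. Ainf_fun m Ai (fst p) (snd p)"
  let ?Pi = "\<lambda>p. matrix_inv (P (fst p) (snd p))"
  let ?c = "\<lambda>p::'b point. fst p ^ m - (snd p $ e) ^ m"
  let ?N = "\<lambda>p. diag_mat (\<lambda>k. \<nu> k (fst p) (snd p))"
  let ?U = "U - {p. fst p = 0}"
  \<comment> \<open>The exponent \<open>j - m + 1\<close> is \<open>- n\<close>. It is negative as
    \<open>j \<le> m - 2\<close>, so the primitive involves no logarithm.\<close>
  define n where "n = m - 1 - j"
  have n: "n \<ge> 1" "m = n + 1 + j" using m j by (auto simp: n_def)
  define D where "D = diag_mat (\<lambda>k. \<mu> k ^ l)"
  define C where "C = (\<lambda>p. ?P p ** D ** ?Pi p)"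
  define \<phi> where "\<phi> = (\<lambda>z::complex. - 1 / (of_nat n * z ^ n))"
  have U': "open ?U" "?U \<subseteq> U"
  proof -
    have "?U = U \<inter> {p. fst p \<noteq> 0}" by auto
    then show "open ?U" using U(1) by (auto intro!: open_Int open_Collect_neq continuous_intros)
  qed auto
  have Pih: "mhol ?Pi U" by (rule mhol_matrix_inv[OF U(1) P])
  have Ch: "mhol C U" unfolding C_def by (intro mhol_mult P(1) Pih mhol_const)
  have ch: "hol ?c U" by (intro hol_diff hol_power hol_fst hol_snd_nth)
  obtain H2 where H2: "mhol H2 U" "\<And>p. p \<in> U \<Longrightarrow>
      mscale (?c p) (?Pi p ** mpd None ?P p) + ?Pi p ** ?A p ** ?P p - ?N p = mscale ((?c p)\<^sup>2) (H2 p)"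
    using diag unfolding cong_total_iff mcong_def mderiv_eq prod.collapse by blast
  have Ph: "mhol (mpd None ?P) U" by (rule mhol_mpd[OF P(1) U(1)])
  have AN: "mcong U ?c (\<lambda>p. ?Pi p ** ?A p ** ?P p) ?N"
    unfolding mcong_def
  proof (intro exI conjI ballI)
    show "mhol (\<lambda>p. mscale (?c p) (H2 p) - ?Pi p ** mpd None ?P p) U"
      by (intro mhol_diff mhol_mscale mhol_mult ch H2(1) Pih Ph)
    fix p assume "p \<in> U"
    from H2(2)[OF this] show "?Pi p ** ?A p ** ?P p - ?N p = mscale (?c p) (mscale (?c p) (H2 p) - ?Pi p ** mpd None ?P p)"
      by (simp add: mscale_diff mscale_mscale power2_eq_square algebra_simps)
  qed
  have Xi: "mcong U ?c (\<lambda>p. ?P p ** diag_mat (\<lambda>k. \<mu> k ^ l * fst p ^ j) ** ?Pi p)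
      (\<lambda>p. mpoly_eval (Xi m e \<psi> Ai l j (snd p)) (fst p))"
    by (rule Xi_cong_diagonal[where P = ?P and N = ?N, OF _ V U Ai \<psi> P N AN])
      (use m inv in \<open>auto simp: cong_total_iff\<close>)
  have zC: "?P p ** diag_mat (\<lambda>k. \<mu> k ^ l * f) ** ?Pi p = mscale f (C p)" for p f
  proof -
    have "diag_mat (\<lambda>k. \<mu> k ^ l * f) = mscale f D" by (simp add: D_def diag_mat_def vec_eq_iff)
    then show ?thesis by (simp add: C_def matrix_mult_mscale)
  qed
  obtain H4 where H4: "mhol H4 U" "\<And>p. p \<in> U \<Longrightarrow>
      mscale (fst p ^ j) (C p) - mpoly_eval (Xi m e \<psi> Ai l j (snd p)) (fst p) = mscale (?c p) (H4 p)"
    using Xi[unfolded mcong_def zC] by blast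
  define W where "W = (\<lambda>p. ?P p ** commutator (H2 p) D ** ?Pi p)"
  have Wh: "mhol W U" unfolding W_def by (intro mhol_mult P(1) Pih mhol_commutator H2(1) mhol_const)
  \<comment> \<open>The derivative of \<open>P\<close> combines with \<open>Ainf_fun\<close> to the
    conjugate of \<open>?N\<close> up to a multiple of the square of \<open>?c\<close>; in the
    commutator with \<open>D\<close> only that multiple survives.\<close>
  have cov: "mscale (?c p) (mpd None C p) + commutator (?A p) (C p) = mscale ((?c p)\<^sup>2) (W p)" if p: "p \<in> U" for p
  proof -
    have "mpd None C p = commutator (mpd None ?P p ** ?Pi p) (C p)"
      unfolding C_def by (rule conj_derivative[OF U(1) P p])
    then have "mscale (?c p) (mpd None C p) = commutator (mscale (?c p) (mpd None ?P p ** ?Pi p)) (C p)"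
      by (simp add: commutator_mscale_left)
    then have "mscale (?c p) (mpd None C p) + commutator (?A p) (C p) =
        commutator (mscale (?c p) (mpd None ?P p ** ?Pi p) + ?A p) (C p)"
      by (simp add: commutator_add_left)
    also have "mscale (?c p) (mpd None ?P p ** ?Pi p) + ?A p = ?P p ** (?N p + mscale ((?c p)\<^sup>2) (H2 p)) ** ?Pi p"
    proof -
      have "?N p + mscale ((?c p)\<^sup>2) (H2 p) = mscale (?c p) (?Pi p ** mpd None ?P p) + ?Pi p ** ?A p ** ?P p"
        unfolding H2(2)[OF p, symmetric] by simp
      then have "?P p ** (?N p + mscale ((?c p)\<^sup>2) (H2 p)) ** ?Pi p =
          mscale (?c p) ((?P p ** ?Pi p) ** mpd None ?P p ** ?Pi p) + (?P p ** ?Pi p) ** ?A p ** (?P p ** ?Pi p)"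
        by (simp add: matrix_add_ldistrib matrix_mult_add_rdistrib matrix_mult_mscale matrix_mul_assoc)
      then show ?thesis by (simp add: matrix_inv P(2)[OF p])
    qed
    also have "commutator \<dots> (C p) = ?P p ** commutator (?N p + mscale ((?c p)\<^sup>2) (H2 p)) D ** ?Pi p"
      unfolding C_def by (rule commutator_conj[OF P(2)[OF p]])
    also have "commutator (?N p + mscale ((?c p)\<^sup>2) (H2 p)) D = mscale ((?c p)\<^sup>2) (commutator (H2 p) D)"
    proof -
      have "commutator (?N p) D = 0" by (simp add: commutator_def D_def diag_mat_mult mult.commute)
      then show ?thesis by (simp add: commutator_add_left commutator_mscale_left)
    qed
    finally show ?thesis by (simp add: W_def matrix_mult_mscale)
  qed
  have B: "B p = mscale (\<phi> (fst p)) (C p)" if "fst p \<noteq> 0" for p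
  proof -
    have "int j - int m + 1 = - int n" using n by simp
    then have "fst p powi (int j - int m + 1) / of_int (int j - int m + 1) = \<phi> (fst p)"
      by (simp add: \<phi>_def power_int_minus divide_inverse)
    then show ?thesis unfolding B_def B0_def zC by (rule arg_cong)
  qed
  have \<phi>h: "hol (\<lambda>p. \<phi> (fst p)) ?U"
    unfolding \<phi>_def by (intro hol_divide hol_const hol_mult hol_power hol_fst) (use n in auto)
  have Ch': "mhol C ?U" by (rule mhol_subset[OF Ch U'(2)])
  have \<phi>C: "mhol (\<lambda>p. mscale (\<phi> (fst p)) (C p)) ?U" by (intro mhol_mscale \<phi>h Ch')
  show "mhol B ?U"
    by (rule mhol_cong[OF U'(1) \<phi>C]) (use B in auto)
  define h where "h = (\<lambda>p. H4 p - mscale (fst p ^ (j + 1) / of_nat n) (W p))"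
  define H where "H = (\<lambda>p. mscale (\<phi> (fst p)) (mscale ((snd p $ e) ^ m - 2 * fst p ^ m) (W p) + mpd None C p) - H4 p)"
  have "mhol h U" unfolding h_def
    by (intro mhol_diff mhol_mscale hol_divide hol_power hol_fst hol_const H4(1) Wh) (use n in auto)
  moreover have "mhol H ?U"
    unfolding H_def
    by (intro mhol_diff mhol_mscale mhol_add \<phi>h hol_diff hol_mult hol_const hol_power hol_fst hol_snd_nth
        mhol_subset[OF Wh U'(2)] mhol_subset[OF H4(1) U'(2)] mhol_subset[OF mhol_mpd[OF Ch U(1)] U'(2)])
  moreover have "mscale (fst p ^ m) (mpd None B p) + commutator (?A p) (B p) =
      mpoly_eval (Xi m e \<psi> Ai l j (snd p)) (fst p) + mscale (fst p ^ m) (h p) + mscale ((snd p $ e) ^ m) (H p)"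
    if p: "p \<in> ?U" for p
  proof -
    have z: "fst p \<noteq> 0" "p \<in> U" using p by auto
    have "((\<lambda>x. \<phi> x) has_field_derivative 1 / fst p ^ (n + 1)) (at (fst p))"
    proof -
      obtain n' where n': "n = Suc n'" using n(1) by (cases n) auto
      have "((\<lambda>x. - 1 / of_nat n * inverse (x ^ n)) has_field_derivative
          - 1 / of_nat n * - (inverse (fst p ^ n) * (of_nat n * fst p ^ (n - 1)) * inverse (fst p ^ n))) (at (fst p))"
        by (intro DERIV_cmult DERIV_inverse_fun) (use z(1) in \<open>auto intro!: derivative_eq_intros\<close>)
      also have "(\<lambda>x. - 1 / of_nat n * inverse (x ^ n)) = \<phi>" by (simp add: \<phi>_def divide_inverse fun_eq_iff)
      also have "- 1 / of_nat n * - (inverse (fst p ^ n) * (of_nat n * fst p ^ (n - 1)) * inverse (fst p ^ n)) = 1 / fst p ^ (n + 1)"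
        using z(1) n' by (simp add: field_simps del: of_nat_Suc)
      finally show ?thesis .
    qed
    then have "pd None (\<lambda>p. \<phi> (fst p)) p = 1 / fst p ^ (n + 1)"
      using pd_None[of "\<lambda>p. \<phi> (fst p)" "fst p" "snd p"] DERIV_imp_deriv by simp
    then have dB: "mpd None B p = mscale (1 / fst p ^ (n + 1)) (C p) + mscale (\<phi> (fst p)) (mpd None C p)"
      using mpd_mscale[OF \<phi>h Ch' p, of None] mpd_cong[OF U'(1) p, of B "\<lambda>p. mscale (\<phi> (fst p)) (C p)" None] B by simp
    have s: "\<phi> (fst p) * fst p ^ m = - (fst p ^ (j + 1) / of_nat n)" "fst p ^ m * (1 / fst p ^ (n + 1)) = fst p ^ j"
      using z(1) n by (auto simp: \<phi>_def power_add field_simps)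
    have cB: "commutator (?A p) (B p) = mscale (\<phi> (fst p)) (commutator (?A p) (C p))"
      by (simp add: B[OF z(1)] commutator_mscale)
    have 1: "fst p ^ j * C p $ i $ k = mpoly_eval (Xi m e \<psi> Ai l j (snd p)) (fst p) $ i $ k + ?c p * H4 p $ i $ k"
      and 2: "?c p * mpd None C p $ i $ k + commutator (?A p) (C p) $ i $ k = (?c p)\<^sup>2 * W p $ i $ k" for i k
      using arg_cong[OF H4(2)[OF z(2)], of "\<lambda>X. X $ i $ k"] arg_cong[OF cov[OF z(2)], of "\<lambda>X. X $ i $ k"]
      by (simp_all add: algebra_simps)
    show ?thesis
      unfolding vec_eq_iff
    proof (intro allI)
      fix i k
      show "(mscale (fst p ^ m) (mpd None B p) + commutator (?A p) (B p)) $ i $ k =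
          (mpoly_eval (Xi m e \<psi> Ai l j (snd p)) (fst p) + mscale (fst p ^ m) (h p) + mscale ((snd p $ e) ^ m) (H p)) $ i $ k"
        unfolding dB cB h_def H_def vector_add_component vector_minus_component mscale_nth
        by (rule B0_primitive_identity[OF 1 2 s])
    qed
  qed
  ultimately show "\<exists>h H. mhol h U \<and> mhol H (U - {p. fst p = 0}) \<and> (\<forall>p\<in>U - {p. fst p = 0}.
      mscale (fst p ^ m) (mpd None B p) + commutator (?A p) (B p) =
      mpoly_eval (Xi m e \<psi> Ai l j (snd p)) (fst p) + mscale (fst p ^ m) (h p) + mscale ((snd p $ e) ^ m) (H p))"
    by blast
qed

section \<open>The normalizing equation and the coefficients of the adjusted Xi\<close>

lemma hol_fix_snd:
  assumes f: "hol f U" and S: "open S" "\<And>z. z \<in> S \<Longrightarrow> (z, b) \<in> U"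
  shows "(\<lambda>z. f (z, b)) holomorphic_on S"
  unfolding holomorphic_on_open[OF S(1)]
proof
  fix z assume "z \<in> S"
  then have "(z, b) \<in> U" using S by auto
  moreover have "holo_total (\<lambda>z b. f (z, b)) U" using f by (simp add: holo_total_iff)
  ultimately show "\<exists>f'. ((\<lambda>z. f (z, b)) has_field_derivative f') (at z)"
    unfolding holo_total_def field_differentiable_def by fast
qed

text \<open>For \<open>x\<close> the coefficients of \<open>Xi\<close> these are the coefficients of
  \<open>Xi_tilde\<close>; leaving \<open>x\<close> free separates the comparison of coefficients
  from the construction of \<open>Xi\<close>.\<close>

definition T_coeff :: "nat \<Rightarrow> 'b \<Rightarrow> (nat \<Rightarrow> complex ^ 'b \<Rightarrow> complex ^ 'r ^ 'r) \<Rightarrow> (nat \<Rightarrow> complex ^ 'b \<Rightarrow> complex ^ 'r ^ 'r) \<Rightarrow>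
    (nat \<Rightarrow> complex ^ 'b \<Rightarrow> complex ^ 'r ^ 'r) \<Rightarrow> nat \<Rightarrow> complex ^ 'b \<Rightarrow> complex ^ 'r ^ 'r"
  where "T_coeff m e Ai R x s b = x s b - conv_low m (\<lambda>q n. commutator (Ai q b) (R n b)) s
    - mscale ((b $ e) ^ m) (conv_high m (\<lambda>q n. commutator (Ai q b) (R n b)) s)"

lemma mholo_base_commutator: "mholo_base F V \<Longrightarrow> mholo_base G V \<Longrightarrow> mholo_base (\<lambda>b. commutator (F b) (G b)) V"
  unfolding mholo_base_iff by (rule mhol_commutator)

lemma mholo_base_T_coeff:
  assumes "mholo_base (x s) V" "\<And>q. q < m \<Longrightarrow> mholo_base (Ai q) V" "\<And>n. n < m \<Longrightarrow> mholo_base (R n) V"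
  shows "mholo_base (T_coeff m e Ai R x s) V"
proof -
  have "mholo_base (\<lambda>b. commutator (Ai q b) (R n b)) V" if "q < m" "n < m" for q n
    using assms that by (intro mholo_base_commutator) auto
  note c = mholo_base_conv[where F = "\<lambda>q n b. commutator (Ai q b) (R n b)" and s = s, OF this, unfolded mholo_base_iff]
  show ?thesis
    unfolding mholo_base_iff T_coeff_def
    by (intro mhol_diff mhol_mscale c hol_power hol_snd_nth assms(1)[unfolded mholo_base_iff])
qed

lemma T_coeff_top:
  assumes m: "m \<ge> 1" and top: "x (m - 1) b = (\<Sum>n<m. commutator (Ai (m - n - 1) b) (R n b))"
  shows "T_coeff m e Ai R x (m - 1) b = 0"
  unfolding T_coeff_def top by (simp only: conv_low_top[OF m] conv_high_top[OF m] mscale_zero_right) simp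

text \<open>Two descriptions of one expression, through \<open>x\<close> and through the normalizing
  equation, differ by multiples of \<open>z ^ m\<close> and \<open>\<epsilon> ^ m\<close>. Below
  degree \<open>m\<close> only the latter can contribute, so the coefficients agree modulo
  \<open>\<epsilon> ^ m\<close>; replacing \<open>S\<close> by \<open>R\<close> and subtracting the
  \<open>conv_high\<close> terms costs only further multiples of
  \<open>\<epsilon> ^ m\<close>.\<close>

lemma cov_defect:
  fixes Ai :: "nat \<Rightarrow> complex ^ 'b::finite \<Rightarrow> complex ^ 'r::finite ^ 'r" and B h H :: "'b point \<Rightarrow> complex ^ 'r ^ 'r"
  assumes m: "m \<ge> 2" and V: "open V" and \<rho>: "\<rho> > 0"
    and Ai: "\<And>q. q < m \<Longrightarrow> mholo_base (Ai q) V"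
    and B: "mhol B (ball 0 \<rho> \<times> V - {p. fst p = 0})" and h: "mhol h (ball 0 \<rho> \<times> V)"
    and H: "mhol H (ball 0 \<rho> \<times> V - {p. fst p = 0})"
    and eq1: "\<And>p. p \<in> ball 0 \<rho> \<times> V - {p. fst p = 0} \<Longrightarrow>
      mscale (fst p ^ m) (mpd None B p) + commutator (Ainf_fun m Ai (fst p) (snd p)) (B p) =
      (\<Sum>s<m. mscale (fst p ^ s) (x s (snd p))) + mscale (fst p ^ m) (h p) + mscale ((snd p $ e) ^ m) (H p)"
    and S: "\<And>z b i k. cmod z < \<rho> \<Longrightarrow> b \<in> V \<Longrightarrow> summable (\<lambda>n. S n b $ i $ k * z ^ n)"
    and Sh: "mhol (\<lambda>p. mseries S (fst p) (snd p)) (ball 0 \<rho> \<times> V)"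
    and eq2: "mcong (ball 0 \<rho> \<times> V - {p. fst p = 0}) (\<lambda>p. (snd p $ e) ^ m)
      (\<lambda>p. mscale (fst p ^ m) (mpd None B p) + commutator (Ainf_fun m Ai (fst p) (snd p)) (B p))
      (\<lambda>p. mscale (fst p ^ m) (mpd None (\<lambda>p. mseries S (fst p) (snd p)) p) + ((\<Sum>q\<le>m - 2. mscale (fst p ^ q) (a q (snd p)))
         + commutator (Ainf_fun m Ai (fst p) (snd p)) (mseries S (fst p) (snd p))))"
    and R: "\<And>n. n < m \<Longrightarrow> mholo_base (R n) V"
    and E: "\<And>n. n < m \<Longrightarrow> mholo_base (E n) V" "\<And>n b. n < m \<Longrightarrow> b \<in> V \<Longrightarrow> R n b - S n b = mscale ((b $ e) ^ m) (E n b)"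
  shows "\<exists>K. mhol K (ball 0 \<rho> \<times> V - {p. fst p = 0}) \<and> (\<forall>p\<in>ball 0 \<rho> \<times> V - {p. fst p = 0}.
    cov m e Ai (\<lambda>p. B p - mseries S (fst p) (snd p)) p =
    (\<Sum>s<m - 1. mscale (fst p ^ s) (T_coeff m e Ai R x s (snd p))) + mscale ((snd p $ e) ^ m) (K p))"
proof -
  let ?U = "ball 0 \<rho> \<times> V :: 'b point set" and ?W = "ball 0 \<rho> \<times> V - {p. fst p = 0} :: 'b point set"
  let ?A = "\<lambda>p. Ainf_fun m Ai (fst p) (snd p)" and ?R = "\<lambda>p. mseries S (fst p) (snd p)"
  have U: "open ?U" using V by (intro open_Times) auto
  have U0: "open ?W" "?W \<subseteq> ?U"
  proof -
    have "?W = ?U \<inter> {p. fst p \<noteq> 0}" by auto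
    then show "open ?W" using U by (auto intro!: open_Int open_Collect_neq continuous_intros)
  qed auto
  have Ah: "mhol ?A ?U" by (rule mhol_subset[OF mhol_Ainf[OF Ai]]) auto
  obtain H2 where H2: "mhol H2 ?W" "\<And>p. p \<in> ?W \<Longrightarrow>
      mscale (fst p ^ m) (mpd None B p) + commutator (?A p) (B p) -
      (mscale (fst p ^ m) (mpd None ?R p) + ((\<Sum>q\<le>m - 2. mscale (fst p ^ q) (a q (snd p))) + commutator (?A p) (?R p))) =
      mscale ((snd p $ e) ^ m) (H2 p)"
    using eq2[unfolded mcong_def] by blast
  have "\<forall>b\<in>V. \<exists>t. (\<forall>i k. (\<lambda>z. t z $ i $ k) holomorphic_on ball 0 \<rho>) \<and>
      (\<forall>z\<in>ball 0 \<rho>. mseries S z b = (\<Sum>n<m. mscale (z ^ n) (S n b)) + mscale (z ^ m) (t z))"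
    by (intro ballI mseries_tail S)
  then obtain t where t: "\<And>b i k. b \<in> V \<Longrightarrow> (\<lambda>z. t b z $ i $ k) holomorphic_on ball 0 \<rho>"
     "\<And>b z. b \<in> V \<Longrightarrow> z \<in> ball 0 \<rho> \<Longrightarrow> mseries S z b = (\<Sum>n<m. mscale (z ^ n) (S n b)) + mscale (z ^ m) (t b z)"
    unfolding bchoice_iff by blast
  define cS where "cS = (\<lambda>b q n. commutator (Ai q b) (S n b))"
  \<comment> \<open>The coefficients \<open>a\<close>, relevant up to index \<open>m - 2\<close>,
    padded by \<open>0\<close> at \<open>m - 1\<close>.\<close>
  define af where "af = (\<lambda>s b. if s \<le> m - 2 then a s b else 0)"
  have af: "(\<Sum>s<m. mscale (z ^ s) (af s b)) = (\<Sum>q\<le>m - 2. mscale (z ^ q) (a q b))"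
    "(\<Sum>s<m - 1. mscale (z ^ s) (af s b)) = (\<Sum>q\<le>m - 2. mscale (z ^ q) (a q b))" for z b
  proof -
    have "{..<m - 1} = {..m - 2}" using m by auto
    then show 2: "(\<Sum>s<m - 1. mscale (z ^ s) (af s b)) = (\<Sum>q\<le>m - 2. mscale (z ^ q) (a q b))"
      by (simp add: af_def)
    have "m = Suc (m - 1)" using m by simp
    then have "(\<Sum>s<m. mscale (z ^ s) (af s b)) = (\<Sum>s<m - 1. mscale (z ^ s) (af s b)) + mscale (z ^ (m - 1)) (af (m - 1) b)"
      using sum.lessThan_Suc[of "\<lambda>s. mscale (z ^ s) (af s b)" "m - 1"] by simp
    also have "af (m - 1) b = 0" using m by (simp add: af_def)
    finally show "(\<Sum>s<m. mscale (z ^ s) (af s b)) = (\<Sum>q\<le>m - 2. mscale (z ^ q) (a q b))" using 2 by simp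
  qed
  \<comment> \<open>Subtracting the two equations leaves the polynomial with coefficients
    \<open>Q\<close>. The function \<open>g\<close> gathers everything that carries
    \<open>z ^ m\<close>, including the tail \<open>t\<close> of the series, which is known to be
    holomorphic in z for each base point.\<close>
  define Q where "Q = (\<lambda>s b. x s b - af s b - conv_low m (cS b) s)"
  define g where "g = (\<lambda>b z. mpd None ?R (z, b) + (\<Sum>s<m. mscale (z ^ s) (conv_high m (cS b) s))
      + commutator (Ainf_fun m Ai z b) (t b z) - h (z, b))"
  have AR: "commutator (Ainf_fun m Ai z b) (mseries S z b) =
      (\<Sum>s<m. mscale (z ^ s) (conv_low m (cS b) s)) + mscale (z ^ m) (\<Sum>s<m. mscale (z ^ s) (conv_high m (cS b) s))
      + mscale (z ^ m) (commutator (Ainf_fun m Ai z b) (t b z))" if "b \<in> V" "z \<in> ball 0 \<rho>" for b z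
  proof -
    have "commutator (Ainf_fun m Ai z b) (\<Sum>n<m. mscale (z ^ n) (S n b)) = (\<Sum>q<m. \<Sum>n<m. mscale (z ^ (q + n)) (cS b q n))"
    proof -
      have "commutator X (\<Sum>n<k. mscale (z ^ n) (S n b)) = (\<Sum>n<k. mscale (z ^ n) (commutator X (S n b)))" for X k
        by (induction k) (simp_all add: commutator_add commutator_mscale, simp add: commutator_def)
      then show ?thesis
        unfolding Ainf_fun_def commutator_sum_left cS_def
        by (simp add: commutator_mscale_left mscale_mscale power_add mult.commute)
    qed
    also have "\<dots> = (\<Sum>s<m. mscale (z ^ s) (conv_low m (cS b) s)) + mscale (z ^ m) (\<Sum>s<m. mscale (z ^ s) (conv_high m (cS b) s))"
      by (rule conv_product) (use m in simp)
    finally show ?thesis unfolding t(2)[OF that] commutator_add commutator_mscale by simp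
  qed
  have "\<exists>M. mholo_base M V \<and> (\<forall>b\<in>V. Q s b = mscale ((b $ e) ^ m) (M b))" if s: "s < m" for s
  proof (rule mcoefficients_divisible[where m = m and g = g, OF V \<rho> _ _ _ s])
    show "mhol (\<lambda>p. H2 p - H p) ?W" by (intro mhol_diff H2(1) H)
    fix b i k assume b: "b \<in> V"
    have fix_b: "(\<lambda>z. F (z, b) $ i $ k) holomorphic_on ball 0 \<rho>" if "mhol F ?U" for F i k
      by (rule hol_fix_snd[of "\<lambda>p. F p $ i $ k" ?U]) (use that b in \<open>auto simp: mhol_def\<close>)
    have Ahb: "(\<lambda>z. Ainf_fun m Ai z b $ i $ k) holomorphic_on ball 0 \<rho>" for i k
      using fix_b[OF Ah] by simp
    show "(\<lambda>z. g b z $ i $ k) holomorphic_on ball 0 \<rho>"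
      unfolding g_def vector_add_component vector_minus_component
    proof (intro holomorphic_on_add holomorphic_on_diff fix_b h mhol_mpd[OF Sh U])
      show "(\<lambda>z. (\<Sum>s<m. mscale (z ^ s) (conv_high m (cS b) s)) $ i $ k) holomorphic_on ball 0 \<rho>"
        by (simp add: sum_component) (intro holomorphic_intros)
      show "(\<lambda>z. commutator (Ainf_fun m Ai z b) (t b z) $ i $ k) holomorphic_on ball 0 \<rho>"
        unfolding commutator_def matrix_matrix_mult_def vector_minus_component vec_lambda_beta
        by (intro holomorphic_on_diff holomorphic_on_sum holomorphic_on_mult Ahb t(1)[OF b])
    qed
  next
    fix z b assume b: "b \<in> V" and z: "z \<noteq> 0" "cmod z < \<rho>"
    then have p: "(z, b) \<in> ?W" "z \<in> ball 0 \<rho>" by auto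
    have "(\<Sum>s<m. mscale (z ^ s) (Q s b)) = (\<Sum>s<m. mscale (z ^ s) (x s b)) - (\<Sum>s<m. mscale (z ^ s) (af s b))
        - (\<Sum>s<m. mscale (z ^ s) (conv_low m (cS b) s))"
      by (simp add: Q_def mscale_diff sum_subtractf)
    also have "\<dots> = mscale (z ^ m) (g b z) + (mscale ((b $ e) ^ m) (H2 (z, b)) - mscale ((b $ e) ^ m) (H (z, b)))"
      using eq1[OF p(1)] H2(2)[OF p(1)] AR[OF b p(2)]
      by (simp add: g_def af mscale_add mscale_diff algebra_simps)
    finally show "(\<Sum>s<m. mscale (z ^ s) (Q s b)) = mscale (z ^ m) (g b z) + mscale ((b $ e) ^ m) (H2 (z, b) - H (z, b))"
      by (simp add: mscale_diff)
  qed
  then obtain M where M: "\<And>s. s < m \<Longrightarrow> mholo_base (M s) V"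
    "\<And>s b. s < m \<Longrightarrow> b \<in> V \<Longrightarrow> Q s b = mscale ((b $ e) ^ m) (M s b)"
    by metis
  define Ks where "Ks = (\<lambda>s b. M s b - conv_low m (\<lambda>q n. commutator (Ai q b) (E n b)) s
      - conv_high m (\<lambda>q n. commutator (Ai q b) (R n b)) s)"
  have Ksh: "mhol (\<lambda>p. Ks s (snd p)) (UNIV \<times> V)" if s: "s < m" for s
  proof -
    have 1: "mholo_base (\<lambda>b. commutator (Ai q b) (E n b)) V" and 2: "mholo_base (\<lambda>b. commutator (Ai q b) (R n b)) V"
      if "q < m" "n < m" for q n
      using that by (auto intro!: mholo_base_commutator Ai E R)
    note c = mholo_base_conv(1)[where F = "\<lambda>q n b. commutator (Ai q b) (E n b)" and s = s, OF 1, unfolded mholo_base_iff]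
      mholo_base_conv(2)[where F = "\<lambda>q n b. commutator (Ai q b) (R n b)" and s = s, OF 2, unfolded mholo_base_iff]
    show ?thesis unfolding Ks_def by (intro mhol_diff c M(1)[OF s, unfolded mholo_base_iff])
  qed
  have T: "T_coeff m e Ai R x s b = af s b + mscale ((b $ e) ^ m) (Ks s b)" if s: "s < m" and b: "b \<in> V" for s b
  proof -
    have "conv_low m (\<lambda>q n. commutator (Ai q b) (R n b)) s =
        conv_low m (\<lambda>q n. cS b q n + mscale ((b $ e) ^ m) (commutator (Ai q b) (E n b))) s"
    proof (rule conv_low_cong)
      fix q n assume "n < m"
      then have "R n b = S n b + mscale ((b $ e) ^ m) (E n b)" using E(2)[OF _ b] by (metis add.commute diff_add_cancel)
      then show "commutator (Ai q b) (R n b) = cS b q n + mscale ((b $ e) ^ m) (commutator (Ai q b) (E n b))"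
        by (simp add: cS_def commutator_add commutator_mscale)
    qed
    also have "\<dots> = conv_low m (cS b) s + mscale ((b $ e) ^ m) (conv_low m (\<lambda>q n. commutator (Ai q b) (E n b)) s)"
      unfolding conv_low_add conv_low_mscale ..
    finally show ?thesis
      using M(2)[OF s b] by (simp add: T_coeff_def Ks_def Q_def mscale_diff mscale_add algebra_simps)
  qed
  \<comment> \<open>The terms with \<open>mpd\<close> arise because \<open>cov\<close> has the
    factor \<open>z ^ m - \<epsilon> ^ m\<close> where the normalizing equation has
    \<open>z ^ m\<close>.\<close>
  define K where "K = (\<lambda>p. H2 p - (mpd None B p - mpd None ?R p) - (\<Sum>s<m - 1. mscale (fst p ^ s) (Ks s (snd p))))"
  have "mhol K ?W"
    unfolding K_def
    by (intro mhol_diff H2(1) mhol_mpd[OF B U0(1)] mhol_subset[OF mhol_mpd[OF Sh U] U0(2)] mhol_sum mhol_mscale hol_power hol_fst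
        mhol_subset[OF Ksh]) auto
  moreover have "cov m e Ai (\<lambda>p. B p - ?R p) p =
      (\<Sum>s<m - 1. mscale (fst p ^ s) (T_coeff m e Ai R x s (snd p))) + mscale ((snd p $ e) ^ m) (K p)" if p: "p \<in> ?W" for p
  proof -
    have b: "snd p \<in> V" using p by auto
    have T: "(\<Sum>s<m - 1. mscale (fst p ^ s) (T_coeff m e Ai R x s (snd p))) =
        (\<Sum>s<m - 1. mscale (fst p ^ s) (af s (snd p))) + mscale ((snd p $ e) ^ m) (\<Sum>s<m - 1. mscale (fst p ^ s) (Ks s (snd p)))"
      unfolding mscale_sum_right sum.distrib[symmetric]
      by (rule sum.cong) (simp_all add: T[OF _ b] mscale_add mscale_mscale mult.commute)
    have c: "cov m e Ai (\<lambda>p. B p - ?R p) p =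
        mscale (fst p ^ m) (mpd None B p) + commutator (?A p) (B p) - (mscale (fst p ^ m) (mpd None ?R p) + commutator (?A p) (?R p))
        - mscale ((snd p $ e) ^ m) (mpd None B p - mpd None ?R p)"
    proof -
      have "mpd None (\<lambda>p. B p - ?R p) p = mpd None B p - mpd None ?R p"
        by (rule mpd_diff[OF B mhol_subset[OF Sh U0(2)] p])
      then show ?thesis
        unfolding cov_def commutator_diff by (simp only:) (simp add: vec_eq_iff algebra_simps)
    qed
    have "mscale (fst p ^ m) (mpd None B p) + commutator (?A p) (B p) =
        mscale ((snd p $ e) ^ m) (H2 p) +
        (mscale (fst p ^ m) (mpd None ?R p) + ((\<Sum>q\<le>m - 2. mscale (fst p ^ q) (a q (snd p))) + commutator (?A p) (?R p)))"
      using H2(2)[OF p] unfolding diff_eq_eq .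
    then show ?thesis
      unfolding c T K_def af mscale_diff by (simp only:) (simp add: algebra_simps)
  qed
  ultimately show ?thesis by blast
qed

text \<open>The adjusting condition kills the coefficient of \<open>z ^ (m - 1)\<close>, so the
  degree is at most \<open>m - 2\<close>, as the solution at infinity requires.\<close>

lemma Xi_tilde_eval:
  fixes Ai :: "nat \<Rightarrow> complex ^ 'b::finite \<Rightarrow> complex ^ 'r::finite ^ 'r"
  assumes m: "m \<ge> 1" and V: "open V" and Ai: "\<And>q. q < m \<Longrightarrow> mholo_base (Ai q) V"
    and \<psi>: "\<And>i q. i < CARD('r) \<Longrightarrow> q < m \<Longrightarrow> holo_base (\<psi> i q) V"
    and top: "mcoeff (Xi m e \<psi> Ai l j b) (m - 1) = (\<Sum>n<m. commutator (Ai (m - n - 1) b) (R l j n b))"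
  shows "Xi_tilde m e \<psi> Ai R l j z b =
    (\<Sum>s<m. mscale (z ^ s) (T_coeff m e Ai (R l j) (\<lambda>s b. mcoeff (Xi m e \<psi> Ai l j b) s) s b))" (is ?all)
    and "Xi_tilde m e \<psi> Ai R l j z b =
    (\<Sum>s<m - 1. mscale (z ^ s) (T_coeff m e Ai (R l j) (\<lambda>s b. mcoeff (Xi m e \<psi> Ai l j b) s) s b))"
proof -
  let ?T = "T_coeff m e Ai (R l j) (\<lambda>s b. mcoeff (Xi m e \<psi> Ai l j b) s)"
  have "Xi_tilde m e \<psi> Ai R l j z b = (\<Sum>s<m. mscale (z ^ s) (mcoeff (Xi m e \<psi> Ai l j b) s))
      - (\<Sum>s<m. mscale (z ^ s) (conv_low m (\<lambda>q n. commutator (Ai q b) (R l j n b)) s))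
      - (\<Sum>s<m. mscale ((b $ e) ^ m * z ^ s) (conv_high m (\<lambda>q n. commutator (Ai q b) (R l j n b)) s))"
    by (simp only: Xi_tilde_def conv_high_eval conv_low_eval[OF m]
      Xi_properties(2)[where Ai = Ai and \<psi> = \<psi>, OF m V Ai \<psi>])
  also have "\<dots> = (\<Sum>s<m. mscale (z ^ s) (?T s b))"
    unfolding sum_subtractf[symmetric]
    by (rule sum.cong) (simp_all add: T_coeff_def mscale_diff mscale_mscale mult.commute)
  finally show eq: ?all .
  note eq
  also have "(\<Sum>s<m. mscale (z ^ s) (?T s b)) = (\<Sum>s<m - 1. mscale (z ^ s) (?T s b)) + mscale (z ^ (m - 1)) (?T (m - 1) b)"
    using sum.lessThan_Suc[of "\<lambda>s. mscale (z ^ s) (?T s b)" "m - 1"] m by simp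
  also have "?T (m - 1) b = 0"
    by (rule T_coeff_top[OF m]) (rule top)
  finally show "Xi_tilde m e \<psi> Ai R l j z b = (\<Sum>s<m - 1. mscale (z ^ s) (?T s b))" by simp
qed

section \<open>The horizontal lift\<close>

lemma mholo_base_subset: "mholo_base F V \<Longrightarrow> V' \<subseteq> V \<Longrightarrow> mholo_base F V'"
  unfolding mholo_base_iff by (erule mhol_subset) auto

text \<open>With \<open>u = 1 / z\<close> the form becomes regular after multiplication by
  \<open>u\<close> because the numerator has degree below \<open>m\<close>; the denominator turns
  into \<open>1 - (u * b $ e) ^ m\<close>, which is nonzero on the chart.\<close>

lemma rational_form_section:
  fixes F :: "nat \<Rightarrow> complex ^ 'b::finite \<Rightarrow> complex ^ 'r::finite ^ 'r" and e :: 'b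
  assumes m: "m \<ge> 1" and V: "open V" and F: "\<And>q. q < m \<Longrightarrow> mholo_base (F q) V"
    and f: "\<And>z b. b \<in> V \<Longrightarrow> f z b = (\<Sum>q<m. mscale (z ^ q) (F q b))"
  defines "a \<equiv> \<lambda>z b. mscale (1 / (z ^ m - (b $ e) ^ m)) (f z b)"
  shows "mholo_total a (UNIV \<times> V - Gam m e V)" "simple_pole_at_inf_dz V a"
proof -
  have Fh: "mhol (\<lambda>p. F q (snd p)) (UNIV \<times> V)" if "q < m" for q
    using F[OF that] by (simp add: mholo_base_iff)
  have op: "open (UNIV \<times> V - Gam m e V)" by (rule open_Gam_compl[OF V])
  have "mhol (\<lambda>p. mscale (1 / (fst p ^ m - (snd p $ e) ^ m)) (\<Sum>q<m. mscale (fst p ^ q) (F q (snd p)))) (UNIV \<times> V - Gam m e V)"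
  proof (intro mhol_mscale mhol_sum hol_divide hol_diff hol_power hol_const hol_fst hol_snd_nth)
    show "fst p ^ m - (snd p $ e) ^ m \<noteq> 0" if "p \<in> UNIV \<times> V - Gam m e V" for p
      using that Gam_roots[OF m, of "snd p" V "fst p" e] by auto
    show "mhol (\<lambda>p. F q (snd p)) (UNIV \<times> V - Gam m e V)" if "q \<in> {..<m}" for q
      using that by (intro mhol_subset[OF Fh]) auto
  qed
  then show "mholo_total a (UNIV \<times> V - Gam m e V)"
    unfolding mholo_total_iff by (rule mhol_cong[OF op]) (auto simp: a_def f)
  have nz: "1 - (u * b $ e) ^ m \<noteq> 0" if "(u, b) \<in> inf_chart m e V" for u b
  proof (cases "u = 0")
    case False
    then have "(1 / u) ^ m \<noteq> (b $ e) ^ m" using that Gam_roots[OF m, of b V "1 / u" e] by (auto simp: inf_chart_def)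
    then show ?thesis using False by (auto simp: power_mult_distrib power_divide field_simps)
  qed (use m in \<open>simp add: power_0_left\<close>)
  define G where "G = (\<lambda>p::'b point. mscale (- 1 / (1 - (fst p * snd p $ e) ^ m)) (\<Sum>q<m. mscale (fst p ^ (m - 1 - q)) (F q (snd p))))"
  have "mhol G (inf_chart m e V)"
    unfolding G_def
  proof (intro mhol_mscale mhol_sum hol_divide hol_diff hol_mult hol_power hol_const hol_fst hol_snd_nth)
    show "1 - (fst p * snd p $ e) ^ m \<noteq> 0" if "p \<in> inf_chart m e V" for p
      using nz[of "fst p" "snd p"] that by simp
    show "mhol (\<lambda>p. F q (snd p)) (inf_chart m e V)" if "q \<in> {..<m}" for q
      using that by (intro mhol_subset[OF Fh]) (auto simp: inf_chart_def)
  qed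
  then have "mholo_total (\<lambda>u b. G (u, b)) (inf_chart m e V)" by (simp add: mholo_total_iff)
  moreover have "G (u, b) = mscale (u * (- 1 / u\<^sup>2)) (a (1 / u) b)" if u: "(u, b) \<in> inf_chart m e V" "u \<noteq> 0" for u b
  proof -
    have b: "b \<in> V" using u by (simp add: inf_chart_def)
    have "- 1 / (1 - (u * b $ e) ^ m) * (u ^ (m - 1 - q) * x) =
        u * (- 1 / u\<^sup>2) * (1 / ((1 / u) ^ m - (b $ e) ^ m) * ((1 / u) ^ q * x))" if "q < m" for q x
    proof -
      define k where "k = m - 1 - q"
      have um: "u ^ m = u * u ^ q * u ^ k" using \<open>q < m\<close> by (simp add: k_def flip: power_Suc power_add)
      have "(1 / u) ^ m - (b $ e) ^ m = (1 - (u * b $ e) ^ m) / u ^ m"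
        using u(2) by (simp add: field_simps power_mult_distrib power_divide)
      then have "u * (- 1 / u\<^sup>2) * (1 / ((1 / u) ^ m - (b $ e) ^ m) * ((1 / u) ^ q * x)) =
          - 1 / (1 - (u * b $ e) ^ m) * (u ^ m / (u * u ^ q) * x)"
        using u(2) nz[OF u(1)] by (simp add: power2_eq_square power_divide field_simps)
      also have "u ^ m / (u * u ^ q) = u ^ k" unfolding um using u(2) by simp
      finally show ?thesis by (simp add: k_def)
    qed
    then have "mscale (- 1 / (1 - (u * b $ e) ^ m)) (mscale (u ^ (m - 1 - q)) X) =
        mscale (u * (- 1 / u\<^sup>2)) (mscale (1 / ((1 / u) ^ m - (b $ e) ^ m)) (mscale ((1 / u) ^ q) X))"
      if "q < m" for q and X :: "complex ^ 'r ^ 'r"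
      using that by (simp only: vec_eq_iff mscale_nth) blast
    then show ?thesis
      unfolding G_def a_def f[OF b] mscale_sum_right fst_conv snd_conv by (intro sum.cong) auto
  qed
  ultimately show "simple_pole_at_inf_dz V a"
    unfolding simple_pole_at_inf_dz_def
    by (intro exI[of _ "inf_chart m e V"] exI[of _ "\<lambda>u b. G (u, b)"])
      (auto simp: open_inf_chart[OF V], auto simp: inf_chart_def)
qed

lemma inv_chart_simple_pole:
  assumes V: "open V" and G: "mhol G (inf_chart m e V)"
  shows "simple_pole_at_inf_fun V (\<lambda>z b. inv_chart G (z, b))"
proof -
  have "mhol (\<lambda>p. mscale (fst p) (G p)) (inf_chart m e V)" by (intro mhol_mscale hol_fst G)
  then have "mholo_total (\<lambda>u b. mscale u (G (u, b))) (inf_chart m e V)" by (simp add: mholo_total_iff)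
  then show ?thesis
    unfolding simple_pole_at_inf_fun_def
    by (intro exI[of _ "inf_chart m e V"] exI[of _ "\<lambda>u b. mscale u (G (u, b))"])
      (auto simp: open_inf_chart[OF V] inv_chart_def, auto simp: inf_chart_def)
qed

theorem proposition4p11:
  fixes m :: nat and e :: "'b::finite"
    and \<mu> :: "'r::finite \<Rightarrow> complex"
    and c :: "nat \<Rightarrow> nat \<Rightarrow> complex ^ 'b \<Rightarrow> complex"
    and \<gamma> :: "real \<Rightarrow> complex ^ 'b \<Rightarrow> complex"
    and W :: "(complex \<times> (complex ^ 'b)) set"
    and A :: "complex \<Rightarrow> complex ^ 'b \<Rightarrow> complex ^ 'r ^ 'r"
    and V :: "(complex ^ 'b) set"
    and Ai :: "nat \<Rightarrow> complex ^ 'b \<Rightarrow> complex ^ 'r ^ 'r"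
    and P :: "complex \<Rightarrow> complex ^ 'b \<Rightarrow> complex ^ 'r ^ 'r"
    and \<psi> :: "nat \<Rightarrow> nat \<Rightarrow> complex ^ 'b \<Rightarrow> complex"
    and R' R :: "nat \<Rightarrow> nat \<Rightarrow> nat \<Rightarrow> complex ^ 'b \<Rightarrow> complex ^ 'r ^ 'r"
    and l j :: nat
  assumes "m \<ge> 2"
    and "exponents m e \<mu> c"
    and "loop_family m e \<gamma> W"
    and "local_connection m e \<mu> c A"
    and "distinct_monodromy m e \<gamma> A"
    and "only_scalar_endomorphisms m e A"
    and "open V" and "0 \<in> V" and "V \<subseteq> polydisc"
    and "extends_to_P1 m e A V Ai"
    and "diagonalizer m e \<mu> c V Ai P"
    and "inverse_exponents m e \<mu> c V \<psi>"
    and "\<forall>l<CARD('r). \<forall>j\<le>m - 2. normalizing_series m e \<mu> V Ai P l j (R' l j)"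
    and "adjusting_data m e \<psi> V Ai R' R"
    and "l \<le> CARD('r) - 1" and "j \<le> m - 2"
  shows "\<exists>V'. open V' \<and> 0 \<in> V' \<and> V' \<subseteq> V \<and>
    (\<exists>\<omega>. horizontal_lift m e \<mu> \<psi> V' Ai P R' R l j \<omega>)"
proof -
  note m = assms(1) and V = assms(7,8,9)
  have m1: "m \<ge> 1" using m by simp
  have l: "l < CARD('r)" using assms(15) zero_less_card_finite[where 'a = 'r] by linarith
  have Ai: "\<And>q. q < m \<Longrightarrow> mholo_base (Ai q) V" using assms(10) by (simp add: extends_to_P1_def)
  have \<psi>: "\<And>i q. i < CARD('r) \<Longrightarrow> q < m \<Longrightarrow> holo_base (\<psi> i q) V"
    and inv: "cong_total (ball 0 1 \<times> V) (\<lambda>z b. z ^ m - (b $ e) ^ m)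
      (\<lambda>z b. eval_T (\<lambda>i. \<Sum>q<m. \<psi> i q b * z ^ q) (diag_mat (\<lambda>k. nu CARD('r) m c (\<mu> k) z b)))
      (\<lambda>z b. diag_mat \<mu>)"
    using assms(12) by (auto simp: inverse_exponents_def)
  obtain N1 where N1: "open N1" "Ddiv m e V \<subseteq> N1" "N1 \<subseteq> ball 0 1 \<times> V" "mholo_total P N1"
      "\<forall>(z, b)\<in>N1. invertible (P z b)"
    and diag: "cong_total N1 (\<lambda>z b. (z ^ m - (b $ e) ^ m)\<^sup>2)
        (\<lambda>z b. mscale (z ^ m - (b $ e) ^ m) (matrix_inv (P z b) ** mderiv P z b)
               + matrix_inv (P z b) ** Ainf_fun m Ai z b ** P z b)
        (\<lambda>z b. diag_mat (\<lambda>k. nu CARD('r) m c (\<mu> k) z b))"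
    using assms(11) unfolding diagonalizer_def by blast
  obtain N2 V2 a where N2: "open N2" "central e V \<subseteq> N2" "N2 \<subseteq> ball 0 1 \<times> V2" and V2: "open V2" "{b \<in> V. b $ e = 0} \<subseteq> V2"
    and S: "\<forall>(z, b)\<in>N2. \<forall>i k. summable (\<lambda>n. R' l j n b $ i $ k * z ^ n)" "mholo_total (mseries (R' l j)) N2"
    and eq: "cong_total (N2 - {(z, b). z = 0}) (\<lambda>z b. (b $ e) ^ m)
        (\<lambda>z b. mscale (z ^ m) (mderiv (B0 m \<mu> P l j) z b)
               + commutator (Ainf_fun m Ai z b) (B0 m \<mu> P l j z b))
        (\<lambda>z b. mscale (z ^ m) (mderiv (mseries (R' l j)) z b)
               + ((\<Sum>q\<le>m - 2. mscale (z ^ q) (a q b))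
                  + commutator (Ainf_fun m Ai z b) (mseries (R' l j) z b)))"
    using assms(13)[rule_format, OF l assms(16)] unfolding normalizing_series_def by blast
  have adj: "\<And>n. n < m \<Longrightarrow> mholo_base (R l j n) V"
    "\<And>n. n < m \<Longrightarrow> \<exists>V0. open V0 \<and> {b \<in> V. b $ e = 0} \<subseteq> V0 \<and> V0 \<subseteq> V \<and>
          cong_base V0 (\<lambda>b. (b $ e) ^ m) (R l j n) (R' l j n)"
    "\<And>b. b \<in> V \<Longrightarrow> mcoeff (Xi m e \<psi> Ai l j b) (m - 1) = (\<Sum>n<m. commutator (Ai (m - n - 1) b) (R l j n b))"
    using assms(14) l assms(16) unfolding adjusting_data_def by auto
  have "\<exists>V0 E. open V0 \<and> 0 \<in> V0 \<and> mholo_base E V0 \<and> (\<forall>b\<in>V0. R l j n b - R' l j n b = mscale ((b $ e) ^ m) (E b))" if "n < m" for n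
    using adj(2)[OF that] V(2) unfolding cong_base_def by (auto simp: subset_iff)
  then obtain V0 E where V0: "\<And>n. n < m \<Longrightarrow> open (V0 n)" "\<And>n. n < m \<Longrightarrow> 0 \<in> V0 n"
    and E: "\<And>n. n < m \<Longrightarrow> mholo_base (E n) (V0 n)"
      "\<And>n b. n < m \<Longrightarrow> b \<in> V0 n \<Longrightarrow> R l j n b - R' l j n b = mscale ((b $ e) ^ m) (E n b)"
    by metis
  obtain a0 and h :: "'r \<Rightarrow> nat" and \<xi> where ev: "eventually (\<lambda>b. msum (ad_mat (Ai (m - 1) b)) \<le> a0 \<and>
      (\<forall>n::int. n \<noteq> 0 \<longrightarrow> invertible (mat (of_int n) - ad_mat (Ai (m - 1) b))) \<and>
      invertible (krylov h \<xi> (Ai (m - 1) b))) (nhds 0)"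
    using nonresonant_neighbourhood[OF m1 assms(3,5) V(1,2) assms(10)] by blast
  obtain V3 where V3: "open V3" "0 \<in> V3"
    and nr': "\<forall>b\<in>V3. msum (ad_mat (Ai (m - 1) b)) \<le> a0 \<and>
      (\<forall>n::int. n \<noteq> 0 \<longrightarrow> invertible (mat (of_int n) - ad_mat (Ai (m - 1) b))) \<and>
      invertible (krylov h \<xi> (Ai (m - 1) b))"
    using ev[unfolded eventually_nhds] by (elim exE conjE)
  have nr: "\<And>b. b \<in> V3 \<Longrightarrow> msum (ad_mat (Ai (m - 1) b)) \<le> a0"
      "\<And>b (n::int). b \<in> V3 \<Longrightarrow> n \<noteq> 0 \<Longrightarrow> invertible (mat (of_int n) - ad_mat (Ai (m - 1) b))"
      "\<And>b. b \<in> V3 \<Longrightarrow> invertible (krylov h \<xi> (Ai (m - 1) b))"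
    using nr' by auto
  \<comment> \<open>The diagonaliser lives near the divisor and the normalizing series near the
    central locus. Both neighbourhoods contain the origin, so after shrinking both objects are
    defined on a common product.\<close>
  have "(0, 0) \<in> N1 \<inter> N2"
    using N1(2) N2(2) V(2) m by (auto simp: Ddiv_def central_def power_0_left)
  moreover have "open (N1 \<inter> N2)" using N1(1) N2(1) by auto
  ultimately obtain X Y where XY: "open X" "open Y" "0 \<in> X" "0 \<in> Y" "X \<times> Y \<subseteq> N1 \<inter> N2"
    by (elim open_prod_elim) auto
  obtain \<rho> where \<rho>: "\<rho> > 0" "ball 0 \<rho> \<subseteq> X" using XY(1,3) openE by blast
  have "open (Y \<inter> V3 \<inter> (\<Inter>n\<in>{..<m}. V0 n))" "0 \<in> Y \<inter> V3 \<inter> (\<Inter>n\<in>{..<m}. V0 n)"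
    using XY V3 V0 by (auto intro!: open_Int open_INT)
  \<comment> \<open>Only the finitely many coefficients with \<open>n < m\<close> are compared, so
    the intersection is open. A ball is chosen because \<open>slice0\<close> does not increase norms
    and hence preserves it.\<close>
  then obtain \<delta> where \<delta>: "\<delta> > 0" "ball 0 \<delta> \<subseteq> Y \<inter> V3 \<inter> (\<Inter>n\<in>{..<m}. V0 n)" using openE by blast
  define V' :: "(complex ^ 'b) set" where "V' = ball 0 \<delta>"
  let ?U = "ball 0 \<rho> \<times> V' :: 'b point set"
  let ?W = "ball 0 \<rho> \<times> V' - {p. fst p = 0} :: 'b point set"
  let ?\<Omega> = "ball 0 \<rho> \<times> V' - Gam m e V' :: 'b point set"
  have V': "open V'" "0 \<in> V'" "V' \<subseteq> V3" "\<And>n. n < m \<Longrightarrow> V' \<subseteq> V0 n"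
    using \<delta> by (auto simp: V'_def)
  have UN: "?U \<subseteq> N1" "?U \<subseteq> N2" using XY(5) \<rho>(2) \<delta>(2) by (auto simp: V'_def)
  have U: "open ?U" using V' by (auto intro!: open_Times)
  have V'V: "V' \<subseteq> V"
  proof
    fix b assume "b \<in> V'"
    then have "(0, b) \<in> ?U" using \<rho> by simp
    then show "b \<in> V" using UN(1) N1(3) by blast
  qed
  have U1: "?U \<subseteq> ball 0 1 \<times> V'" using UN(1) N1(3) by blast
  \<comment> \<open>The slits contain \<open>z = 0\<close> over every base point, so removing them
    also removes the poles of \<open>B0\<close>.\<close>
  have \<Omega>W: "?\<Omega> \<subseteq> ?W" using Gam_zero[OF m1, of _ V' e] by auto
  have Ai': "\<And>q. q < m \<Longrightarrow> mholo_base (Ai q) V'" using mholo_base_subset[OF Ai V'V] .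
  have \<psi>': "\<And>i q. i < CARD('r) \<Longrightarrow> q < m \<Longrightarrow> holo_base (\<psi> i q) V'"
    using \<psi> V'V unfolding holo_base_iff by (meson hol_subset Sigma_mono order_refl)
  have R': "\<And>n. n < m \<Longrightarrow> mholo_base (R l j n) V'" using mholo_base_subset[OF adj(1) V'V] .
  have E': "\<And>n. n < m \<Longrightarrow> mholo_base (E n) V'"
      "\<And>n b. n < m \<Longrightarrow> b \<in> V' \<Longrightarrow> R l j n b - R' l j n b = mscale ((b $ e) ^ m) (E n b)"
    using mholo_base_subset[OF E(1) V'(4)] E(2) V'(4) by blast+
  define x where "x = (\<lambda>s b. mcoeff (Xi m e \<psi> Ai l j b) s)"
  define T where "T = T_coeff m e Ai (R l j) x"
  have xh: "mholo_base (x s) V'" for s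
    unfolding x_def by (rule Xi_properties(1)[where Ai = Ai and \<psi> = \<psi>, OF m1 V'(1) Ai' \<psi>'])
  have Th: "mholo_base (T s) V'" for s
    unfolding T_def by (rule mholo_base_T_coeff[OF xh Ai' R'])
  \<comment> \<open>Two forms are kept: the sum over \<open>s < m\<close> fits the lemma on rational
    forms, the one over \<open>s < m - 1\<close> the equation solved at infinity.\<close>
  have Xt: "Xi_tilde m e \<psi> Ai R l j z b = (\<Sum>s<m. mscale (z ^ s) (T s b))"
    "Xi_tilde m e \<psi> Ai R l j z b = (\<Sum>s<m - 1. mscale (z ^ s) (T s b))" if "b \<in> V'" for z b
    unfolding T_def x_def
    by (rule Xi_tilde_eval[where Ai = Ai and \<psi> = \<psi> and R = R and l = l and j = j, OF m1 V'(1) Ai' \<psi>' adj(3)[OF subsetD[OF V'V that]]]; assumption)+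
  define B where "B = (\<lambda>p. B0 m \<mu> P l j (fst p) (snd p))"
  have Nh: "mhol (\<lambda>p. diag_mat (\<lambda>k. nu CARD('r) m c (\<mu> k) (fst p) (snd p))) ?U"
    unfolding nu_def
  proof (intro mhol_diag_mat hol_sum hol_mult hol_power hol_const hol_fst)
    fix i q assume "i \<in> {..<CARD('r)}" "q \<in> {..<m}"
    then have "hol (\<lambda>p. c i q (snd p)) (UNIV \<times> polydisc)"
      using assms(2) unfolding exponents_def holo_base_iff by auto
    then show "hol (\<lambda>p. c i q (snd p)) ?U" by (rule hol_subset) (use V'V V(3) in auto)
  qed
  have Ph: "mhol (\<lambda>p. P (fst p) (snd p)) ?U" "\<And>p. p \<in> ?U \<Longrightarrow> invertible (P (fst p) (snd p))"
    using N1(4,5) UN(1) mhol_subset unfolding mholo_total_iff by (blast, fastforce)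
  have diag': "cong_total ?U (\<lambda>z b. (z ^ m - (b $ e) ^ m)\<^sup>2)
        (\<lambda>z b. mscale (z ^ m - (b $ e) ^ m) (matrix_inv (P z b) ** mderiv P z b)
               + matrix_inv (P z b) ** Ainf_fun m Ai z b ** P z b)
        (\<lambda>z b. diag_mat (\<lambda>k. nu CARD('r) m c (\<mu> k) z b))"
    using mcong_subset[OF diag[unfolded cong_total_iff] UN(1)] by (simp only: cong_total_iff)
  have "?U \<subseteq> ball 0 1 \<times> V" using UN(1) N1(3) by blast
  then have inv': "cong_total ?U (\<lambda>z b. z ^ m - (b $ e) ^ m)
      (\<lambda>z b. eval_T (\<lambda>i. \<Sum>q<m. \<psi> i q b * z ^ q) (diag_mat (\<lambda>k. nu CARD('r) m c (\<mu> k) z b)))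
      (\<lambda>z b. diag_mat \<mu>)"
    using mcong_subset[OF inv[unfolded cong_total_iff]] by (simp only: cong_total_iff)
  have "?U \<subseteq> UNIV \<times> V'" by auto
  note B0c = B0_congruence[where Ai = Ai and \<psi> = \<psi> and P = P and \<nu> = "\<lambda>k. nu CARD('r) m c (\<mu> k)" and \<mu> = \<mu> and l = l,
      OF m assms(16) V'(1) U this Ai' \<psi>' Ph Nh diag' inv']
  have Bh: "mhol B ?W" unfolding B_def by (rule B0c(1); assumption)
  have "\<exists>h H. mhol h ?U \<and> mhol H ?W \<and> (\<forall>p\<in>?W.
      mscale (fst p ^ m) (mpd None B p) + commutator (Ainf_fun m Ai (fst p) (snd p)) (B p) =
      mpoly_eval (Xi m e \<psi> Ai l j (snd p)) (fst p) + mscale (fst p ^ m) (h p) + mscale ((snd p $ e) ^ m) (H p))"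
    unfolding B_def by (rule B0c(2); assumption)
  then obtain h1 H1 where h1: "mhol h1 ?U" "mhol H1 ?W" "\<And>p. p \<in> ?W \<Longrightarrow>
      mscale (fst p ^ m) (mpd None B p) + commutator (Ainf_fun m Ai (fst p) (snd p)) (B p) =
      mpoly_eval (Xi m e \<psi> Ai l j (snd p)) (fst p) + mscale (fst p ^ m) (h1 p) + mscale ((snd p $ e) ^ m) (H1 p)"
    by blast
  have eq1: "mscale (fst p ^ m) (mpd None B p) + commutator (Ainf_fun m Ai (fst p) (snd p)) (B p) =
      (\<Sum>s<m. mscale (fst p ^ s) (x s (snd p))) + mscale (fst p ^ m) (h1 p) + mscale ((snd p $ e) ^ m) (H1 p)" if "p \<in> ?W" for p
    using h1(3)[OF that] unfolding x_def
    by (simp only: Xi_properties(2)[where Ai = Ai and \<psi> = \<psi>, OF m1 V'(1) Ai' \<psi>'])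
  have Sm: "summable (\<lambda>n. R' l j n b $ i $ k * z ^ n)" if "cmod z < \<rho>" "b \<in> V'" for z b i k
  proof -
    have "(z, b) \<in> N2" using UN(2) that by auto
    then show ?thesis using S(1) by blast
  qed
  have Sh: "mhol (\<lambda>p. mseries (R' l j) (fst p) (snd p)) ?U"
    using S(2) UN(2) mhol_subset unfolding mholo_total_iff by blast
  have "?W \<subseteq> N2 - {(z, b). z = 0}" using UN(2) by auto
  from mcong_subset[OF eq[unfolded cong_total_iff mderiv_eq prod.collapse] this]
  have eq2: "mcong ?W (\<lambda>p. (snd p $ e) ^ m)
      (\<lambda>p. mscale (fst p ^ m) (mpd None B p) + commutator (Ainf_fun m Ai (fst p) (snd p)) (B p))
      (\<lambda>p. mscale (fst p ^ m) (mpd None (\<lambda>p. mseries (R' l j) (fst p) (snd p)) p) + ((\<Sum>q\<le>m - 2. mscale (fst p ^ q) (a q (snd p)))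
         + commutator (Ainf_fun m Ai (fst p) (snd p)) (mseries (R' l j) (fst p) (snd p))))"
    unfolding B_def .
  \<comment> \<open>The value prescribed modulo \<open>\<epsilon> ^ m\<close>, which solves the
    equation only up to \<open>\<epsilon> ^ m\<close> and only near \<open>z = 0\<close>.\<close>
  define B' where "B' = (\<lambda>p. B p - mseries (R' l j) (fst p) (snd p))"
  have "\<exists>K. mhol K ?W \<and> (\<forall>p\<in>?W. cov m e Ai B' p =
      (\<Sum>s<m - 1. mscale (fst p ^ s) (T s (snd p))) + mscale ((snd p $ e) ^ m) (K p))"
    unfolding T_def B'_def
    by (rule cov_defect[where Ai = Ai and x = x and S = "R' l j" and R = "R l j" and E = E and B = B and h = h1 and H = H1 and a = a,
        OF m V'(1) \<rho>(1) Ai' Bh h1(1,2) eq1 Sm Sh eq2 R' E']; assumption)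
  then obtain K where K: "mhol K ?W" "\<And>p. p \<in> ?W \<Longrightarrow>
      cov m e Ai B' p = (\<Sum>s<m - 1. mscale (fst p ^ s) (T s (snd p))) + mscale ((snd p $ e) ^ m) (K p)"
    by blast
  have B'h: "mhol B' ?\<Omega>"
    unfolding B'_def by (intro mhol_diff mhol_subset[OF Bh \<Omega>W] mhol_subset[OF Sh]) auto
  have "\<exists>G X. sol_inf m e Ai V' T G \<and> mhol X ?\<Omega> \<and> (\<forall>p\<in>?\<Omega>. B' p = inv_chart G p + mscale ((snd p $ e) ^ m) (X p))"
  proof (rule matching[where h = h and \<xi> = \<xi> and ?a0.0 = a0, OF m1 V'(1) \<rho>(1) Ai' Th _ _ _ _ B'h mhol_subset[OF K(1) \<Omega>W]])
    show "slice0 e b \<in> V'" if "b \<in> V'" for b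
      using that norm_slice0_le[of e b] by (simp add: V'_def)
    show "cov m e Ai B' p = (\<Sum>s<m - 1. mscale (fst p ^ s) (T s (snd p))) + mscale ((snd p $ e) ^ m) (K p)" if "p \<in> ?\<Omega>" for p
      by (rule K(2)) (use that \<Omega>W in blast)
  qed (use nr V'(3) in auto)
  then obtain G X where G: "sol_inf m e Ai V' T G" and X: "mhol X ?\<Omega>"
    "\<And>p. p \<in> ?\<Omega> \<Longrightarrow> B' p = inv_chart G p + mscale ((snd p $ e) ^ m) (X p)" by blast
  have Gh: "mhol G (inf_chart m e V')" and Gc: "\<And>p. p \<in> UNIV \<times> V' - Gam m e V' \<Longrightarrow>
      cov m e Ai (inv_chart G) p = (\<Sum>s<m - 1. mscale (fst p ^ s) (T s (snd p)))"
    using G unfolding sol_inf_def by auto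
  define a0' where "a0' = (\<lambda>z (b :: complex ^ 'b). mscale (1 / (z ^ m - (b $ e) ^ m)) (Ainf_fun m Ai z b))"
  define a1' where "a1' = (\<lambda>z (b :: complex ^ 'b). mscale (1 / (z ^ m - (b $ e) ^ m)) (Xi_tilde m e \<psi> Ai R l j z b))"
  define Bf where "Bf = (\<lambda>z b. inv_chart G (z, b))"
  have "form_section m e V' (a0', a1', Bf)"
    unfolding form_section.simps
  proof (intro conjI)
    show "mholo_total a0' (UNIV \<times> V' - Gam m e V')" "simple_pole_at_inf_dz V' a0'"
      unfolding a0'_def by (rule rational_form_section[OF m1 V'(1) Ai']; simp add: Ainf_fun_def)+
    show "mholo_total a1' (UNIV \<times> V' - Gam m e V')" "simple_pole_at_inf_dz V' a1'"
      unfolding a1'_def by (rule rational_form_section[OF m1 V'(1) Th Xt(1)]; assumption)+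
    show "mholo_total Bf (UNIV \<times> V' - Gam m e V')"
      using mhol_inv_chart[OF m1 Gh] by (simp add: mholo_total_iff Bf_def)
    show "simple_pole_at_inf_fun V' Bf"
      unfolding Bf_def by (rule inv_chart_simple_pole[OF V'(1) Gh])
  qed
  moreover have "ext_d (a0', a1', Bf) z b + wedge (a0', a1', Bf) (a0', a1', Bf) z b = 0"
    if zb: "(z, b) \<in> UNIV \<times> V' - Gam m e V'" for z b
  proof -
    have c: "z ^ m - (b $ e) ^ m \<noteq> 0" using zb Gam_roots[OF m1, of b V' z e] by auto
    \<comment> \<open>The equation solved at infinity, with the right-hand side recognised as
      \<open>Xi_tilde\<close>; dividing by \<open>z ^ m - \<epsilon> ^ m\<close> gives the vanishing
      of the curvature.\<close>
    have "mscale (z ^ m - (b $ e) ^ m) (mderiv Bf z b) + commutator (Ainf_fun m Ai z b) (Bf z b) = Xi_tilde m e \<psi> Ai R l j z b"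
      using Gc[OF zb] Xt(2)[of b z] zb by (simp add: cov_def mderiv_eq Bf_def)
    then have "mderiv Bf z b = mscale (1 / (z ^ m - (b $ e) ^ m)) (Xi_tilde m e \<psi> Ai R l j z b - commutator (Ainf_fun m Ai z b) (Bf z b))"
      using c by (metis (no_types, lifting) add_diff_cancel_right' mscale_mscale mscale_one nonzero_eq_divide_eq)
    then show ?thesis
      by (simp add: a0'_def a1'_def mscale_diff matrix_mult_mscale commutator_def)
  qed
  moreover have "cong_total (?U - Gam m e V') (\<lambda>z b. (b $ e) ^ m) Bf (\<lambda>z b. B0 m \<mu> P l j z b - mseries (R' l j) z b)"
    unfolding cong_total_iff mcong_def
  proof (intro exI conjI ballI)
    \<comment> \<open>The matching expresses \<open>B'\<close> through the solution, while the
      congruence asks for the opposite difference; hence the sign.\<close>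
    show "mhol (\<lambda>p. - X p) ?\<Omega>" by (intro mhol_uminus X(1))
    fix p assume "p \<in> ?\<Omega>"
    from X(2)[OF this]
    show "Bf (fst p) (snd p) - (B0 m \<mu> P l j (fst p) (snd p) - mseries (R' l j) (fst p) (snd p)) = mscale ((snd p $ e) ^ m) (- X p)"
      by (simp add: Bf_def B'_def B_def vec_eq_iff)
  qed
  moreover have "central e V' \<subseteq> ?U" using \<rho>(1) by (auto simp: central_def)
  ultimately have "horizontal_lift m e \<mu> \<psi> V' Ai P R' R l j (a0', a1', Bf)"
    unfolding horizontal_lift_def using U U1
    by (intro conjI exI[of _ Bf] exI[of _ ?U]) (auto simp: a0'_def a1'_def)
  then show ?thesis using V'(1,2) V'V by blast
qed

end
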